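(* Let $\mathcal X\subset\mathbb R^d$ be bounded and measurable. Let $\lambda:\mathcal X\to\mathbb R_+$ be measurable with $m_\lambda=\int_{\mathcal X}\lambda(x)\,dx<\infty$, and let $g:\mathcal X^2\times\mathbb R\to\mathbb R_+$ be measurable with $g(y,x,h)=0$ for $h<0$. Assume there is a measurable $\bar g_{temp}:\mathbb R_+\to\mathbb R_+$ with $\bar\nu_{temp}=\int_{\mathbb R_+}\bar g_{temp}(h)\,dh<1$ and $\sup_{y\in\mathcal X}\int_{\mathcal X}g(y,x,h)\,dx\le\bar g_{temp}(h)$ for all $h\ge0$. Put $\nu(y)=\int_{\mathcal X\times\mathbb R_+}g(y,x,h)\,dx\,dh$ and $\bar\nu=\sup_{y\in\mathcal X}\nu(y)$. Then a (strongly) time-stationary Hawkes process $\Xi$ with background intensity $\lambda$ and excitation intensity $g$ exists and is $L^2$. For every Borel $A\subseteq\mathcal X$ and $t>0$, $$\mathbb E[\Xi(A\times(0,t])]=t\,\mu(A)=t\int_{A\times\mathbb R_+}\Big(\lambda\ast\sum_{k=0}^\infty g^{\ast k}\Big)(x,r)\,dx\,dr\le t\,\frac{m_\lambda}{1-\bar\nu}.$$ In particular, $\mathbb E[\Xi(\mathcal X\times(0,t])]=t\,m_\mu=t\,\frac{m_\lambda}{1-\nu}$ if $g$ is constant in its first argument (so that $\nu(y)=:\nu$ is constant). Furthermore, with $\bar G_{temp}(s)=\sum_{k=0}^\infty\bar g_{temp}^{\ast k}(s)$, for $t\ge0$, $$\breve\gamma_{[2],\mathcal X}([0,t])\le\frac{m_\lambda}{1-\bar\nu_{temp}}\Big(\int_0^t\int_0^\infty\bar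 G_{temp}(s)\,\bar G_{temp}(s+r)\,ds\,dr-1\Big).$$ In particular, since $\int_0^\infty\bar G_{temp}(s)\,ds\le(1-\bar\nu_{temp})^{-1}<\infty$, there are $\kappa'\ge0$ and $t_0>0$ such that $\sum_{i=1}^N\breve\gamma^+_{[2],A_i}([0,t])\le\kappa'$ for every finite measurable partition $(A_i)_{i=1}^N$ of $\mathcal X$ and every $t\ge t_0$.
   Context: $\mathbb R_+=[0,\infty)$. Hawkes process (via its cluster/branching construction): let $Z_0=\sum_i\delta_{(X_{0i},T_{0i})}$ be a Poisson process on $\mathcal X\times\mathbb R$ with intensity $\lambda(x)\,dx\,dt$. Given generation $Z_k=\sum_i\delta_{(X_{ki},T_{ki})}$, let $\Psi_{ki}$ be independent Poisson processes (also independent of all previous processes) with intensities $g(X_{ki},x,t-T_{ki})\,dx\,dt$, and set $Z_{k+1}=\sum_i\Psi_{ki}$. The time-stationary spatio-temporal Hawkes process is $\Xi=\sum_{k\ge0}Z_k$ (it has conditional intensity given by $\lambda(x)$ plus the sum of $g(y,x,t-s)$ over all points $(y,s)$ of $\Xi$ before time $t$). "Exists" means that $\Xi$ is a.s. finite on $\mathcal X\times I$ for bounded intervals $I$; "strongly time-stationary" that its law is invariant under time shifts; "$L^2$" that its first two moment measures are finite on bounded sets. Convolutions: $(f_1\ast f_2)(y,x,t)=\int_{\mathcal X}\int_{\mathbb R}f_1(y,x',t')f_2(x',x,t-t')\,dx'\,dt'$; $g^{\ast1}=g$, $g^{\ast k}=g\ast g^{\ast(k-1)}$ for $k\ge2$,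 and $g^{\ast0}(y,x,t)=\delta^{(d)}(x-y)\delta^{(1)}(t)$ with Dirac delta functions; $(\lambda\ast f_2)(x,t)=\int_{\mathcal X}\lambda(x')f_2(x',x,t)\,dx'$. Similarly $\bar g_{temp}^{\ast k}$ is the $k$-fold convolution on $\mathbb R_+$ and $\bar g_{temp}^{\ast0}=\delta^{(1)}$. Thus $\bar G_{temp}(s)\,ds$ stands for the measure $\bar M=\delta_0+\sum_{k\ge1}\bar g_{temp}^{\ast k}(s)\,ds$, and the double integral above stands for $(\bar M\otimes\bar M)(\{(u,v)\in\mathbb R_+^2:0\le v-u\le t\})$; in particular the atom at $(0,0)$ contributes $1$. Second-order measures: for $\Xi=\sum_i\delta_{(X_i,T_i)}$, $\mathbb E[\Xi(A\times I)]=\mu(A)\mathrm{Leb}(I)$ with $\mu$ a finite measure, $m_\mu=\mu(\mathcal X)$; $M_{[2],A}(I\times J)=\mathbb E\sum_{i\ne j}1\{X_i,X_j\in A,T_i\in I,T_j\in J\}$; with $\varphi(r,s)=(r,s-r)$ one has $M_{[2],A}\varphi^{-1}=\mathrm{Leb}\otimes\breve M_{[2],A}$ for a locally finite measure $\breve M_{[2],A}$ on $\mathbb R$; $\breve\gamma_{[2],A}(S)=\breve M_{[2],A}(S)-\mu(A)^2\,\mathrm{Leb}(S)$ for bounded Borel $S$; $\breve\gamma^+_{[2],A}$ is the positive part of its Jordan decomposition. *)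

theory Defs
  imports "HOL-Probability.Probability"
begin

section \<open>Countable sums of measures\<close>

definition measure_sum :: "(nat \<Rightarrow> 'b::topological_space measure) \<Rightarrow> 'b measure" where
  "measure_sum K = measure_of UNIV (sets borel) (\<lambda>B. \<Sum>k. emeasure (K k) B)"

lemma sets_measure_sum [simp]: "sets (measure_sum K) = sets borel"
  using sets.sigma_sets_eq[of "borel :: 'a measure"] by (simp add: measure_sum_def)

lemma emeasure_measure_sum:
  fixes K :: "nat \<Rightarrow> 'b::topological_space measure"
  assumes K: "\<And>k. sets (K k) = sets borel" and B: "B \<in> sets borel"
  shows "emeasure (measure_sum K) B = (\<Sum>k. emeasure (K k) B)"
  unfolding measure_sum_def
proof (rule emeasure_measure_of_sigma)
  show "sigma_algebra UNIV (sets (borel :: 'b measure))"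
    using sets.sigma_algebra_axioms[of "borel :: 'b measure"] by simp
  show "positive (sets borel) (\<lambda>B. \<Sum>k. emeasure (K k) B)"
    by (simp add: positive_def)
  show "countably_additive (sets borel) (\<lambda>B. \<Sum>k. emeasure (K k) B)"
  proof (rule countably_additiveI)
    fix A :: "nat \<Rightarrow> 'b set"
    assume A: "range A \<subseteq> sets borel" "disjoint_family A"
    have "(\<Sum>i. \<Sum>k. emeasure (K k) (A i)) = (\<Sum>k. \<Sum>i. emeasure (K k) (A i))"
      using nn_integral_suminf[of "\<lambda>k i. emeasure (K k) (A i)" "count_space UNIV"]
      by (simp add: nn_integral_count_space_nat)
    also have "\<dots> = (\<Sum>k. emeasure (K k) (\<Union>(range A)))"
      using A K by (intro suminf_cong suminf_emeasure) auto
    finally show "(\<Sum>i. \<Sum>k. emeasure (K k) (A i)) = (\<Sum>k. emeasure (K k) (\<Union>(range A)))" .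
  qed
qed (use B in simp)


section \<open>Point configurations and Poisson processes\<close>

text \<open>
  A point process is given by its points, indexed by labels in a countable set \<open>I\<close>: label \<open>u\<close>
  carries the point \<open>b\<close> if \<open>p u \<omega> = Some b\<close>, and is unused if \<open>p u \<omega> = None\<close> (the number of points
  is random). The counting measure is the sum of the Dirac measures at the points.
\<close>

definition point_measure ::
    "'l set \<Rightarrow> ('l \<Rightarrow> 'w \<Rightarrow> 'b option) \<Rightarrow> 'w \<Rightarrow> 'b::topological_space measure" where
  "point_measure I p \<omega> = distr (count_space {u \<in> I. p u \<omega> \<noteq> None}) borel (\<lambda>u. the (p u \<omega>))"

lemma sets_point_measure [simp]: "sets (point_measure I p \<omega>) = sets borel"
  by (simp add: point_measure_def)

lemma emeasure_point_measure:
  assumes "B \<in> sets borel"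
  shows "emeasure (point_measure I p \<omega>) B =
    emeasure (count_space UNIV) {u \<in> I. \<exists>b\<in>B. p u \<omega> = Some b}"
proof -
  have eq: "((\<lambda>u. the (p u \<omega>)) -` B \<inter> {u \<in> I. p u \<omega> \<noteq> None}) = {u \<in> I. \<exists>b\<in>B. p u \<omega> = Some b}"
    by auto
  have "emeasure (point_measure I p \<omega>) B = emeasure (count_space {u \<in> I. p u \<omega> \<noteq> None})
      {u \<in> I. \<exists>b\<in>B. p u \<omega> = Some b}"
    using assms by (simp add: point_measure_def emeasure_distr eq del: not_None_eq)
  also have "\<dots> = emeasure (count_space UNIV) {u \<in> I. \<exists>b\<in>B. p u \<omega> = Some b}"
    by (subst (1 2) emeasure_count_space) auto
  finally show ?thesis .
qed

text \<open>A Poisson variable with infinite mean is almost surely infinite.\<close>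

definition poisson_mass :: "ennreal \<Rightarrow> nat \<Rightarrow> real" where
  "poisson_mass r m = (if r = \<infinity> then 0 else enn2real r ^ m / fact m * exp (- enn2real r))"

text \<open>
  The product formula says at once that the counts \<open>N B\<close> are Poisson with mean \<open>\<Lambda> B\<close> and that
  counts of disjoint sets are independent.
\<close>

definition poisson_process ::
    "'w measure \<Rightarrow> ('w \<Rightarrow> 'b::topological_space measure) \<Rightarrow> 'b measure \<Rightarrow> bool" where
  "poisson_process M N \<Lambda> \<longleftrightarrow>
    (\<forall>\<B> m. finite \<B> \<and> \<B> \<subseteq> sets borel \<and> disjoint \<B> \<longrightarrow>
      measure M {\<omega> \<in> space M. \<forall>B\<in>\<B>. emeasure (N \<omega>) B = of_nat (m B)} =
        (\<Prod>B\<in>\<B>. poisson_mass (emeasure \<Lambda> B) (m B)))"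

text \<open>
  Conditionally on \<open>F\<close>, the \<open>N u\<close> with \<open>u \<in> I\<close> are independent Poisson processes with
  (\<open>F\<close>-measurable, random) intensity measures \<open>\<Lambda> u \<omega>\<close>.
\<close>

definition cond_indep_poisson_processes ::
    "'w measure \<Rightarrow> 'w measure \<Rightarrow> 'l set \<Rightarrow> ('l \<Rightarrow> 'w \<Rightarrow> 'b::topological_space measure) \<Rightarrow>
      ('l \<Rightarrow> 'w \<Rightarrow> 'b measure) \<Rightarrow> bool" where
  "cond_indep_poisson_processes M F I N \<Lambda> \<longleftrightarrow>
    (\<forall>U \<B> m. finite U \<and> U \<subseteq> I \<and> finite \<B> \<and> \<B> \<subseteq> sets borel \<and> disjoint \<B> \<longrightarrow>
      (AE \<omega> in M.
        real_cond_exp M F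
          (indicat_real {\<omega> \<in> space M. \<forall>u\<in>U. \<forall>B\<in>\<B>. emeasure (N u \<omega>) B = of_nat (m u B)}) \<omega> =
        (\<Prod>u\<in>U. \<Prod>B\<in>\<B>. poisson_mass (emeasure (\<Lambda> u \<omega>) B) (m u B))))"


section \<open>The cluster construction of the Hawkes process\<close>

text \<open>
  Points are labelled in the Ulam-Harris way by nonempty lists of naturals: the points of \<open>Z\<^sub>k\<close>
  carry labels of length \<open>k + 1\<close>, and the points of the offspring process \<open>\<Psi>\<close> of the point labelled
  \<open>u\<close> carry the labels \<open>u @ [i]\<close>. Hence \<open>Z\<^sub>k\<^sub>+\<^sub>1\<close> is the sum of the offspring processes of the points of
  \<open>Z\<^sub>k\<close>.
\<close>

definition generation ::
    "(nat list \<Rightarrow> 'w \<Rightarrow> ('a::euclidean_space \<times> real) option) \<Rightarrow> nat \<Rightarrow> 'w \<Rightarrow> ('a \<times> real) measure" where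
  "generation pos k = point_measure {u. length u = Suc k} pos"

definition offspring ::
    "(nat list \<Rightarrow> 'w \<Rightarrow> ('a::euclidean_space \<times> real) option) \<Rightarrow> nat list \<Rightarrow> 'w \<Rightarrow> ('a \<times> real) measure" where
  "offspring pos u = point_measure (range (\<lambda>i. u @ [i])) pos"

definition hawkes_process ::
    "(nat list \<Rightarrow> 'w \<Rightarrow> ('a::euclidean_space \<times> real) option) \<Rightarrow> 'w \<Rightarrow> ('a \<times> real) measure" where
  "hawkes_process pos \<omega> = measure_sum (\<lambda>k. generation pos k \<omega>)"

definition history ::
    "'w measure \<Rightarrow> (nat list \<Rightarrow> 'w \<Rightarrow> ('a::euclidean_space \<times> real) option) \<Rightarrow> nat \<Rightarrow> 'w measure" where
  "history M pos k = sigma (space M)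
    {{\<omega> \<in> space M. \<exists>b\<in>B. pos u \<omega> = Some b} | u B. u \<noteq> [] \<and> length u \<le> Suc k \<and> B \<in> sets borel}"

definition background_intensity ::
    "'a::euclidean_space set \<Rightarrow> ('a \<Rightarrow> real) \<Rightarrow> ('a \<times> real) measure" where
  "background_intensity X lam = density lborel (\<lambda>(x, t). indicator X x * ennreal (lam x))"

text \<open>Unused labels have no offspring.\<close>

definition offspring_intensity ::
    "'a::euclidean_space set \<Rightarrow> ('a \<Rightarrow> 'a \<Rightarrow> real \<Rightarrow> real) \<Rightarrow> ('a \<times> real) option \<Rightarrow> ('a \<times> real) measure" where
  "offspring_intensity X g p = (case p of
      None \<Rightarrow> null_measure borel
    | Some (y, s) \<Rightarrow> density lborel (\<lambda>(x, t). indicator X x * ennreal (g y x (t - s))))"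

definition hawkes_construction ::
    "'w measure \<Rightarrow> 'a::euclidean_space set \<Rightarrow> ('a \<Rightarrow> real) \<Rightarrow> ('a \<Rightarrow> 'a \<Rightarrow> real \<Rightarrow> real) \<Rightarrow>
      (nat list \<Rightarrow> 'w \<Rightarrow> ('a \<times> real) option) \<Rightarrow> bool" where
  "hawkes_construction M X lam g pos \<longleftrightarrow>
    prob_space M \<and>
    (\<forall>u. u \<noteq> [] \<longrightarrow> (\<forall>B\<in>sets borel. {\<omega> \<in> space M. \<exists>b\<in>B. pos u \<omega> = Some b} \<in> sets M)) \<and>
    (\<forall>u \<omega> x t. u \<noteq> [] \<and> \<omega> \<in> space M \<and> pos u \<omega> = Some (x, t) \<longrightarrow> x \<in> X) \<and>
    poisson_process M (generation pos 0) (background_intensity X lam) \<and>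
    (\<forall>k. cond_indep_poisson_processes M (history M pos k) {u. length u = Suc k}
      (offspring pos) (\<lambda>u \<omega>. offspring_intensity X g (pos u \<omega>)))"


section \<open>Finiteness, stationarity and moment measures\<close>

definition as_locally_finite :: "'w measure \<Rightarrow> 'a set \<Rightarrow> ('w \<Rightarrow> ('a \<times> real) measure) \<Rightarrow> bool" where
  "as_locally_finite M X \<Xi> \<longleftrightarrow> (AE \<omega> in M. \<forall>a b. emeasure (\<Xi> \<omega>) (X \<times> {a..b}) < \<infinity>)"

text \<open>The space of Borel measures with the \<open>\<sigma>\<close>-algebra generated by the evaluations.\<close>

definition measure_algebra :: "'b::topological_space measure measure" where
  "measure_algebra = sigma {N. sets N = sets borel}
    {{N. sets N = sets borel \<and> emeasure N B \<in> C} | B C. B \<in> sets borel \<and> C \<in> sets borel}"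

definition strongly_time_stationary ::
    "'w measure \<Rightarrow> ('w \<Rightarrow> ('a::euclidean_space \<times> real) measure) \<Rightarrow> bool" where
  "strongly_time_stationary M \<Xi> \<longleftrightarrow>
    \<Xi> \<in> measurable M measure_algebra \<and>
    (\<forall>h. distr M measure_algebra (\<lambda>\<omega>. distr (\<Xi> \<omega>) borel (\<lambda>(x, t). (x, t + h))) =
         distr M measure_algebra \<Xi>)"

definition L2_process :: "'w measure \<Rightarrow> ('w \<Rightarrow> ('a::euclidean_space \<times> real) measure) \<Rightarrow> bool" where
  "L2_process M \<Xi> \<longleftrightarrow>
    (\<forall>B\<in>sets borel. bounded B \<longrightarrow> (\<integral>\<^sup>+ \<omega>. emeasure (\<Xi> \<omega>) B \<partial>M) < \<infinity>) \<and>
    (\<forall>C\<in>sets borel. bounded C \<longrightarrow> (\<integral>\<^sup>+ \<omega>. emeasure (\<Xi> \<omega> \<Otimes>\<^sub>M \<Xi> \<omega>) C \<partial>M) < \<infinity>)"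

definition spatial_mean_measure ::
    "'w measure \<Rightarrow> 'a::euclidean_space set \<Rightarrow> ('w \<Rightarrow> ('a \<times> real) measure) \<Rightarrow> 'a measure \<Rightarrow> bool" where
  "spatial_mean_measure M X \<Xi> \<mu> \<longleftrightarrow>
    sets \<mu> = sets (restrict_space borel X) \<and> finite_measure \<mu> \<and>
    (\<forall>A\<in>sets borel. A \<subseteq> X \<longrightarrow> (\<forall>I\<in>sets borel.
      (\<integral>\<^sup>+ \<omega>. emeasure (\<Xi> \<omega>) (A \<times> I) \<partial>M) = emeasure \<mu> A * emeasure lborel I))"

text \<open>\<open>M\<^bsub>[2],A\<^esub>\<close>, as a set function on the Borel sets of the plane; the sum is over labels, so that
  distinct points at the same location count as distinct.\<close>

definition factorial_moment2 ::
    "'w measure \<Rightarrow> (nat list \<Rightarrow> 'w \<Rightarrow> ('a::euclidean_space \<times> real) option) \<Rightarrow> 'a set \<Rightarrow>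
      (real \<times> real) set \<Rightarrow> ennreal" where
  "factorial_moment2 M pos A D =
    (\<integral>\<^sup>+ \<omega>. emeasure (count_space UNIV)
      {(u, v). u \<noteq> [] \<and> v \<noteq> [] \<and> u \<noteq> v \<and>
        (\<exists>x s y t. pos u \<omega> = Some (x, s) \<and> pos v \<omega> = Some (y, t) \<and>
          x \<in> A \<and> y \<in> A \<and> (s, t) \<in> D)} \<partial>M)"

definition locally_finite_measure :: "real measure \<Rightarrow> bool" where
  "locally_finite_measure N \<longleftrightarrow>
    sets N = sets borel \<and> (\<forall>S\<in>sets borel. bounded S \<longrightarrow> emeasure N S < \<infinity>)"

definition reduced_factorial_moment2 ::
    "'w measure \<Rightarrow> (nat list \<Rightarrow> 'w \<Rightarrow> ('a::euclidean_space \<times> real) option) \<Rightarrow> 'a set \<Rightarrow>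
      real measure \<Rightarrow> bool" where
  "reduced_factorial_moment2 M pos A R \<longleftrightarrow>
    locally_finite_measure R \<and>
    (\<forall>D\<in>sets borel. factorial_moment2 M pos A ((\<lambda>(r, s). (r, s - r)) -` D) =
      emeasure (lborel \<Otimes>\<^sub>M R) D)"

text \<open>The set function \<open>\<gamma>\<close> below is only meaningful on bounded Borel sets.\<close>

definition reduced_factorial_cov :: "'a measure \<Rightarrow> ('a set \<Rightarrow> real measure) \<Rightarrow> 'a set \<Rightarrow> real set \<Rightarrow> real" where
  "reduced_factorial_cov \<mu> R A S = measure (R A) S - (measure \<mu> A)\<^sup>2 * measure lborel S"

definition jordan_decomposition ::
    "(real set \<Rightarrow> real) \<Rightarrow> real measure \<Rightarrow> real measure \<Rightarrow> bool" where
  "jordan_decomposition \<gamma> P N \<longleftrightarrow>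
    locally_finite_measure P \<and> locally_finite_measure N \<and>
    (\<exists>H\<in>sets borel. emeasure P (- H) = 0 \<and> emeasure N H = 0) \<and>
    (\<forall>S\<in>sets borel. bounded S \<longrightarrow> \<gamma> S = measure P S - measure N S)"


section \<open>Convolutions\<close>

definition conv ::
    "'a::euclidean_space set \<Rightarrow> ('a \<Rightarrow> 'a \<Rightarrow> real \<Rightarrow> ennreal) \<Rightarrow> ('a \<Rightarrow> 'a \<Rightarrow> real \<Rightarrow> ennreal) \<Rightarrow>
      'a \<Rightarrow> 'a \<Rightarrow> real \<Rightarrow> ennreal" where
  "conv X f1 f2 y x t =
    (\<integral>\<^sup>+ x'\<in>X. (\<integral>\<^sup>+ t'. f1 y x' t' * f2 x' x (t - t') \<partial>lborel) \<partial>lborel)"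

text \<open>\<open>conv_pow_Suc X f k\<close> is the convolution power of \<open>f\<close> with exponent \<open>k + 1\<close>.\<close>

primrec conv_pow_Suc ::
    "'a::euclidean_space set \<Rightarrow> ('a \<Rightarrow> 'a \<Rightarrow> real \<Rightarrow> ennreal) \<Rightarrow> nat \<Rightarrow> 'a \<Rightarrow> 'a \<Rightarrow> real \<Rightarrow> ennreal" where
  "conv_pow_Suc X f 0 = f"
| "conv_pow_Suc X f (Suc k) = conv X f (conv_pow_Suc X f k)"

text \<open>
  Since \<open>g\<^sup>*\<^sup>0\<close> is a Dirac delta, the powers are represented by the measures
  \<open>g\<^sup>*\<^sup>k(y, x, t) dx dt\<close> on \<open>X \<times> \<real>\<close>, depending on \<open>y\<close>.
\<close>

definition conv_pow_measure ::
    "'a::euclidean_space set \<Rightarrow> ('a \<Rightarrow> 'a \<Rightarrow> real \<Rightarrow> real) \<Rightarrow> nat \<Rightarrow> 'a \<Rightarrow> ('a \<times> real) measure" where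
  "conv_pow_measure X g k y = (case k of
      0 \<Rightarrow> return borel (y, 0)
    | Suc j \<Rightarrow> density lborel (\<lambda>(x, t).
        indicator X x * conv_pow_Suc X (\<lambda>y x t. ennreal (g y x t)) j y x t))"

text \<open>The measure of \<open>B\<close> under \<open>(\<lambda> * f)(x, t) dx dt\<close>, with \<open>K y\<close> standing for \<open>f(y, x, t) dx dt\<close>.\<close>

definition background_conv ::
    "'a::euclidean_space set \<Rightarrow> ('a \<Rightarrow> real) \<Rightarrow> ('a \<Rightarrow> ('a \<times> real) measure) \<Rightarrow> ('a \<times> real) set \<Rightarrow> ennreal" where
  "background_conv X lam K B = (\<integral>\<^sup>+ y\<in>X. ennreal (lam y) * emeasure (K y) B \<partial>lborel)"

definition temp_conv :: "(real \<Rightarrow> ennreal) \<Rightarrow> (real \<Rightarrow> ennreal) \<Rightarrow> real \<Rightarrow> ennreal" where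
  "temp_conv f1 f2 t = (\<integral>\<^sup>+ s\<in>{0..t}. f1 s * f2 (t - s) \<partial>lborel)"

primrec temp_conv_pow_Suc :: "(real \<Rightarrow> ennreal) \<Rightarrow> nat \<Rightarrow> real \<Rightarrow> ennreal" where
  "temp_conv_pow_Suc f 0 = f"
| "temp_conv_pow_Suc f (Suc k) = temp_conv f (temp_conv_pow_Suc f k)"

definition temp_conv_pow_measure :: "(real \<Rightarrow> real) \<Rightarrow> nat \<Rightarrow> real measure" where
  "temp_conv_pow_measure gt k = (case k of
      0 \<Rightarrow> return borel 0
    | Suc j \<Rightarrow> density lborel (\<lambda>s. indicator {0..} s * temp_conv_pow_Suc (\<lambda>s. ennreal (gt s)) j s))"

text \<open>The measure \<open>G(s) ds\<close>, including its unit atom at 0.\<close>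

definition temp_resolvent :: "(real \<Rightarrow> real) \<Rightarrow> real measure" where
  "temp_resolvent gt = measure_sum (temp_conv_pow_measure gt)"

end

theory Submission
  imports Defs
begin

text \<open>
  Conditionally on the first generations, the next one consists of independent Poisson processes. Hence
  integrating out the last generation replaces a test function \<open>h\<close> by \<open>K h\<close> in means and by
  \<open>K (1 - exp (- h))\<close> in Laplace functionals, where \<open>K\<close> is the offspring kernel, and adds to
  second moments the contribution of siblings. Going back to the background process, whose
  intensity is invariant under time shifts, expresses the law of the process by shift-invariant quantities, which
  gives stationarity and the mean measure.

  Two distinct points are either independent of each other or have a last common ancestor. The second kind of
  pairs makes up the reduced covariance measure, which is therefore nonnegative; its
  negative part is zero. The time lags of the two points to their common ancestor are
  dominated by the resolvent of the temporal bound, and the pairs in which both points are the ancestor itself have to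
  be removed: this is the \<open>- 1\<close> in the covariance bound.

  For existence, the points of independent Poisson processes with Lebesgue intensity on space, time and marks are
  attached to all labels, and a point is kept if its mark is below the intensity prescribed by its parent.
\<close>

section \<open>The function \<open>exp (- x)\<close> on the extended nonnegative reals\<close>

text \<open>The definition of a Poisson process speaks only of events that counts of disjoint Borel
  sets take prescribed finite values. All analysis has to be lifted from such events, first to
  functions of the counts and then to integrals of nonnegative functions. The formulas are
  identities in \<open>ennreal\<close>, free of integrability conditions; \<open>nut < 1\<close>
  supplies the finite masses that make cancellations legitimate. The way back, from Laplace
  functionals to laws, goes through generating functions, because counts are natural numbers or
  infinite.

  The pairs with a given last common ancestor have as mean number a product of two cluster means:
  offspring is Poisson, so descendants of different children factorize. Averaging over the ancestor
  against \<open>mu\<close> times Lebesgue measure leaves a measure of time differences,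
  \<open>rho_full\<close>, which still contains each point paired with itself, an atom of mass
  \<open>mu A\<close> at 0. The constant for partitions is \<open>mu UNIV * (Ct * Ct)\<close>:
  cluster masses in disjoint sets add up to at most \<open>Ct\<close>, so their squares add up to at
  most \<open>Ct * Ct\<close>.\<close>

definition nexp :: "ennreal \<Rightarrow> ennreal" where
  "nexp x = (if x = \<infinity> then 0 else ennreal (exp (- enn2real x)))"

lemma nexp_top [simp]: "nexp \<infinity> = 0" "nexp top = 0"
  by (simp_all add: nexp_def)

lemma nexp_ennreal: "0 \<le> r \<Longrightarrow> nexp (ennreal r) = ennreal (exp (- r))"
  by (simp add: nexp_def)

lemma nexp_0 [simp]: "nexp 0 = 1"
  by (simp add: nexp_def)

lemma nexp_le_1: "nexp x \<le> 1"
  by (cases x) (auto simp: nexp_ennreal simp flip: ennreal_1 intro!: ennreal_leI)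

lemma nexp_less_top [simp]: "nexp x < top"
  using nexp_le_1[of x] by (rule order.strict_trans1) simp

lemma nexp_add: "nexp (x + y) = nexp x * nexp y"
  by (cases x; cases y)
    (auto simp: nexp_ennreal exp_add exp_diff exp_minus field_simps simp flip: ennreal_plus ennreal_mult)

lemma nexp_sum: "nexp (\<Sum>i\<in>A. f i) = (\<Prod>i\<in>A. nexp (f i))"
  by (induction A rule: infinite_finite_induct) (auto simp: nexp_add)

lemma nexp_antimono: "x \<le> y \<Longrightarrow> nexp y \<le> nexp x"
  by (metis le_iff_add mult.right_neutral mult_left_mono nexp_add nexp_le_1 zero_le)

lemma nexp_of_nat_mult: "nexp (s * of_nat n) = nexp s ^ n"
  by (induction n) (auto simp: distrib_left nexp_add)

text \<open>Continuity including the point at infinity: it gives the measurability of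
  \<open>nexp\<close> and allows limits inside Laplace functionals whose exponent may be
  infinite.\<close>

lemma tendsto_nexp:
  assumes "(f \<longlongrightarrow> x) F"
  shows "((\<lambda>i. nexp (f i)) \<longlongrightarrow> nexp x) F"
proof (cases "x = \<infinity>")
  case True
  have "((\<lambda>i. nexp (f i)) \<longlongrightarrow> 0) F"
  proof (rule order_tendstoI)
    fix a :: ennreal assume "0 < a"
    then obtain b where b: "0 < b" "b < a" using dense by blast
    then have bf: "b < top" by (metis order.strict_trans2 top_greatest)
    define r where "r = enn2real b"
    have r: "b = ennreal r" "0 < r"
      using b bf by (auto simp: r_def enn2real_positive_iff)
    \<comment> \<open>\<open>f i\<close> above \<open>- ln r\<close> forces
      \<open>nexp (f i)\<close> to be at most \<open>b = r\<close>; the maximum with 0 keeps the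
      threshold nonnegative when \<open>r > 1\<close>.\<close>
    have "ennreal (max 0 (- ln r)) < x" using True by simp
    then have "\<forall>\<^sub>F i in F. ennreal (max 0 (- ln r)) < f i"
      using order_tendstoD(1)[OF assms] by blast
    then show "\<forall>\<^sub>F i in F. nexp (f i) < a"
    proof eventually_elim
      case (elim i)
      have "nexp (f i) \<le> nexp (ennreal (max 0 (- ln r)))"
        using elim by (intro nexp_antimono) simp
      also have "\<dots> = ennreal (exp (- max 0 (- ln r)))" by (rule nexp_ennreal) simp
      also have "\<dots> \<le> ennreal (exp (ln r))" by (intro ennreal_leI) simp
      also have "\<dots> = b" using r by simp
      finally show ?case using b by simp
    qed
  qed simp
  then show ?thesis using True by simp
next
  case False
  then have fin: "x < top" by (simp add: less_top)
  have "\<forall>\<^sub>F i in F. f i < top" using order_tendstoD(1,2)[OF assms] fin by blast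
  then have ev: "\<forall>\<^sub>F i in F. ennreal (exp (- enn2real (f i))) = nexp (f i)"
    by eventually_elim (auto simp: nexp_def)
  have "((\<lambda>i. ennreal (exp (- enn2real (f i)))) \<longlongrightarrow> ennreal (exp (- enn2real x))) F"
    using fin assms by (intro tendsto_ennrealI tendsto_exp tendsto_minus tendsto_enn2real) auto
  then show ?thesis using False ev
    by (simp add: nexp_def[of x] tendsto_cong)
qed

lemma nexp_measurable [measurable]: "nexp \<in> borel_measurable borel"
  by (intro borel_measurable_continuous_onI)
    (auto simp: continuous_on_def intro!: tendsto_nexp tendsto_ident_at)

section \<open>Moments of the Poisson distribution\<close>

lemma poisson_mass_nonneg [simp]: "0 \<le> poisson_mass r m"
  by (simp add: poisson_mass_def)

lemma poisson_mass_ennreal: "0 \<le> r \<Longrightarrow> poisson_mass (ennreal r) m = r ^ m / fact m * exp (- r)"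
  by (simp add: poisson_mass_def)

lemma poisson_mass_measurable [measurable]: "(\<lambda>r. poisson_mass r m) \<in> borel_measurable borel"
  unfolding poisson_mass_def by measurable

lemma exp_series: "(\<lambda>m. r ^ m / fact m) sums exp (r::real)"
  using exp_converges[of r] by (simp add: scaleR_conv_of_real divide_inverse mult.commute)

text \<open>The factor \<open>m\<close> cancels against the factorial after a shift of the index;
  the term for \<open>m = 0\<close> is zero, so the shifted sum is the whole sum.\<close>

lemma exp_series1: "(\<lambda>m. real m * (r ^ m / fact m)) sums (r * exp (r::real))"
proof -
  have "(\<lambda>m. real (Suc m) * (r ^ Suc m / fact (Suc m))) = (\<lambda>m. r * (r ^ m / fact m))"
    by (auto simp: fun_eq_iff simp del: of_nat_Suc)
  then have "(\<lambda>m. real (Suc m) * (r ^ Suc m / fact (Suc m))) sums (r * exp r)"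
    using sums_mult[OF exp_series[of r], of r] by (simp only:)
  from sums_Suc[OF this] show ?thesis by simp
qed

lemma exp_series2: "(\<lambda>m. real m * real m * (r ^ m / fact m)) sums ((r * r + r) * exp (r::real))"
proof -
  have "(\<lambda>m. real (Suc m) * real (Suc m) * (r ^ Suc m / fact (Suc m))) =
      (\<lambda>m. r * (real m * (r ^ m / fact m) + r ^ m / fact m))"
  proof
    fix m
    have "real (Suc m) * real (Suc m) * (r ^ Suc m / fact (Suc m)) =
      real (Suc m) * (r * (r ^ m / fact m))"
      by (simp del: of_nat_Suc)
    moreover have "real (Suc m) * (r * (r ^ m / fact m)) = r * (real m * (r ^ m / fact m) + r ^ m / fact m)"
      by (simp add: algebra_simps add_divide_distrib)
    ultimately show "real (Suc m) * real (Suc m) * (r ^ Suc m / fact (Suc m)) =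
      r * (real m * (r ^ m / fact m) + r ^ m / fact m)" by (rule trans)
  qed
  moreover have "(\<lambda>m. r * (real m * (r ^ m / fact m) + r ^ m / fact m)) sums (r * (r * exp r + exp r))"
    by (intro sums_mult sums_add exp_series exp_series1)
  ultimately have "(\<lambda>m. real (Suc m) * real (Suc m) * (r ^ Suc m / fact (Suc m))) sums
      (r * (r * exp r + exp r))" by (simp only:)
  from sums_Suc[OF this] show ?thesis by (simp add: algebra_simps)
qed

text \<open>Total mass, mean, second moment and Laplace transform of the Poisson distribution.
  Finiteness of \<open>r\<close> matters: \<open>poisson_mass\<close> vanishes identically for
  infinite \<open>r\<close>, and then the masses sum to 0.\<close>

lemma poisson_suminf:
  assumes "r < \<infinity>"
  shows poisson_suminf_1: "(\<Sum>m. ennreal (poisson_mass r m)) = 1"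
    and poisson_suminf_mean: "(\<Sum>m. of_nat m * ennreal (poisson_mass r m)) = r"
    and poisson_suminf_square: "(\<Sum>m. of_nat m * of_nat m * ennreal (poisson_mass r m)) = r * r + r"
    and poisson_suminf_nexp:
      "(\<Sum>m. nexp (s * of_nat m) * ennreal (poisson_mass r m)) = nexp ((1 - nexp s) * r)"
proof -
  obtain \<rho> where r: "r = ennreal \<rho>" "0 \<le> \<rho>" using assms by (cases r) auto
  have pm: "poisson_mass r m = \<rho> ^ m / fact m * exp (- \<rho>)" for m
    using r by (simp add: poisson_mass_ennreal)
  have "(\<lambda>m. \<rho> ^ m / fact m * exp (- \<rho>)) sums (exp \<rho> * exp (- \<rho>))"
    by (intro sums_mult2 exp_series)
  then show "(\<Sum>m. ennreal (poisson_mass r m)) = 1"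
    unfolding pm using r by (subst suminf_ennreal_eq) (auto simp: exp_minus)
  have *: "a * exp \<rho> * exp (- \<rho>) = a" for a by (simp add: exp_minus)
  have "(\<lambda>m. real m * (\<rho> ^ m / fact m) * exp (- \<rho>)) sums \<rho>"
    using sums_mult2[OF exp_series1, of \<rho> "exp (- \<rho>)"] unfolding * .
  then have "(\<Sum>m. ennreal (real m * (\<rho> ^ m / fact m) * exp (- \<rho>))) = r"
    using r by (subst suminf_ennreal_eq) auto
  moreover have "ennreal (real m * (\<rho> ^ m / fact m) * exp (- \<rho>)) =
      of_nat m * ennreal (poisson_mass r m)" for m
    unfolding pm ennreal_of_nat_eq_real_of_nat using r by (simp add: mult.assoc flip: ennreal_mult')
  ultimately show "(\<Sum>m. of_nat m * ennreal (poisson_mass r m)) = r" by simp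
  have "(\<lambda>m. real m * real m * (\<rho> ^ m / fact m) * exp (- \<rho>)) sums (\<rho> * \<rho> + \<rho>)"
    using sums_mult2[OF exp_series2, of \<rho> "exp (- \<rho>)"] unfolding * .
  then have "(\<Sum>m. ennreal (real m * real m * (\<rho> ^ m / fact m) * exp (- \<rho>))) = r * r + r"
    using r by (subst suminf_ennreal_eq) (auto simp: ennreal_mult)
  moreover have "ennreal (real m * real m * (\<rho> ^ m / fact m) * exp (- \<rho>)) =
      of_nat m * of_nat m * ennreal (poisson_mass r m)" for m
    unfolding pm ennreal_of_nat_eq_real_of_nat using r by (simp add: mult.assoc flip: ennreal_mult')
  ultimately show "(\<Sum>m. of_nat m * of_nat m * ennreal (poisson_mass r m)) = r * r + r" by simp
  \<comment> \<open>The Laplace transform at \<open>s\<close> is the generating function at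
    \<open>x\<close>; \<open>s\<close> may be infinite, in which case \<open>x = 0\<close>.\<close>
  obtain x where x: "nexp s = ennreal x" "0 \<le> x" "x \<le> 1"
    using nexp_le_1[of s] nexp_less_top[of s] by (cases "nexp s") auto
  have "(\<lambda>m. (x * \<rho>) ^ m / fact m * exp (- \<rho>)) sums (exp (x * \<rho>) * exp (- \<rho>))"
    by (intro sums_mult2 exp_series)
  then have "(\<Sum>m. ennreal ((x * \<rho>) ^ m / fact m * exp (- \<rho>))) = ennreal (exp (x * \<rho>) * exp (- \<rho>))"
    using r x by (subst suminf_ennreal_eq) auto
  moreover have "ennreal ((x * \<rho>) ^ m / fact m * exp (- \<rho>)) = nexp (s * of_nat m) * ennreal (poisson_mass r m)" for m
    unfolding pm using r x by (simp add: nexp_of_nat_mult power_mult_distrib ennreal_power flip: ennreal_mult')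
  moreover have "ennreal (exp (x * \<rho>) * exp (- \<rho>)) = nexp ((1 - nexp s) * r)"
  proof -
    have "(1 - nexp s) * r = ennreal ((1 - x) * \<rho>)"
      using x r by (simp add: ennreal_mult ennreal_minus flip: ennreal_1)
    then show ?thesis using x r
      by (simp add: nexp_ennreal mult_left_le_one_le)
        (simp add: left_diff_distrib exp_diff exp_minus field_simps)
  qed
  ultimately show "(\<Sum>m. nexp (s * of_nat m) * ennreal (poisson_mass r m)) = nexp ((1 - nexp s) * r)"
    by simp
qed

section \<open>Monotone-continuous linear functionals on nonnegative functions\<close>

text \<open>The three properties that the standard induction over measurable functions uses. They
  are isolated because many functionals below are not given as integrals against a measure, for
  instance a weighted mean of random integrals; two such functionals then need to be compared on
  indicators only.\<close>

definition nnlin :: "(('b::topological_space \<Rightarrow> ennreal) \<Rightarrow> ennreal) \<Rightarrow> bool" where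
  "nnlin \<Phi> \<longleftrightarrow>
    (\<forall>f\<in>borel_measurable borel. \<forall>g\<in>borel_measurable borel. \<Phi> (\<lambda>x. f x + g x) = \<Phi> f + \<Phi> g) \<and>
    (\<forall>c. \<forall>f\<in>borel_measurable borel. \<Phi> (\<lambda>x. c * f x) = c * \<Phi> f) \<and>
    (\<forall>U f. (\<forall>i. U i \<in> borel_measurable borel) \<and> incseq U \<and> (\<forall>x. f x = (SUP i. U i x)) \<longrightarrow>
      incseq (\<lambda>i. \<Phi> (U i)) \<and> \<Phi> f = (SUP i. \<Phi> (U i)))"

lemma nnlinD:
  assumes "nnlin \<Phi>"
  shows "f \<in> borel_measurable borel \<Longrightarrow> g \<in> borel_measurable borel \<Longrightarrow> \<Phi> (\<lambda>x. f x + g x) = \<Phi> f + \<Phi> g"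
    and "f \<in> borel_measurable borel \<Longrightarrow> \<Phi> (\<lambda>x. c * f x) = c * \<Phi> f"
    and "(\<And>i. U i \<in> borel_measurable borel) \<Longrightarrow> incseq U \<Longrightarrow> (\<And>x. f x = (SUP i. U i x)) \<Longrightarrow>
      \<Phi> f = (SUP i. \<Phi> (U i))"
    and "(\<And>i. U i \<in> borel_measurable borel) \<Longrightarrow> incseq U \<Longrightarrow> incseq (\<lambda>i. \<Phi> (U i))"
proof -
  note A = assms[unfolded nnlin_def]
  show "f \<in> borel_measurable borel \<Longrightarrow> g \<in> borel_measurable borel \<Longrightarrow> \<Phi> (\<lambda>x. f x + g x) = \<Phi> f + \<Phi> g"
    using A[THEN conjunct1] by blast
  show "f \<in> borel_measurable borel \<Longrightarrow> \<Phi> (\<lambda>x. c * f x) = c * \<Phi> f"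
    using A[THEN conjunct2, THEN conjunct1] by blast
  note A3 = A[THEN conjunct2, THEN conjunct2, rule_format, OF conjI, OF _ conjI, rule_format]
  show "(\<And>i. U i \<in> borel_measurable borel) \<Longrightarrow> incseq U \<Longrightarrow> (\<And>x. f x = (SUP i. U i x)) \<Longrightarrow>
      \<Phi> f = (SUP i. \<Phi> (U i))"
    by (rule A3[THEN conjunct2]) auto
  show "(\<And>i. U i \<in> borel_measurable borel) \<Longrightarrow> incseq U \<Longrightarrow> incseq (\<lambda>i. \<Phi> (U i))"
    by (rule A3[THEN conjunct1]) auto
qed

lemma nnlin_nn_integral:
  assumes "sets \<kappa> = sets borel"
  shows "nnlin (\<lambda>f. \<integral>\<^sup>+x. f x \<partial>\<kappa>)"
proof -
  have [measurable_cong]: "sets \<kappa> = sets borel" by fact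
  show ?thesis
    unfolding nnlin_def
  proof (intro conjI ballI allI impI)
    fix U :: "nat \<Rightarrow> 'a \<Rightarrow> ennreal" and f
    assume *: "(\<forall>i. U i \<in> borel_measurable borel) \<and> incseq U \<and> (\<forall>x. f x = (SUP i. U i x))"
    then have [measurable]: "\<And>i. U i \<in> borel_measurable borel" by auto
    show "(\<integral>\<^sup>+x. f x \<partial>\<kappa>) = (SUP i. \<integral>\<^sup>+x. U i x \<partial>\<kappa>)"
    proof -
      have "(\<integral>\<^sup>+x. f x \<partial>\<kappa>) = (\<integral>\<^sup>+x. (SUP i. U i x) \<partial>\<kappa>)" using * by metis
      then show ?thesis using * by (simp add: nn_integral_monotone_convergence_SUP)
    qed
    show "incseq (\<lambda>i. \<integral>\<^sup>+x. U i x \<partial>\<kappa>)"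
      using * by (auto simp: incseq_def le_fun_def intro!: nn_integral_mono)
  qed (auto simp: nn_integral_add nn_integral_cmult)
qed

lemma nnlin_integral:
  assumes lin: "\<And>\<omega>. \<omega> \<in> space M \<Longrightarrow> nnlin (\<Phi> \<omega>)"
    and meas: "\<And>f. f \<in> borel_measurable borel \<Longrightarrow> (\<lambda>\<omega>. \<Phi> \<omega> f) \<in> borel_measurable M"
    and [measurable]: "W \<in> borel_measurable M"
  shows "nnlin (\<lambda>f. \<integral>\<^sup>+\<omega>. W \<omega> * \<Phi> \<omega> f \<partial>M)"
  unfolding nnlin_def
proof (intro conjI ballI allI impI)
  fix f g :: "'b \<Rightarrow> ennreal" assume [measurable]: "f \<in> borel_measurable borel" "g \<in> borel_measurable borel"
  note [measurable] = meas[of f] meas[of g]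
  have "(\<integral>\<^sup>+\<omega>. W \<omega> * \<Phi> \<omega> (\<lambda>x. f x + g x) \<partial>M) = (\<integral>\<^sup>+\<omega>. W \<omega> * \<Phi> \<omega> f + W \<omega> * \<Phi> \<omega> g \<partial>M)"
    by (intro nn_integral_cong) (simp add: nnlinD(1)[OF lin] distrib_left)
  then show "(\<integral>\<^sup>+\<omega>. W \<omega> * \<Phi> \<omega> (\<lambda>x. f x + g x) \<partial>M) =
      (\<integral>\<^sup>+\<omega>. W \<omega> * \<Phi> \<omega> f \<partial>M) + (\<integral>\<^sup>+\<omega>. W \<omega> * \<Phi> \<omega> g \<partial>M)"
    by (simp add: nn_integral_add)
next
  fix c and f :: "'b \<Rightarrow> ennreal" assume [measurable]: "f \<in> borel_measurable borel"
  note [measurable] = meas[of f]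
  have "(\<integral>\<^sup>+\<omega>. W \<omega> * \<Phi> \<omega> (\<lambda>x. c * f x) \<partial>M) = (\<integral>\<^sup>+\<omega>. c * (W \<omega> * \<Phi> \<omega> f) \<partial>M)"
    by (intro nn_integral_cong) (simp add: nnlinD(2)[OF lin] ac_simps)
  then show "(\<integral>\<^sup>+\<omega>. W \<omega> * \<Phi> \<omega> (\<lambda>x. c * f x) \<partial>M) = c * (\<integral>\<^sup>+\<omega>. W \<omega> * \<Phi> \<omega> f \<partial>M)"
    by (simp add: nn_integral_cmult)
next
  fix U :: "nat \<Rightarrow> 'b \<Rightarrow> ennreal" and f
  assume *: "(\<forall>i. U i \<in> borel_measurable borel) \<and> incseq U \<and> (\<forall>x. f x = (SUP i. U i x))"
  note [measurable] = meas[of "U i" for i]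
  have inc: "incseq (\<lambda>i. \<Phi> \<omega> (U i))" if "\<omega> \<in> space M" for \<omega>
    using nnlinD(4)[OF lin[OF that]] * by blast
  have sup: "\<Phi> \<omega> f = (SUP i. \<Phi> \<omega> (U i))" if "\<omega> \<in> space M" for \<omega>
    using * by (intro nnlinD(3)[OF lin[OF that]]) auto
  have U: "\<And>i. U i \<in> borel_measurable borel" using * by auto
  have "(\<integral>\<^sup>+\<omega>. W \<omega> * \<Phi> \<omega> f \<partial>M) = (\<integral>\<^sup>+\<omega>. (SUP i. W \<omega> * \<Phi> \<omega> (U i)) \<partial>M)"
    by (intro nn_integral_cong) (simp add: sup SUP_mult_left_ennreal)
  also have "\<dots> = (SUP i. \<integral>\<^sup>+\<omega>. W \<omega> * \<Phi> \<omega> (U i) \<partial>M)"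
    using inc U by (intro nn_integral_monotone_convergence_SUP_AE)
      (auto simp: incseq_def intro!: mult_left_mono)
  finally show "(\<integral>\<^sup>+\<omega>. W \<omega> * \<Phi> \<omega> f \<partial>M) = (SUP i. \<integral>\<^sup>+\<omega>. W \<omega> * \<Phi> \<omega> (U i) \<partial>M)" .
  show "incseq (\<lambda>i. \<integral>\<^sup>+\<omega>. W \<omega> * \<Phi> \<omega> (U i) \<partial>M)"
    using inc by (auto simp: incseq_def intro!: nn_integral_mono mult_left_mono)
qed

lemma nnlin_cmult: assumes "nnlin \<Phi>" shows "nnlin (\<lambda>f. c * \<Phi> f)"
  unfolding nnlin_def
proof (intro conjI ballI allI impI)
  fix U :: "nat \<Rightarrow> 'a \<Rightarrow> ennreal" and f
  note \<Phi> = assms assume *: "(\<forall>i. U i \<in> borel_measurable borel) \<and> incseq U \<and> (\<forall>x. f x = (SUP i. U i x))"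
  have "\<Phi> f = (SUP i. \<Phi> (U i))" using * by (intro nnlinD(3)[OF \<Phi>]) auto
  then show "c * \<Phi> f = (SUP i. c * \<Phi> (U i))" by (simp only: SUP_mult_left_ennreal)
  have "incseq (\<lambda>i. \<Phi> (U i))" using * by (intro nnlinD(4)[OF \<Phi>]) auto
  then show "incseq (\<lambda>i. c * \<Phi> (U i))" by (auto simp: incseq_def intro: mult_left_mono)
next
  fix f g :: "'a \<Rightarrow> ennreal" assume "f \<in> borel_measurable borel" "g \<in> borel_measurable borel"
  then show "c * \<Phi> (\<lambda>x. f x + g x) = c * \<Phi> f + c * \<Phi> g" by (simp only: nnlinD(1)[OF assms] distrib_left)
next
  fix d and f :: "'a \<Rightarrow> ennreal" assume "f \<in> borel_measurable borel"
  then show "c * \<Phi> (\<lambda>x. d * f x) = d * (c * \<Phi> f)" by (simp only: nnlinD(2)[OF assms] mult.left_commute)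
qed

text \<open>Addition is integration over the counting measure on \<open>bool\<close>, so
  \<open>nnlin_integral\<close> applies.\<close>

lemma nnlin_add:
  assumes "nnlin \<Phi>" "nnlin \<Psi>"
  shows "nnlin (\<lambda>f. \<Phi> f + \<Psi> f)"
proof -
  have "nnlin (if b then \<Phi> else \<Psi>)" for b using assms by simp
  then have "nnlin (\<lambda>f. \<integral>\<^sup>+b. 1 * (if b then \<Phi> else \<Psi>) f \<partial>count_space (UNIV :: bool set))"
    using assms by (intro nnlin_integral) (auto split: if_split)
  then show ?thesis by (simp add: nn_integral_count_space_finite UNIV_bool add.commute)
qed

text \<open>Serves to compose functionals with multiplication by a fixed function and with the
  offspring operator and its powers.\<close>

lemma nnlin_comp:
  assumes "nnlin \<Phi>"
    and meas: "\<And>f. f \<in> borel_measurable borel \<Longrightarrow> T f \<in> borel_measurable borel"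
    and lin: "\<And>x. nnlin (\<lambda>f. T f x)"
  shows "nnlin (\<lambda>f. \<Phi> (T f))"
  unfolding nnlin_def
proof (intro conjI ballI allI impI)
  fix f g :: "'b \<Rightarrow> ennreal" assume fg: "f \<in> borel_measurable borel" "g \<in> borel_measurable borel"
  have "T (\<lambda>x. f x + g x) = (\<lambda>y. T f y + T g y)" using fg nnlinD(1)[OF lin] by auto
  then show "\<Phi> (T (\<lambda>x. f x + g x)) = \<Phi> (T f) + \<Phi> (T g)"
    using meas fg nnlinD(1)[OF assms(1), of "T f" "T g"] by simp
next
  fix c and f :: "'b \<Rightarrow> ennreal" assume f: "f \<in> borel_measurable borel"
  have "T (\<lambda>x. c * f x) = (\<lambda>y. c * T f y)" using f nnlinD(2)[OF lin] by auto
  then show "\<Phi> (T (\<lambda>x. c * f x)) = c * \<Phi> (T f)"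
    using meas f nnlinD(2)[OF assms(1), of "T f"] by simp
next
  fix U :: "nat \<Rightarrow> 'b \<Rightarrow> ennreal" and f
  assume *: "(\<forall>i. U i \<in> borel_measurable borel) \<and> incseq U \<and> (\<forall>x. f x = (SUP i. U i x))"
  have inc: "incseq (\<lambda>i. T (U i))" 
    using nnlinD(4)[OF lin] * by (auto simp: incseq_def le_fun_def)
  have sup: "\<And>x. T f x = (SUP i. T (U i) x)"
    using * by (intro nnlinD(3)[OF lin]) auto
  show "\<Phi> (T f) = (SUP i. \<Phi> (T (U i)))"
    using * inc sup meas by (intro nnlinD(3)[OF assms(1)]) auto
  show "incseq (\<lambda>i. \<Phi> (T (U i)))"
    using * inc meas by (intro nnlinD(4)[OF assms(1)]) auto
qed

text \<open>Agreement on all Borel subsets of the \<open>E n\<close> reaches every Borel set by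
  monotone continuity, and every measurable function by induction. No subtraction occurs, so values
  may be infinite.\<close>

lemma nnlin_ext:
  fixes \<Phi> \<Psi> :: "('b::topological_space \<Rightarrow> ennreal) \<Rightarrow> ennreal"
  assumes lin: "nnlin \<Phi>" "nnlin \<Psi>"
    and E: "incseq E" "\<And>n. E n \<in> sets borel" "(\<Union>n. E n) = UNIV"
    and eq: "\<And>n A. A \<in> sets borel \<Longrightarrow> A \<subseteq> E n \<Longrightarrow> \<Phi> (indicator A) = \<Psi> (indicator A)"
    and f: "f \<in> borel_measurable borel"
  shows "\<Phi> f = \<Psi> f"
  using f
proof induction
  case (cong f g)
  then have "f = g" by auto
  with cong show ?case by simp
next
  case (set A)
  have sup: "indicator A x = (SUP n. indicator (A \<inter> E n) x :: ennreal)" for x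
  proof -
    obtain m where m: "x \<in> E m" using E(3) by blast
    show ?thesis
    proof (rule antisym)
      show "indicator A x \<le> (SUP n. indicator (A \<inter> E n) x :: ennreal)"
        using m by (intro SUP_upper2[of m]) (auto simp: indicator_def)
    qed (auto intro!: SUP_least simp: indicator_def)
  qed
  have inc: "incseq (\<lambda>n. indicator (A \<inter> E n) :: 'b \<Rightarrow> ennreal)"
    using E(1) by (auto simp: incseq_def le_fun_def indicator_def)
  have *: "\<Theta> (indicator A) = (SUP n. \<Theta> (indicator (A \<inter> E n)))" if "nnlin \<Theta>" for \<Theta>
    using set E inc sup by (intro nnlinD(3)[OF that]) auto
  have "\<Phi> (indicator (A \<inter> E n)) = \<Psi> (indicator (A \<inter> E n))" for n
    using set E by (intro eq[of _ n]) auto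
  then show ?case by (simp add: *[OF lin(1)] *[OF lin(2)])
next
  case (mult u c) then show ?case using lin by (simp add: nnlinD(2))
next
  case (add u v) then show ?case using lin by (simp add: nnlinD(1))
next
  case (seq U)
  have *: "\<Theta> (SUP i. U i) = (SUP n. \<Theta> (U n))" if "nnlin \<Theta>" for \<Theta>
    using seq by (intro nnlinD(3)[OF that]) (auto simp: image_comp)
  show ?case unfolding *[OF lin(1)] *[OF lin(2)] using seq by simp
qed

lemma nnlin_ext':
  fixes \<Phi> \<Psi> :: "('b::topological_space \<Rightarrow> ennreal) \<Rightarrow> ennreal"
  assumes "nnlin \<Phi>" "nnlin \<Psi>"
    and "\<And>A. A \<in> sets borel \<Longrightarrow> \<Phi> (indicator A) = \<Psi> (indicator A)"
    and "f \<in> borel_measurable borel"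
  shows "\<Phi> f = \<Psi> f"
  using assms(1,2) _ _ _ _ assms(4)
  by (rule nnlin_ext[where E="\<lambda>_. UNIV"]) (use assms in auto)

lemma kernel_nn_integral_measurable:
  fixes \<kappa> :: "'w \<Rightarrow> 'b::topological_space measure"
  assumes s: "\<And>\<omega>. \<omega> \<in> space M \<Longrightarrow> sets (\<kappa> \<omega>) = sets borel"
    and m: "\<And>B. B \<in> sets borel \<Longrightarrow> (\<lambda>\<omega>. emeasure (\<kappa> \<omega>) B) \<in> borel_measurable M"
    and f: "f \<in> borel_measurable borel"
  shows "(\<lambda>\<omega>. \<integral>\<^sup>+x. f x \<partial>\<kappa> \<omega>) \<in> borel_measurable M"
proof -
  have lin: "nnlin (\<lambda>f. \<integral>\<^sup>+x. f x \<partial>\<kappa> \<omega>)" if "\<omega> \<in> space M" for \<omega>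
    using s[OF that] by (rule nnlin_nn_integral)
  show ?thesis using f
  proof induction
    case (cong f g) then have "f = g" by auto
    with cong show ?case by simp
  next
    case (set A)
    have "(\<lambda>\<omega>. emeasure (\<kappa> \<omega>) A) \<in> borel_measurable M \<longleftrightarrow>
        (\<lambda>\<omega>. \<integral>\<^sup>+x. indicator A x \<partial>\<kappa> \<omega>) \<in> borel_measurable M"
      using s set by (intro measurable_cong) (subst nn_integral_indicator, auto)
    then show ?case using m[OF set] by blast
  next
    case (mult u c)
    have "(\<lambda>\<omega>. c * (\<integral>\<^sup>+x. u x \<partial>\<kappa> \<omega>)) \<in> borel_measurable M \<longleftrightarrow>
        (\<lambda>\<omega>. \<integral>\<^sup>+x. c * u x \<partial>\<kappa> \<omega>) \<in> borel_measurable M"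
      using mult by (intro measurable_cong) (simp add: nnlinD(2)[OF lin])
    moreover have "(\<lambda>\<omega>. c * (\<integral>\<^sup>+x. u x \<partial>\<kappa> \<omega>)) \<in> borel_measurable M"
      using mult by (intro borel_measurable_times_ennreal borel_measurable_const)
    ultimately show ?case by blast
  next
    case (add u v)
    have "(\<lambda>\<omega>. (\<integral>\<^sup>+x. v x \<partial>\<kappa> \<omega>) + (\<integral>\<^sup>+x. u x \<partial>\<kappa> \<omega>)) \<in> borel_measurable M \<longleftrightarrow>
        (\<lambda>\<omega>. \<integral>\<^sup>+x. v x + u x \<partial>\<kappa> \<omega>) \<in> borel_measurable M"
      using add by (intro measurable_cong) (simp add: nnlinD(1)[OF lin])
    moreover have "(\<lambda>\<omega>. (\<integral>\<^sup>+x. v x \<partial>\<kappa> \<omega>) + (\<integral>\<^sup>+x. u x \<partial>\<kappa> \<omega>)) \<in> borel_measurable M"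
      using add by (intro borel_measurable_add)
    ultimately show ?case by blast
  next
    case (seq U)
    have "(\<lambda>\<omega>. SUP i. \<integral>\<^sup>+x. U i x \<partial>\<kappa> \<omega>) \<in> borel_measurable M \<longleftrightarrow>
        (\<lambda>\<omega>. \<integral>\<^sup>+x. (SUP i. U i) x \<partial>\<kappa> \<omega>) \<in> borel_measurable M"
      using seq by (intro measurable_cong) (simp add: nnlinD(3)[OF lin, of _ U] image_comp)
    moreover have "(\<lambda>\<omega>. SUP i. \<integral>\<^sup>+x. U i x \<partial>\<kappa> \<omega>) \<in> borel_measurable M"
      using seq by (intro borel_measurable_SUP) auto
    ultimately show ?case by blast
  qed
qed

lemma nnlin_kernel:
  fixes \<kappa> :: "'w \<Rightarrow> 'b::topological_space measure"
  assumes "\<And>\<omega>. \<omega> \<in> space M \<Longrightarrow> sets (\<kappa> \<omega>) = sets borel"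
    and "\<And>B. B \<in> sets borel \<Longrightarrow> (\<lambda>\<omega>. emeasure (\<kappa> \<omega>) B) \<in> borel_measurable M"
    and "W \<in> borel_measurable M"
  shows "nnlin (\<lambda>f. \<integral>\<^sup>+\<omega>. W \<omega> * (\<integral>\<^sup>+x. f x \<partial>\<kappa> \<omega>) \<partial>M)"
  using assms by (intro nnlin_integral nnlin_nn_integral kernel_nn_integral_measurable)

section \<open>Conditionally independent Poisson processes\<close>

text \<open>The densities \<open>f\<close> and \<open>g\<close> define measures that agree after
  restriction to \<open>F\<close>, and an \<open>F\<close>-measurable \<open>Y\<close> integrates
  equally against both. In this form conditional laws are used without conditional
  expectations.\<close>

lemma nn_integral_mult_eqI:
  assumes F: "subalgebra M F"
    and [measurable]: "f \<in> borel_measurable M" "g \<in> borel_measurable M"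
    and Y: "Y \<in> borel_measurable F"
    and eq: "\<And>H. H \<in> sets F \<Longrightarrow> (\<integral>\<^sup>+\<omega>\<in>H. f \<omega> \<partial>M) = (\<integral>\<^sup>+\<omega>\<in>H. g \<omega> \<partial>M)"
  shows "(\<integral>\<^sup>+\<omega>. Y \<omega> * f \<omega> \<partial>M) = (\<integral>\<^sup>+\<omega>. Y \<omega> * g \<omega> \<partial>M)"
proof -
  have YM [measurable]: "Y \<in> borel_measurable M" using F Y by (rule measurable_from_subalg)
  have sub: "subalgebra (density M h) F" for h using F by (simp add: subalgebra_def)
  have "restr_to_subalg (density M f) F = restr_to_subalg (density M g) F"
  proof (rule measure_eqI)
    fix H assume "H \<in> sets (restr_to_subalg (density M f) F)"
    then have H: "H \<in> sets F" using sets_restr_to_subalg[OF sub] by blast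
    then have [measurable]: "H \<in> sets M" using F by (auto simp: subalgebra_def)
    show "emeasure (restr_to_subalg (density M f) F) H = emeasure (restr_to_subalg (density M g) F) H"
      using eq[OF H] by (simp add: emeasure_restr_to_subalg[OF sub H] emeasure_density)
  qed (simp add: sets_restr_to_subalg[OF sub])
  then have "(\<integral>\<^sup>+\<omega>. Y \<omega> \<partial>density M f) = (\<integral>\<^sup>+\<omega>. Y \<omega> \<partial>density M g)"
    using nn_integral_subalgebra2[OF sub Y] by metis
  then show ?thesis by (simp add: nn_integral_density mult.commute)
qed

lemma borel_measurable_nn_integral_count_space:
  assumes I: "countable I" and f: "\<And>i. i \<in> I \<Longrightarrow> f i \<in> borel_measurable M"
  shows "(\<lambda>x. \<integral>\<^sup>+i. f i x \<partial>count_space I) \<in> borel_measurable M"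
proof (cases "finite I")
  case True
  then show ?thesis using f by (simp add: nn_integral_count_space_finite)
next
  case False
  then have ne: "I \<noteq> {}" by auto
  note * = bij_betw_from_nat_into[OF I False]
  have "(\<integral>\<^sup>+i. f i x \<partial>count_space I) = (\<Sum>n. f (from_nat_into I n) x)" for x
    by (simp add: nn_integral_bij_count_space[symmetric, OF *] nn_integral_count_space_nat)
  then show ?thesis using f from_nat_into[OF ne] by (simp add: borel_measurable_suminf)
qed

lemma nexp_le_one_mult: "c \<le> 1 \<Longrightarrow> nexp x * c \<le> 1"
  using mult_mono[OF nexp_le_1[of x], of c 1] by simp

lemma suminf_pull:
  fixes x :: ennreal
  shows "(\<Sum>k. a k * (x * (y * (b k * z)))) = x * (((\<Sum>k. a k * b k) * y) * z)"
proof -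
  have "(\<Sum>k. a k * (x * (y * (b k * z)))) = (\<Sum>k. a k * b k * (x * y * z))"
    by (simp add: ac_simps)
  then show ?thesis by (simp add: ennreal_suminf_multc ac_simps)
qed

text \<open>Covers both uses of the Poisson property: offspring processes given a history, and the
  background process with a trivial \<open>F\<close> and a single label. \<open>law\<close> is the
  conditional law integrated over events of \<open>F\<close>; the sets \<open>E n\<close> exhaust
  the space and have finite intensity.\<close>

locale cond_poisson = prob_space M for M :: "'w measure" +
  fixes F :: "'w measure" and I :: "'l set"
    and N L :: "'l \<Rightarrow> 'w \<Rightarrow> 'b::topological_space measure" and E :: "nat \<Rightarrow> 'b set"
  assumes subalg: "subalgebra M F"
    and countable_I: "countable I"
    and sets_N: "\<And>u \<omega>. sets (N u \<omega>) = sets borel"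
    and sets_L: "\<And>u \<omega>. sets (L u \<omega>) = sets borel"
    and emeasure_N: "\<And>u B. u \<in> I \<Longrightarrow> B \<in> sets borel \<Longrightarrow> (\<lambda>\<omega>. emeasure (N u \<omega>) B) \<in> borel_measurable M"
    and emeasure_L: "\<And>u B. u \<in> I \<Longrightarrow> B \<in> sets borel \<Longrightarrow> (\<lambda>\<omega>. emeasure (L u \<omega>) B) \<in> borel_measurable F"
    and E: "incseq E" "\<And>n. E n \<in> sets borel" "(\<Union>n. E n) = UNIV"
    and L_finite: "\<And>u \<omega> n. u \<in> I \<Longrightarrow> \<omega> \<in> space M \<Longrightarrow> emeasure (L u \<omega>) (E n) < \<infinity>"
    and law: "\<And>U \<B> H m. finite U \<Longrightarrow> U \<subseteq> I \<Longrightarrow> finite \<B> \<Longrightarrow> \<B> \<subseteq> sets borel \<Longrightarrow> disjoint \<B> \<Longrightarrow>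
      H \<in> sets F \<Longrightarrow>
      emeasure M {\<omega>\<in>H. \<forall>u\<in>U. \<forall>B\<in>\<B>. emeasure (N u \<omega>) B = of_nat (m u B)} =
      (\<integral>\<^sup>+\<omega>\<in>H. (\<Prod>u\<in>U. \<Prod>B\<in>\<B>. ennreal (poisson_mass (emeasure (L u \<omega>) B) (m u B))) \<partial>M)"
begin

lemma emeasure_L_M [measurable]:
  "u \<in> I \<Longrightarrow> B \<in> sets borel \<Longrightarrow> (\<lambda>\<omega>. emeasure (L u \<omega>) B) \<in> borel_measurable M"
  using emeasure_L subalg by (blast intro: measurable_from_subalg)

lemmas emeasure_N' [measurable] = emeasure_N

lemma N_integral_measurable:
  "u \<in> I \<Longrightarrow> f \<in> borel_measurable borel \<Longrightarrow> (\<lambda>\<omega>. \<integral>\<^sup>+x. f x \<partial>N u \<omega>) \<in> borel_measurable M"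
  by (rule kernel_nn_integral_measurable) (auto simp: sets_N)

lemma L_integral_measurable_F:
  "u \<in> I \<Longrightarrow> f \<in> borel_measurable borel \<Longrightarrow> (\<lambda>\<omega>. \<integral>\<^sup>+x. f x \<partial>L u \<omega>) \<in> borel_measurable F"
  by (rule kernel_nn_integral_measurable) (auto simp: sets_L emeasure_L)

lemma L_integral_measurable:
  "u \<in> I \<Longrightarrow> f \<in> borel_measurable borel \<Longrightarrow> (\<lambda>\<omega>. \<integral>\<^sup>+x. f x \<partial>L u \<omega>) \<in> borel_measurable M"
  using L_integral_measurable_F subalg by (blast intro: measurable_from_subalg)

lemma measurable_F_M: "Y \<in> borel_measurable F \<Longrightarrow> Y \<in> borel_measurable M"
  using subalg by (rule measurable_from_subalg)

lemma L_finite_subset: "u \<in> I \<Longrightarrow> \<omega> \<in> space M \<Longrightarrow> B \<subseteq> E n \<Longrightarrow> emeasure (L u \<omega>) B < \<infinity>"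
  using emeasure_mono[of B "E n" "L u \<omega>"] L_finite[of u \<omega> n] E by (simp add: sets_L le_less_trans)

text \<open>The product of the indicators is the indicator of the event in \<open>law\<close>;
  \<open>nn_integral_mult_eqI\<close> then replaces the events \<open>H\<close> by functions
  \<open>Y\<close>.\<close>

lemma counts_indicator:
  assumes U: "finite U" "U \<subseteq> I" and \<B>: "finite \<B>" "\<B> \<subseteq> sets borel" "disjoint \<B>"
    and Y: "Y \<in> borel_measurable F"
  shows "(\<integral>\<^sup>+\<omega>. Y \<omega> * (\<Prod>u\<in>U. \<Prod>B\<in>\<B>. indicator {of_nat (m u B)} (emeasure (N u \<omega>) B)) \<partial>M) =
    (\<integral>\<^sup>+\<omega>. Y \<omega> * (\<Prod>u\<in>U. \<Prod>B\<in>\<B>. ennreal (poisson_mass (emeasure (L u \<omega>) B) (m u B))) \<partial>M)"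
proof -
  have uI: "u \<in> I" if "u \<in> U" for u using that U by blast
  have BB: "B \<in> sets borel" if "B \<in> \<B>" for B using that \<B> by blast
  show ?thesis
  proof (rule nn_integral_mult_eqI[OF subalg _ _ Y])
    show "(\<lambda>\<omega>. \<Prod>u\<in>U. \<Prod>B\<in>\<B>. indicator {of_nat (m u B)} (emeasure (N u \<omega>) B) :: ennreal) \<in> borel_measurable M"
      by (intro borel_measurable_prod_ennreal measurable_compose[OF emeasure_N]) (auto simp: uI BB)
    show "(\<lambda>\<omega>. \<Prod>u\<in>U. \<Prod>B\<in>\<B>. ennreal (poisson_mass (emeasure (L u \<omega>) B) (m u B))) \<in> borel_measurable M"
      by (intro borel_measurable_prod_ennreal measurable_compose[OF emeasure_L_M]) (auto simp: uI BB)
    fix H assume H: "H \<in> sets F"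
    then have HM [measurable]: "H \<in> sets M" using subalg by (auto simp: subalgebra_def)
    let ?S = "{\<omega>\<in>H. \<forall>u\<in>U. \<forall>B\<in>\<B>. emeasure (N u \<omega>) B = of_nat (m u B)}"
    have "{\<omega>\<in>space M. \<omega> \<in> H \<and> (\<forall>u\<in>U. \<forall>B\<in>\<B>. emeasure (N u \<omega>) B = of_nat (m u B))} \<in> sets M"
      using U(1) \<B>(1) uI BB by measurable
    then have S: "?S \<in> sets M"
      by (rule back_subst[where P="\<lambda>x. x \<in> sets M"]) (use sets.sets_into_space[OF HM] in auto)
    have "(\<Prod>u\<in>U. \<Prod>B\<in>\<B>. indicator {of_nat (m u B)} (emeasure (N u \<omega>) B)) * indicator H \<omega> = (indicator ?S \<omega> :: ennreal)" for \<omega>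
    proof (cases "\<forall>u\<in>U. \<forall>B\<in>\<B>. emeasure (N u \<omega>) B = of_nat (m u B)")
      case True then show ?thesis by (simp add: indicator_def)
    next
      case False
      then obtain u B where uB: "u \<in> U" "B \<in> \<B>" "emeasure (N u \<omega>) B \<noteq> of_nat (m u B)" by blast
      then have "(\<Prod>B\<in>\<B>. indicator {of_nat (m u B)} (emeasure (N u \<omega>) B)) = (0::ennreal)"
        using \<B>(1) by (intro prod_zero) (auto intro!: bexI[of _ B])
      then have "(\<Prod>u\<in>U. \<Prod>B\<in>\<B>. indicator {of_nat (m u B)} (emeasure (N u \<omega>) B)) = (0::ennreal)"
        using U(1) uB by (intro prod_zero) auto
      then show ?thesis using False by simp
    qed
    then show "(\<integral>\<^sup>+\<omega>\<in>H. (\<Prod>u\<in>U. \<Prod>B\<in>\<B>. indicator {of_nat (m u B)} (emeasure (N u \<omega>) B)) \<partial>M) =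
      (\<integral>\<^sup>+\<omega>\<in>H. (\<Prod>u\<in>U. \<Prod>B\<in>\<B>. ennreal (poisson_mass (emeasure (L u \<omega>) B) (m u B))) \<partial>M)"
      using law[OF U \<B> H, of m] S by simp
  qed
qed

text \<open>\<open>N u\<close> is an arbitrary measure here, and the law only gives probabilities of
  finite integer values. For finite intensity these probabilities sum to 1, which leaves no room for
  other values.\<close>

lemma count_AE_nat:
  assumes u: "u \<in> I" and B: "B \<in> sets borel" "\<And>\<omega>. \<omega> \<in> space M \<Longrightarrow> emeasure (L u \<omega>) B < \<infinity>"
  shows "AE \<omega> in M. emeasure (N u \<omega>) B \<in> range of_nat"
proof -
  note [measurable] = emeasure_N[OF u B(1)] emeasure_L_M[OF u B(1)]
  have "(\<integral>\<^sup>+\<omega>. indicator {of_nat k} (emeasure (N u \<omega>) B) \<partial>M) =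
      (\<integral>\<^sup>+\<omega>. ennreal (poisson_mass (emeasure (L u \<omega>) B) k) \<partial>M)" for k
    using counts_indicator[of "{u}" "{B}" "\<lambda>_. 1" "\<lambda>_ _. k"] u B by simp
  then have "(\<Sum>k. \<integral>\<^sup>+\<omega>. indicator {of_nat k} (emeasure (N u \<omega>) B) \<partial>M) =
      (\<integral>\<^sup>+\<omega>. (\<Sum>k. ennreal (poisson_mass (emeasure (L u \<omega>) B) k)) \<partial>M)"
    by (simp add: nn_integral_suminf)
  also have "\<dots> = (\<integral>\<^sup>+\<omega>. 1 \<partial>M)" using B by (intro nn_integral_cong poisson_suminf_1) auto
  also have "\<dots> = 1" by (simp add: emeasure_space_1)
  finally have 1: "(\<Sum>k. \<integral>\<^sup>+\<omega>. indicator {of_nat k} (emeasure (N u \<omega>) B) \<partial>M) = 1" .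
  define S where "S k = {\<omega>\<in>space M. emeasure (N u \<omega>) B = of_nat k}" for k
  have S [measurable]: "S k \<in> sets M" for k unfolding S_def by measurable
  have "(\<integral>\<^sup>+\<omega>. indicator {of_nat k} (emeasure (N u \<omega>) B) \<partial>M) = (\<integral>\<^sup>+\<omega>. indicator (S k) \<omega> \<partial>M)" for k
    by (intro nn_integral_cong) (auto simp: S_def indicator_def)
  then have "(\<Sum>k. emeasure M (S k)) = 1" using 1 by simp
  moreover have "disjoint_family S" by (auto simp: disjoint_family_on_def S_def)
  ultimately have "emeasure M (\<Union>k. S k) = 1" by (subst suminf_emeasure[symmetric]) auto
  then have "AE \<omega> in M. \<omega> \<in> (\<Union>k. S k)" by (intro AE_prob_1) (simp add: measure_def)
  then show ?thesis by eventually_elim (auto simp: S_def)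
qed

text \<open>The indicators of prescribed values are replaced by arbitrary functions one cell \<open>(u, B)\<close> at a
  time.\<close>

lemma counts_product:
  fixes \<phi> :: "'l \<Rightarrow> 'b set \<Rightarrow> ennreal \<Rightarrow> ennreal"
  assumes U: "finite U" "U \<subseteq> I" and \<B>: "finite \<B>" "\<B> \<subseteq> sets borel" "disjoint \<B>"
    and fin: "\<And>u B \<omega>. u \<in> U \<Longrightarrow> B \<in> \<B> \<Longrightarrow> \<omega> \<in> space M \<Longrightarrow> emeasure (L u \<omega>) B < \<infinity>"
    and Y: "Y \<in> borel_measurable F"
    and \<phi> [measurable]: "\<And>u B. \<phi> u B \<in> borel_measurable borel"
  shows "(\<integral>\<^sup>+\<omega>. Y \<omega> * (\<Prod>u\<in>U. \<Prod>B\<in>\<B>. \<phi> u B (emeasure (N u \<omega>) B)) \<partial>M) =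
    (\<integral>\<^sup>+\<omega>. Y \<omega> * (\<Prod>u\<in>U. \<Prod>B\<in>\<B>.
      \<Sum>m. \<phi> u B (of_nat m) * ennreal (poisson_mass (emeasure (L u \<omega>) B) m)) \<partial>M)"
proof -
  define C where "C = U \<times> \<B>"
  have finC: "finite C" using U \<B> by (simp add: C_def)
  define n where "n c \<omega> = emeasure (N (fst c) \<omega>) (snd c)" for c \<omega>
  define l where "l c \<omega> = emeasure (L (fst c) \<omega>) (snd c)" for c \<omega>
  define f where "f c = \<phi> (fst c) (snd c)" for c
  define s where "s c \<omega> = (\<Sum>m. f c (of_nat m) * ennreal (poisson_mass (l c \<omega>) m))" for c \<omega>
  have n [measurable]: "n c \<in> borel_measurable M" if "c \<in> C" for c
    using that U \<B> unfolding n_def C_def by (intro emeasure_N) auto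
  have l [measurable]: "l c \<in> borel_measurable M" if "c \<in> C" for c
    using that U \<B> unfolding l_def C_def by (intro emeasure_L_M) auto
  have f [measurable]: "f c \<in> borel_measurable borel" for c unfolding f_def by simp
  have YM [measurable]: "Y \<in> borel_measurable M" using Y by (rule measurable_F_M)
  have s [measurable]: "s c \<in> borel_measurable M" if "c \<in> C" for c
    unfolding s_def using l[OF that] by measurable
  \<comment> \<open>\<open>D\<close> collects the cells whose indicator has already been replaced by
    \<open>f c\<close>; the cells in \<open>C - D\<close> still carry prescribed values. These are
    kept arbitrary, so that one of them can be varied at the next cell.\<close>
  have ind: "(\<integral>\<^sup>+\<omega>. Y \<omega> * ((\<Prod>c\<in>D. f c (n c \<omega>)) * (\<Prod>c\<in>C - D. indicator {of_nat (m c)} (n c \<omega>))) \<partial>M) =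
      (\<integral>\<^sup>+\<omega>. Y \<omega> * ((\<Prod>c\<in>D. s c \<omega>) * (\<Prod>c\<in>C - D. ennreal (poisson_mass (l c \<omega>) (m c)))) \<partial>M)"
    if "finite D" "D \<subseteq> C" for D m
    using that
  proof (induction D arbitrary: m)
    case empty
    show ?case
      using counts_indicator[OF U \<B> Y, of "\<lambda>u B. m (u, B)"]
      by (simp add: C_def n_def l_def prod.cartesian_product case_prod_unfold)
  next
    case (insert c D)
    have c: "c \<in> C" and D: "D \<subseteq> C" using insert by auto
    define R where "R = C - insert c D"
    have CD: "C - D = insert c R" using insert c by (auto simp: R_def)
    have R: "finite R" "c \<notin> R" "R \<subseteq> C" using finC by (auto simp: R_def)
    have "AE \<omega> in M. n c \<omega> \<in> range of_nat"
      unfolding n_def using c U \<B> fin by (intro count_AE_nat) (auto simp: C_def)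
    \<comment> \<open>A count that is almost surely a natural number turns \<open>f c\<close> into a
      series of indicators; the induction hypothesis is applied to each term, with
      \<open>m c\<close> set to \<open>k\<close>.\<close>
    then have AE: "AE \<omega> in M. f c (n c \<omega>) = (\<Sum>k. f c (of_nat k) * indicator {of_nat k} (n c \<omega>))"
    proof eventually_elim
      case (elim \<omega>)
      then obtain k where k: "n c \<omega> = of_nat k" by auto
      have "(\<Sum>k. f c (of_nat k) * indicator {of_nat k} (n c \<omega>)) =
          (\<Sum>j\<in>{k}. f c (of_nat j) * indicator {of_nat j} (n c \<omega>))"
        by (intro suminf_finite) (auto simp: k indicator_def)
      then show ?case by (simp add: k)
    qed
    have IH: "(\<integral>\<^sup>+\<omega>. Y \<omega> * ((\<Prod>c\<in>D. f c (n c \<omega>)) * (indicator {of_nat k} (n c \<omega>) * (\<Prod>c\<in>R. indicator {of_nat (m c)} (n c \<omega>)))) \<partial>M) =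
        (\<integral>\<^sup>+\<omega>. Y \<omega> * ((\<Prod>c\<in>D. s c \<omega>) * (ennreal (poisson_mass (l c \<omega>) k) * (\<Prod>c\<in>R. ennreal (poisson_mass (l c \<omega>) (m c))))) \<partial>M)" for k
    proof -
      have "(\<Prod>i\<in>R. g i ((m(c := k)) i)) = (\<Prod>c\<in>R. g c (m c))" for g :: "_ \<Rightarrow> nat \<Rightarrow> ennreal"
      proof (intro prod.cong refl)
        fix i assume "i \<in> R"
        then have "i \<noteq> c" using R by blast
        then show "g i ((m(c := k)) i) = g i (m i)" by simp
      qed
      note * = this[of "\<lambda>c j. indicator {of_nat j} (n c \<omega>)" for \<omega>]
        this[of "\<lambda>c j. ennreal (poisson_mass (l c \<omega>) j)" for \<omega>]
      show ?thesis
        using insert.IH[OF D, of "m(c := k)"] R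
        by (simp only: CD prod.insert[OF R(1,2)] * fun_upd_same)
    qed
    have mR [measurable]: "(\<lambda>\<omega>. \<Prod>c\<in>R. indicator {of_nat (m c)} (n c \<omega>) :: ennreal) \<in> borel_measurable M"
      using R n by (intro borel_measurable_prod_ennreal measurable_compose[OF n]) auto
    have mD [measurable]: "(\<lambda>\<omega>. \<Prod>c\<in>D. f c (n c \<omega>)) \<in> borel_measurable M"
      using D n by (intro borel_measurable_prod_ennreal measurable_compose[OF n]) auto
    have mRs [measurable]: "(\<lambda>\<omega>. \<Prod>c\<in>R. ennreal (poisson_mass (l c \<omega>) (m c))) \<in> borel_measurable M"
      using R l by (intro borel_measurable_prod_ennreal measurable_compose[OF l]) auto
    have mDs [measurable]: "(\<lambda>\<omega>. \<Prod>c\<in>D. s c \<omega>) \<in> borel_measurable M"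
      using D s by (intro borel_measurable_prod_ennreal) auto
    note nc [measurable] = n[OF c] l[OF c]
    have "(\<integral>\<^sup>+\<omega>. Y \<omega> * ((\<Prod>c\<in>insert c D. f c (n c \<omega>)) * (\<Prod>c\<in>R. indicator {of_nat (m c)} (n c \<omega>))) \<partial>M) =
       (\<integral>\<^sup>+\<omega>. (\<Sum>k. f c (of_nat k) * (Y \<omega> * ((\<Prod>c\<in>D. f c (n c \<omega>)) * (indicator {of_nat k} (n c \<omega>) * (\<Prod>c\<in>R. indicator {of_nat (m c)} (n c \<omega>)))))) \<partial>M)"
    proof (rule nn_integral_cong_AE, use AE in eventually_elim)
      case (elim \<omega>)
      have "(\<Prod>c\<in>insert c D. f c (n c \<omega>)) = (\<Sum>k. f c (of_nat k) * indicator {of_nat k} (n c \<omega>)) * (\<Prod>c\<in>D. f c (n c \<omega>))"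
        using insert elim by simp
      then show ?case by (simp only: suminf_pull)
    qed
    also have "\<dots> = (\<Sum>k. f c (of_nat k) * (\<integral>\<^sup>+\<omega>. (Y \<omega> * ((\<Prod>c\<in>D. f c (n c \<omega>)) * (indicator {of_nat k} (n c \<omega>) * (\<Prod>c\<in>R. indicator {of_nat (m c)} (n c \<omega>))))) \<partial>M))"
      by (subst nn_integral_suminf) (auto simp: nn_integral_cmult)
    also have "\<dots> = (\<Sum>k. f c (of_nat k) * (\<integral>\<^sup>+\<omega>. Y \<omega> * ((\<Prod>c\<in>D. s c \<omega>) * (ennreal (poisson_mass (l c \<omega>) k) * (\<Prod>c\<in>R. ennreal (poisson_mass (l c \<omega>) (m c))))) \<partial>M))"
      by (simp only: IH)
    also have "\<dots> = (\<integral>\<^sup>+\<omega>. (\<Sum>k. f c (of_nat k) * (Y \<omega> * ((\<Prod>c\<in>D. s c \<omega>) * (ennreal (poisson_mass (l c \<omega>) k) * (\<Prod>c\<in>R. ennreal (poisson_mass (l c \<omega>) (m c))))))) \<partial>M)"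
      by (subst nn_integral_suminf) (auto simp: nn_integral_cmult)
    also have "\<dots> = (\<integral>\<^sup>+\<omega>. Y \<omega> * ((\<Prod>c\<in>insert c D. s c \<omega>) * (\<Prod>c\<in>R. ennreal (poisson_mass (l c \<omega>) (m c)))) \<partial>M)"
      by (intro nn_integral_cong) (simp only: s_def[of c] suminf_pull prod.insert[OF insert(1,2)])
    finally show ?case by (simp add: R_def)
  qed
  have *: "(\<Prod>u\<in>U. \<Prod>B\<in>\<B>. h u B) = (\<Prod>c\<in>C. h (fst c) (snd c))" for h :: "'l \<Rightarrow> 'b set \<Rightarrow> ennreal"
    by (simp add: C_def prod.cartesian_product case_prod_unfold)
  from ind[OF finC order_refl] show ?thesis
    by (simp only: * n_def[symmetric] l_def[symmetric] f_def[symmetric] s_def[symmetric]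
        Diff_cancel prod.empty mult_1_right)
qed

text \<open>For a simple function the integral is a linear combination of counts of its level sets,
  which are disjoint and have finite intensity; the Poisson Laplace transform then acts on each cell
  separately.\<close>

lemma laplace_finite:
  assumes U: "finite U" "U \<subseteq> I" and f: "simple_function borel f" "{x. f x \<noteq> 0} \<subseteq> E n"
    and Y: "Y \<in> borel_measurable F"
  shows "(\<integral>\<^sup>+\<omega>. Y \<omega> * nexp (\<Sum>u\<in>U. \<integral>\<^sup>+x. f x \<partial>N u \<omega>) \<partial>M) =
    (\<integral>\<^sup>+\<omega>. Y \<omega> * nexp (\<Sum>u\<in>U. \<integral>\<^sup>+x. 1 - nexp (f x) \<partial>L u \<omega>) \<partial>M)"
proof -
  define V where "V = range f - {0}"
  define b where "b v = f -` {v}" for v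
  have V: "finite V" using simple_functionD(1)[OF f(1)] by (simp add: V_def)
  have b: "b v \<in> sets borel" for v
    using measurable_sets[OF borel_measurable_simple_function[OF f(1)], of "{v}"] by (simp add: b_def)
  \<comment> \<open>Stated for every \<open>h\<close> with \<open>h 0 = 0\<close>, because it is
    used for the identity on the side of \<open>N\<close> and for \<open>1 - nexp\<close> on the
    side of \<open>L\<close>.\<close>
  have rep: "h (f x) = (\<Sum>v\<in>V. h v * indicator (b v) x)" if "h 0 = 0" for h :: "ennreal \<Rightarrow> ennreal" and x
  proof -
    have "(\<Sum>v\<in>V. h v * indicator (b v) x) = (\<Sum>v\<in>V. if f x = v then h v else 0)"
      by (intro sum.cong) (auto simp: b_def indicator_def)
    also have "\<dots> = h (f x)" using V that by (auto simp: sum.delta V_def)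
    finally show ?thesis ..
  qed
  have integral: "(\<integral>\<^sup>+x. h (f x) \<partial>\<kappa>) = (\<Sum>v\<in>V. h v * emeasure \<kappa> (b v))"
    if "h 0 = 0" "sets \<kappa> = sets borel" for h and \<kappa> :: "'b measure"
  proof -
    have [measurable]: "b v \<in> sets \<kappa>" for v using b that by simp
    show ?thesis unfolding rep[of h, OF that(1)]
      by (simp add: nn_integral_sum nn_integral_cmult)
  qed
  have inj: "inj_on b V" by (auto simp: inj_on_def b_def V_def)
  define \<B> where "\<B> = b ` V"
  have \<B>: "finite \<B>" "\<B> \<subseteq> sets borel" "disjoint \<B>"
    using V b by (auto simp: \<B>_def disjoint_def b_def)
  \<comment> \<open>\<open>counts_product\<close> indexes its functions by sets, so the value of
    \<open>f\<close> has to be recovered from its level set; \<open>b\<close> is injective on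
    \<open>V\<close> because these level sets are nonempty and disjoint.\<close>
  define val where "val = the_inv_into V b"
  have val: "val (b v) = v" if "v \<in> V" for v using the_inv_into_f_f[OF inj that] by (simp add: val_def)
  have prod\<B>: "(\<Prod>B\<in>\<B>. \<psi> B) = (\<Prod>v\<in>V. \<psi> (b v))" for \<psi> :: "'b set \<Rightarrow> ennreal"
    unfolding \<B>_def by (simp add: prod.reindex[OF inj])
  have fin: "emeasure (L u \<omega>) B < \<infinity>" if "u \<in> U" "B \<in> \<B>" "\<omega> \<in> space M" for u B \<omega>
    using that U f(2) by (intro L_finite_subset[of _ _ _ n]) (auto simp: \<B>_def b_def V_def)
  have "(\<integral>\<^sup>+\<omega>. Y \<omega> * nexp (\<Sum>u\<in>U. \<integral>\<^sup>+x. f x \<partial>N u \<omega>) \<partial>M) =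
      (\<integral>\<^sup>+\<omega>. Y \<omega> * (\<Prod>u\<in>U. \<Prod>B\<in>\<B>. nexp (val B * emeasure (N u \<omega>) B)) \<partial>M)"
    using integral[of "\<lambda>x. x"] by (simp add: sets_N nexp_sum prod\<B> val cong: prod.cong)
  also have "\<dots> = (\<integral>\<^sup>+\<omega>. Y \<omega> * (\<Prod>u\<in>U. \<Prod>B\<in>\<B>.
      \<Sum>m. nexp (val B * of_nat m) * ennreal (poisson_mass (emeasure (L u \<omega>) B) m)) \<partial>M)"
    by (intro counts_product U \<B> fin Y) auto
  also have "\<dots> = (\<integral>\<^sup>+\<omega>. Y \<omega> * (\<Prod>u\<in>U. \<Prod>B\<in>\<B>. nexp ((1 - nexp (val B)) * emeasure (L u \<omega>) B)) \<partial>M)"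
    using fin by (intro nn_integral_cong arg_cong2[where f="(*)"] prod.cong refl poisson_suminf_nexp) auto
  also have "\<dots> = (\<integral>\<^sup>+\<omega>. Y \<omega> * nexp (\<Sum>u\<in>U. \<integral>\<^sup>+x. 1 - nexp (f x) \<partial>L u \<omega>) \<partial>M)"
    using integral[of "\<lambda>x. 1 - nexp x"] by (simp add: sets_L nexp_sum prod\<B> val cong: prod.cong)
  finally show ?thesis .
qed

text \<open>The finite set of labels and the function grow together, so that a single limit exhausts
  both; extended by zero to the other labels, the summands increase and monotone convergence
  applies.\<close>

lemma sum_to_count_space:
  fixes \<kappa> :: "'l \<Rightarrow> 'b measure"
  assumes \<kappa>: "\<And>u. sets (\<kappa> u) = sets borel" and g: "incseq g" "\<And>i. g i \<in> borel_measurable borel"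
    and lim: "\<And>x. (\<lambda>i. g i x) \<longlonglongrightarrow> G x"
  shows "(\<lambda>i. \<Sum>u\<in>{u\<in>I. to_nat_on I u < i}. \<integral>\<^sup>+x. g i x \<partial>\<kappa> u) \<longlonglongrightarrow>
    (\<integral>\<^sup>+u. \<integral>\<^sup>+x. G x \<partial>\<kappa> u \<partial>count_space I)"
proof -
  define U where "U i = {u\<in>I. to_nat_on I u < i}" for i
  have finU: "finite (U i)" for i
  proof (rule finite_imageD)
    show "finite (to_nat_on I ` U i)" by (rule finite_subset[of _ "{..<i}"]) (auto simp: U_def)
    show "inj_on (to_nat_on I) (U i)"
      by (rule inj_on_subset[OF inj_on_to_nat_on[OF countable_I]]) (auto simp: U_def)
  qed
  define h where "h i u = indicator (U i) u * (\<integral>\<^sup>+x. g i x \<partial>\<kappa> u)" for i u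
  have "(\<Sum>u\<in>U i. \<integral>\<^sup>+x. g i x \<partial>\<kappa> u) = (\<integral>\<^sup>+u. h i u \<partial>count_space I)" for i
    by (subst nn_integral_count_space'[OF finU[of i]]) (auto simp: h_def U_def)
  moreover have "(\<lambda>i. \<integral>\<^sup>+u. h i u \<partial>count_space I) \<longlonglongrightarrow>
      (\<integral>\<^sup>+u. indicator I u * (\<integral>\<^sup>+x. G x \<partial>\<kappa> u) \<partial>count_space I)"
  proof (rule nn_integral_LIMSEQ)
    have "g i x \<le> g j x" if "i \<le> j" for i j x using g(1) that by (auto simp: incseq_def le_fun_def)
    then show "incseq h"
      by (auto simp: incseq_def le_fun_def h_def U_def indicator_def intro!: nn_integral_mono)
    fix u
    have "(\<lambda>i. \<integral>\<^sup>+x. g i x \<partial>\<kappa> u) \<longlonglongrightarrow> (\<integral>\<^sup>+x. G x \<partial>\<kappa> u)"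
      using g \<kappa> lim by (intro nn_integral_LIMSEQ) (auto cong: measurable_cong_sets)
    moreover have "\<forall>\<^sub>F i in sequentially. (\<integral>\<^sup>+x. g i x \<partial>\<kappa> u) = h i u" if "u \<in> I"
      using eventually_gt_at_top[of "to_nat_on I u"] by eventually_elim (auto simp: h_def U_def that)
    ultimately show "(\<lambda>i. h i u) \<longlonglongrightarrow> indicator I u * (\<integral>\<^sup>+x. G x \<partial>\<kappa> u)"
      by (cases "u \<in> I") (auto simp: h_def U_def intro: Lim_transform_eventually)
  qed auto
  moreover have "(\<integral>\<^sup>+u. indicator I u * (\<integral>\<^sup>+x. G x \<partial>\<kappa> u) \<partial>count_space I) =
      (\<integral>\<^sup>+u. \<integral>\<^sup>+x. G x \<partial>\<kappa> u \<partial>count_space I)"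
    by (intro nn_integral_cong) auto
  ultimately show ?thesis by (simp add: U_def)
qed

text \<open>The case of finitely many labels and a simple function passes to the limit on both sides
  by dominated convergence with bound 1; this is where \<open>Y \<le> 1\<close> enters.\<close>

theorem laplace:
  assumes f: "f \<in> borel_measurable borel" and Y: "Y \<in> borel_measurable F" "\<And>\<omega>. Y \<omega> \<le> 1"
  shows "(\<integral>\<^sup>+\<omega>. Y \<omega> * nexp (\<integral>\<^sup>+u. \<integral>\<^sup>+x. f x \<partial>N u \<omega> \<partial>count_space I) \<partial>M) =
    (\<integral>\<^sup>+\<omega>. Y \<omega> * nexp (\<integral>\<^sup>+u. \<integral>\<^sup>+x. 1 - nexp (f x) \<partial>L u \<omega> \<partial>count_space I) \<partial>M)"
proof -
  from f obtain f0 where f0: "\<And>i. simple_function borel (f0 i)" "incseq f0" "\<And>x. (SUP i. f0 i x) = f x"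
    by (rule borel_measurable_implies_simple_function_sequence') blast
  \<comment> \<open>The cut-off places the support of the approximation in a set of finite
    intensity, as \<open>laplace_finite\<close> requires; since the \<open>E i\<close> exhaust the
    space, the limit is still \<open>f\<close>.\<close>
  define g where "g i x = f0 i x * indicator (E i) x" for i x
  have g: "simple_function borel (g i)" "{x. g i x \<noteq> 0} \<subseteq> E i" for i
  proof -
    show "simple_function borel (g i)"
      unfolding g_def[abs_def] using f0(1)[of i] E(2)[of i] by (intro simple_function_mult simple_function_indicator)
    show "{x. g i x \<noteq> 0} \<subseteq> E i" by (auto simp: g_def indicator_def)
  qed
  have gm [measurable]: "g i \<in> borel_measurable borel" for i
    using g(1) by (rule borel_measurable_simple_function)
  have f0_mono: "f0 i x \<le> f0 j x" if "i \<le> j" for i j x using f0(2) that by (auto simp: incseq_def le_fun_def)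
  have incE: "E i \<subseteq> E j" if "i \<le> j" for i j using E(1) that by (auto simp: incseq_def)
  have g_mono: "g i x \<le> g j x" if "i \<le> j" for i j x
    using f0_mono[OF that, of x] incE[OF that] by (auto simp: g_def indicator_def)
  have g_lim: "(\<lambda>i. g i x) \<longlonglongrightarrow> f x" for x
  proof -
    obtain k where k: "x \<in> E k" using E(3) by blast
    have "(\<lambda>i. f0 i x) \<longlonglongrightarrow> f x"
      unfolding f0(3)[symmetric] using f0_mono by (intro LIMSEQ_SUP) (auto simp: incseq_def)
    moreover have "\<forall>\<^sub>F i in sequentially. f0 i x = g i x"
      using eventually_ge_at_top[of k] by eventually_elim (use k incE in \<open>auto simp: g_def indicator_def\<close>)
    ultimately show ?thesis by (rule Lim_transform_eventually)
  qed
  define U where "U i = {u\<in>I. to_nat_on I u < i}" for i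
  have U: "finite (U i)" "U i \<subseteq> I" for i
  proof (rule finite_imageD)
    show "finite (to_nat_on I ` U i)" by (rule finite_subset[of _ "{..<i}"]) (auto simp: U_def)
    show "inj_on (to_nat_on I) (U i)"
      by (rule inj_on_subset[OF inj_on_to_nat_on[OF countable_I]]) (auto simp: U_def)
  qed (auto simp: U_def)
  have eq: "(\<integral>\<^sup>+\<omega>. Y \<omega> * nexp (\<Sum>u\<in>U i. \<integral>\<^sup>+x. g i x \<partial>N u \<omega>) \<partial>M) =
    (\<integral>\<^sup>+\<omega>. Y \<omega> * nexp (\<Sum>u\<in>U i. \<integral>\<^sup>+x. 1 - nexp (g i x) \<partial>L u \<omega>) \<partial>M)" for i
    by (intro laplace_finite[OF U g] Y)
  have YM [measurable]: "Y \<in> borel_measurable M" using Y(1) by (rule measurable_F_M)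
  have YT: "Y x < top" for x using Y(2)[of x] by (rule order.strict_trans1) simp
  have bound: "Y x * nexp c \<le> 1" for x c using nexp_le_one_mult[OF Y(2)] by (simp add: mult.commute)
  have limit: "(\<lambda>i. \<integral>\<^sup>+\<omega>. Y \<omega> * nexp (S i \<omega>) \<partial>M) \<longlonglongrightarrow> (\<integral>\<^sup>+\<omega>. Y \<omega> * nexp (S' \<omega>) \<partial>M)"
    if [measurable]: "\<And>i. S i \<in> borel_measurable M" "S' \<in> borel_measurable M"
      and S: "\<And>\<omega>. (\<lambda>i. S i \<omega>) \<longlonglongrightarrow> S' \<omega>" for S S'
  proof (rule nn_integral_dominated_convergence[where w="\<lambda>_. 1"])
    show "AE x in M. (\<lambda>i. Y x * nexp (S i x)) \<longlonglongrightarrow> Y x * nexp (S' x)"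
      using YT by (intro AE_I2 tendsto_mult_ennreal tendsto_nexp S tendsto_const) (auto simp: less_top)
  qed (auto simp: bound emeasure_space_1)
  have "(\<lambda>i. \<integral>\<^sup>+\<omega>. Y \<omega> * nexp (\<Sum>u\<in>U i. \<integral>\<^sup>+x. g i x \<partial>N u \<omega>) \<partial>M) \<longlonglongrightarrow>
      (\<integral>\<^sup>+\<omega>. Y \<omega> * nexp (\<integral>\<^sup>+u. \<integral>\<^sup>+x. f x \<partial>N u \<omega> \<partial>count_space I) \<partial>M)"
  proof (rule limit)
    show "(\<lambda>i. \<Sum>u\<in>U i. \<integral>\<^sup>+x. g i x \<partial>N u \<omega>) \<longlonglongrightarrow> (\<integral>\<^sup>+u. \<integral>\<^sup>+x. f x \<partial>N u \<omega> \<partial>count_space I)" for \<omega>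
      unfolding U_def using g_mono
      by (intro sum_to_count_space g_lim) (auto simp: sets_N incseq_def le_fun_def)
    have u: "u \<in> I" if "u \<in> U i" for u i using that U by blast
    show "(\<lambda>\<omega>. \<Sum>u\<in>U i. \<integral>\<^sup>+x. g i x \<partial>N u \<omega>) \<in> borel_measurable M" for i
      by (intro borel_measurable_sum N_integral_measurable gm u)
    show "(\<lambda>\<omega>. \<integral>\<^sup>+u. \<integral>\<^sup>+x. f x \<partial>N u \<omega> \<partial>count_space I) \<in> borel_measurable M"
      by (intro borel_measurable_nn_integral_count_space countable_I N_integral_measurable f)
  qed
  moreover have "(\<lambda>i. \<integral>\<^sup>+\<omega>. Y \<omega> * nexp (\<Sum>u\<in>U i. \<integral>\<^sup>+x. 1 - nexp (g i x) \<partial>L u \<omega>) \<partial>M) \<longlonglongrightarrow>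
      (\<integral>\<^sup>+\<omega>. Y \<omega> * nexp (\<integral>\<^sup>+u. \<integral>\<^sup>+x. 1 - nexp (f x) \<partial>L u \<omega> \<partial>count_space I) \<partial>M)"
  proof (rule limit)
    show "(\<lambda>i. \<Sum>u\<in>U i. \<integral>\<^sup>+x. 1 - nexp (g i x) \<partial>L u \<omega>) \<longlonglongrightarrow>
        (\<integral>\<^sup>+u. \<integral>\<^sup>+x. 1 - nexp (f x) \<partial>L u \<omega> \<partial>count_space I)" for \<omega>
      unfolding U_def using g_mono
      by (intro sum_to_count_space tendsto_diff_ennreal tendsto_const tendsto_nexp g_lim)
        (auto simp: sets_L incseq_def le_fun_def nexp_less_top[THEN less_imp_neq] intro!: ennreal_minus_mono nexp_antimono)
    have u: "u \<in> I" if "u \<in> U i" for u i using that U by blast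
    show "(\<lambda>\<omega>. \<Sum>u\<in>U i. \<integral>\<^sup>+x. 1 - nexp (g i x) \<partial>L u \<omega>) \<in> borel_measurable M" for i
      by (intro borel_measurable_sum L_integral_measurable u) measurable
    show "(\<lambda>\<omega>. \<integral>\<^sup>+u. \<integral>\<^sup>+x. 1 - nexp (f x) \<partial>L u \<omega> \<partial>count_space I) \<in> borel_measurable M"
      by (intro borel_measurable_nn_integral_count_space countable_I L_integral_measurable) (use f in measurable)
  qed
  ultimately show ?thesis unfolding eq by (rule LIMSEQ_unique)
qed

end

lemma nnlin_eval_mult: "nnlin (\<lambda>f. f x * c)"
  unfolding nnlin_def
proof (intro conjI ballI allI impI)
  fix U :: "nat \<Rightarrow> 'a \<Rightarrow> ennreal" and f
  assume *: "(\<forall>i. U i \<in> borel_measurable borel) \<and> incseq U \<and> (\<forall>x. f x = (SUP i. U i x))"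
  then have "f x = (SUP i. U i x)" by blast
  then show "f x * c = (SUP i. U i x * c)" by (simp only: SUP_mult_right_ennreal)
  show "incseq (\<lambda>i. U i x * c)" using * by (auto simp: incseq_def le_fun_def intro: mult_right_mono)
qed (simp_all add: distrib_right mult.assoc)

context cond_poisson
begin

lemma mean_set:
  assumes u: "u \<in> I" and B: "B \<in> sets borel" "B \<subseteq> E n" and Y: "Y \<in> borel_measurable F"
  shows "(\<integral>\<^sup>+\<omega>. Y \<omega> * emeasure (N u \<omega>) B \<partial>M) = (\<integral>\<^sup>+\<omega>. Y \<omega> * emeasure (L u \<omega>) B \<partial>M)"
proof -
  have fin: "emeasure (L u \<omega>) B < \<infinity>" if "\<omega> \<in> space M" for \<omega>
    using L_finite_subset[OF u that B(2)] .
  have "(\<integral>\<^sup>+\<omega>. Y \<omega> * emeasure (N u \<omega>) B \<partial>M) =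
      (\<integral>\<^sup>+\<omega>. Y \<omega> * (\<Sum>m. of_nat m * ennreal (poisson_mass (emeasure (L u \<omega>) B) m)) \<partial>M)"
    using counts_product[of "{u}" "{B}" Y "\<lambda>_ _ x. x"] u B Y fin by simp
  also have "\<dots> = (\<integral>\<^sup>+\<omega>. Y \<omega> * emeasure (L u \<omega>) B \<partial>M)"
    using fin by (intro nn_integral_cong) (simp add: poisson_suminf_mean)
  finally show ?thesis .
qed

lemma mean:
  assumes u: "u \<in> I" and f: "f \<in> borel_measurable borel" and Y: "Y \<in> borel_measurable F"
  shows "(\<integral>\<^sup>+\<omega>. Y \<omega> * (\<integral>\<^sup>+x. f x \<partial>N u \<omega>) \<partial>M) = (\<integral>\<^sup>+\<omega>. Y \<omega> * (\<integral>\<^sup>+x. f x \<partial>L u \<omega>) \<partial>M)"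
proof (rule nnlin_ext[OF _ _ E _ f])
  fix n A assume "A \<in> sets (borel :: 'b measure)" "A \<subseteq> E n"
  then show "(\<integral>\<^sup>+\<omega>. Y \<omega> * (\<integral>\<^sup>+x. indicator A x \<partial>N u \<omega>) \<partial>M) = (\<integral>\<^sup>+\<omega>. Y \<omega> * (\<integral>\<^sup>+x. indicator A x \<partial>L u \<omega>) \<partial>M)"
    using mean_set[OF u _ _ Y, of A n] by (simp add: sets_N sets_L)
qed (auto intro!: nnlin_kernel simp: sets_N sets_L u Y measurable_F_M)

theorem mean_total:
  assumes f: "f \<in> borel_measurable borel" and Y: "Y \<in> borel_measurable F"
  shows "(\<integral>\<^sup>+\<omega>. Y \<omega> * (\<integral>\<^sup>+u. \<integral>\<^sup>+x. f x \<partial>N u \<omega> \<partial>count_space I) \<partial>M) =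
    (\<integral>\<^sup>+\<omega>. Y \<omega> * (\<integral>\<^sup>+u. \<integral>\<^sup>+x. f x \<partial>L u \<omega> \<partial>count_space I) \<partial>M)"
proof -
  note [measurable] = measurable_F_M[OF Y]
  have *: "(\<integral>\<^sup>+\<omega>. Y \<omega> * (\<integral>\<^sup>+u. a u \<omega> \<partial>count_space I) \<partial>M) = (\<integral>\<^sup>+u. \<integral>\<^sup>+\<omega>. Y \<omega> * a u \<omega> \<partial>M \<partial>count_space I)"
    if "\<And>u. u \<in> I \<Longrightarrow> a u \<in> borel_measurable M" for a
    using that by (simp add: nn_integral_cmult[symmetric] nn_integral_count_space_nn_integral countable_I)
  show ?thesis
    by (subst (1 2) *) (auto intro!: N_integral_measurable L_integral_measurable
      nn_integral_cong[where M="count_space I"] mean f Y)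
qed

text \<open>Counts of different labels or of disjoint sets factorize, and the same count taken twice
  has second moment \<open>r * r + r\<close>; the extra \<open>r\<close> is the term with
  \<open>B \<inter> C\<close>.\<close>

lemma second_set_aux:
  assumes uv: "u \<in> I" "v \<in> I" and B: "B \<in> sets borel" "B \<subseteq> E n" and C: "C \<in> sets borel" "C \<subseteq> E n"
    and BC: "B = C \<or> B \<inter> C = {}" and Y: "Y \<in> borel_measurable F"
  shows "(\<integral>\<^sup>+\<omega>. Y \<omega> * (emeasure (N u \<omega>) B * emeasure (N v \<omega>) C) \<partial>M) =
    (\<integral>\<^sup>+\<omega>. Y \<omega> * (emeasure (L u \<omega>) B * emeasure (L v \<omega>) C + (if u = v then emeasure (L u \<omega>) (B \<inter> C) else 0)) \<partial>M)"
proof -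
  have fin: "emeasure (L w \<omega>) D < \<infinity>" if "w \<in> {u, v}" "D \<in> {B, C}" "\<omega> \<in> space M" for w D \<omega>
    using that uv B C by (intro L_finite_subset[of _ _ _ n]) auto
  show ?thesis
  proof (cases "u = v \<and> B = C")
    case True
    have "(\<integral>\<^sup>+\<omega>. Y \<omega> * (emeasure (N u \<omega>) B * emeasure (N u \<omega>) B) \<partial>M) =
        (\<integral>\<^sup>+\<omega>. Y \<omega> * (\<Sum>m. of_nat m * of_nat m * ennreal (poisson_mass (emeasure (L u \<omega>) B) m)) \<partial>M)"
      using counts_product[of "{u}" "{B}" Y "\<lambda>_ _ x. x * x"] uv B Y fin by simp
    also have "\<dots> = (\<integral>\<^sup>+\<omega>. Y \<omega> * (emeasure (L u \<omega>) B * emeasure (L u \<omega>) B + emeasure (L u \<omega>) B) \<partial>M)"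
      using fin by (intro nn_integral_cong) (simp add: poisson_suminf_square)
    finally show ?thesis using True by simp
  next
    case False
    \<comment> \<open>\<open>counts_product\<close> works on a full rectangle of cells,
      \<open>{u, v}\<close> times \<open>{B, C}\<close>. Only \<open>(u, B)\<close> and
      \<open>(v, C)\<close> carry their counts; the other cells carry the constant 1, whose Poisson
      mean is 1.\<close>
    define P where "P w D \<longleftrightarrow> w = u \<and> D = B \<or> w = v \<and> D = C" for w D
    define \<phi> where "\<phi> w D x = (if P w D then x else 1)"
      for w and D and x :: ennreal
    have prod: "(\<Prod>w\<in>{u, v}. \<Prod>D\<in>{B, C}. \<phi> w D (h w D)) = h u B * h v C" for h
      using False by (cases "u = v"; cases "B = C") (auto simp: \<phi>_def P_def)
    have \<phi>_mean: "(\<Sum>m. \<phi> w D (of_nat m) * ennreal (poisson_mass r m)) = \<phi> w D r" if "r < \<infinity>" for w D r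
      using that poisson_suminf_1[OF that] by (cases "P w D") (simp_all add: \<phi>_def poisson_suminf_mean)
    have disj: "disjoint {B, C}" using BC by (auto simp: disjoint_def)
    have "(\<integral>\<^sup>+\<omega>. Y \<omega> * (emeasure (N u \<omega>) B * emeasure (N v \<omega>) C) \<partial>M) =
      (\<integral>\<^sup>+\<omega>. Y \<omega> * (\<Prod>w\<in>{u, v}. \<Prod>D\<in>{B, C}. \<phi> w D (emeasure (N w \<omega>) D)) \<partial>M)"
      by (simp only: prod)
    also have "\<dots> = (\<integral>\<^sup>+\<omega>. Y \<omega> * (\<Prod>w\<in>{u, v}. \<Prod>D\<in>{B, C}.
        \<Sum>m. \<phi> w D (of_nat m) * ennreal (poisson_mass (emeasure (L w \<omega>) D) m)) \<partial>M)"
      using uv B C fin disj Y by (intro counts_product) (auto simp: \<phi>_def)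
    also have "\<dots> = (\<integral>\<^sup>+\<omega>. Y \<omega> * (\<Prod>w\<in>{u, v}. \<Prod>D\<in>{B, C}. \<phi> w D (emeasure (L w \<omega>) D)) \<partial>M)"
      by (intro nn_integral_cong arg_cong2[where f="(*)"] prod.cong refl \<phi>_mean fin)
    also have "\<dots> = (\<integral>\<^sup>+\<omega>. Y \<omega> * (emeasure (L u \<omega>) B * emeasure (L v \<omega>) C) \<partial>M)"
      by (simp only: prod)
    finally have eq: "(\<integral>\<^sup>+\<omega>. Y \<omega> * (emeasure (N u \<omega>) B * emeasure (N v \<omega>) C) \<partial>M) =
        (\<integral>\<^sup>+\<omega>. Y \<omega> * (emeasure (L u \<omega>) B * emeasure (L v \<omega>) C) \<partial>M)" .
    have "(if u = v then emeasure (L u \<omega>) (B \<inter> C) else 0) = 0" for \<omega>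
      using False BC by (cases "u = v") auto
    then show ?thesis by (simp only: eq add_0_right)
  qed
qed

text \<open>Any two of the pieces \<open>B \<inter> C\<close>, \<open>B - C\<close> and
  \<open>C - B\<close> are equal or disjoint as needed for the previous case, and only the pair of
  two copies of \<open>B \<inter> C\<close> produces the additional term.\<close>

lemma second_set:
  assumes uv: "u \<in> I" "v \<in> I" and B: "B \<in> sets borel" "B \<subseteq> E n" and C: "C \<in> sets borel" "C \<subseteq> E n"
    and Y: "Y \<in> borel_measurable F"
  shows "(\<integral>\<^sup>+\<omega>. Y \<omega> * (emeasure (N u \<omega>) B * emeasure (N v \<omega>) C) \<partial>M) =
    (\<integral>\<^sup>+\<omega>. Y \<omega> * (emeasure (L u \<omega>) B * emeasure (L v \<omega>) C + (if u = v then emeasure (L u \<omega>) (B \<inter> C) else 0)) \<partial>M)"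
proof -
  let ?D = "B \<inter> C" and ?B = "B - C" and ?C = "C - B"
  have split: "emeasure \<kappa> B * emeasure \<kappa>' C =
      (emeasure \<kappa> ?D * emeasure \<kappa>' ?D + emeasure \<kappa> ?D * emeasure \<kappa>' ?C) +
      (emeasure \<kappa> ?B * emeasure \<kappa>' ?D + emeasure \<kappa> ?B * emeasure \<kappa>' ?C)"
    if "sets \<kappa> = sets borel" "sets \<kappa>' = sets borel" for \<kappa> \<kappa>'
  proof -
    have "emeasure \<kappa> B = emeasure \<kappa> ?D + emeasure \<kappa> ?B"
      using B C that by (subst plus_emeasure) (auto intro!: arg_cong[where f="emeasure \<kappa>"])
    moreover have "emeasure \<kappa>' C = emeasure \<kappa>' ?D + emeasure \<kappa>' ?C"
      using B C that by (subst plus_emeasure) (auto intro!: arg_cong[where f="emeasure \<kappa>'"])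
    ultimately show ?thesis by (simp add: distrib_left distrib_right)
  qed
  note [measurable] = measurable_F_M[OF Y]
  have s [measurable]: "?D \<in> sets borel" "?B \<in> sets borel" "?C \<in> sets borel" using B C by auto
  have mN [measurable]: "(\<lambda>\<omega>. emeasure (N w \<omega>) S) \<in> borel_measurable M"
      "(\<lambda>\<omega>. emeasure (L w \<omega>) S) \<in> borel_measurable M"
    if "w \<in> {u, v}" "S \<in> {?D, ?B, ?C}" for w S
    using that s uv by (auto intro!: emeasure_N emeasure_L_M)
  have sub: "?D \<subseteq> E n" "?B \<subseteq> E n" "?C \<subseteq> E n" using B C by auto
  have "(\<integral>\<^sup>+\<omega>. Y \<omega> * (emeasure (N u \<omega>) B * emeasure (N v \<omega>) C) \<partial>M) =
    ((\<integral>\<^sup>+\<omega>. Y \<omega> * (emeasure (N u \<omega>) ?D * emeasure (N v \<omega>) ?D) \<partial>M) +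
     (\<integral>\<^sup>+\<omega>. Y \<omega> * (emeasure (N u \<omega>) ?D * emeasure (N v \<omega>) ?C) \<partial>M)) +
    ((\<integral>\<^sup>+\<omega>. Y \<omega> * (emeasure (N u \<omega>) ?B * emeasure (N v \<omega>) ?D) \<partial>M) +
     (\<integral>\<^sup>+\<omega>. Y \<omega> * (emeasure (N u \<omega>) ?B * emeasure (N v \<omega>) ?C) \<partial>M))"
    by (simp only: split[OF sets_N sets_N] distrib_left) (simp add: nn_integral_add mN)
  also have "\<dots> =
    ((\<integral>\<^sup>+\<omega>. Y \<omega> * (emeasure (L u \<omega>) ?D * emeasure (L v \<omega>) ?D + (if u = v then emeasure (L u \<omega>) ?D else 0)) \<partial>M) +
     (\<integral>\<^sup>+\<omega>. Y \<omega> * (emeasure (L u \<omega>) ?D * emeasure (L v \<omega>) ?C) \<partial>M)) +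
    ((\<integral>\<^sup>+\<omega>. Y \<omega> * (emeasure (L u \<omega>) ?B * emeasure (L v \<omega>) ?D) \<partial>M) +
     (\<integral>\<^sup>+\<omega>. Y \<omega> * (emeasure (L u \<omega>) ?B * emeasure (L v \<omega>) ?C) \<partial>M))"
  proof -
    have e: "(B \<inter> C) \<inter> (C - B) = {}" "(B - C) \<inter> (B \<inter> C) = {}" "(B - C) \<inter> (C - B) = {}" by auto
    show ?thesis
      using second_set_aux[OF uv s(1) sub(1) s(1) sub(1) _ Y] second_set_aux[OF uv s(1) sub(1) s(3) sub(3) _ Y]
        second_set_aux[OF uv s(2) sub(2) s(1) sub(1) _ Y] second_set_aux[OF uv s(2) sub(2) s(3) sub(3) _ Y]
      by (simp add: e cong: if_cong)
  qed
  also have "\<dots> = (\<integral>\<^sup>+\<omega>. Y \<omega> * (emeasure (L u \<omega>) B * emeasure (L v \<omega>) C + (if u = v then emeasure (L u \<omega>) ?D else 0)) \<partial>M)"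
    by (simp only: split[OF sets_L sets_L] distrib_left)
      (cases "u = v"; simp add: nn_integral_add mN ac_simps)
  finally show ?thesis .
qed

text \<open>Both sides are linear and monotone-continuous in \<open>f\<close> and in
  \<open>h\<close> separately, so agreement on indicators extends first in one argument and then in
  the other.\<close>

lemma second:
  assumes uv: "u \<in> I" "v \<in> I" and f: "f \<in> borel_measurable borel" and h: "h \<in> borel_measurable borel"
    and Y: "Y \<in> borel_measurable F"
  shows "(\<integral>\<^sup>+\<omega>. Y \<omega> * ((\<integral>\<^sup>+x. f x \<partial>N u \<omega>) * (\<integral>\<^sup>+x. h x \<partial>N v \<omega>)) \<partial>M) =
    (\<integral>\<^sup>+\<omega>. Y \<omega> * ((\<integral>\<^sup>+x. f x \<partial>L u \<omega>) * (\<integral>\<^sup>+x. h x \<partial>L v \<omega>)) \<partial>M) +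
    (if u = v then \<integral>\<^sup>+\<omega>. Y \<omega> * (\<integral>\<^sup>+x. f x * h x \<partial>L u \<omega>) \<partial>M else 0)"
    (is "?l f h = ?r f h")
proof -
  note YM [measurable] = measurable_F_M[OF Y]
  have linf: "nnlin (\<lambda>f. ?l f h)" "nnlin (\<lambda>f. ?r f h)" if h [measurable]: "h \<in> borel_measurable borel" for h
  proof -
    note [measurable] = N_integral_measurable[OF uv(2) h] L_integral_measurable[OF uv(2) h]
    have "nnlin (\<lambda>f. \<integral>\<^sup>+\<omega>. (Y \<omega> * (\<integral>\<^sup>+x. h x \<partial>N v \<omega>)) * (\<integral>\<^sup>+x. f x \<partial>N u \<omega>) \<partial>M)"
      by (intro nnlin_kernel) (auto simp: sets_N uv)
    then show "nnlin (\<lambda>f. ?l f h)" by (simp add: ac_simps)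
    have "nnlin (\<lambda>f. (\<integral>\<^sup>+\<omega>. (Y \<omega> * (\<integral>\<^sup>+x. h x \<partial>L v \<omega>)) * (\<integral>\<^sup>+x. f x \<partial>L u \<omega>) \<partial>M) +
       (if u = v then 1 else 0) * (\<integral>\<^sup>+\<omega>. Y \<omega> * (\<integral>\<^sup>+x. f x * h x \<partial>L u \<omega>) \<partial>M))"
      by (intro nnlin_add nnlin_kernel nnlin_cmult nnlin_integral nnlin_comp[OF nnlin_nn_integral] nnlin_eval_mult
          L_integral_measurable) (auto simp: sets_L uv)
    then show "nnlin (\<lambda>f. ?r f h)" by (auto simp add: ac_simps cong: if_cong elim: back_subst[where P=nnlin])
  qed
  have linh: "nnlin (?l f)" "nnlin (?r f)" if f [measurable]: "f \<in> borel_measurable borel" for f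
  proof -
    note [measurable] = N_integral_measurable[OF uv(1) f] L_integral_measurable[OF uv(1) f]
    have "nnlin (\<lambda>h. \<integral>\<^sup>+\<omega>. (Y \<omega> * (\<integral>\<^sup>+x. f x \<partial>N u \<omega>)) * (\<integral>\<^sup>+x. h x \<partial>N v \<omega>) \<partial>M)"
      by (intro nnlin_kernel) (auto simp: sets_N uv)
    then show "nnlin (?l f)" by (simp add: ac_simps)
    have "nnlin (\<lambda>h. (\<integral>\<^sup>+\<omega>. (Y \<omega> * (\<integral>\<^sup>+x. f x \<partial>L u \<omega>)) * (\<integral>\<^sup>+x. h x \<partial>L v \<omega>) \<partial>M) +
       (if u = v then 1 else 0) * (\<integral>\<^sup>+\<omega>. Y \<omega> * (\<integral>\<^sup>+x. h x * f x \<partial>L u \<omega>) \<partial>M))"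
      by (intro nnlin_add nnlin_kernel nnlin_cmult nnlin_integral nnlin_comp[OF nnlin_nn_integral] nnlin_eval_mult
          L_integral_measurable) (auto simp: sets_L uv)
    then show "nnlin (?r f)" by (auto simp add: ac_simps cong: if_cong elim: back_subst[where P=nnlin])
  qed
  have 0: "?l (indicator B) (indicator C) = ?r (indicator B) (indicator C)"
    if B: "B \<in> sets borel" "B \<subseteq> E n" and C: "C \<in> sets borel" "C \<subseteq> E m" for B C n m
  proof -
    note [measurable] = emeasure_L_M[OF uv(1) B(1)] emeasure_L_M[OF uv(2) C(1)]
      emeasure_L_M[OF uv(2) B(1)] emeasure_L_M[OF uv(2) sets.Int[OF B(1) C(1)]]
    have *: "indicator B x * indicator C x = (indicator (B \<inter> C) x :: ennreal)" for x :: 'b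
      by (simp add: indicator_def)
    have "E n \<subseteq> E (max n m)" "E m \<subseteq> E (max n m)" using E(1) by (auto simp: incseq_def)
    then have "B \<subseteq> E (max n m)" "C \<subseteq> E (max n m)" using B C by auto
    from second_set[OF uv B(1) this(1) C(1) this(2) Y] show ?thesis
      unfolding * using B C sets.Int[OF B(1) C(1)]
      by (cases "u = v") (auto simp: sets_N sets_L nn_integral_add distrib_left)
  qed
  have 1: "?l f (indicator C) = ?r f (indicator C)"
    if C: "C \<in> sets borel" "C \<subseteq> E m" for C m
    proof (rule nnlin_ext[OF linf(1) linf(2) E _ f])
    fix n B assume "B \<in> sets (borel :: 'b measure)" "B \<subseteq> E n"
    then show "?l (indicator B) (indicator C) = ?r (indicator B) (indicator C)" by (rule 0[OF _ _ C])
  qed (use C in auto)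
  show ?thesis
    proof (rule nnlin_ext[OF linh(1) linh(2) E _ h])
    fix n C assume "C \<in> sets (borel :: 'b measure)" "C \<subseteq> E n"
    then show "?l f (indicator C) = ?r f (indicator C)" by (rule 1)
  qed (use f in auto)
qed

text \<open>Over all pairs of labels the additional term survives only for equal labels. It counts
  the points paired with themselves, while distinct points contribute the product of the
  intensities.\<close>

theorem second_total:
  assumes f: "f \<in> borel_measurable borel" and h: "h \<in> borel_measurable borel"
    and Y: "Y \<in> borel_measurable F"
  shows "(\<integral>\<^sup>+\<omega>. Y \<omega> * ((\<integral>\<^sup>+u. \<integral>\<^sup>+x. f x \<partial>N u \<omega> \<partial>count_space I) * (\<integral>\<^sup>+u. \<integral>\<^sup>+x. h x \<partial>N u \<omega> \<partial>count_space I)) \<partial>M) =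
    (\<integral>\<^sup>+\<omega>. Y \<omega> * ((\<integral>\<^sup>+u. \<integral>\<^sup>+x. f x \<partial>L u \<omega> \<partial>count_space I) * (\<integral>\<^sup>+u. \<integral>\<^sup>+x. h x \<partial>L u \<omega> \<partial>count_space I)) \<partial>M) +
    (\<integral>\<^sup>+\<omega>. Y \<omega> * (\<integral>\<^sup>+u. \<integral>\<^sup>+x. f x * h x \<partial>L u \<omega> \<partial>count_space I) \<partial>M)"
proof -
  note [measurable] = measurable_F_M[OF Y]
  have swap: "(\<integral>\<^sup>+\<omega>. Y \<omega> * ((\<integral>\<^sup>+u. a u \<omega> \<partial>count_space I) * (\<integral>\<^sup>+v. b v \<omega> \<partial>count_space I)) \<partial>M) =
      (\<integral>\<^sup>+u. \<integral>\<^sup>+v. \<integral>\<^sup>+\<omega>. Y \<omega> * (a u \<omega> * b v \<omega>) \<partial>M \<partial>count_space I \<partial>count_space I)"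
    if a: "\<And>u. u \<in> I \<Longrightarrow> a u \<in> borel_measurable M" and b: "\<And>u. u \<in> I \<Longrightarrow> b u \<in> borel_measurable M" for a b
  proof -
    have "(\<integral>\<^sup>+\<omega>. Y \<omega> * ((\<integral>\<^sup>+u. a u \<omega> \<partial>count_space I) * (\<integral>\<^sup>+v. b v \<omega> \<partial>count_space I)) \<partial>M) =
      (\<integral>\<^sup>+\<omega>. \<integral>\<^sup>+u. \<integral>\<^sup>+v. Y \<omega> * (a u \<omega> * b v \<omega>) \<partial>count_space I \<partial>count_space I \<partial>M)"
      by (simp add: nn_integral_cmult nn_integral_multc)
    also have "\<dots> = (\<integral>\<^sup>+u. \<integral>\<^sup>+\<omega>. \<integral>\<^sup>+v. Y \<omega> * (a u \<omega> * b v \<omega>) \<partial>count_space I \<partial>M \<partial>count_space I)"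
      using a b by (intro nn_integral_count_space_nn_integral countable_I
        borel_measurable_nn_integral_count_space) auto
    also have "\<dots> = (\<integral>\<^sup>+u. \<integral>\<^sup>+v. \<integral>\<^sup>+\<omega>. Y \<omega> * (a u \<omega> * b v \<omega>) \<partial>M \<partial>count_space I \<partial>count_space I)"
      using a b by (intro nn_integral_cong nn_integral_count_space_nn_integral countable_I) auto
    finally show ?thesis .
  qed
  have swap1: "(\<integral>\<^sup>+\<omega>. Y \<omega> * (\<integral>\<^sup>+u. a u \<omega> \<partial>count_space I) \<partial>M) = (\<integral>\<^sup>+u. \<integral>\<^sup>+\<omega>. Y \<omega> * a u \<omega> \<partial>M \<partial>count_space I)"
    if "\<And>u. u \<in> I \<Longrightarrow> a u \<in> borel_measurable M" for a
    using that by (simp add: nn_integral_cmult[symmetric] nn_integral_count_space_nn_integral countable_I)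
  have diag: "(\<integral>\<^sup>+v. (if u = v then c else 0) \<partial>count_space I) = c" if "u \<in> I" for c u
    using that by (subst nn_integral_count_space'[of "{u}"]) auto
  have fh: "(\<lambda>x. f x * h x) \<in> borel_measurable borel" using f h by measurable
  have "(\<integral>\<^sup>+\<omega>. Y \<omega> * ((\<integral>\<^sup>+u. \<integral>\<^sup>+x. f x \<partial>N u \<omega> \<partial>count_space I) * (\<integral>\<^sup>+u. \<integral>\<^sup>+x. h x \<partial>N u \<omega> \<partial>count_space I)) \<partial>M) =
      (\<integral>\<^sup>+u. \<integral>\<^sup>+v. (\<integral>\<^sup>+\<omega>. Y \<omega> * ((\<integral>\<^sup>+x. f x \<partial>L u \<omega>) * (\<integral>\<^sup>+x. h x \<partial>L v \<omega>)) \<partial>M) +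
        (if u = v then \<integral>\<^sup>+\<omega>. Y \<omega> * (\<integral>\<^sup>+x. f x * h x \<partial>L u \<omega>) \<partial>M else 0) \<partial>count_space I \<partial>count_space I)"
    using f h Y by (subst swap)
      (auto intro!: N_integral_measurable nn_integral_cong[where M="count_space I"] second)
  also have "\<dots> = (\<integral>\<^sup>+u. (\<integral>\<^sup>+v. (\<integral>\<^sup>+\<omega>. Y \<omega> * ((\<integral>\<^sup>+x. f x \<partial>L u \<omega>) * (\<integral>\<^sup>+x. h x \<partial>L v \<omega>)) \<partial>M) \<partial>count_space I) +
        (\<integral>\<^sup>+\<omega>. Y \<omega> * (\<integral>\<^sup>+x. f x * h x \<partial>L u \<omega>) \<partial>M) \<partial>count_space I)"
    by (intro nn_integral_cong) (simp add: nn_integral_add diag)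
  also have "\<dots> = (\<integral>\<^sup>+u. \<integral>\<^sup>+v. (\<integral>\<^sup>+\<omega>. Y \<omega> * ((\<integral>\<^sup>+x. f x \<partial>L u \<omega>) * (\<integral>\<^sup>+x. h x \<partial>L v \<omega>)) \<partial>M) \<partial>count_space I \<partial>count_space I) +
        (\<integral>\<^sup>+u. \<integral>\<^sup>+\<omega>. Y \<omega> * (\<integral>\<^sup>+x. f x * h x \<partial>L u \<omega>) \<partial>M \<partial>count_space I)"
    by (simp add: nn_integral_add)
  also have "\<dots> = (\<integral>\<^sup>+\<omega>. Y \<omega> * ((\<integral>\<^sup>+u. \<integral>\<^sup>+x. f x \<partial>L u \<omega> \<partial>count_space I) * (\<integral>\<^sup>+u. \<integral>\<^sup>+x. h x \<partial>L u \<omega> \<partial>count_space I)) \<partial>M) +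
    (\<integral>\<^sup>+\<omega>. Y \<omega> * (\<integral>\<^sup>+u. \<integral>\<^sup>+x. f x * h x \<partial>L u \<omega> \<partial>count_space I) \<partial>M)"
    using f h fh by (subst swap, simp_all add: L_integral_measurable, subst swap1, simp_all add: L_integral_measurable)
  finally show ?thesis .
qed

end

section \<open>Generating functions determine the law of counts\<close>

lemma powser_ennreal_split:
  fixes a :: "nat \<Rightarrow> ennreal"
  shows "(\<Sum>m. a m * x ^ m) = a 0 + x * (\<Sum>m. a (Suc m) * x ^ m)"
proof -
  have "(\<Sum>m. a m * x ^ m) = (\<Sum>m. a (Suc m) * x ^ Suc m) + a 0"
    using suminf_offset[of "\<lambda>m. a m * x ^ m" 1] by simp
  also have "(\<Sum>m. a (Suc m) * x ^ Suc m) = (\<Sum>m. x * (a (Suc m) * x ^ m))"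
    by (simp add: ac_simps)
  finally show ?thesis by (simp add: ac_simps)
qed

text \<open>Coefficients are compared one at a time: small \<open>x\<close> gives equality of the
  constant terms, which are finite and can be cancelled; division by \<open>x\<close> leaves the
  shifted series.\<close>

lemma powser_ennreal_unique:
  fixes a b :: "nat \<Rightarrow> ennreal"
  assumes "(\<Sum>m. a m) < top" "(\<Sum>m. b m) < top"
    and "\<And>x::real. 0 < x \<Longrightarrow> x < 1 \<Longrightarrow> (\<Sum>m. a m * ennreal x ^ m) = (\<Sum>m. b m * ennreal x ^ m)"
  shows "a n = b n"
proof -
  have *: "a 0 \<le> b 0" if fb: "(\<Sum>m. b m) < top"
    and eq: "\<And>x::real. 0 < x \<Longrightarrow> x < 1 \<Longrightarrow> (\<Sum>m. a m * ennreal x ^ m) = (\<Sum>m. b m * ennreal x ^ m)"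
    for a b :: "nat \<Rightarrow> ennreal"
  proof (rule ennreal_le_epsilon)
    fix e :: real assume e: "0 < e"
    obtain S where S: "(\<Sum>m. b m) = ennreal S" "0 \<le> S" using fb by (cases "\<Sum>m. b m") auto
    \<comment> \<open>Chosen such that \<open>x < 1\<close> and the tail, which is at most
      \<open>x * S\<close>, stays below \<open>e\<close>; \<open>S + 1\<close> avoids a division by
      zero.\<close>
    define x where "x = min (1/2) (e / (S + 1))"
    have x: "0 < x" "x < 1" "x * S \<le> e"
    proof -
      show "0 < x" "x < 1" using e S by (auto simp: x_def)
      have "x * S \<le> e / (S + 1) * S" using S by (intro mult_right_mono) (auto simp: x_def)
      also have "\<dots> \<le> e" using S e by (simp add: field_simps)
      finally show "x * S \<le> e" .
    qed
    have "a 0 \<le> (\<Sum>m. a m * ennreal x ^ m)" by (subst powser_ennreal_split) simp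
    also have "\<dots> = b 0 + ennreal x * (\<Sum>m. b (Suc m) * ennreal x ^ m)"
      using x by (simp only: eq powser_ennreal_split[of b])
    also have "\<dots> \<le> b 0 + ennreal x * ennreal S"
    proof (intro add_left_mono mult_left_mono)
      have "(\<Sum>m. b (Suc m) * ennreal x ^ m) \<le> (\<Sum>m. b (Suc m))"
      proof (intro suminf_le)
        fix m
        have "ennreal x ^ m \<le> 1 ^ m" using x by (intro power_mono) auto
        then show "b (Suc m) * ennreal x ^ m \<le> b (Suc m)"
          using mult_left_mono[of "ennreal x ^ m" 1 "b (Suc m)"] by simp
      qed auto
      also have "\<dots> \<le> (\<Sum>m. b m)" using powser_ennreal_split[of b 1] by simp
      finally show "(\<Sum>m. b (Suc m) * ennreal x ^ m) \<le> ennreal S" by (simp add: S)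
    qed auto
    also have "\<dots> \<le> b 0 + ennreal e"
      using x S by (intro add_left_mono) (simp add: ennreal_leI flip: ennreal_mult)
    finally show "a 0 \<le> b 0 + ennreal e" .
  qed
  show ?thesis using assms
  proof (induction n arbitrary: a b)
    case 0
    show ?case by (rule antisym[OF *[OF 0(2) 0(3)] *[OF 0(1) 0(3)[symmetric]]])
  next
    case (Suc n)
    have 0: "a 0 = b 0"
      by (rule antisym[OF *[OF Suc.prems(2) Suc.prems(3)] *[OF Suc.prems(1) Suc.prems(3)[symmetric]]])
    have tail: "(\<Sum>m. c (Suc m)) < top" if "(\<Sum>m. c m) < top" for c :: "nat \<Rightarrow> ennreal"
      using powser_ennreal_split[of c 1] that by simp
    have "a 0 \<le> (\<Sum>m. a m)" using powser_ennreal_split[of a 1] by simp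
    then have a0: "a 0 < top" using Suc.prems(1) by (rule le_less_trans)
    show ?case
    proof (rule Suc.IH[of "\<lambda>m. a (Suc m)" "\<lambda>m. b (Suc m)"])
      fix x :: real assume x: "0 < x" "x < 1"
      have "a 0 + ennreal x * (\<Sum>m. a (Suc m) * ennreal x ^ m) = b 0 + ennreal x * (\<Sum>m. b (Suc m) * ennreal x ^ m)"
        using Suc.prems(3)[OF x] by (simp only: powser_ennreal_split[symmetric])
      then have "ennreal x * (\<Sum>m. a (Suc m) * ennreal x ^ m) = ennreal x * (\<Sum>m. b (Suc m) * ennreal x ^ m)"
        using a0 by (auto simp: 0 ennreal_add_left_cancel)
      then show "(\<Sum>m. a (Suc m) * ennreal x ^ m) = (\<Sum>m. b (Suc m) * ennreal x ^ m)"
        using x by (simp add: ennreal_mult_cancel_left)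
    qed (use Suc.prems tail in auto)
  qed
qed

text \<open>An infinite count contributes 0 to both sides. On the left this rests on
  \<open>s > 0\<close>: for \<open>s = 0\<close> the product \<open>s * top\<close> is 0 and its
  \<open>nexp\<close> is 1.\<close>

lemma nexp_count:
  assumes n: "n \<in> insert top (range of_nat)" and s: "s > 0"
  shows "nexp (s * n) = (\<Sum>m. nexp s ^ m * indicator {of_nat m} n)"
proof (cases "n = top")
  case True
  then show ?thesis using s by (simp add: ennreal_mult_top)
next
  case False
  then obtain k where k: "n = of_nat k" using n by auto
  have "(\<Sum>m. nexp s ^ m * indicator {of_nat m} n) = (\<Sum>m\<in>{k}. nexp s ^ m * indicator {of_nat m} n)"
    by (intro suminf_finite) (auto simp: k indicator_def)
  then show ?thesis by (simp add: k nexp_of_nat_mult)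
qed

text \<open>The weight \<open>W\<close> carries the factors of other counts when several counts are
  treated one after another. Uniqueness of power series applies because the coefficients on both
  sides have finite sums.\<close>

lemma generating_function_coeff:
  assumes [measurable]: "n \<in> borel_measurable M" "W \<in> borel_measurable M"
    and count: "AE \<omega> in M. n \<omega> \<in> insert top (range of_nat)"
    and W: "(\<integral>\<^sup>+\<omega>. W \<omega> \<partial>M) < top" and a: "(\<Sum>m. a m) < top"
    and eq: "\<And>s::real. 0 < s \<Longrightarrow> (\<integral>\<^sup>+\<omega>. W \<omega> * nexp (ennreal s * n \<omega>) \<partial>M) = (\<Sum>m. a m * nexp (ennreal s) ^ m)"
  shows "(\<integral>\<^sup>+\<omega>. W \<omega> * indicator {of_nat m} (n \<omega>) \<partial>M) = a m"
proof -
  define b where "b m = (\<integral>\<^sup>+\<omega>. W \<omega> * indicator {of_nat m} (n \<omega>) \<partial>M)" for m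
  have gf: "(\<integral>\<^sup>+\<omega>. W \<omega> * nexp (ennreal s * n \<omega>) \<partial>M) = (\<Sum>m. b m * nexp (ennreal s) ^ m)" if "0 < s" for s
  proof -
    have "(\<integral>\<^sup>+\<omega>. W \<omega> * nexp (ennreal s * n \<omega>) \<partial>M) =
        (\<integral>\<^sup>+\<omega>. (\<Sum>m. nexp (ennreal s) ^ m * (W \<omega> * indicator {of_nat m} (n \<omega>))) \<partial>M)"
    proof (rule nn_integral_cong_AE, use count in eventually_elim)
      case (elim \<omega>)
      have "W \<omega> * nexp (ennreal s * n \<omega>) = (\<Sum>m. W \<omega> * (nexp (ennreal s) ^ m * indicator {of_nat m} (n \<omega>)))"
        using nexp_count[OF elim, of "ennreal s"] that by simp
      then show ?case by (simp only: mult.left_commute)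
    qed
    also have "\<dots> = (\<Sum>m. nexp (ennreal s) ^ m * b m)"
      unfolding b_def by (subst nn_integral_suminf) (auto simp: nn_integral_cmult)
    finally show ?thesis by (simp add: mult.commute)
  qed
  have "(\<Sum>m. indicator {of_nat m} (n \<omega>)) \<le> (1::ennreal)" for \<omega>
  proof (cases "\<exists>k. n \<omega> = of_nat k")
    case True
    then obtain k where k: "n \<omega> = of_nat k" by blast
    have "(\<Sum>m. indicator {of_nat m} (n \<omega>)) = (\<Sum>m\<in>{k}. indicator {of_nat m} (n \<omega>) :: ennreal)"
      by (intro suminf_finite) (auto simp: k indicator_def)
    then show ?thesis by (simp add: k)
  next
    case False then show ?thesis by simp
  qed
  then have "(\<Sum>m. W \<omega> * indicator {of_nat m} (n \<omega>)) \<le> W \<omega>" for \<omega>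
    using mult_left_mono[of _ 1 "W \<omega>"] by simp
  then have "(\<integral>\<^sup>+\<omega>. (\<Sum>m. W \<omega> * indicator {of_nat m} (n \<omega>)) \<partial>M) \<le> (\<integral>\<^sup>+\<omega>. W \<omega> \<partial>M)"
    by (intro nn_integral_mono) auto
  then have b: "(\<Sum>m. b m) < top" using W unfolding b_def by (subst (asm) nn_integral_suminf) auto
  have "b m = a m"
  proof (rule powser_ennreal_unique[OF b a])
    fix x :: real assume x: "0 < x" "x < 1"
    \<comment> \<open>Every \<open>x\<close> strictly between 0 and 1 is \<open>nexp s\<close> for a
      real \<open>s > 0\<close>.\<close>
    have "nexp (ennreal (- ln x)) = ennreal x" using x by (simp add: nexp_ennreal)
    then show "(\<Sum>m. b m * ennreal x ^ m) = (\<Sum>m. a m * ennreal x ^ m)"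
      using gf[of "- ln x"] eq[of "- ln x"] x by simp
  qed
  then show ?thesis by (simp add: b_def)
qed

lemma prod_le_one_ennreal:
  "(\<And>i. i \<in> A \<Longrightarrow> f i \<le> (1::ennreal)) \<Longrightarrow> (\<Prod>i\<in>A. f i) \<le> 1"
proof (induction A rule: infinite_finite_induct)
  case (insert x F)
  then have "f x * (\<Prod>i\<in>F. f i) \<le> 1 * 1" by (intro mult_mono) auto
  then show ?case using insert by simp
qed auto

text \<open>One index at a time is converted from its Laplace transform to a prescribed value. Each
  \<open>p j\<close> has a sum bounded by 1 and not necessarily equal to 1, which admits counts that
  are infinite with positive probability.\<close>

theorem generating_function_product:
  fixes n :: "'j \<Rightarrow> 'w \<Rightarrow> ennreal" and p :: "'j \<Rightarrow> nat \<Rightarrow> ennreal"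
  assumes M: "prob_space M" and J: "finite J"
    and n [measurable]: "\<And>j. j \<in> J \<Longrightarrow> n j \<in> borel_measurable M"
    and count: "\<And>j. j \<in> J \<Longrightarrow> AE \<omega> in M. n j \<omega> \<in> insert top (range of_nat)"
    and p: "\<And>j. j \<in> J \<Longrightarrow> (\<Sum>m. p j m) \<le> 1"
    and eq: "\<And>s::'j \<Rightarrow> real. (\<And>j. 0 < s j) \<Longrightarrow>
      (\<integral>\<^sup>+\<omega>. (\<Prod>j\<in>J. nexp (ennreal (s j) * n j \<omega>)) \<partial>M) = (\<Prod>j\<in>J. \<Sum>m. p j m * nexp (ennreal (s j)) ^ m)"
  shows "(\<integral>\<^sup>+\<omega>. (\<Prod>j\<in>J. indicator {of_nat (m j)} (n j \<omega>)) \<partial>M) = (\<Prod>j\<in>J. p j (m j))"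
proof -
  interpret prob_space M by fact
  have g1: "(\<Sum>m. p j m * nexp x ^ m) \<le> 1" if "j \<in> J" for j x
  proof -
    have "nexp x ^ m \<le> 1" for m by (simp add: nexp_of_nat_mult[symmetric] nexp_le_1)
    then have "p j m * nexp x ^ m \<le> p j m" for m using mult_left_mono[of "nexp x ^ m" 1 "p j m"] by simp
    then have "(\<Sum>m. p j m * nexp x ^ m) \<le> (\<Sum>m. p j m)" by (intro suminf_le) auto
    then show ?thesis using p[OF that] by simp
  qed
  have p1: "p j m \<le> 1" if "j \<in> J" for j m
  proof -
    have "(\<Sum>i\<in>{m}. p j i) \<le> (\<Sum>m. p j m)" by (intro sum_le_suminf) auto
    then show ?thesis using p[OF that] by simp
  qed
  have "(\<integral>\<^sup>+\<omega>. (\<Prod>j\<in>D. indicator {of_nat (m j)} (n j \<omega>)) * (\<Prod>j\<in>J - D. nexp (ennreal (s j) * n j \<omega>)) \<partial>M) =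
      (\<Prod>j\<in>D. p j (m j)) * (\<Prod>j\<in>J - D. \<Sum>m. p j m * nexp (ennreal (s j)) ^ m)"
    if "finite D" "D \<subseteq> J" "\<And>j. 0 < s j" for D s
    using that
  proof (induction D arbitrary: s)
    case empty
    then show ?case using eq[of s] by simp
  next
    case (insert c D)
    have c: "c \<in> J" and D: "D \<subseteq> J" using insert by auto
    define R where "R = J - insert c D"
    have JD: "J - D = insert c R" using insert c by (auto simp: R_def)
    have R: "finite R" "c \<notin> R" "R \<subseteq> J" using J by (auto simp: R_def)
    define W where "W \<omega> = (\<Prod>j\<in>D. indicator {of_nat (m j)} (n j \<omega>)) * (\<Prod>j\<in>R. nexp (ennreal (s j) * n j \<omega>))" for \<omega>
    define C where "C = (\<Prod>j\<in>D. p j (m j)) * (\<Prod>j\<in>R. \<Sum>m. p j m * nexp (ennreal (s j)) ^ m)"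
    have "(\<Prod>j\<in>D. p j (m j)) \<le> 1" "(\<Prod>j\<in>R. \<Sum>m. p j m * nexp (ennreal (s j)) ^ m) \<le> 1"
      using D R by (auto intro!: prod_le_one_ennreal p1 g1)
    then have C: "C \<le> 1" unfolding C_def using mult_mono[of _ 1 _ "1::ennreal"] by simp
    have W1: "W \<omega> \<le> 1" for \<omega>
    proof -
      have "(\<Prod>j\<in>D. indicator {of_nat (m j)} (n j \<omega>)) \<le> (1::ennreal)" "(\<Prod>j\<in>R. nexp (ennreal (s j) * n j \<omega>)) \<le> 1"
        by (auto intro!: prod_le_one_ennreal nexp_le_1 simp: indicator_def)
      then show ?thesis unfolding W_def using mult_mono[of _ 1 _ "1::ennreal"] by simp
    qed
    have m1: "(\<lambda>\<omega>. \<Prod>j\<in>D. indicator {of_nat (m j)} (n j \<omega>) :: ennreal) \<in> borel_measurable M"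
      using D n by (intro borel_measurable_prod_ennreal measurable_compose[OF n]) auto
    have m2: "(\<lambda>\<omega>. \<Prod>j\<in>R. nexp (ennreal (s j) * n j \<omega>)) \<in> borel_measurable M"
      using R n by (intro borel_measurable_prod_ennreal measurable_compose[OF n]) auto
    have WM [measurable]: "W \<in> borel_measurable M" unfolding W_def using m1 m2 by measurable
    note [measurable] = n[OF c]
    have "(\<integral>\<^sup>+\<omega>. W \<omega> * indicator {of_nat (m c)} (n c \<omega>) \<partial>M) = C * p c (m c)"
    proof (rule generating_function_coeff)
      show "AE \<omega> in M. n c \<omega> \<in> insert top (range of_nat)" by (rule count[OF c])
      have "(\<integral>\<^sup>+\<omega>. W \<omega> \<partial>M) \<le> (\<integral>\<^sup>+\<omega>. 1 \<partial>M)" using W1 by (intro nn_integral_mono) auto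
      then show "(\<integral>\<^sup>+\<omega>. W \<omega> \<partial>M) < top" by (simp add: emeasure_space_1 le_less_trans)
      have "(\<Sum>m. C * p c m) \<le> 1"
        using mult_mono[OF C p[OF c]] by simp
      then show "(\<Sum>m. C * p c m) < top" by (rule le_less_trans) simp
      fix t :: real assume t: "0 < t"
      have *: "(\<Prod>j\<in>R. g j ((s(c := t)) j)) = (\<Prod>j\<in>R. g j (s j))" for g :: "'j \<Rightarrow> real \<Rightarrow> ennreal"
      proof (intro prod.cong refl)
        fix i assume "i \<in> R"
        then have "i \<noteq> c" using R by blast
        then show "g i ((s(c := t)) i) = g i (s i)" by simp
      qed
      note IH = insert.IH[OF D, of "s(c := t)", unfolded JD prod.insert[OF R(1,2)]
        *[of "\<lambda>j x. nexp (ennreal x * n j \<omega>)" for \<omega>] *[of "\<lambda>j x. \<Sum>m. p j m * nexp (ennreal x) ^ m"] fun_upd_same]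
      have "(\<integral>\<^sup>+\<omega>. W \<omega> * nexp (ennreal t * n c \<omega>) \<partial>M) = C * (\<Sum>m. p c m * nexp (ennreal t) ^ m)"
        using IH insert.prems t by (simp add: W_def C_def ac_simps)
      then show "(\<integral>\<^sup>+\<omega>. W \<omega> * nexp (ennreal t * n c \<omega>) \<partial>M) = (\<Sum>m. C * p c m * nexp (ennreal t) ^ m)"
        by (simp add: mult.assoc)
    qed measurable
    then show ?case using insert(1,2) by (simp add: W_def C_def R_def ac_simps)
  qed
  from this[OF J order_refl, of "\<lambda>_. 1"] show ?thesis by simp
qed

text \<open>The masses at natural numbers come from \<open>s > 0\<close>. The mass at infinity is
  invisible there and is recovered from \<open>s = 0\<close>: it is what the total mass exceeds the
  finite sum of the other masses by.\<close>

lemma generating_function_unique1: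
  assumes [measurable]: "n \<in> borel_measurable M" "W \<in> borel_measurable M"
      "n' \<in> borel_measurable M'" "W' \<in> borel_measurable M'"
    and count: "AE \<omega> in M. n \<omega> \<in> insert top (range of_nat)" "AE \<omega> in M'. n' \<omega> \<in> insert top (range of_nat)"
    and W: "(\<integral>\<^sup>+\<omega>. W \<omega> \<partial>M) < top"
    and eq: "\<And>s::real. 0 \<le> s \<Longrightarrow>
      (\<integral>\<^sup>+\<omega>. W \<omega> * nexp (ennreal s * n \<omega>) \<partial>M) = (\<integral>\<^sup>+\<omega>. W' \<omega> * nexp (ennreal s * n' \<omega>) \<partial>M')"
    and C: "C \<in> sets borel"
  shows "(\<integral>\<^sup>+\<omega>. W \<omega> * indicator C (n \<omega>) \<partial>M) = (\<integral>\<^sup>+\<omega>. W' \<omega> * indicator C (n' \<omega>) \<partial>M')"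
proof -
  have tot: "(\<integral>\<^sup>+\<omega>. W \<omega> \<partial>M) = (\<integral>\<^sup>+\<omega>. W' \<omega> \<partial>M')" using eq[of 0] by simp
  have ind: "indicator C x = indicator C top * indicator {top} x + (\<Sum>m. indicator C (of_nat m) * indicator {of_nat m} x :: ennreal)"
    if x: "x \<in> insert top (range of_nat)" for x :: ennreal and C
  proof (cases "x = top")
    case True then show ?thesis by simp
  next
    case False
    then obtain k where k: "x = of_nat k" using x by auto
    have "(\<Sum>m. indicator C (of_nat m) * indicator {of_nat m} x :: ennreal) =
        (\<Sum>m\<in>{k}. indicator C (of_nat m) * indicator {of_nat m} x)"
      by (intro suminf_finite) (auto simp: k indicator_def)
    then show ?thesis by (simp add: k)
  qed
  have dec: "(\<integral>\<^sup>+\<omega>. W \<omega> * indicator C (n \<omega>) \<partial>M) = indicator C top * (\<integral>\<^sup>+\<omega>. W \<omega> * indicator {top} (n \<omega>) \<partial>M) +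
      (\<Sum>m. indicator C (of_nat m) * (\<integral>\<^sup>+\<omega>. W \<omega> * indicator {of_nat m} (n \<omega>) \<partial>M))"
    if [measurable]: "n \<in> borel_measurable M" "W \<in> borel_measurable M"
      and count: "AE \<omega> in M. n \<omega> \<in> insert top (range of_nat)" for n :: "'c \<Rightarrow> ennreal" and W C and M :: "'c measure"
  proof -
    have "(\<integral>\<^sup>+\<omega>. W \<omega> * indicator C (n \<omega>) \<partial>M) =
        (\<integral>\<^sup>+\<omega>. indicator C top * (W \<omega> * indicator {top} (n \<omega>)) +
          (\<Sum>m. indicator C (of_nat m) * (W \<omega> * indicator {of_nat m} (n \<omega>))) \<partial>M)"
    proof (rule nn_integral_cong_AE, use count in eventually_elim)
      case (elim \<omega>)
      have "W \<omega> * (\<Sum>m. indicator C (of_nat m) * indicator {of_nat m} (n \<omega>)) =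
          (\<Sum>m. W \<omega> * (indicator C (of_nat m) * indicator {of_nat m} (n \<omega>)))" by simp
      then show ?case
        by (subst ind[OF elim]) (simp only: distrib_left mult.left_commute)
    qed
    also have "\<dots> = indicator C top * (\<integral>\<^sup>+\<omega>. W \<omega> * indicator {top} (n \<omega>) \<partial>M) +
        (\<integral>\<^sup>+\<omega>. (\<Sum>m. indicator C (of_nat m) * (W \<omega> * indicator {of_nat m} (n \<omega>))) \<partial>M)"
      by (subst nn_integral_add) (auto simp: nn_integral_cmult)
    also have "(\<integral>\<^sup>+\<omega>. (\<Sum>m. indicator C (of_nat m) * (W \<omega> * indicator {of_nat m} (n \<omega>))) \<partial>M) =
        (\<Sum>m. indicator C (of_nat m) * (\<integral>\<^sup>+\<omega>. W \<omega> * indicator {of_nat m} (n \<omega>) \<partial>M))"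
      by (subst nn_integral_suminf) (auto simp: nn_integral_cmult)
    finally show ?thesis .
  qed
  note decs = dec[OF assms(1,2) count(1)] and decs' = dec[OF assms(3,4) count(2)]
  have sum': "(\<Sum>m. \<integral>\<^sup>+\<omega>. W' \<omega> * indicator {of_nat m} (n' \<omega>) \<partial>M') < top"
    using decs'[of UNIV] tot W by (simp add: add_top less_top)
  have gf': "(\<integral>\<^sup>+\<omega>. W' \<omega> * nexp (ennreal s * n' \<omega>) \<partial>M') =
      (\<Sum>m. (\<integral>\<^sup>+\<omega>. W' \<omega> * indicator {of_nat m} (n' \<omega>) \<partial>M') * nexp (ennreal s) ^ m)" if "0 < s" for s
  proof -
    have "(\<integral>\<^sup>+\<omega>. W' \<omega> * nexp (ennreal s * n' \<omega>) \<partial>M') =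
        (\<integral>\<^sup>+\<omega>. (\<Sum>m. (W' \<omega> * indicator {of_nat m} (n' \<omega>)) * nexp (ennreal s) ^ m) \<partial>M')"
    proof (rule nn_integral_cong_AE, use count(2) in eventually_elim)
      case (elim \<omega>)
      have "W' \<omega> * nexp (ennreal s * n' \<omega>) = (\<Sum>m. W' \<omega> * (nexp (ennreal s) ^ m * indicator {of_nat m} (n' \<omega>)))"
        using nexp_count[OF elim, of "ennreal s"] that by simp
      then show ?case by (simp only: mult_ac)
    qed
    also have "\<dots> = (\<Sum>m. (\<integral>\<^sup>+\<omega>. W' \<omega> * indicator {of_nat m} (n' \<omega>) \<partial>M') * nexp (ennreal s) ^ m)"
      by (subst nn_integral_suminf) (auto simp: nn_integral_multc)
    finally show ?thesis .
  qed
  have coeff: "(\<integral>\<^sup>+\<omega>. W \<omega> * indicator {of_nat m} (n \<omega>) \<partial>M) = (\<integral>\<^sup>+\<omega>. W' \<omega> * indicator {of_nat m} (n' \<omega>) \<partial>M')" for m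
    using eq gf' by (intro generating_function_coeff[OF _ _ count(1) W sum']) auto
  have "(\<integral>\<^sup>+\<omega>. W \<omega> * indicator {top} (n \<omega>) \<partial>M) + (\<Sum>m. \<integral>\<^sup>+\<omega>. W' \<omega> * indicator {of_nat m} (n' \<omega>) \<partial>M') =
      (\<integral>\<^sup>+\<omega>. W' \<omega> * indicator {top} (n' \<omega>) \<partial>M') + (\<Sum>m. \<integral>\<^sup>+\<omega>. W' \<omega> * indicator {of_nat m} (n' \<omega>) \<partial>M')"
    using decs[of UNIV] decs'[of UNIV] tot by (simp add: coeff)
  then have "(\<integral>\<^sup>+\<omega>. W \<omega> * indicator {top} (n \<omega>) \<partial>M) = (\<integral>\<^sup>+\<omega>. W' \<omega> * indicator {top} (n' \<omega>) \<partial>M')"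
    unfolding add.commute[of _ "suminf _"] ennreal_add_left_cancel infinity_ennreal_def
    using less_imp_neq[OF sum'] by blast
  then show ?thesis unfolding decs[of C] decs'[of C] coeff by (simp only:)
qed

text \<open>One index at a time is converted from Laplace form to an indicator; the indices already
  converted and those still in Laplace form make up the weights \<open>W\<close> and
  \<open>W'\<close>. The sets \<open>C j\<close> may contain \<open>top\<close>.\<close>

theorem generating_function_unique:
  fixes n :: "'j \<Rightarrow> 'w \<Rightarrow> ennreal" and n' :: "'j \<Rightarrow> 'v \<Rightarrow> ennreal"
  assumes M: "prob_space M" "prob_space M'" and J: "finite J"
    and n [measurable]: "\<And>j. j \<in> J \<Longrightarrow> n j \<in> borel_measurable M" "\<And>j. j \<in> J \<Longrightarrow> n' j \<in> borel_measurable M'"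
    and count: "\<And>j. j \<in> J \<Longrightarrow> AE \<omega> in M. n j \<omega> \<in> insert top (range of_nat)"
      "\<And>j. j \<in> J \<Longrightarrow> AE \<omega> in M'. n' j \<omega> \<in> insert top (range of_nat)"
    and eq: "\<And>s::'j \<Rightarrow> real. (\<And>j. 0 \<le> s j) \<Longrightarrow>
      (\<integral>\<^sup>+\<omega>. (\<Prod>j\<in>J. nexp (ennreal (s j) * n j \<omega>)) \<partial>M) = (\<integral>\<^sup>+\<omega>. (\<Prod>j\<in>J. nexp (ennreal (s j) * n' j \<omega>)) \<partial>M')"
    and C: "\<And>j. j \<in> J \<Longrightarrow> C j \<in> sets borel"
  shows "(\<integral>\<^sup>+\<omega>. (\<Prod>j\<in>J. indicator (C j) (n j \<omega>)) \<partial>M) = (\<integral>\<^sup>+\<omega>. (\<Prod>j\<in>J. indicator (C j) (n' j \<omega>)) \<partial>M')"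
proof -
  interpret M: prob_space M by fact
  interpret M': prob_space M' by fact
  have "(\<integral>\<^sup>+\<omega>. (\<Prod>j\<in>D. indicator (C j) (n j \<omega>)) * (\<Prod>j\<in>J - D. nexp (ennreal (s j) * n j \<omega>)) \<partial>M) =
      (\<integral>\<^sup>+\<omega>. (\<Prod>j\<in>D. indicator (C j) (n' j \<omega>)) * (\<Prod>j\<in>J - D. nexp (ennreal (s j) * n' j \<omega>)) \<partial>M')"
    if "finite D" "D \<subseteq> J" "\<And>j. 0 \<le> s j" for D s
    using that
  proof (induction D arbitrary: s)
    case empty
    then show ?case using eq[of s] by simp
  next
    case (insert c D)
    have c: "c \<in> J" and D: "D \<subseteq> J" using insert by auto
    define R where "R = J - insert c D"
    have JD: "J - D = insert c R" using insert c by (auto simp: R_def)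
    have R: "finite R" "c \<notin> R" "R \<subseteq> J" using J by (auto simp: R_def)
    define W where "W \<omega> = (\<Prod>j\<in>D. indicator (C j) (n j \<omega>)) * (\<Prod>j\<in>R. nexp (ennreal (s j) * n j \<omega>))" for \<omega>
    define W' where "W' \<omega> = (\<Prod>j\<in>D. indicator (C j) (n' j \<omega>)) * (\<Prod>j\<in>R. nexp (ennreal (s j) * n' j \<omega>))" for \<omega>
    have W1: "W \<omega> \<le> 1" for \<omega>
    proof -
      have "(\<Prod>j\<in>D. indicator (C j) (n j \<omega>)) \<le> (1::ennreal)" "(\<Prod>j\<in>R. nexp (ennreal (s j) * n j \<omega>)) \<le> 1"
        by (auto intro!: prod_le_one_ennreal nexp_le_1 simp: indicator_def)
      then show ?thesis unfolding W_def using mult_mono[of _ 1 _ "1::ennreal"] by simp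
    qed
    have Cm: "indicator (C j) \<in> borel_measurable borel" if "j \<in> D" for j
      using C D that by auto
    have m1: "(\<lambda>\<omega>. \<Prod>j\<in>D. indicator (C j) (n j \<omega>) :: ennreal) \<in> borel_measurable M"
        "(\<lambda>\<omega>. \<Prod>j\<in>D. indicator (C j) (n' j \<omega>) :: ennreal) \<in> borel_measurable M'"
      using D by (auto intro!: borel_measurable_prod_ennreal measurable_compose[OF n(1)] measurable_compose[OF n(2)] borel_measurable_indicator C)
    have m2: "(\<lambda>\<omega>. \<Prod>j\<in>R. nexp (ennreal (s j) * n j \<omega>)) \<in> borel_measurable M"
        "(\<lambda>\<omega>. \<Prod>j\<in>R. nexp (ennreal (s j) * n' j \<omega>)) \<in> borel_measurable M'"
      using R by (auto intro!: borel_measurable_prod_ennreal measurable_compose[OF n(1)] measurable_compose[OF n(2)])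
    have WM [measurable]: "W \<in> borel_measurable M" "W' \<in> borel_measurable M'"
      unfolding W_def W'_def using m1 m2 by auto
    have "(\<integral>\<^sup>+\<omega>. W \<omega> * indicator (C c) (n c \<omega>) \<partial>M) = (\<integral>\<^sup>+\<omega>. W' \<omega> * indicator (C c) (n' c \<omega>) \<partial>M')"
    proof (rule generating_function_unique1[OF n(1)[OF c] WM(1) n(2)[OF c] WM(2) count(1)[OF c] count(2)[OF c] _ _ C[OF c]])
      have "(\<integral>\<^sup>+\<omega>. W \<omega> \<partial>M) \<le> (\<integral>\<^sup>+\<omega>. 1 \<partial>M)" using W1 by (intro nn_integral_mono) auto
      then show "(\<integral>\<^sup>+\<omega>. W \<omega> \<partial>M) < top" by (simp add: M.emeasure_space_1 le_less_trans)
      fix t :: real assume t: "0 \<le> t"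
      have *: "(\<Prod>j\<in>R. g j ((s(c := t)) j)) = (\<Prod>j\<in>R. g j (s j))" for g :: "'j \<Rightarrow> real \<Rightarrow> ennreal"
      proof (intro prod.cong refl)
        fix i assume "i \<in> R"
        then have "i \<noteq> c" using R by blast
        then show "g i ((s(c := t)) i) = g i (s i)" by simp
      qed
      note IH = insert.IH[OF D, of "s(c := t)", unfolded JD prod.insert[OF R(1,2)]
        *[of "\<lambda>j x. nexp (ennreal x * n j \<omega>)" for \<omega>] *[of "\<lambda>j x. nexp (ennreal x * n' j \<omega>)" for \<omega>] fun_upd_same]
      show "(\<integral>\<^sup>+\<omega>. W \<omega> * nexp (ennreal t * n c \<omega>) \<partial>M) = (\<integral>\<^sup>+\<omega>. W' \<omega> * nexp (ennreal t * n' c \<omega>) \<partial>M')"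
        using IH insert.prems t by (simp add: W_def W'_def ac_simps)
    qed
    then show ?case using insert(1,2) by (simp add: W_def W'_def R_def ac_simps)
  qed
  from this[OF J order_refl, of "\<lambda>_. 0"] show ?thesis by simp
qed

section \<open>Mixtures of measures\<close>

lemma nn_integral_measure_sum:
  fixes K :: "nat \<Rightarrow> 'b::topological_space measure"
  assumes K: "\<And>k. sets (K k) = sets borel" and f: "f \<in> borel_measurable borel"
  shows "(\<integral>\<^sup>+x. f x \<partial>measure_sum K) = (\<Sum>k. \<integral>\<^sup>+x. f x \<partial>K k)"
proof -
  have "(\<integral>\<^sup>+x. f x \<partial>measure_sum K) = (\<integral>\<^sup>+k. 1 * (\<integral>\<^sup>+x. f x \<partial>K k) \<partial>count_space UNIV)"
  proof (rule nnlin_ext'[OF _ _ _ f])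
    show "nnlin (\<lambda>f. \<integral>\<^sup>+x. f x \<partial>measure_sum K)" by (rule nnlin_nn_integral) simp
    show "nnlin (\<lambda>f. \<integral>\<^sup>+k. 1 * (\<integral>\<^sup>+x. f x \<partial>K k) \<partial>count_space UNIV)"
      by (rule nnlin_kernel) (auto simp: K)
    fix A :: "'b set" assume A: "A \<in> sets borel"
    then show "(\<integral>\<^sup>+x. indicator A x \<partial>measure_sum K) = (\<integral>\<^sup>+k. 1 * (\<integral>\<^sup>+x. indicator A x \<partial>K k) \<partial>count_space UNIV)"
      by (simp add: K emeasure_measure_sum[of K, OF K] nn_integral_count_space_nat)
  qed
  then show ?thesis by (simp add: nn_integral_count_space_nat)
qed

text \<open>The mean measure of a random measure \<open>\<kappa>\<close>. Neither \<open>M\<close>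
  nor \<open>\<kappa>\<close> has to be finite, so that mean measures of point processes on the
  whole time axis are covered.\<close>

definition mixture :: "'w measure \<Rightarrow> ('w \<Rightarrow> 'b::topological_space measure) \<Rightarrow> 'b measure" where
  "mixture M \<kappa> = measure_of UNIV (sets borel) (\<lambda>B. \<integral>\<^sup>+\<omega>. emeasure (\<kappa> \<omega>) B \<partial>M)"

lemma sets_mixture [simp, measurable_cong]:
  fixes \<kappa> :: "'w \<Rightarrow> 'b::topological_space measure"
  shows "sets (mixture M \<kappa>) = sets borel"
  using sets.sigma_sets_eq[of "borel :: 'b measure"] by (simp add: mixture_def)

lemma space_mixture [simp]: "space (mixture M \<kappa>) = UNIV"
  by (simp add: mixture_def)

lemma emeasure_mixture:
  fixes \<kappa> :: "'w \<Rightarrow> 'b::topological_space measure"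
  assumes \<kappa>: "\<And>\<omega>. \<omega> \<in> space M \<Longrightarrow> sets (\<kappa> \<omega>) = sets borel"
    and m: "\<And>B. B \<in> sets borel \<Longrightarrow> (\<lambda>\<omega>. emeasure (\<kappa> \<omega>) B) \<in> borel_measurable M"
    and B: "B \<in> sets borel"
  shows "emeasure (mixture M \<kappa>) B = (\<integral>\<^sup>+\<omega>. emeasure (\<kappa> \<omega>) B \<partial>M)"
  unfolding mixture_def
proof (rule emeasure_measure_of_sigma)
  show "sigma_algebra UNIV (sets (borel :: 'b measure))"
    using sets.sigma_algebra_axioms[of "borel :: 'b measure"] by simp
  show "countably_additive (sets borel) (\<lambda>B. \<integral>\<^sup>+\<omega>. emeasure (\<kappa> \<omega>) B \<partial>M)"
  proof (rule countably_additiveI)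
    fix A :: "nat \<Rightarrow> 'b set"
    assume A: "range A \<subseteq> sets borel" "disjoint_family A"
    have "(\<Sum>i. \<integral>\<^sup>+\<omega>. emeasure (\<kappa> \<omega>) (A i) \<partial>M) = (\<integral>\<^sup>+\<omega>. (\<Sum>i. emeasure (\<kappa> \<omega>) (A i)) \<partial>M)"
      using A m by (intro nn_integral_suminf[symmetric]) auto
    also have "\<dots> = (\<integral>\<^sup>+\<omega>. emeasure (\<kappa> \<omega>) (\<Union>(range A)) \<partial>M)"
      using A \<kappa> by (intro nn_integral_cong suminf_emeasure) auto
    finally show "(\<Sum>i. \<integral>\<^sup>+\<omega>. emeasure (\<kappa> \<omega>) (A i) \<partial>M) = (\<integral>\<^sup>+\<omega>. emeasure (\<kappa> \<omega>) (\<Union>(range A)) \<partial>M)" .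
  qed
qed (use B in \<open>auto simp: positive_def\<close>)

lemma nn_integral_mixture:
  fixes \<kappa> :: "'w \<Rightarrow> 'b::topological_space measure"
  assumes \<kappa>: "\<And>\<omega>. \<omega> \<in> space M \<Longrightarrow> sets (\<kappa> \<omega>) = sets borel"
    and m: "\<And>B. B \<in> sets borel \<Longrightarrow> (\<lambda>\<omega>. emeasure (\<kappa> \<omega>) B) \<in> borel_measurable M"
    and f: "f \<in> borel_measurable borel"
  shows "(\<integral>\<^sup>+x. f x \<partial>mixture M \<kappa>) = (\<integral>\<^sup>+\<omega>. \<integral>\<^sup>+x. f x \<partial>\<kappa> \<omega> \<partial>M)"
proof -
  have "(\<integral>\<^sup>+x. f x \<partial>mixture M \<kappa>) = (\<integral>\<^sup>+\<omega>. 1 * (\<integral>\<^sup>+x. f x \<partial>\<kappa> \<omega>) \<partial>M)"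
  proof (rule nnlin_ext'[OF _ _ _ f])
    show "nnlin (\<lambda>f. \<integral>\<^sup>+x. f x \<partial>mixture M \<kappa>)" by (rule nnlin_nn_integral) simp
    show "nnlin (\<lambda>f. \<integral>\<^sup>+\<omega>. 1 * (\<integral>\<^sup>+x. f x \<partial>\<kappa> \<omega>) \<partial>M)"
      by (rule nnlin_kernel) (auto simp: \<kappa> m)
    fix A :: "'b set" assume A: "A \<in> sets borel"
    have "(\<integral>\<^sup>+\<omega>. emeasure (\<kappa> \<omega>) A \<partial>M) = (\<integral>\<^sup>+\<omega>. 1 * (\<integral>\<^sup>+x. indicator A x \<partial>\<kappa> \<omega>) \<partial>M)"
      using A \<kappa> by (intro nn_integral_cong) simp
    then show "(\<integral>\<^sup>+x. indicator A x \<partial>mixture M \<kappa>) = (\<integral>\<^sup>+\<omega>. 1 * (\<integral>\<^sup>+x. indicator A x \<partial>\<kappa> \<omega>) \<partial>M)"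
      using A emeasure_mixture[OF \<kappa> m A] by simp
  qed
  then show ?thesis by simp
qed

section \<open>Integration over space and time\<close>

lemma borel_measurable_fst' [measurable (raw)]:
  fixes f :: "'z \<Rightarrow> 'a::second_countable_topology \<times> 'b::second_countable_topology"
  assumes "f \<in> borel_measurable M" shows "(\<lambda>x. fst (f x)) \<in> borel_measurable M"
  using assms by (rule measurable_compose) (intro borel_measurable_continuous_onI continuous_intros)

lemma borel_measurable_snd' [measurable (raw)]:
  fixes f :: "'z \<Rightarrow> 'a::second_countable_topology \<times> 'b::second_countable_topology"
  assumes "f \<in> borel_measurable M" shows "(\<lambda>x. snd (f x)) \<in> borel_measurable M"
  using assms by (rule measurable_compose) (intro borel_measurable_continuous_onI continuous_intros)

lemma nn_integral_lborel_pair: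
  fixes f :: "'a::euclidean_space \<times> 'b::euclidean_space \<Rightarrow> ennreal"
  assumes [measurable]: "f \<in> borel_measurable borel"
  shows "(\<integral>\<^sup>+z. f z \<partial>lborel) = (\<integral>\<^sup>+x. \<integral>\<^sup>+t. f (x, t) \<partial>lborel \<partial>lborel)"
    and "(\<integral>\<^sup>+z. f z \<partial>lborel) = (\<integral>\<^sup>+t. \<integral>\<^sup>+x. f (x, t) \<partial>lborel \<partial>lborel)"
proof -
  have f: "f \<in> borel_measurable (lborel \<Otimes>\<^sub>M lborel)" by (simp add: lborel_prod)
  show 1: "(\<integral>\<^sup>+z. f z \<partial>lborel) = (\<integral>\<^sup>+x. \<integral>\<^sup>+t. f (x, t) \<partial>lborel \<partial>lborel)"
    using lborel.nn_integral_fst[OF f] by (simp add: lborel_prod)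
  show "(\<integral>\<^sup>+z. f z \<partial>lborel) = (\<integral>\<^sup>+t. \<integral>\<^sup>+x. f (x, t) \<partial>lborel \<partial>lborel)"
    using lborel_pair.nn_integral_snd[OF f] by (simp add: lborel_prod case_prod_unfold)
qed

lemma nn_integral_lborel_swap:
  fixes f :: "'a::euclidean_space \<Rightarrow> 'b::euclidean_space \<Rightarrow> ennreal"
  assumes "(\<lambda>(x, y). f x y) \<in> borel_measurable borel"
  shows "(\<integral>\<^sup>+x. \<integral>\<^sup>+y. f x y \<partial>lborel \<partial>lborel) = (\<integral>\<^sup>+y. \<integral>\<^sup>+x. f x y \<partial>lborel \<partial>lborel)"
  using nn_integral_lborel_pair[OF assms] by simp

lemma nn_integral_lborel_shift:
  fixes f :: "'a::euclidean_space \<Rightarrow> ennreal"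
  assumes [measurable]: "f \<in> borel_measurable borel"
  shows "(\<integral>\<^sup>+z. f (c + z) \<partial>lborel) = (\<integral>\<^sup>+z. f z \<partial>lborel)"
proof -
  have "(\<integral>\<^sup>+z. f z \<partial>lborel) = (\<integral>\<^sup>+z. f z \<partial>distr lborel borel ((+) c))"
    by (simp add: lborel_distr_plus)
  also have "\<dots> = (\<integral>\<^sup>+z. f (c + z) \<partial>lborel)" by (subst nn_integral_distr) auto
  finally show ?thesis by simp
qed

lemma nn_integral_lborel_shift_time:
  fixes f :: "'a::euclidean_space \<times> real \<Rightarrow> ennreal"
  assumes "f \<in> borel_measurable borel"
  shows "(\<integral>\<^sup>+z. f (fst z, s + snd z) \<partial>lborel) = (\<integral>\<^sup>+z. f z \<partial>lborel)"
proof -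
  have "(fst z, s + snd z) = (0, s) + z" for z :: "'a \<times> real" by (cases z) simp
  then show ?thesis using nn_integral_lborel_shift[OF assms, of "(0, s)"] by simp
qed

lemma suminf_geometric_ennreal:
  fixes r :: ennreal assumes "r < 1" shows "(\<Sum>k. r ^ k) = 1 / (1 - r)"
proof -
  have "r < top" using assms by (rule order.strict_trans) simp
  then obtain x where x: "r = ennreal x" "0 \<le> x" by (cases r) auto
  then have x1: "x < 1" using assms by (simp add: ennreal_less_iff flip: ennreal_1)
  have "(\<lambda>k. x ^ k) sums (1 / (1 - x))" using x x1 by (intro geometric_sums) simp
  then have "(\<Sum>k. ennreal (x ^ k)) = ennreal (1 / (1 - x))"
    using x by (intro suminf_ennreal_eq) auto
  also have "ennreal (1 / (1 - x)) = 1 / (1 - r)"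
    using x x1 by (simp add: ennreal_minus divide_ennreal flip: ennreal_1)
  finally show ?thesis using x by (simp add: ennreal_power)
qed

section \<open>The offspring kernel and its powers\<close>

locale hawkes_data =
  fixes X :: "'a::euclidean_space set"
    and lam :: "'a \<Rightarrow> real"
    and g :: "'a \<Rightarrow> 'a \<Rightarrow> real \<Rightarrow> real"
    and gt :: "real \<Rightarrow> real"
  assumes X: "X \<in> sets borel"
    and lam: "lam \<in> borel_measurable (restrict_space borel X)"
    and m_lam: "(\<integral>\<^sup>+x\<in>X. ennreal (lam x) \<partial>lborel) < \<infinity>"
    and g: "(\<lambda>(y, x, h). g y x h) \<in> borel_measurable (restrict_space borel (X \<times> X \<times> UNIV))"
    and g_neg: "\<And>y x h. y \<in> X \<Longrightarrow> x \<in> X \<Longrightarrow> h < 0 \<Longrightarrow> g y x h = 0"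
    and gt: "gt \<in> borel_measurable (restrict_space borel {0..})"
    and nu_temp: "(\<integral>\<^sup>+h\<in>{0..}. ennreal (gt h) \<partial>lborel) < 1"
    and g_le_gt: "\<And>y h. y \<in> X \<Longrightarrow> 0 \<le> h \<Longrightarrow> (\<integral>\<^sup>+x\<in>X. ennreal (g y x h) \<partial>lborel) \<le> ennreal (gt h)"
begin

text \<open>The extensions by zero are measurable on the whole space and turn integrals over
  \<open>X\<close> or over positive times into plain Lebesgue integrals, to which Fubini and
  translations apply directly.\<close>

definition lamX :: "'a \<Rightarrow> ennreal" where "lamX x = ennreal (lam x) * indicator X x"
definition gX :: "'a \<Rightarrow> 'a \<Rightarrow> real \<Rightarrow> ennreal" where
  "gX y x t = ennreal (g y x t) * indicator (X \<times> X \<times> UNIV) (y, x, t)"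
definition gtp :: "real \<Rightarrow> ennreal" where "gtp t = ennreal (gt t) * indicator {0..} t"

lemma X_measurable [measurable]: "X \<in> sets borel" by (rule X)

lemma lamX_measurable [measurable]: "lamX \<in> borel_measurable borel"
proof -
  have "(\<lambda>x. ennreal (lam x)) \<in> borel_measurable (restrict_space borel X)" using lam by measurable
  then show ?thesis unfolding lamX_def[abs_def] by (subst (asm) borel_measurable_restrict_space_iff_ennreal) auto
qed

lemma gX_measurable0: "(\<lambda>(y, x, t). gX y x t) \<in> borel_measurable borel"
proof -
  have "(\<lambda>z. ennreal ((\<lambda>(y, x, h). g y x h) z)) \<in> borel_measurable (restrict_space borel (X \<times> X \<times> UNIV))"
    using g by measurable
  moreover have "X \<times> X \<times> (UNIV :: real set) \<in> sets borel"
    unfolding borel_prod[symmetric] by (intro pair_measureI) auto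
  ultimately show ?thesis
    by (subst (asm) borel_measurable_restrict_space_iff_ennreal) (auto simp: gX_def case_prod_unfold)
qed

lemma gX_measurable [measurable (raw)]:
  assumes [measurable]: "f1 \<in> borel_measurable M" "f2 \<in> borel_measurable M" "f3 \<in> borel_measurable M"
  shows "(\<lambda>z. gX (f1 z) (f2 z) (f3 z)) \<in> borel_measurable M"
proof -
  have "(\<lambda>z. (f1 z, f2 z, f3 z)) \<in> borel_measurable M" by measurable
  from measurable_compose[OF this gX_measurable0] show ?thesis by simp
qed

lemma gtp_measurable [measurable]: "gtp \<in> borel_measurable borel"
proof -
  have "(\<lambda>x. ennreal (gt x)) \<in> borel_measurable (restrict_space borel {0..})" using gt by measurable
  then show ?thesis unfolding gtp_def[abs_def] by (subst (asm) borel_measurable_restrict_space_iff_ennreal) auto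
qed

lemma gX_neg: "t < 0 \<Longrightarrow> gX y x t = 0"
  by (auto simp: gX_def indicator_def g_neg)

lemma gX_le_gtp: "(\<integral>\<^sup>+x. gX y x t \<partial>lborel) \<le> gtp t"
proof (cases "y \<in> X \<and> 0 \<le> t")
  case True
  then have "(\<integral>\<^sup>+x. gX y x t \<partial>lborel) = (\<integral>\<^sup>+x\<in>X. ennreal (g y x t) \<partial>lborel)"
    by (intro nn_integral_cong) (auto simp: gX_def indicator_def)
  then show ?thesis using g_le_gt[of y t] True by (simp add: gtp_def)
next
  case False
  then have "gX y x t = 0" for x by (auto simp: gX_neg) (simp add: gX_def)
  then show ?thesis by simp
qed

text \<open>The convolution powers of the extended kernel, with a single integral over space and
  time. \<open>cp j\<close> has exponent \<open>j + 1\<close>, like \<open>conv_pow_Suc\<close>,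
  with which it agrees on \<open>X\<close>.\<close>

primrec cp :: "nat \<Rightarrow> 'a \<Rightarrow> 'a \<Rightarrow> real \<Rightarrow> ennreal" where
  "cp 0 = gX"
| "cp (Suc j) = (\<lambda>y x t. \<integral>\<^sup>+p. gX y (fst p) (snd p) * cp j (fst p) x (t - snd p) \<partial>lborel)"

lemma cp_measurable0: "(\<lambda>(y, x, t). cp j y x t) \<in> borel_measurable (borel \<Otimes>\<^sub>M borel \<Otimes>\<^sub>M borel)"
proof (induction j)
  case 0
  then show ?case by simp
next
  case (Suc j)
  have [measurable]: "(\<lambda>z. cp j (f1 z) (f2 z) (f3 z)) \<in> borel_measurable M"
    if [measurable]: "f1 \<in> borel_measurable M" "f2 \<in> borel_measurable M" "f3 \<in> borel_measurable M"
    for f1 f2 f3 and M :: "'z measure"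
  proof -
    have "(\<lambda>z. (f1 z, f2 z, f3 z)) \<in> measurable M (borel \<Otimes>\<^sub>M borel \<Otimes>\<^sub>M borel)" by measurable
    from measurable_compose[OF this Suc.IH] show ?thesis by simp
  qed
  show ?case by simp
qed

lemma cp_measurable [measurable (raw)]:
  assumes [measurable]: "f1 \<in> borel_measurable M" "f2 \<in> borel_measurable M" "f3 \<in> borel_measurable M"
  shows "(\<lambda>z. cp j (f1 z) (f2 z) (f3 z)) \<in> borel_measurable M"
proof -
  have "(\<lambda>z. (f1 z, f2 z, f3 z)) \<in> measurable M (borel \<Otimes>\<^sub>M borel \<Otimes>\<^sub>M borel)" by measurable
  from measurable_compose[OF this cp_measurable0] show ?thesis by simp
qed

lemma cp_outside: "y \<notin> X \<or> x \<notin> X \<Longrightarrow> cp j y x t = 0"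
proof (induction j arbitrary: y t)
  case (Suc j)
  have "cp (Suc j) y x t = (\<integral>\<^sup>+p. 0 \<partial>(lborel :: ('a \<times> real) measure))"
    unfolding cp.simps using Suc by (intro nn_integral_cong) (auto simp: gX_def)
  then show ?case by simp
qed (auto simp: gX_def)

lemma cp_neg: "t < 0 \<Longrightarrow> cp j y x t = 0"
proof (induction j arbitrary: y t)
  case (Suc j)
  have "gX y (fst p) (snd p) * cp j (fst p) x (t - snd p) = 0" for p
    using Suc by (cases "snd p < 0") (auto simp: gX_neg)
  then have "cp (Suc j) y x t = (\<integral>\<^sup>+p. 0 \<partial>(lborel :: ('a \<times> real) measure))"
    unfolding cp.simps by (intro nn_integral_cong)
  then show ?case by simp
qed (auto simp: gX_neg)

lemma conv_pow_Suc_eq_cp: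
  "y \<in> X \<Longrightarrow> x \<in> X \<Longrightarrow> conv_pow_Suc X (\<lambda>y x t. ennreal (g y x t)) j y x t = cp j y x t"
proof (induction j arbitrary: y t)
  case 0
  then show ?case by (simp add: gX_def)
next
  case (Suc j)
  have "conv_pow_Suc X (\<lambda>y x t. ennreal (g y x t)) (Suc j) y x t =
      (\<integral>\<^sup>+x'. \<integral>\<^sup>+t'. gX y x' t' * cp j x' x (t - t') \<partial>lborel \<partial>lborel)"
    using Suc unfolding conv_pow_Suc.simps conv_def
    by (intro nn_integral_cong) (auto simp: gX_def indicator_def)
  also have "\<dots> = cp (Suc j) y x t"
    unfolding cp.simps by (subst nn_integral_lborel_pair(1)) simp_all
  finally show ?case .
qed

primrec kap :: "nat \<Rightarrow> 'a \<Rightarrow> ('a \<times> real) measure" where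
  "kap 0 = (\<lambda>y. return borel (y, 0))"
| "kap (Suc j) = (\<lambda>y. density lborel (\<lambda>z. cp j y (fst z) (snd z)))"

lemma sets_kap [simp, measurable_cong]: "sets (kap k y) = sets borel"
  by (cases k) auto

lemma conv_pow_measure_eq_kap: "y \<in> X \<Longrightarrow> conv_pow_measure X g k y = kap k y"
proof (cases k)
  case (Suc j)
  assume y: "y \<in> X"
  have "indicator X x * conv_pow_Suc X (\<lambda>y x t. ennreal (g y x t)) j y x t = cp j y x t" for x t
    using y by (cases "x \<in> X") (auto simp: conv_pow_Suc_eq_cp cp_outside)
  then show ?thesis by (simp add: Suc conv_pow_measure_def case_prod_unfold)
qed (simp add: conv_pow_measure_def)

text \<open>\<open>K f p\<close> is the mean of the sum of \<open>f\<close> over the offspring of a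
  point at \<open>p\<close>; in Laplace functionals the same operator acts on
  \<open>1 - nexp f\<close>.\<close>

definition K :: "('a \<times> real \<Rightarrow> ennreal) \<Rightarrow> 'a \<times> real \<Rightarrow> ennreal" where
  "K f p = (\<integral>\<^sup>+z. gX (fst p) (fst z) (snd z - snd p) * f z \<partial>lborel)"

lemma K_measurable [measurable]:
  assumes [measurable]: "f \<in> borel_measurable borel" shows "K f \<in> borel_measurable borel"
  unfolding K_def[abs_def] by measurable

lemma K_pow_measurable [measurable]:
  "f \<in> borel_measurable borel \<Longrightarrow> (K ^^ k) f \<in> borel_measurable borel"
  by (induction k) auto

lemma K_shift:
  assumes [measurable]: "f \<in> borel_measurable borel"
  shows "K f p = (\<integral>\<^sup>+z. gX (fst p) (fst z) (snd z) * f (fst z, snd p + snd z) \<partial>lborel)"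
  unfolding K_def
  by (subst nn_integral_lborel_shift_time[where s="snd p", symmetric]) auto

text \<open>The two recursions match: \<open>K\<close> moves from a parent to its children, and
  convolution splits off the first lag. The kernel depends on lags only, so the birth time
  \<open>s\<close> merely translates the test function.\<close>

theorem K_pow:
  assumes f [measurable]: "f \<in> borel_measurable borel"
  shows "(K ^^ k) f (y, s) = (\<integral>\<^sup>+z. f (fst z, s + snd z) \<partial>kap k y)"
proof (induction k arbitrary: y s)
  case 0
  then show ?case by (simp add: nn_integral_return)
next
  case (Suc k)
  have "(K ^^ Suc k) f (y, s) =
      (\<integral>\<^sup>+p. gX y (fst p) (snd p) * (K ^^ k) f (fst p, s + snd p) \<partial>lborel)"
    by (simp add: K_shift)
  also have "\<dots> = (\<integral>\<^sup>+p. gX y (fst p) (snd p) * (\<integral>\<^sup>+z. f (fst z, (s + snd p) + snd z) \<partial>kap k (fst p)) \<partial>lborel)"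
    by (simp only: Suc.IH)
  also have "\<dots> = (\<integral>\<^sup>+z. f (fst z, s + snd z) \<partial>kap (Suc k) y)"
  proof (cases k)
    case 0
    then show ?thesis by (simp add: nn_integral_return nn_integral_density)
  next
    case (Suc j)
    have "(\<integral>\<^sup>+p. gX y (fst p) (snd p) * (\<integral>\<^sup>+z. f (fst z, (s + snd p) + snd z) \<partial>kap k (fst p)) \<partial>lborel) =
        (\<integral>\<^sup>+p. \<integral>\<^sup>+z. gX y (fst p) (snd p) * (cp j (fst p) (fst z) (snd z - snd p) * f (fst z, s + snd z)) \<partial>lborel \<partial>lborel)"
    proof (intro nn_integral_cong)
      fix p :: "'a \<times> real"
      have "(\<integral>\<^sup>+z. f (fst z, (s + snd p) + snd z) \<partial>kap k (fst p)) =
          (\<integral>\<^sup>+z. cp j (fst p) (fst z) (snd z) * f (fst z, (s + snd p) + snd z) \<partial>lborel)"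
        by (simp add: Suc nn_integral_density)
      also have "\<dots> = (\<integral>\<^sup>+z. cp j (fst p) (fst z) (snd z - snd p) * f (fst z, s + snd z) \<partial>lborel)"
        by (subst nn_integral_lborel_shift_time[where s="snd p"
              and f="\<lambda>z. cp j (fst p) (fst z) (snd z - snd p) * f (fst z, s + snd z)", symmetric])
          (auto simp: add.assoc)
      finally show "gX y (fst p) (snd p) * (\<integral>\<^sup>+z. f (fst z, (s + snd p) + snd z) \<partial>kap k (fst p)) =
         (\<integral>\<^sup>+z. gX y (fst p) (snd p) * (cp j (fst p) (fst z) (snd z - snd p) * f (fst z, s + snd z)) \<partial>lborel)"
        by (simp add: nn_integral_cmult)
    qed
    also have "\<dots> = (\<integral>\<^sup>+z. \<integral>\<^sup>+p. gX y (fst p) (snd p) * (cp j (fst p) (fst z) (snd z - snd p) * f (fst z, s + snd z)) \<partial>lborel \<partial>lborel)"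
      by (rule nn_integral_lborel_swap) (simp add: borel_prod[symmetric])
    also have "\<dots> = (\<integral>\<^sup>+z. cp (Suc j) y (fst z) (snd z) * f (fst z, s + snd z) \<partial>lborel)"
      by (intro nn_integral_cong) (simp add: nn_integral_multc mult.assoc[symmetric])
    also have "\<dots> = (\<integral>\<^sup>+z. f (fst z, s + snd z) \<partial>kap (Suc k) y)"
      by (simp add: Suc nn_integral_density del: cp.simps)
    finally show ?thesis .
  qed
  finally show ?case .
qed

definition G :: "'a \<Rightarrow> ('a \<times> real) measure" where "G y = measure_sum (\<lambda>k. kap k y)"

text \<open>The mean of the sum of \<open>f\<close> over the cluster of a point at \<open>p\<close>;
  the term \<open>k = 0\<close> is the point itself.\<close>

definition GG :: "('a \<times> real \<Rightarrow> ennreal) \<Rightarrow> 'a \<times> real \<Rightarrow> ennreal" where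
  "GG f p = (\<Sum>k. (K ^^ k) f p)"

lemma sets_G [simp, measurable_cong]: "sets (G y) = sets borel"
  by (simp add: G_def)

lemma space_G [simp]: "space (G y) = UNIV"
  using sets_eq_imp_space_eq[OF sets_G] by simp

lemma nn_integral_G: "f \<in> borel_measurable borel \<Longrightarrow> (\<integral>\<^sup>+z. f z \<partial>G y) = (\<Sum>k. \<integral>\<^sup>+z. f z \<partial>kap k y)"
  by (simp add: G_def nn_integral_measure_sum)

lemma emeasure_G: "B \<in> sets borel \<Longrightarrow> emeasure (G y) B = (\<Sum>k. emeasure (kap k y) B)"
  by (simp add: G_def emeasure_measure_sum)

text \<open>Separates the Dirac part from the absolutely continuous part, so that measurability in
  \<open>y\<close> can be read off term by term.\<close>

lemma nn_integral_G_density: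
  assumes [measurable]: "f \<in> borel_measurable borel"
  shows "(\<integral>\<^sup>+z. f z \<partial>G y) = f (y, 0) + (\<Sum>j. \<integral>\<^sup>+z. cp j y (fst z) (snd z) * f z \<partial>lborel)"
proof -
  have "(\<integral>\<^sup>+z. f z \<partial>G y) = (\<Sum>k. \<integral>\<^sup>+z. f z \<partial>kap (k + 1) y) + (\<Sum>k<1. \<integral>\<^sup>+z. f z \<partial>kap k y)"
    unfolding nn_integral_G[OF assms] by (rule suminf_offset) simp
  then show ?thesis by (simp add: nn_integral_return nn_integral_density add.commute)
qed

lemma nn_integral_G_measurable:
  assumes [measurable]: "(\<lambda>(y, z). f y z) \<in> borel_measurable (M \<Otimes>\<^sub>M borel)" "h \<in> borel_measurable M"
  shows "(\<lambda>y. \<integral>\<^sup>+z. f y z \<partial>G (h y)) \<in> borel_measurable M"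
proof -
  have "(\<lambda>y. f y (h y, 0) + (\<Sum>j. \<integral>\<^sup>+z. cp j (h y) (fst z) (snd z) * f y z \<partial>lborel)) \<in> borel_measurable M"
    by measurable
  moreover have "(\<integral>\<^sup>+z. f y z \<partial>G (h y)) = f y (h y, 0) + (\<Sum>j. \<integral>\<^sup>+z. cp j (h y) (fst z) (snd z) * f y z \<partial>lborel)"
    if "y \<in> space M" for y
    using measurable_compose[OF measurable_Pair1'[OF that] assms(1)]
    by (intro nn_integral_G_density) simp
  ultimately show ?thesis by (simp cong: measurable_cong)
qed

lemma emeasure_G_measurable:
  assumes "B \<in> sets borel" shows "(\<lambda>y. emeasure (G y) B) \<in> borel_measurable borel"
proof -
  have "(\<lambda>y. \<integral>\<^sup>+z. indicator B z \<partial>G y) \<in> borel_measurable borel"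
    by (rule nn_integral_G_measurable) (use assms in measurable)
  then show ?thesis using assms by simp
qed

lemma GG_measurable [measurable]: "f \<in> borel_measurable borel \<Longrightarrow> GG f \<in> borel_measurable borel"
  unfolding GG_def[abs_def] by measurable

lemma GG_eq:
  assumes [measurable]: "f \<in> borel_measurable borel"
  shows "GG f (y, s) = (\<integral>\<^sup>+z. f (fst z, s + snd z) \<partial>G y)"
  by (simp add: GG_def K_pow nn_integral_G)

section \<open>Total masses of the kernels and the geometric series\<close>

definition nuy :: "'a \<Rightarrow> ennreal" where "nuy y = (\<integral>\<^sup>+z. gX y (fst z) (snd z) \<partial>lborel)"
definition nut :: ennreal where "nut = (\<integral>\<^sup>+t. gtp t \<partial>lborel)"

lemma g_pos_time: "y \<in> X \<Longrightarrow> x \<in> X \<Longrightarrow> ennreal (g y x h) \<noteq> 0 \<Longrightarrow> 0 \<le> h"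
  using g_neg[of y x h] by (cases "h < 0") auto

lemma nuy_eq:
  assumes "y \<in> X" shows "(\<integral>\<^sup>+(x, h)\<in>X \<times> {0..}. ennreal (g y x h) \<partial>lborel) = nuy y"
  unfolding nuy_def using assms
  by (intro nn_integral_cong) (auto simp: gX_def indicator_def intro: g_pos_time)

lemma nuy_outside: "y \<notin> X \<Longrightarrow> nuy y = 0"
  by (simp add: nuy_def gX_def)

lemma nut_less_1: "nut < 1"
  using nu_temp by (simp add: nut_def gtp_def)

lemma nuy_le_nut: "nuy y \<le> nut"
proof -
  have "nuy y = (\<integral>\<^sup>+t. \<integral>\<^sup>+x. gX y x t \<partial>lborel \<partial>lborel)"
    unfolding nuy_def by (subst nn_integral_lborel_pair(2)) auto
  also have "\<dots> \<le> nut" unfolding nut_def by (intro nn_integral_mono gX_le_gtp)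
  finally show ?thesis .
qed

lemma kap_mass_Suc: "emeasure (kap (Suc k) y) UNIV = (\<integral>\<^sup>+p. gX y (fst p) (snd p) * emeasure (kap k (fst p)) UNIV \<partial>lborel)"
proof -
  have *: "(K ^^ k) (\<lambda>_. 1) (y, s) = emeasure (kap k y) UNIV" for k y s
    using sets_eq_imp_space_eq[OF sets_kap[of k y]] by (simp add: K_pow del: kap.simps)
  have "emeasure (kap (Suc k) y) UNIV = (K ^^ Suc k) (\<lambda>_. 1) (y, 0)" by (simp only: *)
  also have "\<dots> = (\<integral>\<^sup>+p. gX y (fst p) (snd p) * (K ^^ k) (\<lambda>_. 1) (fst p, 0 + snd p) \<partial>lborel)"
    by (simp add: K_shift)
  finally show ?thesis by (simp only: *)
qed

lemma kap_mass_le: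
  assumes "\<And>y. nuy y \<le> c" shows "emeasure (kap k y) UNIV \<le> c ^ k"
proof (induction k arbitrary: y)
  case (Suc k)
  have "emeasure (kap (Suc k) y) UNIV \<le> (\<integral>\<^sup>+p. gX y (fst p) (snd p) * c ^ k \<partial>lborel)"
    unfolding kap_mass_Suc using Suc by (intro nn_integral_mono mult_left_mono) auto
  also have "\<dots> = nuy y * c ^ k" by (simp add: nn_integral_multc nuy_def)
  also have "\<dots> \<le> c * c ^ k" using assms by (intro mult_right_mono) auto
  finally show ?case by simp
qed simp

text \<open>It is enough that \<open>nuy\<close> is constant on \<open>X\<close>: the kernel
  \<open>gX\<close> vanishes unless the child lies in \<open>X\<close>, so a line of descent never
  leaves \<open>X\<close>.\<close>

lemma kap_mass_eq:
  assumes "\<And>y. y \<in> X \<Longrightarrow> nuy y = c" "y \<in> X" shows "emeasure (kap k y) UNIV = c ^ k"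
  using assms(2)
proof (induction k arbitrary: y)
  case (Suc k)
  have "gX y (fst p) (snd p) * emeasure (kap k (fst p)) UNIV = gX y (fst p) (snd p) * c ^ k" for p
    using Suc.IH[of "fst p"] by (cases p; cases "fst p \<in> X") (auto simp: gX_def)
  then have "emeasure (kap (Suc k) y) UNIV = (\<integral>\<^sup>+p. gX y (fst p) (snd p) * c ^ k \<partial>lborel)"
    unfolding kap_mass_Suc by (simp only:)
  also have "\<dots> = c * c ^ k" using assms(1)[OF Suc.prems] by (simp add: nn_integral_multc nuy_def)
  finally show ?case by simp
qed simp

lemma emeasure_G_UNIV: "emeasure (G y) UNIV = (\<Sum>k. emeasure (kap k y) UNIV)"
  by (rule emeasure_G) simp

lemma G_mass_le:
  assumes "\<And>y. nuy y \<le> c" "c < 1" shows "emeasure (G y) UNIV \<le> 1 / (1 - c)"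
  unfolding suminf_geometric_ennreal[OF assms(2), symmetric] emeasure_G_UNIV
  by (intro suminf_le kap_mass_le assms) auto

lemma G_mass_eq:
  assumes "\<And>y. y \<in> X \<Longrightarrow> nuy y = c" "y \<in> X" "c < 1" shows "emeasure (G y) UNIV = 1 / (1 - c)"
  unfolding suminf_geometric_ennreal[OF assms(3), symmetric] emeasure_G_UNIV
  by (intro suminf_cong kap_mass_eq assms)

text \<open>The geometric series of \<open>nut\<close>: it bounds the mean cluster size uniformly in
  the location of the ancestor.\<close>

definition Ct :: ennreal where "Ct = 1 / (1 - nut)"

lemma Ct_finite: "Ct < top"
proof -
  have "0 < 1 - nut" using nut_less_1 by (simp add: diff_gr0_ennreal)
  then have "1 / (1 - nut) \<noteq> top" by (auto simp: ennreal_divide_eq_top_iff)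
  then show ?thesis by (simp add: Ct_def less_top)
qed

lemma G_mass: "emeasure (G y) UNIV \<le> Ct"
  unfolding Ct_def by (intro G_mass_le nuy_le_nut nut_less_1)

lemma finite_G: "finite_measure (G y)"
  using G_mass[of y] Ct_finite by (intro finite_measureI) auto

subsection \<open>The mean measure\<close>

text \<open>A background point at \<open>y\<close> contributes the locations of its whole cluster;
  the lags are dropped by the projection \<open>fst\<close>.\<close>

definition mu :: "'a measure" where
  "mu = mixture (density lborel lamX) (\<lambda>y. distr (G y) borel fst)"

lemma sets_mu [simp, measurable_cong]: "sets mu = sets borel"
  by (simp add: mu_def)

lemma space_mu [simp]: "space mu = UNIV"
  by (simp add: mu_def)

lemma nn_integral_mu:
  assumes [measurable]: "f \<in> borel_measurable borel"
  shows "(\<integral>\<^sup>+x. f x \<partial>mu) = (\<integral>\<^sup>+y. lamX y * (\<integral>\<^sup>+z. f (fst z) \<partial>G y) \<partial>lborel)"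
proof -
  have m: "(\<lambda>y. emeasure (distr (G y) borel fst) B) \<in> borel_measurable borel" if B: "B \<in> sets borel" for B
    using B measurable_sets[OF borel_measurable_fst'[OF measurable_ident], of B]
    by (subst emeasure_distr) (auto intro!: emeasure_G_measurable)
  have f: "(\<lambda>y. \<integral>\<^sup>+z. f (fst z) \<partial>G y) \<in> borel_measurable borel"
    by (rule nn_integral_G_measurable) measurable
  have "(\<integral>\<^sup>+x. f x \<partial>mu) = (\<integral>\<^sup>+y. \<integral>\<^sup>+x. f x \<partial>distr (G y) borel fst \<partial>density lborel lamX)"
    unfolding mu_def using m by (intro nn_integral_mixture) auto
  also have "\<dots> = (\<integral>\<^sup>+y. \<integral>\<^sup>+z. f (fst z) \<partial>G y \<partial>density lborel lamX)"
    by (intro nn_integral_cong nn_integral_distr) auto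
  finally show ?thesis using f by (simp add: nn_integral_density)
qed

lemma emeasure_mu:
  assumes A: "A \<in> sets borel"
  shows "emeasure mu A = (\<integral>\<^sup>+y. lamX y * emeasure (G y) (A \<times> UNIV) \<partial>lborel)"
proof -
  have "emeasure mu A = (\<integral>\<^sup>+x. indicator A x \<partial>mu)" using A by simp
  also have "\<dots> = (\<integral>\<^sup>+y. lamX y * (\<integral>\<^sup>+z. indicator A (fst z) \<partial>G y) \<partial>lborel)"
    using A by (intro nn_integral_mu) auto
  also have "\<dots> = (\<integral>\<^sup>+y. lamX y * (\<integral>\<^sup>+z. indicator (A \<times> UNIV) z \<partial>G y) \<partial>lborel)"
    by (intro nn_integral_cong arg_cong2[where f="(*)"] refl) (auto simp: indicator_def)
  also have "\<dots> = (\<integral>\<^sup>+y. lamX y * emeasure (G y) (A \<times> UNIV) \<partial>lborel)"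
  proof -
    have "A \<times> (UNIV :: real set) \<in> sets borel"
      unfolding borel_prod[symmetric] using A by (intro pair_measureI) auto
    then show ?thesis by simp
  qed
  finally show ?thesis .
qed

lemma m_lam_eq: "(\<integral>\<^sup>+x\<in>X. ennreal (lam x) \<partial>lborel) = (\<integral>\<^sup>+x. lamX x \<partial>lborel)"
  by (simp add: lamX_def)

lemma emeasure_mu_le:
  assumes A: "A \<in> sets borel" and c: "\<And>y. nuy y \<le> c" "c < 1"
  shows "emeasure mu A \<le> (\<integral>\<^sup>+x. lamX x \<partial>lborel) / (1 - c)"
proof -
  have "emeasure (G y) (A \<times> UNIV) \<le> 1 / (1 - c)" for y
    by (rule order_trans[OF emeasure_mono G_mass_le[OF c]]) auto
  then have "emeasure mu A \<le> (\<integral>\<^sup>+y. lamX y * (1 / (1 - c)) \<partial>lborel)"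
    unfolding emeasure_mu[OF A] by (intro nn_integral_mono mult_left_mono) auto
  also have "\<dots> = (\<integral>\<^sup>+y. lamX y \<partial>lborel) * (1 / (1 - c))" by (simp add: nn_integral_multc)
  finally show ?thesis by (simp add: ennreal_times_divide)
qed

lemma emeasure_mu_UNIV_eq:
  assumes c: "\<And>y. y \<in> X \<Longrightarrow> nuy y = c" "c < 1"
  shows "emeasure mu UNIV = (\<integral>\<^sup>+x. lamX x \<partial>lborel) / (1 - c)"
proof -
  have "lamX y * emeasure (G y) UNIV = lamX y * (1 / (1 - c))" for y
    using G_mass_eq[OF c(1) _ c(2)] by (cases "y \<in> X") (auto simp: lamX_def)
  then have "emeasure mu UNIV = (\<integral>\<^sup>+y. lamX y * (1 / (1 - c)) \<partial>lborel)"
    by (subst emeasure_mu) auto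
  also have "\<dots> = (\<integral>\<^sup>+y. lamX y \<partial>lborel) * (1 / (1 - c))" by (simp add: nn_integral_multc)
  finally show ?thesis by (simp add: ennreal_times_divide)
qed

lemma emeasure_mu_finite: "emeasure mu A < top"
proof (cases "A \<in> sets borel")
  case True
  have "emeasure mu A \<le> (\<integral>\<^sup>+x. lamX x \<partial>lborel) * Ct"
    using emeasure_mu_le[OF True nuy_le_nut nut_less_1] by (simp add: Ct_def ennreal_times_divide)
  also have "\<dots> < top" using m_lam Ct_finite by (simp add: m_lam_eq ennreal_mult_less_top)
  finally show ?thesis .
qed (simp add: emeasure_notin_sets)

lemma finite_mu: "finite_measure mu"
  using emeasure_mu_finite[of UNIV] by (intro finite_measureI) auto

text \<open>For \<open>y\<close> in \<open>X\<close>, both the atom of \<open>G y\<close> at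
  \<open>y\<close> and the densities \<open>cp\<close> put nothing on the complement of
  \<open>X\<close>; for other \<open>y\<close> the weight \<open>lamX\<close> is 0.\<close>

lemma emeasure_mu_outside: "emeasure mu (- X) = 0"
proof -
  have G: "emeasure (G y) ((- X) \<times> UNIV) = 0" if "y \<in> X" for y
  proof -
    have B: "(- X) \<times> (UNIV :: real set) \<in> sets borel"
      unfolding borel_prod[symmetric] by (intro pair_measureI) auto
    have "emeasure (G y) ((- X) \<times> UNIV) = (\<integral>\<^sup>+z. indicator ((- X) \<times> UNIV) z \<partial>G y)" using B by simp
    also have "\<dots> = 0"
    proof -
      have "cp j y (fst z) (snd z) * indicator ((- X) \<times> UNIV) z = 0" for j and z :: "'a \<times> real"
        by (cases "fst z \<in> X") (auto simp: cp_outside indicator_def)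
      then show ?thesis using B that by (subst nn_integral_G_density) (simp_all del: mult_eq_0_iff)
    qed
    finally show ?thesis .
  qed
  have "lamX y * emeasure (G y) ((- X) \<times> UNIV) = 0" for y
    using G[of y] by (cases "y \<in> X") (auto simp: lamX_def)
  then show ?thesis by (subst emeasure_mu) (simp_all del: mult_eq_0_iff)
qed

lemma background_eq: "background_intensity X lam = density lborel (\<lambda>z. lamX (fst z))"
  unfolding background_intensity_def by (intro arg_cong2[where f=density]) (auto simp: lamX_def mult.commute)

text \<open>The birth time of the ancestor is integrated against Lebesgue measure, which absorbs the
  lag of the descendant; what remains is the product of \<open>mu\<close> and Lebesgue
  measure.\<close>

theorem mean_formula:
  assumes f [measurable]: "f \<in> borel_measurable borel"
  shows "(\<integral>\<^sup>+z. lamX (fst z) * GG f z \<partial>lborel) = (\<integral>\<^sup>+x. \<integral>\<^sup>+s. f (x, s) \<partial>lborel \<partial>mu)"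
proof -
  have "(\<integral>\<^sup>+z. lamX (fst z) * GG f z \<partial>lborel) = (\<integral>\<^sup>+y. \<integral>\<^sup>+s. lamX y * GG f (y, s) \<partial>lborel \<partial>lborel)"
    by (subst nn_integral_lborel_pair(1)) auto
  also have "\<dots> = (\<integral>\<^sup>+y. lamX y * (\<integral>\<^sup>+z. \<integral>\<^sup>+s. f (fst z, s) \<partial>lborel \<partial>G y) \<partial>lborel)"
  proof (intro nn_integral_cong)
    fix y
    interpret finite_measure "G y" by (rule finite_G)
    interpret pair_sigma_finite lborel "G y" ..
    have "(\<integral>\<^sup>+s. lamX y * GG f (y, s) \<partial>lborel) = lamX y * (\<integral>\<^sup>+s. \<integral>\<^sup>+z. f (fst z, s + snd z) \<partial>G y \<partial>lborel)"
      by (simp add: nn_integral_cmult GG_eq[symmetric])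
    also have "(\<integral>\<^sup>+s. \<integral>\<^sup>+z. f (fst z, s + snd z) \<partial>G y \<partial>lborel) = (\<integral>\<^sup>+z. \<integral>\<^sup>+s. f (fst z, s + snd z) \<partial>lborel \<partial>G y)"
      by (rule Fubini'[symmetric]) measurable
    also have "\<dots> = (\<integral>\<^sup>+z. \<integral>\<^sup>+s. f (fst z, s) \<partial>lborel \<partial>G y)"
    proof (rule nn_integral_cong)
      fix z :: "'a \<times> real"
      show "(\<integral>\<^sup>+s. f (fst z, s + snd z) \<partial>lborel) = (\<integral>\<^sup>+s. f (fst z, s) \<partial>lborel)"
        using nn_integral_lborel_shift[of "\<lambda>s. f (fst z, s)" "snd z"] by (simp add: add.commute)
    qed
    finally show "(\<integral>\<^sup>+s. lamX y * GG f (y, s) \<partial>lborel) = lamX y * (\<integral>\<^sup>+z. \<integral>\<^sup>+s. f (fst z, s) \<partial>lborel \<partial>G y)" .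
  qed
  also have "\<dots> = (\<integral>\<^sup>+x. \<integral>\<^sup>+s. f (x, s) \<partial>lborel \<partial>mu)"
    by (rule nn_integral_mu[symmetric]) measurable
  finally show ?thesis .
qed

subsection \<open>Domination by the temporal resolvent\<close>

text \<open>Integration over the whole line replaces the interval \<open>{0..t}\<close> of
  \<open>temp_conv\<close>, because \<open>gtp\<close> and its convolution powers vanish at negative
  times.\<close>

primrec tc :: "nat \<Rightarrow> real \<Rightarrow> ennreal" where
  "tc 0 = gtp"
| "tc (Suc j) = (\<lambda>t. \<integral>\<^sup>+s. gtp s * tc j (t - s) \<partial>lborel)"

lemma tc_measurable [measurable]: "tc j \<in> borel_measurable borel"
  by (induction j) auto

lemma tc_eq: "indicator {0..} t * temp_conv_pow_Suc (\<lambda>s. ennreal (gt s)) j t = tc j t"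
proof (induction j arbitrary: t)
  case 0
  then show ?case by (simp add: gtp_def mult.commute)
next
  case (Suc j)
  show ?case
  proof (cases "0 \<le> t")
    case True
    have "temp_conv_pow_Suc (\<lambda>s. ennreal (gt s)) (Suc j) t = (\<integral>\<^sup>+s. gtp s * tc j (t - s) \<partial>lborel)"
      unfolding temp_conv_pow_Suc.simps temp_conv_def Suc.IH[symmetric]
      by (intro nn_integral_cong) (auto simp: gtp_def indicator_def)
    then show ?thesis using True by simp
  next
    case False
    have "gtp s * tc j (t - s) = 0" for s
      using False Suc.IH[of "t - s", symmetric] by (cases "0 \<le> s") (auto simp: gtp_def)
    then show ?thesis using False by (simp del: mult_eq_0_iff)
  qed
qed

lemma temp_conv_pow_measure_eq: "temp_conv_pow_measure gt k = (case k of 0 \<Rightarrow> return borel 0 | Suc j \<Rightarrow> density lborel (tc j))"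
  by (cases k) (simp_all add: temp_conv_pow_measure_def tc_eq)

lemma sets_temp_conv_pow_measure [simp]: "sets (temp_conv_pow_measure gt k) = sets borel"
  by (cases k) (simp_all add: temp_conv_pow_measure_eq)

text \<open>The final location is integrated out first, with a bound that is uniform in the
  intermediate location; only then the intermediate location is integrated out of \<open>gX\<close>,
  which leaves \<open>gtp\<close>.\<close>

lemma cp_le_tc: "(\<integral>\<^sup>+x. cp j y x t \<partial>lborel) \<le> tc j t"
proof (induction j arbitrary: y t)
  case 0
  then show ?case by (simp add: gX_le_gtp)
next
  case (Suc j)
  have "(\<integral>\<^sup>+x. cp (Suc j) y x t \<partial>lborel) =
      (\<integral>\<^sup>+p. \<integral>\<^sup>+x. gX y (fst p) (snd p) * cp j (fst p) x (t - snd p) \<partial>lborel \<partial>lborel)"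
    unfolding cp.simps by (rule nn_integral_lborel_swap) (simp add: borel_prod[symmetric])
  also have "\<dots> \<le> (\<integral>\<^sup>+p. gX y (fst p) (snd p) * tc j (t - snd p) \<partial>lborel)"
    using Suc.IH by (intro nn_integral_mono) (auto simp: nn_integral_cmult intro!: mult_left_mono)
  also have "\<dots> = (\<integral>\<^sup>+s. (\<integral>\<^sup>+x. gX y x s \<partial>lborel) * tc j (t - s) \<partial>lborel)"
    by (subst nn_integral_lborel_pair(2)) (auto simp: nn_integral_multc)
  also have "\<dots> \<le> tc (Suc j) t"
    by (auto intro!: nn_integral_mono mult_right_mono gX_le_gtp)
  finally show ?case .
qed

lemma kap_le_temp:
  assumes [measurable]: "\<phi> \<in> borel_measurable borel"
  shows "(\<integral>\<^sup>+z. \<phi> (snd z) \<partial>kap k y) \<le> (\<integral>\<^sup>+t. \<phi> t \<partial>temp_conv_pow_measure gt k)"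
proof (cases k)
  case 0
  then show ?thesis by (simp add: temp_conv_pow_measure_eq nn_integral_return)
next
  case (Suc j)
  have "(\<integral>\<^sup>+z. \<phi> (snd z) \<partial>kap k y) = (\<integral>\<^sup>+z. cp j y (fst z) (snd z) * \<phi> (snd z) \<partial>lborel)"
    by (simp add: Suc nn_integral_density)
  also have "\<dots> = (\<integral>\<^sup>+t. (\<integral>\<^sup>+x. cp j y x t \<partial>lborel) * \<phi> t \<partial>lborel)"
    by (subst nn_integral_lborel_pair(2)) (auto simp: nn_integral_multc)
  also have "\<dots> \<le> (\<integral>\<^sup>+t. tc j t * \<phi> t \<partial>lborel)"
    by (intro nn_integral_mono mult_right_mono cp_le_tc) auto
  also have "\<dots> = (\<integral>\<^sup>+t. \<phi> t \<partial>temp_conv_pow_measure gt k)"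
    by (simp add: Suc temp_conv_pow_measure_eq nn_integral_density)
  finally show ?thesis .
qed

definition T :: "real measure" where "T = temp_resolvent gt"

lemma sets_T [simp, measurable_cong]: "sets T = sets borel"
  by (simp add: T_def temp_resolvent_def)

lemma space_T [simp]: "space T = UNIV"
  using sets_eq_imp_space_eq[OF sets_T] by simp

lemma nn_integral_T: "\<phi> \<in> borel_measurable borel \<Longrightarrow> (\<integral>\<^sup>+t. \<phi> t \<partial>T) = (\<Sum>k. \<integral>\<^sup>+t. \<phi> t \<partial>temp_conv_pow_measure gt k)"
  unfolding T_def temp_resolvent_def by (rule nn_integral_measure_sum) auto

lemma G_le_T:
  assumes [measurable]: "\<phi> \<in> borel_measurable borel"
  shows "(\<integral>\<^sup>+z. \<phi> (snd z) \<partial>G y) \<le> (\<integral>\<^sup>+t. \<phi> t \<partial>T)"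
  by (simp add: nn_integral_G nn_integral_T suminf_le kap_le_temp)

text \<open>Masses multiply under convolution, so the mass of the resolvent is exactly the geometric
  series that bounds the masses of all \<open>G y\<close>.\<close>

lemma T_mass: "emeasure T UNIV = Ct"
proof -
  have tc: "(\<integral>\<^sup>+t. tc j t \<partial>lborel) = nut ^ Suc j" for j
  proof (induction j)
    case 0
    then show ?case by (simp add: nut_def)
  next
    case (Suc j)
    have "(\<integral>\<^sup>+t. tc (Suc j) t \<partial>lborel) = (\<integral>\<^sup>+s. \<integral>\<^sup>+t. gtp s * tc j (t - s) \<partial>lborel \<partial>lborel)"
      unfolding tc.simps by (rule nn_integral_lborel_swap) (simp add: borel_prod[symmetric])
    also have "\<dots> = (\<integral>\<^sup>+s. gtp s * (\<integral>\<^sup>+t. tc j t \<partial>lborel) \<partial>lborel)"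
    proof (intro nn_integral_cong)
      fix s :: real
      have "(\<integral>\<^sup>+t. tc j (t - s) \<partial>lborel) = (\<integral>\<^sup>+t. tc j t \<partial>lborel)"
        using nn_integral_lborel_shift[of "tc j" "- s"] by simp
      then show "(\<integral>\<^sup>+t. gtp s * tc j (t - s) \<partial>lborel) = gtp s * (\<integral>\<^sup>+t. tc j t \<partial>lborel)"
        by (simp add: nn_integral_cmult)
    qed
    also have "\<dots> = nut * nut ^ Suc j" using Suc by (simp add: nn_integral_multc nut_def)
    finally show ?case by simp
  qed
  have "(\<integral>\<^sup>+t. 1 \<partial>temp_conv_pow_measure gt k) = nut ^ k" for k
  proof (cases k)
    case (Suc j)
    have "(\<integral>\<^sup>+t. 1 \<partial>density lborel (tc j)) = (\<integral>\<^sup>+t. tc j t \<partial>lborel)"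
      by (subst nn_integral_density) auto
    then show ?thesis using tc[of j] by (simp add: Suc temp_conv_pow_measure_eq)
  qed (simp add: temp_conv_pow_measure_eq)
  then have "(\<integral>\<^sup>+t. 1 \<partial>T) = (\<Sum>k. nut ^ k)" by (subst nn_integral_T) auto
  then show ?thesis using suminf_geometric_ennreal[OF nut_less_1] by (simp add: Ct_def)
qed

lemma finite_T: "finite_measure T"
  using T_mass Ct_finite by (intro finite_measureI) auto

end

text \<open>Written as a mixture over two indices, so that its integral is a case of
  \<open>nn_integral_mixture\<close>.\<close>

definition measure_add :: "'b::topological_space measure \<Rightarrow> 'b measure \<Rightarrow> 'b measure" where
  "measure_add M N = mixture (count_space UNIV) (\<lambda>b. if b then M else N)"

lemma sets_measure_add [simp, measurable_cong]: "sets (measure_add M N) = sets borel"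
  by (simp add: measure_add_def)

lemma emeasure_measure_add:
  assumes "sets M = sets borel" "sets N = sets borel" "B \<in> sets borel"
  shows "emeasure (measure_add M N) B = emeasure M B + emeasure N B"
  using assms unfolding measure_add_def
  by (subst emeasure_mixture) (auto simp: nn_integral_count_space_finite UNIV_bool add.commute)

lemma nn_integral_measure_add:
  assumes "sets M = sets borel" "sets N = sets borel" "f \<in> borel_measurable borel"
  shows "(\<integral>\<^sup>+x. f x \<partial>measure_add M N) = (\<integral>\<^sup>+x. f x \<partial>M) + (\<integral>\<^sup>+x. f x \<partial>N)"
  using assms unfolding measure_add_def
  by (subst nn_integral_mixture) (auto simp: nn_integral_count_space_finite UNIV_bool add.commute)

context hawkes_data
begin

subsection \<open>The pair measure of time differences\<close>

text \<open>The lags, relative to an ancestor at \<open>y\<close>, of those members of its cluster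
  that lie in \<open>A\<close>.\<close>

definition GA :: "'a set \<Rightarrow> 'a \<Rightarrow> real measure" where
  "GA A y = distr (density (G y) (\<lambda>z. indicator A (fst z))) borel snd"

lemma sets_GA [simp, measurable_cong]: "sets (GA A y) = sets borel"
  by (simp add: GA_def)

lemma space_GA [simp]: "space (GA A y) = UNIV"
  by (simp add: GA_def)

lemma nn_integral_GA:
  assumes A [measurable]: "A \<in> sets borel" and [measurable]: "\<phi> \<in> borel_measurable borel"
  shows "(\<integral>\<^sup>+t. \<phi> t \<partial>GA A y) = (\<integral>\<^sup>+z. indicator A (fst z) * \<phi> (snd z) \<partial>G y)"
proof -
  have [measurable]: "(\<lambda>z. indicator A (fst z) :: ennreal) \<in> borel_measurable (G y)" by measurable
  have "snd \<in> measurable (density (G y) (\<lambda>z. indicator A (fst z))) borel" by measurable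
  then have "(\<integral>\<^sup>+t. \<phi> t \<partial>GA A y) = (\<integral>\<^sup>+z. \<phi> (snd z) \<partial>density (G y) (\<lambda>z. indicator A (fst z)))"
    unfolding GA_def by (intro nn_integral_distr) auto
  then show ?thesis by (simp add: nn_integral_density)
qed

lemma nn_integral_GA_le:
  assumes A: "A \<in> sets borel" and [measurable]: "\<phi> \<in> borel_measurable borel"
  shows "(\<integral>\<^sup>+t. \<phi> t \<partial>GA A y) \<le> (\<integral>\<^sup>+t. \<phi> t \<partial>T)"
proof -
  have "(\<integral>\<^sup>+t. \<phi> t \<partial>GA A y) \<le> (\<integral>\<^sup>+z. \<phi> (snd z) \<partial>G y)"
    unfolding nn_integral_GA[OF assms] by (intro nn_integral_mono) (auto simp: indicator_def)
  then show ?thesis using G_le_T[of \<phi> y] by simp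
qed

lemma GA_mass_le: "A \<in> sets borel \<Longrightarrow> emeasure (GA A y) UNIV \<le> Ct"
  using nn_integral_GA_le[of A "\<lambda>_. 1" y] T_mass by simp

lemma finite_GA: "A \<in> sets borel \<Longrightarrow> finite_measure (GA A y)"
  using GA_mass_le[of A y] Ct_finite by (intro finite_measureI) auto

lemma nn_integral_GA_measurable:
  assumes A [measurable]: "A \<in> sets borel"
    and [measurable]: "(\<lambda>(y, z). f y z) \<in> borel_measurable (M \<Otimes>\<^sub>M borel)" "h \<in> borel_measurable M"
  shows "(\<lambda>y. \<integral>\<^sup>+z. f y z \<partial>GA A (h y)) \<in> borel_measurable M"
proof -
  have "(\<lambda>y. \<integral>\<^sup>+z. indicator A (fst z) * f y (snd z) \<partial>G (h y)) \<in> borel_measurable M"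
    by (rule nn_integral_G_measurable) measurable
  moreover have "(\<integral>\<^sup>+z. f y z \<partial>GA A (h y)) = (\<integral>\<^sup>+z. indicator A (fst z) * f y (snd z) \<partial>G (h y))"
    if "y \<in> space M" for y
    using measurable_compose[OF measurable_Pair1'[OF that] assms(2)] A
    by (intro nn_integral_GA) simp_all
  ultimately show ?thesis by (simp cong: measurable_cong)
qed

definition dif :: "'a set \<Rightarrow> 'a \<Rightarrow> real measure" where
  "dif A y = distr (GA A y \<Otimes>\<^sub>M GA A y) borel (\<lambda>(u, v). v - u)"

lemma sets_dif [simp, measurable_cong]: "sets (dif A y) = sets borel"
  by (simp add: dif_def)

lemma space_dif [simp]: "space (dif A y) = UNIV"
  by (simp add: dif_def)

lemma nn_integral_dif:
  assumes A: "A \<in> sets borel" and [measurable]: "\<phi> \<in> borel_measurable borel"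
  shows "(\<integral>\<^sup>+d. \<phi> d \<partial>dif A y) = (\<integral>\<^sup>+u. \<integral>\<^sup>+v. \<phi> (v - u) \<partial>GA A y \<partial>GA A y)"
proof -
  interpret finite_measure "GA A y" by (rule finite_GA[OF A])
  have m: "(\<lambda>(u, v). v - u) \<in> measurable (GA A y \<Otimes>\<^sub>M GA A y) borel" by measurable
  have "(\<integral>\<^sup>+d. \<phi> d \<partial>dif A y) = (\<integral>\<^sup>+p. \<phi> (snd p - fst p) \<partial>(GA A y \<Otimes>\<^sub>M GA A y))"
    unfolding dif_def using m by (subst nn_integral_distr) (auto simp: case_prod_unfold)
  also have "\<dots> = (\<integral>\<^sup>+u. \<integral>\<^sup>+v. \<phi> (v - u) \<partial>GA A y \<partial>GA A y)"
    by (subst nn_integral_fst[symmetric]) auto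
  finally show ?thesis .
qed

lemma emeasure_dif_measurable:
  assumes A [measurable]: "A \<in> sets borel" and S [measurable]: "S \<in> sets borel"
  shows "(\<lambda>y. emeasure (dif A y) S) \<in> borel_measurable borel"
proof -
  have "(\<lambda>y. \<integral>\<^sup>+u. \<integral>\<^sup>+v. indicator S (v - u) \<partial>GA A y \<partial>GA A y) \<in> borel_measurable borel"
    by (intro nn_integral_GA_measurable A) (unfold case_prod_unfold, intro nn_integral_GA_measurable A, measurable)
  then show ?thesis using nn_integral_dif[OF A, of "indicator S"] by simp
qed

lemma emeasure_dif_measurable_mu:
  "A \<in> sets borel \<Longrightarrow> S \<in> sets borel \<Longrightarrow> (\<lambda>y. emeasure (dif A y) S) \<in> borel_measurable mu"
  using emeasure_dif_measurable[of A S] by (simp cong: measurable_cong_sets)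

text \<open>Time differences of ordered pairs in \<open>A\<close> with a last common ancestor,
  averaged over its location. The ancestor belongs to its own cluster, so each point paired with
  itself is included, with difference 0.\<close>

definition rho_full :: "'a set \<Rightarrow> real measure" where
  "rho_full A = mixture mu (dif A)"

lemma sets_rho_full [simp, measurable_cong]: "sets (rho_full A) = sets borel"
  by (simp add: rho_full_def)

lemma emeasure_rho_full:
  "A \<in> sets borel \<Longrightarrow> S \<in> sets borel \<Longrightarrow> emeasure (rho_full A) S = (\<integral>\<^sup>+y. emeasure (dif A y) S \<partial>mu)"
  unfolding rho_full_def by (rule emeasure_mixture) (auto intro: emeasure_dif_measurable_mu)

lemma nn_integral_rho_full:
  "A \<in> sets borel \<Longrightarrow> \<phi> \<in> borel_measurable borel \<Longrightarrow>
    (\<integral>\<^sup>+d. \<phi> d \<partial>rho_full A) = (\<integral>\<^sup>+y. \<integral>\<^sup>+d. \<phi> d \<partial>dif A y \<partial>mu)"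
  unfolding rho_full_def by (rule nn_integral_mixture) (auto intro: emeasure_dif_measurable_mu)

lemma dif_UNIV:
  assumes A: "A \<in> sets borel" shows "emeasure (dif A y) UNIV = emeasure (GA A y) UNIV * emeasure (GA A y) UNIV"
  using nn_integral_dif[OF A, of "\<lambda>_. 1" y] by simp

lemma rho_full_UNIV_le:
  assumes A: "A \<in> sets borel" shows "emeasure (rho_full A) UNIV \<le> emeasure mu UNIV * (Ct * Ct)"
proof -
  have "emeasure (rho_full A) UNIV \<le> (\<integral>\<^sup>+y. Ct * Ct \<partial>mu)"
    unfolding emeasure_rho_full[OF A sets.top[of borel, unfolded space_borel]] dif_UNIV[OF A]
    using A by (intro nn_integral_mono mult_mono GA_mass_le) auto
  then show ?thesis by (simp add: mult.commute)
qed

lemma finite_rho_full: "A \<in> sets borel \<Longrightarrow> finite_measure (rho_full A)"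
proof (rule finite_measureI)
  assume A: "A \<in> sets borel"
  have "emeasure mu UNIV * (Ct * Ct) < top"
    using emeasure_mu_finite Ct_finite by (simp add: ennreal_mult_less_top)
  then show "emeasure (rho_full A) (space (rho_full A)) \<noteq> \<infinity>"
    using rho_full_UNIV_le[OF A] sets_eq_imp_space_eq[OF sets_rho_full[of A]] by (auto simp: top_unique)
qed

text \<open>The share of \<open>rho_full\<close> that comes from points paired with themselves:
  their time difference is 0, and their mean number per unit of time is \<open>mu A\<close>.\<close>

definition atom :: "'a set \<Rightarrow> real measure" where
  "atom A = density (return borel 0) (\<lambda>_. emeasure mu A)"

lemma sets_atom [simp, measurable_cong]: "sets (atom A) = sets borel"
  by (simp add: atom_def)

lemma emeasure_atom: "S \<in> sets borel \<Longrightarrow> emeasure (atom A) S = emeasure mu A * indicator S 0"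
  by (simp add: atom_def emeasure_density nn_integral_return)

lemma nn_integral_atom: "\<phi> \<in> borel_measurable borel \<Longrightarrow> (\<integral>\<^sup>+d. \<phi> d \<partial>atom A) = emeasure mu A * \<phi> 0"
  by (simp add: atom_def nn_integral_density nn_integral_return)

lemma GA_zero: 
  assumes A [measurable]: "A \<in> sets borel" shows "indicator A y \<le> emeasure (GA A y) {0}"
proof -
  have "indicator A y = indicator A (fst (y, 0::real)) * (indicator {0} (snd (y, 0::real)) :: ennreal)" by simp
  also have "\<dots> \<le> (\<integral>\<^sup>+z. indicator A (fst z) * indicator {0} (snd z) \<partial>G y)"
    by (subst nn_integral_G_density) auto
  also have "\<dots> = (\<integral>\<^sup>+t. indicator {0} t \<partial>GA A y)" by (rule nn_integral_GA[symmetric]) auto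
  finally show ?thesis by simp
qed

text \<open>An ancestor in \<open>A\<close> lies in its own cluster with lag 0, so
  \<open>GA A y\<close> charges 0 with mass at least 1, and the pair of lags \<open>(0, 0)\<close>
  has difference 0. The inequality makes \<open>rho\<close> a genuine difference of
  measures.\<close>

lemma atom_le_rho_full:
  assumes A: "A \<in> sets borel" and S: "S \<in> sets borel"
  shows "emeasure (atom A) S \<le> emeasure (rho_full A) S"
proof (cases "0 \<in> S")
  case True
  have *: "indicator A y \<le> emeasure (dif A y) S" for y
  proof -
    interpret finite_measure "GA A y" by (rule finite_GA[OF A])
    have "indicator A y = indicator A y * (indicator A y :: ennreal)" by (simp add: indicator_def)
    also have "\<dots> \<le> emeasure (GA A y) {0} * emeasure (GA A y) {0}"
      by (intro mult_mono GA_zero A) auto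
    also have "\<dots> = emeasure (GA A y \<Otimes>\<^sub>M GA A y) ({0} \<times> {0})"
      by (rule emeasure_pair_measure_Times[symmetric]) auto
    also have "\<dots> \<le> emeasure (dif A y) S"
    proof -
      have m: "(\<lambda>(u, v). v - u) \<in> measurable (GA A y \<Otimes>\<^sub>M GA A y) borel" by measurable
      show ?thesis
        unfolding dif_def emeasure_distr[OF m S]
        using measurable_sets[OF m S] True by (intro emeasure_mono) (auto simp: space_pair_measure)
    qed
    finally show ?thesis .
  qed
  have "emeasure (atom A) S = (\<integral>\<^sup>+y. indicator A y \<partial>mu)" using True A S by (simp add: emeasure_atom)
  also have "\<dots> \<le> emeasure (rho_full A) S"
    unfolding emeasure_rho_full[OF A S] by (intro nn_integral_mono *)
  finally show ?thesis .
qed (simp add: emeasure_atom S)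

definition rho :: "'a set \<Rightarrow> real measure" where
  "rho A = diff_measure (rho_full A) (atom A)"

lemma sets_rho [simp, measurable_cong]: "sets (rho A) = sets borel"
  by (simp add: rho_def)

lemma finite_atom: "finite_measure (atom A)"
  using emeasure_mu_finite[of A] sets_eq_imp_space_eq[OF sets_atom[of A]]
  by (intro finite_measureI) (auto simp: emeasure_atom)

lemma emeasure_rho:
  assumes A: "A \<in> sets borel" and S: "S \<in> sets borel"
  shows "emeasure (rho A) S = emeasure (rho_full A) S - emeasure (atom A) S"
  unfolding rho_def using finite_rho_full[OF A] finite_atom atom_le_rho_full[OF A] S
  by (intro emeasure_diff_measure) auto

lemma rho_full_eq:
  assumes A: "A \<in> sets borel" and S: "S \<in> sets borel"
  shows "emeasure (rho_full A) S = emeasure (rho A) S + emeasure (atom A) S"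
  unfolding emeasure_rho[OF assms] using atom_le_rho_full[OF assms]
  by (simp add: diff_add_cancel_ennreal)

text \<open>The candidate for the reduced second factorial moment measure: independent pairs give
  the constant density, pairs with a common ancestor give \<open>rho\<close>.\<close>

definition R :: "'a set \<Rightarrow> real measure" where
  "R A = measure_add (density lborel (\<lambda>_. emeasure mu A * emeasure mu A)) (rho A)"

lemma sets_R [simp, measurable_cong]: "sets (R A) = sets borel"
  by (simp add: R_def)

lemma emeasure_R:
  "S \<in> sets borel \<Longrightarrow> emeasure (R A) S = emeasure mu A * emeasure mu A * emeasure lborel S + emeasure (rho A) S"
  unfolding R_def by (subst emeasure_measure_add) (auto simp: emeasure_density nn_integral_cmult)

definition R_full :: "'a set \<Rightarrow> real measure" where
  "R_full A = measure_add (density lborel (\<lambda>_. emeasure mu A * emeasure mu A)) (rho_full A)"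

lemma sets_R_full [simp, measurable_cong]: "sets (R_full A) = sets borel"
  by (simp add: R_full_def)

lemma R_full_eq:
  assumes A: "A \<in> sets borel"
  shows "R_full A = measure_add (R A) (atom A)"
proof (rule measure_eqI)
  fix S assume "S \<in> sets (R_full A)"
  then have S: "S \<in> sets borel" by simp
  show "emeasure (R_full A) S = emeasure (measure_add (R A) (atom A)) S"
    unfolding R_full_def using S A
    by (simp add: emeasure_measure_add emeasure_density nn_integral_cmult rho_full_eq emeasure_R add.assoc)
qed simp

lemma nn_integral_R_full:
  assumes A: "A \<in> sets borel" and [measurable]: "\<phi> \<in> borel_measurable borel"
  shows "(\<integral>\<^sup>+d. \<phi> d \<partial>R_full A) = emeasure mu A * emeasure mu A * (\<integral>\<^sup>+d. \<phi> d \<partial>lborel) +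
    (\<integral>\<^sup>+y. \<integral>\<^sup>+u. \<integral>\<^sup>+v. \<phi> (v - u) \<partial>GA A y \<partial>GA A y \<partial>mu)"
  unfolding R_full_def using A
  by (subst nn_integral_measure_add)
    (auto simp: nn_integral_density nn_integral_cmult nn_integral_rho_full nn_integral_dif)

text \<open>For an ancestor born at \<open>s\<close> with descendants at lags \<open>u\<close> and
  \<open>v\<close>, the substitution \<open>r = s + u\<close> leaves the time of the first
  descendant and the difference \<open>v - u\<close>; the birth time disappears.\<close>

theorem mean_GG_product:
  assumes A [measurable]: "A \<in> sets borel"
    and \<phi> [measurable]: "\<phi> \<in> borel_measurable borel" and \<psi> [measurable]: "\<psi> \<in> borel_measurable borel"
  shows "(\<integral>\<^sup>+x. \<integral>\<^sup>+s. GG (\<lambda>z. indicator A (fst z) * \<phi> (snd z)) (x, s) *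
      GG (\<lambda>z. indicator A (fst z) * \<psi> (snd z)) (x, s) \<partial>lborel \<partial>mu) =
    (\<integral>\<^sup>+r. \<phi> r * (\<integral>\<^sup>+d. \<psi> (r + d) \<partial>rho_full A) \<partial>lborel)"
proof -
  have GG: "GG (\<lambda>z. indicator A (fst z) * \<phi> (snd z)) (x, s) = (\<integral>\<^sup>+u. \<phi> (s + u) \<partial>GA A x)"
    if [measurable]: "\<phi> \<in> borel_measurable borel" for x s \<phi>
    by (subst GG_eq) (auto simp: nn_integral_GA)
  have inner: "(\<integral>\<^sup>+s. (\<integral>\<^sup>+u. \<phi> (s + u) \<partial>GA A x) * (\<integral>\<^sup>+v. \<psi> (s + v) \<partial>GA A x) \<partial>lborel) =
      (\<integral>\<^sup>+r. \<phi> r * (\<integral>\<^sup>+d. \<psi> (r + d) \<partial>dif A x) \<partial>lborel)" for x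
  proof -
    interpret G: finite_measure "GA A x" by (rule finite_GA[OF A])
    interpret P: pair_sigma_finite lborel "GA A x" ..
    have "(\<integral>\<^sup>+s. (\<integral>\<^sup>+u. \<phi> (s + u) \<partial>GA A x) * (\<integral>\<^sup>+v. \<psi> (s + v) \<partial>GA A x) \<partial>lborel) =
        (\<integral>\<^sup>+s. \<integral>\<^sup>+u. \<phi> (s + u) * (\<integral>\<^sup>+v. \<psi> (s + v) \<partial>GA A x) \<partial>GA A x \<partial>lborel)"
      by (simp add: nn_integral_multc)
    also have "\<dots> = (\<integral>\<^sup>+u. \<integral>\<^sup>+s. \<phi> (s + u) * (\<integral>\<^sup>+v. \<psi> (s + v) \<partial>GA A x) \<partial>lborel \<partial>GA A x)"
      by (rule P.Fubini'[symmetric]) measurable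
    also have "\<dots> = (\<integral>\<^sup>+u. \<integral>\<^sup>+r. \<phi> r * (\<integral>\<^sup>+v. \<psi> (r - u + v) \<partial>GA A x) \<partial>lborel \<partial>GA A x)"
    proof (rule nn_integral_cong)
      fix u :: real
      show "(\<integral>\<^sup>+s. \<phi> (s + u) * (\<integral>\<^sup>+v. \<psi> (s + v) \<partial>GA A x) \<partial>lborel) =
          (\<integral>\<^sup>+r. \<phi> r * (\<integral>\<^sup>+v. \<psi> (r - u + v) \<partial>GA A x) \<partial>lborel)"
        by (subst nn_integral_lborel_shift[of "\<lambda>r. \<phi> r * (\<integral>\<^sup>+v. \<psi> (r - u + v) \<partial>GA A x)" u, symmetric])
          (auto simp: add.commute)
    qed
    also have "\<dots> = (\<integral>\<^sup>+r. \<integral>\<^sup>+u. \<phi> r * (\<integral>\<^sup>+v. \<psi> (r - u + v) \<partial>GA A x) \<partial>GA A x \<partial>lborel)"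
      by (rule P.Fubini') measurable
    also have "\<dots> = (\<integral>\<^sup>+r. \<phi> r * (\<integral>\<^sup>+d. \<psi> (r + d) \<partial>dif A x) \<partial>lborel)"
      by (intro nn_integral_cong) (simp add: nn_integral_dif nn_integral_cmult algebra_simps)
    finally show ?thesis .
  qed
  have dm: "(\<lambda>(x, r). \<integral>\<^sup>+d. \<psi> (r + d) \<partial>dif A x) \<in> borel_measurable (mu \<Otimes>\<^sub>M lborel)"
  proof -
    have "(\<lambda>p. \<integral>\<^sup>+u. \<integral>\<^sup>+v. \<psi> (snd p + (v - u)) \<partial>GA A (fst p) \<partial>GA A (fst p)) \<in> borel_measurable (mu \<Otimes>\<^sub>M lborel)"
      by (intro nn_integral_GA_measurable A) (unfold case_prod_unfold, intro nn_integral_GA_measurable A, measurable)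
    then show ?thesis by (simp add: nn_integral_dif case_prod_unfold)
  qed
  interpret mu: finite_measure mu by (rule finite_mu)
  interpret P: pair_sigma_finite mu lborel ..
  have "(\<integral>\<^sup>+x. \<integral>\<^sup>+s. GG (\<lambda>z. indicator A (fst z) * \<phi> (snd z)) (x, s) *
      GG (\<lambda>z. indicator A (fst z) * \<psi> (snd z)) (x, s) \<partial>lborel \<partial>mu) =
      (\<integral>\<^sup>+x. \<integral>\<^sup>+r. \<phi> r * (\<integral>\<^sup>+d. \<psi> (r + d) \<partial>dif A x) \<partial>lborel \<partial>mu)"
    by (simp add: GG inner)
  also have "\<dots> = (\<integral>\<^sup>+r. \<integral>\<^sup>+x. \<phi> r * (\<integral>\<^sup>+d. \<psi> (r + d) \<partial>dif A x) \<partial>mu \<partial>lborel)"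
    by (rule P.Fubini'[symmetric]) (use dm in \<open>simp add: case_prod_unfold\<close>)
  also have "\<dots> = (\<integral>\<^sup>+r. \<phi> r * (\<integral>\<^sup>+d. \<psi> (r + d) \<partial>rho_full A) \<partial>lborel)"
  proof (rule nn_integral_cong)
    fix r :: real
    have "(\<lambda>x. \<integral>\<^sup>+d. \<psi> (r + d) \<partial>dif A x) \<in> borel_measurable mu"
      using measurable_compose[OF measurable_Pair2'[of r lborel mu] dm] by simp
    then show "(\<integral>\<^sup>+x. \<phi> r * (\<integral>\<^sup>+d. \<psi> (r + d) \<partial>dif A x) \<partial>mu) = \<phi> r * (\<integral>\<^sup>+d. \<psi> (r + d) \<partial>rho_full A)"
      by (simp add: nn_integral_cmult nn_integral_rho_full)
  qed
  finally show ?thesis .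
qed

subsection \<open>Bounds\<close>

text \<open>\<open>G_le_T\<close> compares integrals of functions of the lag alone, so the two lags
  are replaced one after the other.\<close>

lemma dif_le_T:
  assumes A: "A \<in> sets borel" and S: "S \<in> sets borel"
  shows "emeasure (dif A y) S \<le> (\<integral>\<^sup>+u. \<integral>\<^sup>+v. indicator S (v - u) \<partial>T \<partial>T)"
proof -
  interpret T: finite_measure T by (rule finite_T)
  have [measurable]: "S \<in> sets borel" by fact
  have "emeasure (dif A y) S = (\<integral>\<^sup>+u. \<integral>\<^sup>+v. indicator S (v - u) \<partial>GA A y \<partial>GA A y)"
    using nn_integral_dif[OF A, of "indicator S"] S by simp
  also have "\<dots> \<le> (\<integral>\<^sup>+u. \<integral>\<^sup>+v. indicator S (v - u) \<partial>T \<partial>GA A y)"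
    by (intro nn_integral_mono nn_integral_GA_le A) measurable
  also have "\<dots> \<le> (\<integral>\<^sup>+u. \<integral>\<^sup>+v. indicator S (v - u) \<partial>T \<partial>T)"
    by (intro nn_integral_GA_le A) measurable
  finally show ?thesis .
qed

lemma rho_full_le_T:
  assumes A: "A \<in> sets borel" and S: "S \<in> sets borel"
  shows "emeasure (rho_full A) S \<le> emeasure mu UNIV * (\<integral>\<^sup>+u. \<integral>\<^sup>+v. indicator S (v - u) \<partial>T \<partial>T)"
proof -
  have "emeasure (rho_full A) S \<le> (\<integral>\<^sup>+y. (\<integral>\<^sup>+u. \<integral>\<^sup>+v. indicator S (v - u) \<partial>T \<partial>T) \<partial>mu)"
    unfolding emeasure_rho_full[OF assms] by (intro nn_integral_mono dif_le_T assms)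
  then show ?thesis by (simp add: mult.commute)
qed

text \<open>In each square one factor is bounded by \<open>Ct\<close>; by disjointness the other
  factors add up to at most the mass of \<open>G y\<close>, again at most \<open>Ct\<close>. The
  bound depends neither on the sets nor on their number.\<close>

lemma sum_rho_full_le:
  assumes As: "\<And>i. i \<in> J \<Longrightarrow> As i \<in> sets borel" "disjoint_family_on As J" and J: "finite J"
  shows "(\<Sum>i\<in>J. emeasure (rho_full (As i)) UNIV) \<le> emeasure mu UNIV * (Ct * Ct)"
proof -
  have "(\<Sum>i\<in>J. emeasure (rho_full (As i)) UNIV) =
      (\<integral>\<^sup>+y. (\<Sum>i\<in>J. emeasure (GA (As i) y) UNIV * emeasure (GA (As i) y) UNIV) \<partial>mu)"
    using As J by (subst nn_integral_sum)
      (auto simp: emeasure_rho_full dif_UNIV[symmetric] intro!: emeasure_dif_measurable_mu)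
  also have "\<dots> \<le> (\<integral>\<^sup>+y. Ct * Ct \<partial>mu)"
  proof (rule nn_integral_mono)
    fix y
    have "(\<Sum>i\<in>J. emeasure (GA (As i) y) UNIV * emeasure (GA (As i) y) UNIV) \<le>
        (\<Sum>i\<in>J. emeasure (GA (As i) y) UNIV * Ct)"
      using As by (intro sum_mono mult_left_mono GA_mass_le) auto
    also have "\<dots> = (\<Sum>i\<in>J. emeasure (GA (As i) y) UNIV) * Ct" by (simp add: sum_distrib_right)
    also have "(\<Sum>i\<in>J. emeasure (GA (As i) y) UNIV) = (\<Sum>i\<in>J. \<integral>\<^sup>+z. indicator (As i) (fst z) \<partial>G y)"
    proof (rule sum.cong[OF refl])
      fix i assume "i \<in> J"
      then show "emeasure (GA (As i) y) UNIV = (\<integral>\<^sup>+z. indicator (As i) (fst z) \<partial>G y)"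
        using nn_integral_GA[OF As(1), of i "\<lambda>_. 1" y] by simp
    qed
    also have "\<dots> = (\<integral>\<^sup>+z. (\<Sum>i\<in>J. indicator (As i) (fst z)) \<partial>G y)"
    proof (rule nn_integral_sum[symmetric])
      fix i assume "i \<in> J"
      then have [measurable]: "As i \<in> sets borel" using As by blast
      show "(\<lambda>z. indicator (As i) (fst z) :: ennreal) \<in> borel_measurable (G y)" by measurable
    qed
    also have "\<dots> \<le> (\<integral>\<^sup>+z. 1 \<partial>G y)"
    proof (rule nn_integral_mono)
      fix z :: "'a \<times> real"
      have "(\<Sum>i\<in>J. indicator (As i) (fst z)) = (indicator (\<Union>i\<in>J. As i) (fst z) :: ennreal)"
        using As(2) J by (rule indicator_UN_disjoint[symmetric, rotated])
      then show "(\<Sum>i\<in>J. indicator (As i) (fst z)) \<le> (1 :: ennreal)" by (simp add: indicator_def)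
    qed
    also have "\<dots> * Ct \<le> Ct * Ct" using G_mass[of y] by (intro mult_right_mono) auto
    finally show "(\<Sum>i\<in>J. emeasure (GA (As i) y) UNIV * emeasure (GA (As i) y) UNIV) \<le> Ct * Ct"
      by (simp add: mult_right_mono)
  qed
  finally show ?thesis by (simp add: mult.commute)
qed

end

section \<open>Functionals of the generations\<close>

lemma space_history [simp]: "space (history M pos k) = space M"
  by (simp add: history_def space_measure_of_conv)

lemma history_gen:
  "u \<noteq> [] \<Longrightarrow> length u \<le> Suc k \<Longrightarrow> B \<in> sets borel \<Longrightarrow>
    {\<eta> \<in> space M. \<exists>b\<in>B. pos u \<eta> = Some b} \<in> sets (history M pos k)"
  unfolding history_def by (intro in_measure_of) auto

lemma sets_history:
  "sets (history M pos k) = sigma_sets (space M)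
    {{\<eta> \<in> space M. \<exists>b\<in>B. pos u \<eta> = Some b} | u B. u \<noteq> [] \<and> length u \<le> Suc k \<and> B \<in> sets borel}"
  unfolding history_def by (rule sets_measure_of) auto

lemma subalgebra_history:
  assumes "\<And>u B. u \<noteq> [] \<Longrightarrow> B \<in> sets borel \<Longrightarrow> {\<eta> \<in> space M. \<exists>b\<in>B. pos u \<eta> = Some b} \<in> sets M"
  shows "subalgebra M (history M pos k)"
  unfolding subalgebra_def sets_history
  by (intro conjI sets.sigma_sets_subset) (use assms in auto)

definition oapp :: "('b \<Rightarrow> ennreal) \<Rightarrow> 'b option \<Rightarrow> ennreal" where
  "oapp f p = (case p of None \<Rightarrow> 0 | Some b \<Rightarrow> f b)"

lemma oapp_simps [simp]: "oapp f None = 0" "oapp f (Some b) = f b"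
  by (simp_all add: oapp_def)

lemma nnlin_oapp: "nnlin (\<lambda>f. oapp f p)"
proof (cases p)
  case None
  then show ?thesis by (simp add: nnlin_def)
next
  case (Some b)
  then show ?thesis using nnlin_eval_mult[of b 1] by simp
qed

text \<open>The optional point is read as a point process with the single label \<open>()\<close>,
  whose counts are the indicators of the events in the hypothesis;
  \<open>kernel_nn_integral_measurable\<close> passes from sets to \<open>f\<close>.\<close>

lemma oapp_measurable:
  assumes p: "\<And>B. B \<in> sets borel \<Longrightarrow> {\<omega> \<in> space M. \<exists>b\<in>B. p \<omega> = Some b} \<in> sets M"
    and f: "f \<in> borel_measurable (borel :: 'b::topological_space measure)"
  shows "(\<lambda>\<omega>. oapp f (p \<omega>)) \<in> borel_measurable M"
proof -
  define \<kappa> where "\<kappa> \<omega> = point_measure UNIV (\<lambda>_::unit. p) \<omega>" for \<omega>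
  have e: "emeasure (\<kappa> \<omega>) B = indicator {\<omega> \<in> space M. \<exists>b\<in>B. p \<omega> = Some b} \<omega>"
    if "B \<in> sets borel" "\<omega> \<in> space M" for B \<omega>
  proof (cases "\<exists>b\<in>B. p \<omega> = Some b")
    case True
    then have "{u::unit. \<exists>b\<in>B. p \<omega> = Some b} = {()}" by auto
    then show ?thesis using that True by (simp add: \<kappa>_def emeasure_point_measure)
  qed (use that in \<open>simp add: \<kappa>_def emeasure_point_measure\<close>)
  have i: "(\<integral>\<^sup>+x. f x \<partial>\<kappa> \<omega>) = oapp f (p \<omega>)" for \<omega>
    using f by (cases "p \<omega>") (simp_all add: \<kappa>_def point_measure_def nn_integral_distr nn_integral_count_space_finite)
  have "(\<lambda>\<omega>. \<integral>\<^sup>+x. f x \<partial>\<kappa> \<omega>) \<in> borel_measurable M"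
  proof (rule kernel_nn_integral_measurable)
    fix B :: "'b set" assume B: "B \<in> sets borel"
    have "(\<lambda>\<omega>. indicator {\<omega> \<in> space M. \<exists>b\<in>B. p \<omega> = Some b} \<omega> :: ennreal) \<in> borel_measurable M"
      using p[OF B] by measurable
    then show "(\<lambda>\<omega>. emeasure (\<kappa> \<omega>) B) \<in> borel_measurable M"
      using B by (subst measurable_cong[OF e]) auto
  qed (auto simp: \<kappa>_def f)
  then show ?thesis by (simp only: i)
qed

lemma nn_integral_point_measure:
  assumes [measurable]: "f \<in> borel_measurable borel"
  shows "(\<integral>\<^sup>+x. f x \<partial>point_measure J p \<omega>) = (\<integral>\<^sup>+u. oapp f (p u \<omega>) \<partial>count_space J)"
proof -
  have "(\<integral>\<^sup>+x. f x \<partial>point_measure J p \<omega>) = (\<integral>\<^sup>+u. f (the (p u \<omega>)) \<partial>count_space {u \<in> J. p u \<omega> \<noteq> None})"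
    unfolding point_measure_def by (rule nn_integral_distr) auto
  also have "\<dots> = (\<integral>\<^sup>+u. oapp f (p u \<omega>) \<partial>count_space J)"
    by (subst (1 2) nn_integral_count_space_indicator)
      (auto intro!: nn_integral_cong simp: indicator_def split: option.splits simp: oapp_def)
  finally show ?thesis .
qed

text \<open>Multiplication on \<open>ennreal\<close> is discontinuous at the pair of 0 and infinity.
  For increasing sequences this does no harm: a limit 0 means that the sequence is constantly
  0.\<close>

lemma ennreal_LIMSEQ_mult_incseq:
  fixes a b :: "nat \<Rightarrow> ennreal"
  assumes "incseq a" "incseq b" "a \<longlonglongrightarrow> x" "b \<longlonglongrightarrow> y"
  shows "(\<lambda>n. a n * b n) \<longlonglongrightarrow> x * y"
proof -
  have le: "a n \<le> x" "b n \<le> y" for n using assms by (auto intro: incseq_le)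
  show ?thesis
  proof (cases "x = 0 \<or> y = 0")
    case True
    then have "(\<lambda>n. a n * b n) = (\<lambda>_. x * y)" using le by (fastforce simp: fun_eq_iff)
    then show ?thesis by simp
  next
    case False
    then show ?thesis using assms by (intro tendsto_mult_ennreal) auto
  qed
qed

context hawkes_data
begin

definition L0 :: "('a \<times> real \<Rightarrow> ennreal) \<Rightarrow> ennreal" where
  "L0 f = (\<integral>\<^sup>+z. lamX (fst z) * f z \<partial>lborel)"

lemma nn_integral_background:
  "f \<in> borel_measurable borel \<Longrightarrow> (\<integral>\<^sup>+z. f z \<partial>background_intensity X lam) = L0 f"
  unfolding background_eq L0_def by (subst nn_integral_density) auto

lemma offspring_intensity_Some:
  assumes "y \<in> X"
  shows "offspring_intensity X g (Some (y, s)) = density lborel (\<lambda>z. gX y (fst z) (snd z - s))"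
  unfolding offspring_intensity_def using assms
  by (auto intro!: arg_cong2[where f=density] simp: gX_def indicator_def)

lemma nn_integral_offspring_intensity:
  assumes [measurable]: "f \<in> borel_measurable borel" and p: "\<And>y s. p = Some (y, s) \<Longrightarrow> y \<in> X"
  shows "(\<integral>\<^sup>+z. f z \<partial>offspring_intensity X g p) = oapp (K f) p"
proof (cases p)
  case None
  then show ?thesis by (simp add: offspring_intensity_def)
next
  case (Some a)
  obtain y s where a: "a = (y, s)" by (cases a)
  then have "y \<in> X" using p Some by auto
  then show ?thesis by (simp add: Some a offspring_intensity_Some nn_integral_density K_def)
qed

lemma sets_offspring_intensity [simp]: "sets (offspring_intensity X g p) = sets borel"
  by (cases p) (auto simp: offspring_intensity_def)

end

text \<open>A label of length \<open>n + 1\<close> splits uniquely into its parent and its last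
  entry, so the offspring of one generation is exactly the next.\<close>

lemma nn_integral_count_space_snoc:
  fixes h :: "nat list \<Rightarrow> ennreal"
  shows "(\<integral>\<^sup>+u. \<integral>\<^sup>+v. h v \<partial>count_space (range (\<lambda>i. u @ [i])) \<partial>count_space {u. length u = n}) =
    (\<integral>\<^sup>+v. h v \<partial>count_space {u. length u = Suc n})"
proof -
  let ?A = "{u :: nat list. length u = n}"
  have 1: "(\<integral>\<^sup>+v. h v \<partial>count_space (range (\<lambda>i. u @ [i]))) = (\<integral>\<^sup>+i. h (u @ [i]) \<partial>count_space UNIV)" for u
    by (rule nn_integral_bij_count_space[symmetric]) (auto simp: bij_betw_def inj_on_def)
  have "(\<integral>\<^sup>+u. \<integral>\<^sup>+i. h (u @ [i]) \<partial>count_space UNIV \<partial>count_space ?A) =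
      (\<integral>\<^sup>+u. \<integral>\<^sup>+i. h (u @ [i]) * indicator (?A \<times> UNIV) (u, i) \<partial>count_space UNIV \<partial>count_space UNIV)"
    by (subst nn_integral_count_space_indicator) (auto intro!: nn_integral_cong simp: indicator_def)
  also have "\<dots> = (\<integral>\<^sup>+p. h (fst p @ [snd p]) * indicator (?A \<times> UNIV) p \<partial>count_space UNIV)"
    using nn_integral_fst_count_space[of "\<lambda>p. h (fst p @ [snd p]) * indicator (?A \<times> UNIV) p"] by simp
  also have "\<dots> = (\<integral>\<^sup>+p. h (fst p @ [snd p]) \<partial>count_space (?A \<times> (UNIV :: nat set)))"
    by (subst nn_integral_count_space_indicator) auto
  also have "\<dots> = (\<integral>\<^sup>+v. h v \<partial>count_space {u. length u = Suc n})"
  proof (rule nn_integral_bij_count_space)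
    have "v \<in> (\<lambda>p. fst p @ [snd p]) ` (?A \<times> UNIV)" if "length v = Suc n" for v :: "nat list"
      using that by (intro image_eqI[of _ _ "(butlast v, last v)"]) (auto simp: append_butlast_last_id[OF length_greater_0_conv[THEN iffD1]])
    then show "bij_betw (\<lambda>p. fst p @ [snd p]) (?A \<times> UNIV) {u :: nat list. length u = Suc n}"
      by (auto simp: bij_betw_def inj_on_def)
  qed
  finally show ?thesis by (simp only: 1)
qed

section \<open>Conditional laws of the generations in an arbitrary construction\<close>

locale hawkes = hawkes_data X lam g gt
  for X :: "'a::euclidean_space set" and lam g gt +
  fixes M :: "'w measure" and pos :: "nat list \<Rightarrow> 'w \<Rightarrow> ('a \<times> real) option"
  assumes construction: "hawkes_construction M X lam g pos"
begin

lemma prob_M: "prob_space M"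
  using construction by (simp add: hawkes_construction_def)

sublocale prob_space M by (rule prob_M)

lemma pos_measurable:
  "u \<noteq> [] \<Longrightarrow> B \<in> sets borel \<Longrightarrow> {\<omega> \<in> space M. \<exists>b\<in>B. pos u \<omega> = Some b} \<in> sets M"
  using construction by (simp add: hawkes_construction_def)

lemma pos_X: "u \<noteq> [] \<Longrightarrow> \<omega> \<in> space M \<Longrightarrow> pos u \<omega> = Some (x, t) \<Longrightarrow> x \<in> X"
  using construction unfolding hawkes_construction_def by blast

definition Z :: "nat \<Rightarrow> ('a \<times> real \<Rightarrow> ennreal) \<Rightarrow> 'w \<Rightarrow> ennreal" where
  "Z k f \<omega> = (\<integral>\<^sup>+u. oapp f (pos u \<omega>) \<partial>count_space {u. length u = Suc k})"

abbreviation "hist \<equiv> history M pos"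

lemma subalgebra_hist: "subalgebra M (hist k)"
  by (rule subalgebra_history) (rule pos_measurable)

lemma oapp_hist: "u \<noteq> [] \<Longrightarrow> length u \<le> Suc k \<Longrightarrow> f \<in> borel_measurable borel \<Longrightarrow> (\<lambda>\<omega>. oapp f (pos u \<omega>)) \<in> borel_measurable (hist k)"
  by (rule oapp_measurable) (auto intro: history_gen)

lemma oapp_M: "u \<noteq> [] \<Longrightarrow> f \<in> borel_measurable borel \<Longrightarrow> (\<lambda>\<omega>. oapp f (pos u \<omega>)) \<in> borel_measurable M"
  by (rule oapp_measurable) (auto intro: pos_measurable)

lemma Z_hist: "k \<le> j \<Longrightarrow> f \<in> borel_measurable borel \<Longrightarrow> Z k f \<in> borel_measurable (hist j)"
  unfolding Z_def[abs_def]
  by (intro borel_measurable_nn_integral_count_space oapp_hist) auto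

lemma Z_M [measurable]: "f \<in> borel_measurable borel \<Longrightarrow> Z k f \<in> borel_measurable M"
  using Z_hist[of k k f] subalgebra_hist by (auto intro: measurable_from_subalg)

lemma nnlin_Z: "nnlin (\<lambda>f. Z k f \<omega>)"
proof -
  have "nnlin (\<lambda>f. \<integral>\<^sup>+u. 1 * oapp f (pos u \<omega>) \<partial>count_space {u. length u = Suc k})"
    by (intro nnlin_integral nnlin_oapp) auto
  then show ?thesis by (simp add: Z_def[abs_def])
qed

lemma nn_integral_generation: "f \<in> borel_measurable borel \<Longrightarrow> (\<integral>\<^sup>+z. f z \<partial>generation pos k \<omega>) = Z k f \<omega>"
  by (simp add: generation_def nn_integral_point_measure Z_def)

text \<open>Slabs bounded in time only: the intensities are carried by \<open>X\<close> and have
  finite mass over bounded times.\<close>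

definition E :: "nat \<Rightarrow> ('a \<times> real) set" where "E n = UNIV \<times> {- real n..real n}"

lemma E_props: "incseq E" "\<And>n. E n \<in> sets borel" "(\<Union>n. E n) = UNIV"
proof -
  show "incseq E" by (auto simp: incseq_def E_def)
  show "E n \<in> sets borel" for n unfolding E_def borel_prod[symmetric] by (intro pair_measureI) auto
  have "z \<in> (\<Union>n. E n)" for z :: "'a \<times> real"
  proof -
    obtain n where "\<bar>snd z\<bar> \<le> real n" using real_arch_simple by blast
    then have "z \<in> E n" by (cases z) (auto simp: E_def)
    then show ?thesis by blast
  qed
  then show "(\<Union>n. E n) = UNIV" by auto
qed

lemma cond_indep: "cond_indep_poisson_processes M (hist k) {u. length u = Suc k}
    (offspring pos) (\<lambda>u \<omega>. offspring_intensity X g (pos u \<omega>))"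
  using construction by (simp add: hawkes_construction_def)

lemma emeasure_offspring_intensity:
  assumes "B \<in> sets borel" "u \<noteq> []" "\<omega> \<in> space M"
  shows "emeasure (offspring_intensity X g (pos u \<omega>)) B = oapp (K (indicator B)) (pos u \<omega>)"
proof -
  have "(\<integral>\<^sup>+z. indicator B z \<partial>offspring_intensity X g (pos u \<omega>)) = oapp (K (indicator B)) (pos u \<omega>)"
    using assms pos_X by (intro nn_integral_offspring_intensity) auto
  then show ?thesis using assms by simp
qed

text \<open>The conditional expectation of the construction becomes the integrated form of
  \<open>law\<close>: over an event \<open>H\<close> of the history, it has the same integral as the
  indicator that it conditions.\<close>

lemma cond_poisson_offspring:
  "cond_poisson M (hist k) {u. length u = Suc k} (offspring pos)
    (\<lambda>u \<omega>. offspring_intensity X g (pos u \<omega>)) E"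
proof
  let ?I = "{u :: nat list. length u = Suc k}"
  show "subalgebra M (hist k)" by (rule subalgebra_hist)
  show "countable ?I" by simp
  show sN: "sets (offspring pos u \<omega>) = sets borel" for u \<omega> by (simp add: offspring_def)
  show "sets (offspring_intensity X g (pos u \<omega>)) = sets borel" for u \<omega> by simp
  show mN: "(\<lambda>\<omega>. emeasure (offspring pos u \<omega>) B) \<in> borel_measurable M" if "u \<in> ?I" "B \<in> sets borel" for u B
  proof -
    have "emeasure (offspring pos u \<omega>) B = (\<integral>\<^sup>+v. oapp (indicator B) (pos v \<omega>) \<partial>count_space (range (\<lambda>i. u @ [i])))" for \<omega>
      using nn_integral_point_measure[of "indicator B" "range (\<lambda>i. u @ [i])" pos \<omega>] that by (simp add: offspring_def)
    moreover have "(\<lambda>\<omega>. \<integral>\<^sup>+v. oapp (indicator B) (pos v \<omega>) \<partial>count_space (range (\<lambda>i. u @ [i]))) \<in> borel_measurable M"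
      using that by (intro borel_measurable_nn_integral_count_space oapp_M) auto
    ultimately show ?thesis by simp
  qed
  show mL: "(\<lambda>\<omega>. emeasure (offspring_intensity X g (pos u \<omega>)) B) \<in> borel_measurable (hist k)"
    if "u \<in> ?I" "B \<in> sets borel" for u B
  proof -
    have "u \<noteq> []" using that by auto
    then have "(\<lambda>\<omega>. oapp (K (indicator B)) (pos u \<omega>)) \<in> borel_measurable (hist k)"
      using that by (intro oapp_hist) auto
    then show ?thesis
      using that \<open>u \<noteq> []\<close> by (subst measurable_cong[OF emeasure_offspring_intensity]) auto
  qed
  show "incseq E" "\<And>n. E n \<in> sets borel" "(\<Union>n. E n) = UNIV" by (fact E_props)+
  show "emeasure (offspring_intensity X g (pos u \<omega>)) (E n) < \<infinity>" if "u \<in> ?I" "\<omega> \<in> space M" for u \<omega> n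
  proof -
    have "u \<noteq> []" using that by auto
    have "K (indicator B) p \<le> nut" if [measurable]: "B \<in> sets borel" for B p
    proof -
      have "K (indicator B) p \<le> (\<integral>\<^sup>+z. gX (fst p) (fst z) (snd z) \<partial>lborel)"
        by (subst K_shift) (auto intro!: nn_integral_mono simp: indicator_def)
      then show ?thesis using nuy_le_nut[of "fst p"] by (simp add: nuy_def)
    qed
    then have "oapp (K (indicator (E n))) (pos u \<omega>) \<le> nut"
      using E_props(2) by (cases "pos u \<omega>") auto
    also have "\<dots> < \<infinity>" using nut_less_1 by (rule order.strict_trans) simp
    finally show ?thesis using that \<open>u \<noteq> []\<close> E_props(2) by (simp add: emeasure_offspring_intensity)
  qed
  fix U :: "nat list set" and \<B> :: "('a \<times> real) set set" and H and m :: "nat list \<Rightarrow> ('a \<times> real) set \<Rightarrow> nat"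
  assume U: "finite U" "U \<subseteq> ?I" and \<B>: "finite \<B>" "\<B> \<subseteq> sets borel" "disjoint \<B>" and H: "H \<in> sets (hist k)"
  let ?S = "{\<omega> \<in> space M. \<forall>u\<in>U. \<forall>B\<in>\<B>. emeasure (offspring pos u \<omega>) B = of_nat (m u B)}"
  let ?P = "\<lambda>\<omega>. \<Prod>u\<in>U. \<Prod>B\<in>\<B>. poisson_mass (emeasure (offspring_intensity X g (pos u \<omega>)) B) (m u B)"
  interpret S: finite_measure_subalgebra M "hist k"
    by standard (rule subalgebra_hist)
  have HM: "H \<in> sets M" using H subalgebra_hist[of k] by (auto simp: subalgebra_def)
  have S [measurable]: "?S \<in> sets M"
    using U \<B> mN[OF subsetD[OF U(2)] subsetD[OF \<B>(2)]] by measurable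
  have P: "?P \<in> borel_measurable (hist k)"
    using U \<B> by (intro borel_measurable_prod measurable_compose[OF mL poisson_mass_measurable]) auto
  then have PM [measurable]: "?P \<in> borel_measurable M" using subalgebra_hist by (rule measurable_from_subalg[rotated])
  have AE: "AE \<omega> in M. real_cond_exp M (hist k) (indicat_real ?S) \<omega> = ?P \<omega>"
    using cond_indep[of k] U \<B> unfolding cond_indep_poisson_processes_def by blast
  have iS: "integrable M (indicat_real ?S)" by (simp add: less_top[symmetric])
  have "integrable M (real_cond_exp M (hist k) (indicat_real ?S))" using iS by (rule S.real_cond_exp_int)
  then have iP: "integrable M ?P" using AE by (subst integrable_cong_AE[symmetric]) auto
  have "measure M (H \<inter> ?S) = (\<integral>\<omega>\<in>H. indicat_real ?S \<omega> \<partial>M)"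
    using HM by (simp add: set_lebesgue_integral_def indicator_inter_arith[symmetric])
  also have "\<dots> = (\<integral>\<omega>\<in>H. real_cond_exp M (hist k) (indicat_real ?S) \<omega> \<partial>M)"
    using iS H by (rule S.real_cond_exp_intA)
  also have "\<dots> = (\<integral>\<omega>\<in>H. ?P \<omega> \<partial>M)"
    unfolding set_lebesgue_integral_def using AE HM by (intro integral_cong_AE) auto
  finally have eq: "measure M (H \<inter> ?S) = (\<integral>\<omega>\<in>H. ?P \<omega> \<partial>M)" .
  have "emeasure M (H \<inter> ?S) = ennreal (\<integral>\<omega>. indicator H \<omega> * ?P \<omega> \<partial>M)"
    unfolding emeasure_eq_measure eq by (simp add: set_lebesgue_integral_def)
  also have "\<dots> = (\<integral>\<^sup>+\<omega>. ennreal (indicator H \<omega> * ?P \<omega>) \<partial>M)"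
    using iP HM by (intro nn_integral_eq_integral[symmetric] integrable_real_mult_indicator[of H M ?P, simplified mult.commute])
      (auto intro!: AE_I2 mult_nonneg_nonneg prod_nonneg simp: mult.commute simp del: zero_le_mult_iff)
  also have "\<dots> = (\<integral>\<^sup>+\<omega>\<in>H. (\<Prod>u\<in>U. \<Prod>B\<in>\<B>. ennreal (poisson_mass (emeasure (offspring_intensity X g (pos u \<omega>)) B) (m u B))) \<partial>M)"
    by (intro nn_integral_cong) (auto simp: indicator_def prod_ennreal prod_nonneg)
  also have "H \<inter> ?S = {\<omega>\<in>H. \<forall>u\<in>U. \<forall>B\<in>\<B>. emeasure (offspring pos u \<omega>) B = of_nat (m u B)}"
    using sets.sets_into_space[OF HM] by auto
  finally show "emeasure M {\<omega>\<in>H. \<forall>u\<in>U. \<forall>B\<in>\<B>. emeasure (offspring pos u \<omega>) B = of_nat (m u B)} =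
     (\<integral>\<^sup>+\<omega>\<in>H. (\<Prod>u\<in>U. \<Prod>B\<in>\<B>. ennreal (poisson_mass (emeasure (offspring_intensity X g (pos u \<omega>)) B) (m u B))) \<partial>M)" .
qed

text \<open>The background process is the case of one label and of a trivial \<sigma>-algebra, whose
  only events are the empty set and the whole space.\<close>

lemma cond_poisson_background:
  "cond_poisson M (sigma (space M) {}) {()} (\<lambda>_. generation pos 0) (\<lambda>_ _. background_intensity X lam) E"
proof
  show "subalgebra M (sigma (space M) {})"
    by (auto simp: subalgebra_def space_measure_of_conv sets_measure_of sigma_sets_empty_eq)
  show "sets (generation pos 0 \<omega>) = sets borel" for \<omega> by (simp add: generation_def)
  show "sets (background_intensity X lam) = sets borel" by (simp add: background_eq)
  show mN: "(\<lambda>\<omega>. emeasure (generation pos 0 \<omega>) B) \<in> borel_measurable M" if "B \<in> sets borel" for B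
  proof -
    have "emeasure (generation pos 0 \<omega>) B = Z 0 (indicator B) \<omega>" for \<omega>
      using nn_integral_generation[of "indicator B" 0 \<omega>] that by (simp add: generation_def)
    then show ?thesis using that by simp
  qed
  show "incseq E" "\<And>n. E n \<in> sets borel" "(\<Union>n. E n) = UNIV" by (fact E_props)+
  show "emeasure (background_intensity X lam) (E n) < \<infinity>" for n
  proof -
    have "emeasure (background_intensity X lam) (E n) = (\<integral>\<^sup>+z. lamX (fst z) * indicator (E n) z \<partial>lborel)"
      unfolding background_eq using E_props(2) by (subst emeasure_density) auto
    also have "\<dots> = (\<integral>\<^sup>+x. \<integral>\<^sup>+t. lamX x * indicator (E n) (x, t) \<partial>lborel \<partial>lborel)"
      using E_props(2)[of n] by (subst nn_integral_lborel_pair(1)) auto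
    also have "\<dots> = (\<integral>\<^sup>+x. \<integral>\<^sup>+t. lamX x * indicator {- real n..real n} t \<partial>lborel \<partial>lborel)"
      by (intro nn_integral_cong) (auto simp: E_def indicator_def)
    also have "\<dots> = (\<integral>\<^sup>+x. lamX x \<partial>lborel) * ennreal (2 * real n)"
      by (simp add: nn_integral_cmult nn_integral_multc)
    also have "\<dots> < \<infinity>" using m_lam by (simp add: m_lam_eq ennreal_mult_less_top)
    finally show ?thesis .
  qed
  fix U :: "unit set" and \<B> :: "('a \<times> real) set set" and H and m :: "unit \<Rightarrow> ('a \<times> real) set \<Rightarrow> nat"
  assume U: "finite U" "U \<subseteq> {()}" and \<B>: "finite \<B>" "\<B> \<subseteq> sets borel" "disjoint \<B>" and H: "H \<in> sets (sigma (space M) {})"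
  have H': "H = {} \<or> H = space M" using H by (auto simp: sets_measure_of sigma_sets_empty_eq)
  have U': "U = {} \<or> U = {()}" using U by blast
  have "measure M {\<omega> \<in> space M. \<forall>B\<in>\<B>. emeasure (generation pos 0 \<omega>) B = of_nat (m () B)} =
      (\<Prod>B\<in>\<B>. poisson_mass (emeasure (background_intensity X lam) B) (m () B))"
    using construction \<B> unfolding hawkes_construction_def poisson_process_def by blast
  then have e: "emeasure M {\<omega> \<in> space M. \<forall>B\<in>\<B>. emeasure (generation pos 0 \<omega>) B = of_nat (m () B)} =
      (\<Prod>B\<in>\<B>. ennreal (poisson_mass (emeasure (background_intensity X lam) B) (m () B)))"
    by (simp add: emeasure_eq_measure prod_ennreal)
  show "emeasure M {\<omega>\<in>H. \<forall>u\<in>U. \<forall>B\<in>\<B>. emeasure (generation pos 0 \<omega>) B = of_nat (m u B)} =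
     (\<integral>\<^sup>+\<omega>\<in>H. (\<Prod>u\<in>U. \<Prod>B\<in>\<B>. ennreal (poisson_mass (emeasure (background_intensity X lam) B) (m u B))) \<partial>M)"
    using H' U' by (auto simp: e emeasure_space_1 nn_integral_cmult_indicator)
qed auto

end

lemma nnlin_cong:
  assumes \<Phi>: "nnlin \<Phi>" and eq: "\<And>f. f \<in> borel_measurable borel \<Longrightarrow> \<Phi> f = \<Psi> f"
  shows "nnlin \<Psi>"
  unfolding nnlin_def
proof (intro conjI ballI allI impI)
  fix f g :: "'a \<Rightarrow> ennreal" assume [measurable]: "f \<in> borel_measurable borel" "g \<in> borel_measurable borel"
  show "\<Psi> (\<lambda>x. f x + g x) = \<Psi> f + \<Psi> g"
    using nnlinD(1)[OF \<Phi>, of f g] by (simp add: eq)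
next
  fix c and f :: "'a \<Rightarrow> ennreal" assume [measurable]: "f \<in> borel_measurable borel"
  show "\<Psi> (\<lambda>x. c * f x) = c * \<Psi> f"
    using nnlinD(2)[OF \<Phi>, of f c] by (simp add: eq)
next
  fix U :: "nat \<Rightarrow> 'a \<Rightarrow> ennreal" and f
  assume *: "(\<forall>i. U i \<in> borel_measurable borel) \<and> incseq U \<and> (\<forall>x. f x = (SUP i. U i x))"
  then have [measurable]: "U i \<in> borel_measurable borel" for i by blast
  have f: "f = (\<lambda>x. SUP i. U i x)" using * by auto
  have [measurable]: "f \<in> borel_measurable borel" unfolding f by measurable
  have "\<Phi> f = (SUP i. \<Phi> (U i))" using * by (intro nnlinD(3)[OF \<Phi>]) auto
  then show "\<Psi> f = (SUP i. \<Psi> (U i))" by (simp add: eq)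
  have "incseq (\<lambda>i. \<Phi> (U i))" using * by (intro nnlinD(4)[OF \<Phi>]) auto
  then show "incseq (\<lambda>i. \<Psi> (U i))" by (simp add: eq)
qed

lemma incseq_sum_atMost_ennreal: "incseq (\<lambda>n. \<Sum>k\<le>n. (f k :: ennreal))"
  by (auto simp: incseq_Suc_iff intro: add_increasing2)

lemma LIMSEQ_sum_atMost_ennreal: "(\<lambda>n. \<Sum>k\<le>n. (f k :: ennreal)) \<longlonglongrightarrow> (\<Sum>k. f k)"
  using summable_LIMSEQ'[of f] by simp

context hawkes_data
begin

lemma nnlin_L0: "nnlin L0"
proof -
  have "nnlin (\<lambda>f. \<integral>\<^sup>+z. f z \<partial>background_intensity X lam)"
    by (rule nnlin_nn_integral) (simp add: background_eq)
  then show ?thesis by (rule nnlin_cong) (rule nn_integral_background)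
qed

lemma nnlin_K: "nnlin (\<lambda>f. K f p)"
proof -
  have "nnlin (\<lambda>f. \<integral>\<^sup>+z. f z \<partial>density lborel (\<lambda>z. gX (fst p) (fst z) (snd z - snd p)))"
    by (rule nnlin_nn_integral) simp
  then show ?thesis
    by (rule nnlin_cong) (simp add: K_def nn_integral_density)
qed

lemma nnlin_K_pow: "nnlin (\<lambda>f. (K ^^ k) f p)"
proof (induction k arbitrary: p)
  case 0
  then show ?case using nnlin_eval_mult[of p 1] by simp
next
  case (Suc k)
  have "nnlin (\<lambda>f. K ((K ^^ k) f) p)"
    using Suc.IH by (intro nnlin_comp[OF nnlin_K]) auto
  then show ?case by simp
qed

lemma nnlin_L0_K_pow: "nnlin (\<lambda>f. L0 ((K ^^ k) f))"
  by (intro nnlin_comp[OF nnlin_L0] nnlin_K_pow) auto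

lemma L0_GG: "f \<in> borel_measurable borel \<Longrightarrow> L0 (GG f) = (\<Sum>k. L0 ((K ^^ k) f))"
  unfolding L0_def GG_def by (subst ennreal_suminf_cmult[symmetric], subst nn_integral_suminf) auto

text \<open>The iterate \<open>(pushf f ^^ j) h\<close> is \<open>f + K f + \<dots> + (K ^^ (j - 1)) f + (K ^^ j) h\<close>.\<close>

definition pushf :: "('a \<times> real \<Rightarrow> ennreal) \<Rightarrow> ('a \<times> real \<Rightarrow> ennreal) \<Rightarrow> 'a \<times> real \<Rightarrow> ennreal" where
  "pushf f h = (\<lambda>z. f z + K h z)"

lemma pushf_measurable [measurable]:
  assumes [measurable]: "f \<in> borel_measurable borel" "h \<in> borel_measurable borel"
  shows "pushf f h \<in> borel_measurable borel"
  unfolding pushf_def by measurable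

lemma K_sum:
  assumes "\<And>i. i \<in> A \<Longrightarrow> f i \<in> borel_measurable borel"
  shows "K (\<lambda>z. \<Sum>i\<in>A. f i z) p = (\<Sum>i\<in>A. K (f i) p)"
  unfolding K_def using assms by (subst nn_integral_sum[symmetric]) (auto simp: sum_distrib_left)

lemma pushf_pow:
  assumes [measurable]: "f \<in> borel_measurable borel"
  shows "(pushf f ^^ j) f = (\<lambda>z. \<Sum>k\<le>j. (K ^^ k) f z)"
proof (induction j)
  case (Suc j)
  have "(pushf f ^^ Suc j) f = (\<lambda>z. f z + (\<Sum>k\<le>j. (K ^^ Suc k) f z))"
    by (simp add: Suc pushf_def K_sum)
  also have "\<dots> = (\<lambda>z. \<Sum>k\<le>Suc j. (K ^^ k) f z)"
    by (simp only: sum.atMost_Suc_shift) simp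
  finally show ?case .
qed simp

text \<open>The iterate \<open>(lapf f ^^ n)\<close>, started at 0 and evaluated at
  \<open>z\<close>, is minus the logarithm of the Laplace functional of the first \<open>n\<close>
  generations in the cluster of a point at \<open>z\<close>, this point being the first
  generation.\<close>

definition lapf :: "('a \<times> real \<Rightarrow> ennreal) \<Rightarrow> ('a \<times> real \<Rightarrow> ennreal) \<Rightarrow> 'a \<times> real \<Rightarrow> ennreal" where
  "lapf f h = (\<lambda>z. f z + K (\<lambda>z. 1 - nexp (h z)) z)"

lemma lapf_measurable [measurable]:
  assumes [measurable]: "f \<in> borel_measurable borel" "h \<in> borel_measurable borel"
  shows "lapf f h \<in> borel_measurable borel"
  unfolding lapf_def by measurable

lemma lapf_pow_measurable [measurable]:
  "f \<in> borel_measurable borel \<Longrightarrow> h \<in> borel_measurable borel \<Longrightarrow> (lapf f ^^ j) h \<in> borel_measurable borel"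
  by (induction j) auto

end

section \<open>Laplace functionals and moments of finitely many generations, and their
  limits\<close>

context hawkes
begin

lemma offspring_total:
  assumes f: "f \<in> borel_measurable borel"
  shows "(\<integral>\<^sup>+u. \<integral>\<^sup>+z. f z \<partial>offspring pos u \<omega> \<partial>count_space {u. length u = Suc k}) = Z (Suc k) f \<omega>"
  unfolding Z_def nn_integral_count_space_snoc[where n="Suc k", symmetric]
  using f by (simp add: offspring_def nn_integral_point_measure)

lemma offspring_intensity_total:
  assumes f: "f \<in> borel_measurable borel" and \<omega>: "\<omega> \<in> space M"
  shows "(\<integral>\<^sup>+u. \<integral>\<^sup>+z. f z \<partial>offspring_intensity X g (pos u \<omega>) \<partial>count_space {u. length u = Suc k}) = Z k (K f) \<omega>"
  unfolding Z_def
proof (rule nn_integral_cong)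
  fix u assume "u \<in> space (count_space {u :: nat list. length u = Suc k})"
  then have "u \<noteq> []" by auto
  then show "(\<integral>\<^sup>+z. f z \<partial>offspring_intensity X g (pos u \<omega>)) = oapp (K f) (pos u \<omega>)"
    using pos_X \<omega> by (intro nn_integral_offspring_intensity f) blast
qed

lemma Z_add: "f \<in> borel_measurable borel \<Longrightarrow> h \<in> borel_measurable borel \<Longrightarrow> Z k (\<lambda>z. f z + h z) \<omega> = Z k f \<omega> + Z k h \<omega>"
  by (rule nnlinD(1)[OF nnlin_Z])

lemma laplace_step:
  assumes f [measurable]: "f \<in> borel_measurable borel" and Y: "Y \<in> borel_measurable (hist k)" "\<And>\<omega>. Y \<omega> \<le> 1"
  shows "(\<integral>\<^sup>+\<omega>. Y \<omega> * nexp (Z (Suc k) f \<omega>) \<partial>M) = (\<integral>\<^sup>+\<omega>. Y \<omega> * nexp (Z k (K (\<lambda>z. 1 - nexp (f z))) \<omega>) \<partial>M)"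
proof -
  have "(\<integral>\<^sup>+\<omega>. Y \<omega> * nexp (Z (Suc k) f \<omega>) \<partial>M) =
     (\<integral>\<^sup>+\<omega>. Y \<omega> * nexp (\<integral>\<^sup>+u. \<integral>\<^sup>+z. 1 - nexp (f z) \<partial>offspring_intensity X g (pos u \<omega>) \<partial>count_space {u. length u = Suc k}) \<partial>M)"
    using cond_poisson.laplace[OF cond_poisson_offspring f Y] by (simp only: offspring_total[OF f])
  also have "\<dots> = (\<integral>\<^sup>+\<omega>. Y \<omega> * nexp (Z k (K (\<lambda>z. 1 - nexp (f z))) \<omega>) \<partial>M)"
    by (intro nn_integral_cong) (simp add: offspring_intensity_total)
  finally show ?thesis .
qed

lemma mean_step:
  assumes f [measurable]: "f \<in> borel_measurable borel" and Y: "Y \<in> borel_measurable (hist k)"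
  shows "(\<integral>\<^sup>+\<omega>. Y \<omega> * Z (Suc k) f \<omega> \<partial>M) = (\<integral>\<^sup>+\<omega>. Y \<omega> * Z k (K f) \<omega> \<partial>M)"
proof -
  have "(\<integral>\<^sup>+\<omega>. Y \<omega> * Z (Suc k) f \<omega> \<partial>M) =
     (\<integral>\<^sup>+\<omega>. Y \<omega> * (\<integral>\<^sup>+u. \<integral>\<^sup>+z. f z \<partial>offspring_intensity X g (pos u \<omega>) \<partial>count_space {u. length u = Suc k}) \<partial>M)"
    using cond_poisson.mean_total[OF cond_poisson_offspring f Y] by (simp only: offspring_total[OF f])
  also have "\<dots> = (\<integral>\<^sup>+\<omega>. Y \<omega> * Z k (K f) \<omega> \<partial>M)"
    by (intro nn_integral_cong) (simp add: offspring_intensity_total)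
  finally show ?thesis .
qed

text \<open>Conditionally on the history the new generation is Poisson: distinct points contribute
  the product of the conditional means, and the last term pairs each new point with itself.\<close>

lemma second_step:
  assumes f [measurable]: "f \<in> borel_measurable borel" and h [measurable]: "h \<in> borel_measurable borel"
  shows "(\<integral>\<^sup>+\<omega>. Z (Suc k) f \<omega> * Z (Suc k) h \<omega> \<partial>M) =
    (\<integral>\<^sup>+\<omega>. Z k (K f) \<omega> * Z k (K h) \<omega> \<partial>M) + (\<integral>\<^sup>+\<omega>. Z k (K (\<lambda>z. f z * h z)) \<omega> \<partial>M)"
proof -
  have 1: "(\<lambda>_. 1) \<in> borel_measurable (hist k)" by simp
  have fh: "(\<lambda>z. f z * h z) \<in> borel_measurable borel" by measurable
  let ?L = "\<lambda>f \<omega>. \<integral>\<^sup>+u. \<integral>\<^sup>+z. f z \<partial>offspring_intensity X g (pos u \<omega>) \<partial>count_space {u. length u = Suc k}"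
  have "(\<integral>\<^sup>+\<omega>. Z (Suc k) f \<omega> * Z (Suc k) h \<omega> \<partial>M) =
     (\<integral>\<^sup>+\<omega>. ?L f \<omega> * ?L h \<omega> \<partial>M) + (\<integral>\<^sup>+\<omega>. ?L (\<lambda>z. f z * h z) \<omega> \<partial>M)"
    using cond_poisson.second_total[OF cond_poisson_offspring f h 1]
    unfolding offspring_total[OF f] offspring_total[OF h] by simp
  also have "\<dots> = (\<integral>\<^sup>+\<omega>. Z k (K f) \<omega> * Z k (K h) \<omega> \<partial>M) + (\<integral>\<^sup>+\<omega>. Z k (K (\<lambda>z. f z * h z)) \<omega> \<partial>M)"
    by (intro arg_cong2[where f="(+)"] nn_integral_cong)
      (simp_all only: offspring_intensity_total[OF f] offspring_intensity_total[OF h] offspring_intensity_total[OF fh])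
  finally show ?thesis .
qed

lemma background_step:
  assumes f [measurable]: "f \<in> borel_measurable borel" and h [measurable]: "h \<in> borel_measurable borel"
  shows laplace_0: "(\<integral>\<^sup>+\<omega>. nexp (Z 0 f \<omega>) \<partial>M) = nexp (L0 (\<lambda>z. 1 - nexp (f z)))"
    and mean_0: "(\<integral>\<^sup>+\<omega>. Z 0 f \<omega> \<partial>M) = L0 f"
    and second_0: "(\<integral>\<^sup>+\<omega>. Z 0 f \<omega> * Z 0 h \<omega> \<partial>M) = L0 f * L0 h + L0 (\<lambda>z. f z * h z)"
proof -
  have 1: "(\<lambda>_. 1) \<in> borel_measurable (sigma (space M) {})" by simp
  note * = nn_integral_count_space_finite nn_integral_generation nn_integral_background emeasure_space_1
  show "(\<integral>\<^sup>+\<omega>. nexp (Z 0 f \<omega>) \<partial>M) = nexp (L0 (\<lambda>z. 1 - nexp (f z)))"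
    using cond_poisson.laplace[OF cond_poisson_background f 1] by (simp add: *)
  show "(\<integral>\<^sup>+\<omega>. Z 0 f \<omega> \<partial>M) = L0 f"
    using cond_poisson.mean_total[OF cond_poisson_background f 1] by (simp add: *)
  show "(\<integral>\<^sup>+\<omega>. Z 0 f \<omega> * Z 0 h \<omega> \<partial>M) = L0 f * L0 h + L0 (\<lambda>z. f z * h z)"
    using cond_poisson.second_total[OF cond_poisson_background f h 1] by (simp add: *)
qed

lemma mean_Z:
  assumes "f \<in> borel_measurable borel"
  shows "(\<integral>\<^sup>+\<omega>. Z k f \<omega> \<partial>M) = L0 ((K ^^ k) f)"
  using assms
proof (induction k arbitrary: f)
  case 0
  then show ?case by (simp add: mean_0)
next
  case (Suc k)
  have "(\<integral>\<^sup>+\<omega>. Z (Suc k) f \<omega> \<partial>M) = (\<integral>\<^sup>+\<omega>. Z k (K f) \<omega> \<partial>M)"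
    using mean_step[OF Suc.prems, of "\<lambda>_. 1" k] by simp
  then show ?case using Suc by (simp add: funpow_swap1)
qed

text \<open>The last generation is integrated out, which changes the test function on the generation
  before.\<close>

lemma laplace_generations:
  assumes [measurable]: "f \<in> borel_measurable borel" "h \<in> borel_measurable borel"
  shows "(\<integral>\<^sup>+\<omega>. nexp ((\<Sum>k<n. Z k f \<omega>) + Z n h \<omega>) \<partial>M) = nexp (L0 (\<lambda>z. 1 - nexp ((lapf f ^^ n) h z)))"
  using assms(2)
proof (induction n arbitrary: h)
  case 0
  then show ?case by (simp add: laplace_0)
next
  case (Suc n)
  note [measurable] = Suc.prems
  have m: "(\<lambda>\<omega>. nexp (\<Sum>k<Suc n. Z k f \<omega>)) \<in> borel_measurable (hist n)"
    using Z_hist[of _ n f]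
    by (intro measurable_compose[OF _ nexp_measurable] borel_measurable_sum) (auto simp: less_Suc_eq_le)
  have "(\<integral>\<^sup>+\<omega>. nexp ((\<Sum>k<Suc n. Z k f \<omega>) + Z (Suc n) h \<omega>) \<partial>M) =
      (\<integral>\<^sup>+\<omega>. nexp (\<Sum>k<Suc n. Z k f \<omega>) * nexp (Z n (K (\<lambda>z. 1 - nexp (h z))) \<omega>) \<partial>M)"
    unfolding nexp_add by (rule laplace_step[OF Suc.prems m nexp_le_1])
  also have "\<dots> = (\<integral>\<^sup>+\<omega>. nexp ((\<Sum>k<n. Z k f \<omega>) + Z n (lapf f h) \<omega>) \<partial>M)"
    unfolding lapf_def by (intro nn_integral_cong) (simp add: nexp_add Z_add mult.assoc)
  also have "\<dots> = nexp (L0 (\<lambda>z. 1 - nexp ((lapf f ^^ n) (lapf f h) z)))"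
    by (rule Suc.IH) measurable
  finally show ?case by (simp add: funpow_swap1)
qed

text \<open>After \<open>j\<close> generations have been integrated out, generation
  \<open>n - j\<close> carries the test functions \<open>(pushf f ^^ j) f'\<close> and
  \<open>(pushf h ^^ j) h'\<close>. The summand for \<open>j\<close> comes from the points of this
  generation paired with themselves, that is, from pairs of points whose last common ancestor
  belongs to this generation.\<close>

lemma second_generations:
  assumes [measurable]: "f \<in> borel_measurable borel" "h \<in> borel_measurable borel"
    and "f' \<in> borel_measurable borel" "h' \<in> borel_measurable borel"
  shows "(\<integral>\<^sup>+\<omega>. ((\<Sum>k<n. Z k f \<omega>) + Z n f' \<omega>) * ((\<Sum>k<n. Z k h \<omega>) + Z n h' \<omega>) \<partial>M) =
    L0 ((pushf f ^^ n) f') * L0 ((pushf h ^^ n) h') +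
    (\<Sum>j\<le>n. L0 ((K ^^ (n - j)) (\<lambda>z. (pushf f ^^ j) f' z * (pushf h ^^ j) h' z)))"
  using assms(3,4)
proof (induction n arbitrary: f' h')
  case 0
  then show ?case by (simp add: second_0)
next
  case (Suc n)
  note [measurable] = Suc.prems
  let ?A = "\<lambda>\<omega>. \<Sum>k<Suc n. Z k f \<omega>" and ?B = "\<lambda>\<omega>. \<Sum>k<Suc n. Z k h \<omega>"
  have A: "?A \<in> borel_measurable (hist n)" and B: "?B \<in> borel_measurable (hist n)"
    using Z_hist[of _ n f] Z_hist[of _ n h]
    by (auto intro!: borel_measurable_sum simp: less_Suc_eq_le)
  have AM [measurable]: "?A \<in> borel_measurable M" and BM [measurable]: "?B \<in> borel_measurable M" by auto
  \<comment> \<open>The earlier generations are functions of the history. The last one occurs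
    linearly in the mixed terms, where \<open>mean_step\<close> applies, and quadratically in the
    last term only, where \<open>second_step\<close> adds the new summand; then the product is
    folded back.\<close>
  have expand: "(a + x) * (b + y) = a * b + (a * y + (b * x + x * y))" for a b x y :: ennreal
    by (simp add: distrib_left distrib_right ac_simps)
  have "(\<integral>\<^sup>+\<omega>. (?A \<omega> + Z (Suc n) f' \<omega>) * (?B \<omega> + Z (Suc n) h' \<omega>) \<partial>M) =
      (\<integral>\<^sup>+\<omega>. ?A \<omega> * ?B \<omega> \<partial>M) + ((\<integral>\<^sup>+\<omega>. ?A \<omega> * Z (Suc n) h' \<omega> \<partial>M) +
        ((\<integral>\<^sup>+\<omega>. ?B \<omega> * Z (Suc n) f' \<omega> \<partial>M) + (\<integral>\<^sup>+\<omega>. Z (Suc n) f' \<omega> * Z (Suc n) h' \<omega> \<partial>M)))"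
    unfolding expand by (simp add: nn_integral_add del: sum.lessThan_Suc)
  also have "\<dots> = (\<integral>\<^sup>+\<omega>. ?A \<omega> * ?B \<omega> \<partial>M) + ((\<integral>\<^sup>+\<omega>. ?A \<omega> * Z n (K h') \<omega> \<partial>M) +
        ((\<integral>\<^sup>+\<omega>. ?B \<omega> * Z n (K f') \<omega> \<partial>M) + ((\<integral>\<^sup>+\<omega>. Z n (K f') \<omega> * Z n (K h') \<omega> \<partial>M) +
          (\<integral>\<^sup>+\<omega>. Z n (K (\<lambda>z. f' z * h' z)) \<omega> \<partial>M))))"
    by (simp only: mean_step[OF Suc.prems(1) B] mean_step[OF Suc.prems(2) A] second_step[OF Suc.prems])
  also have "\<dots> = (\<integral>\<^sup>+\<omega>. (?A \<omega> + Z n (K f') \<omega>) * (?B \<omega> + Z n (K h') \<omega>) \<partial>M) +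
      (\<integral>\<^sup>+\<omega>. Z n (K (\<lambda>z. f' z * h' z)) \<omega> \<partial>M)"
    unfolding expand by (simp add: nn_integral_add add.assoc del: sum.lessThan_Suc)
  also have "(\<integral>\<^sup>+\<omega>. (?A \<omega> + Z n (K f') \<omega>) * (?B \<omega> + Z n (K h') \<omega>) \<partial>M) =
      (\<integral>\<^sup>+\<omega>. ((\<Sum>k<n. Z k f \<omega>) + Z n (pushf f f') \<omega>) * ((\<Sum>k<n. Z k h \<omega>) + Z n (pushf h h') \<omega>) \<partial>M)"
    unfolding pushf_def by (intro nn_integral_cong) (simp add: Z_add add.assoc)
  also have "\<dots> = L0 ((pushf f ^^ n) (pushf f f')) * L0 ((pushf h ^^ n) (pushf h h')) +
    (\<Sum>j\<le>n. L0 ((K ^^ (n - j)) (\<lambda>z. (pushf f ^^ j) (pushf f f') z * (pushf h ^^ j) (pushf h h') z)))"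
    by (rule Suc.IH) measurable
  also have "(\<integral>\<^sup>+\<omega>. Z n (K (\<lambda>z. f' z * h' z)) \<omega> \<partial>M) = L0 ((K ^^ Suc n) (\<lambda>z. f' z * h' z))"
    by (subst mean_Z) (auto simp: funpow_swap1)
  finally show ?case
    by (simp add: sum.atMost_Suc_shift funpow_swap1 ac_simps del: sum.atMost_Suc)
qed

definition XI :: "('a \<times> real \<Rightarrow> ennreal) \<Rightarrow> 'w \<Rightarrow> ennreal" where "XI f \<omega> = (\<Sum>k. Z k f \<omega>)"

lemma XI_measurable [measurable]: "f \<in> borel_measurable borel \<Longrightarrow> XI f \<in> borel_measurable M"
  unfolding XI_def[abs_def] by measurable

lemma nn_integral_hawkes: "f \<in> borel_measurable borel \<Longrightarrow> (\<integral>\<^sup>+z. f z \<partial>hawkes_process pos \<omega>) = XI f \<omega>"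
  unfolding hawkes_process_def XI_def
  by (subst nn_integral_measure_sum) (simp_all add: generation_def nn_integral_generation[unfolded generation_def])

lemma sets_hawkes [simp]: "sets (hawkes_process pos \<omega>) = sets borel"
  by (simp add: hawkes_process_def)

lemma emeasure_hawkes: "B \<in> sets borel \<Longrightarrow> emeasure (hawkes_process pos \<omega>) B = XI (indicator B) \<omega>"
  using nn_integral_hawkes[of "indicator B" \<omega>] by simp

theorem mean_XI:
  assumes f [measurable]: "f \<in> borel_measurable borel"
  shows "(\<integral>\<^sup>+\<omega>. XI f \<omega> \<partial>M) = (\<integral>\<^sup>+x. \<integral>\<^sup>+s. f (x, s) \<partial>lborel \<partial>mu)"
proof -
  have "(\<integral>\<^sup>+\<omega>. XI f \<omega> \<partial>M) = (\<Sum>k. L0 ((K ^^ k) f))"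
    unfolding XI_def by (subst nn_integral_suminf) (auto simp: mean_Z)
  also have "\<dots> = L0 (GG f)" by (simp add: L0_GG)
  finally show ?thesis unfolding L0_def by (simp add: mean_formula)
qed

text \<open>The limit depends on \<open>X\<close>, \<open>lam\<close>, \<open>g\<close> and \<open>f\<close> only, so all constructions have the same law.\<close>

theorem laplace_XI:
  assumes f [measurable]: "f \<in> borel_measurable borel"
  shows "(\<lambda>n. nexp (L0 (\<lambda>z. 1 - nexp ((lapf f ^^ n) (\<lambda>_. 0) z)))) \<longlonglongrightarrow> (\<integral>\<^sup>+\<omega>. nexp (XI f \<omega>) \<partial>M)"
proof -
  have "(\<lambda>n. \<integral>\<^sup>+\<omega>. nexp (\<Sum>k<n. Z k f \<omega>) \<partial>M) \<longlonglongrightarrow> (\<integral>\<^sup>+\<omega>. nexp (XI f \<omega>) \<partial>M)"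
  proof (rule nn_integral_dominated_convergence[where w="\<lambda>_. 1"])
    show "AE \<omega> in M. (\<lambda>n. nexp (\<Sum>k<n. Z k f \<omega>)) \<longlonglongrightarrow> nexp (XI f \<omega>)"
      unfolding XI_def by (intro AE_I2 tendsto_nexp summable_LIMSEQ) simp
  qed (auto simp: nexp_le_1 emeasure_space_1)
  moreover have "(\<integral>\<^sup>+\<omega>. nexp (\<Sum>k<n. Z k f \<omega>) \<partial>M) = nexp (L0 (\<lambda>z. 1 - nexp ((lapf f ^^ n) (\<lambda>_. 0) z)))" for n
  proof -
    \<comment> \<open>With test function 0 on generation \<open>n\<close>, the formula for finitely
      many generations concerns the first \<open>n\<close> of them alone.\<close>
    have "Z n (\<lambda>_. 0) \<omega> = 0" for \<omega>
      using nnlinD(2)[OF nnlin_Z[of n \<omega>], of "\<lambda>_. 0" 0] by simp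
    then show ?thesis using laplace_generations[OF f, of "\<lambda>_. 0" n] by simp
  qed
  ultimately show ?thesis by simp
qed

text \<open>The first term belongs to independent pairs. The second one sums over the last common
  ancestor \<open>(x, s)\<close>: its Poisson offspring makes the mean number of such pairs the
  product of the two cluster means, the ancestor itself being a possible member of the pair.\<close>

theorem second_XI:
  assumes f [measurable]: "f \<in> borel_measurable borel" and h [measurable]: "h \<in> borel_measurable borel"
  shows "(\<integral>\<^sup>+\<omega>. XI f \<omega> * XI h \<omega> \<partial>M) = (\<integral>\<^sup>+x. \<integral>\<^sup>+s. f (x, s) \<partial>lborel \<partial>mu) * (\<integral>\<^sup>+x. \<integral>\<^sup>+s. h (x, s) \<partial>lborel \<partial>mu) +
    (\<integral>\<^sup>+x. \<integral>\<^sup>+s. GG f (x, s) * GG h (x, s) \<partial>lborel \<partial>mu)"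
proof -
  define F where "F n z = (\<Sum>k\<le>n. (K ^^ k) f z)" for n z
  define H where "H n z = (\<Sum>k\<le>n. (K ^^ k) h z)" for n z
  have FH [measurable]: "F n \<in> borel_measurable borel" "H n \<in> borel_measurable borel" for n
    unfolding F_def[abs_def] H_def[abs_def] by measurable
  have inc: "incseq (\<lambda>n. F n z)" "incseq (\<lambda>n. H n z)" for z
    unfolding F_def H_def by (rule incseq_sum_atMost_ennreal)+
  have lim: "(\<lambda>n. F n z) \<longlonglongrightarrow> GG f z" "(\<lambda>n. H n z) \<longlonglongrightarrow> GG h z" for z
    unfolding F_def H_def GG_def by (rule LIMSEQ_sum_atMost_ennreal)+
  \<comment> \<open>Summation by the generation \<open>k = n - j\<close> of the ancestor, instead of
    by \<open>j\<close>, makes each summand increasing in \<open>n\<close>, so that monotone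
    convergence over \<open>k\<close> applies.\<close>
  have eq: "(\<integral>\<^sup>+\<omega>. (\<Sum>k\<le>n. Z k f \<omega>) * (\<Sum>k\<le>n. Z k h \<omega>) \<partial>M) =
      L0 (F n) * L0 (H n) + (\<integral>\<^sup>+k. indicator {..n} k * L0 ((K ^^ k) (\<lambda>z. F (n - k) z * H (n - k) z)) \<partial>count_space UNIV)" for n
  proof -
    have "(\<integral>\<^sup>+\<omega>. (\<Sum>k\<le>n. Z k f \<omega>) * (\<Sum>k\<le>n. Z k h \<omega>) \<partial>M) =
      (\<integral>\<^sup>+\<omega>. ((\<Sum>k<n. Z k f \<omega>) + Z n f \<omega>) * ((\<Sum>k<n. Z k h \<omega>) + Z n h \<omega>) \<partial>M)"
      by (simp add: lessThan_Suc_atMost[symmetric])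
    also have "\<dots> = L0 (F n) * L0 (H n) + (\<Sum>j\<le>n. L0 ((K ^^ (n - j)) (\<lambda>z. F j z * H j z)))"
      using second_generations[OF f h f h, of n] by (simp add: pushf_pow F_def[abs_def] H_def[abs_def])
    also have "(\<Sum>j\<le>n. L0 ((K ^^ (n - j)) (\<lambda>z. F j z * H j z))) =
        (\<Sum>k\<le>n. L0 ((K ^^ k) (\<lambda>z. F (n - k) z * H (n - k) z)))"
      by (rule sum.reindex_bij_witness[of _ "\<lambda>k. n - k" "\<lambda>k. n - k"]) auto
    also have "\<dots> = (\<integral>\<^sup>+k. indicator {..n} k * L0 ((K ^^ k) (\<lambda>z. F (n - k) z * H (n - k) z)) \<partial>count_space UNIV)"
      by (subst nn_integral_count_space'[of "{..n}"]) (auto simp: indicator_def)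
    finally show ?thesis .
  qed
  have 1: "(\<lambda>n. \<integral>\<^sup>+\<omega>. (\<Sum>k\<le>n. Z k f \<omega>) * (\<Sum>k\<le>n. Z k h \<omega>) \<partial>M) \<longlonglongrightarrow> (\<integral>\<^sup>+\<omega>. XI f \<omega> * XI h \<omega> \<partial>M)"
    unfolding XI_def
  proof (rule nn_integral_LIMSEQ)
    show "incseq (\<lambda>n \<omega>. (\<Sum>k\<le>n. Z k f \<omega>) * (\<Sum>k\<le>n. Z k h \<omega>))"
      using incseq_sum_atMost_ennreal by (auto simp: incseq_def le_fun_def intro!: mult_mono)
    show "(\<lambda>n. (\<Sum>k\<le>n. Z k f \<omega>) * (\<Sum>k\<le>n. Z k h \<omega>)) \<longlonglongrightarrow> (\<Sum>k. Z k f \<omega>) * (\<Sum>k. Z k h \<omega>)" for \<omega>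
      by (intro ennreal_LIMSEQ_mult_incseq incseq_sum_atMost_ennreal LIMSEQ_sum_atMost_ennreal)
  qed measurable
  \<comment> \<open>Both \<open>L0\<close> and its compositions with powers of \<open>K\<close> are
    \<open>nnlin\<close>, so all of them pass to increasing limits.\<close>
  have lin: "incseq (\<lambda>n. \<Phi> (a n))" "(\<lambda>n. \<Phi> (a n)) \<longlonglongrightarrow> \<Phi> b"
    if \<Phi>: "nnlin \<Phi>" and a: "\<And>n. a n \<in> borel_measurable borel" "\<And>z. incseq (\<lambda>n. a n z)" "\<And>z. (\<lambda>n. a n z) \<longlonglongrightarrow> b z"
    for \<Phi> :: "('a \<times> real \<Rightarrow> ennreal) \<Rightarrow> ennreal" and a b
  proof -
    have ia: "incseq a" using a(2) by (auto simp: incseq_def le_fun_def)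
    show i: "incseq (\<lambda>n. \<Phi> (a n))" by (rule nnlinD(4)[OF \<Phi> a(1) ia])
    have "b z = (SUP n. a n z)" for z using LIMSEQ_unique[OF a(3) LIMSEQ_SUP[OF a(2)]] .
    then have "\<Phi> b = (SUP n. \<Phi> (a n))" by (intro nnlinD(3)[OF \<Phi> a(1) ia])
    then show "(\<lambda>n. \<Phi> (a n)) \<longlonglongrightarrow> \<Phi> b" using LIMSEQ_SUP[OF i] by simp
  qed
  have 2: "(\<lambda>n. L0 (F n) * L0 (H n)) \<longlonglongrightarrow> L0 (GG f) * L0 (GG h)"
    by (intro ennreal_LIMSEQ_mult_incseq lin[OF nnlin_L0 FH(1) inc(1) lim(1)] lin[OF nnlin_L0 FH(2) inc(2) lim(2)])
  have 3: "(\<lambda>n. \<integral>\<^sup>+k. indicator {..n} k * L0 ((K ^^ k) (\<lambda>z. F (n - k) z * H (n - k) z)) \<partial>count_space UNIV) \<longlonglongrightarrow>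
      (\<integral>\<^sup>+k. L0 ((K ^^ k) (\<lambda>z. GG f z * GG h z)) \<partial>count_space UNIV)"
  proof (rule nn_integral_LIMSEQ)
    have prod_inc: "incseq (\<lambda>n. F n z * H n z)" for z
      using inc[of z] by (auto simp: incseq_def intro!: mult_mono)
    have l: "incseq (\<lambda>n. L0 ((K ^^ k) (\<lambda>z. F n z * H n z)))"
        "(\<lambda>n. L0 ((K ^^ k) (\<lambda>z. F n z * H n z))) \<longlonglongrightarrow> L0 ((K ^^ k) (\<lambda>z. GG f z * GG h z))" for k
    proof -
      have m: "(\<lambda>z. F n z * H n z) \<in> borel_measurable borel" for n by measurable
      have li: "(\<lambda>n. F n z * H n z) \<longlonglongrightarrow> GG f z * GG h z" for z
        by (intro ennreal_LIMSEQ_mult_incseq inc lim)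
      show "incseq (\<lambda>n. L0 ((K ^^ k) (\<lambda>z. F n z * H n z)))"
        by (rule lin(1)[OF nnlin_L0_K_pow m prod_inc li])
      show "(\<lambda>n. L0 ((K ^^ k) (\<lambda>z. F n z * H n z))) \<longlonglongrightarrow> L0 ((K ^^ k) (\<lambda>z. GG f z * GG h z))"
        by (rule lin(2)[OF nnlin_L0_K_pow m prod_inc li])
    qed
    have "L0 ((K ^^ k) (\<lambda>z. F (n - k) z * H (n - k) z)) \<le> L0 ((K ^^ k) (\<lambda>z. F (m - k) z * H (m - k) z))"
      if "n \<le> m" for n m k
      using l(1)[of k] that by (auto simp: incseq_def)
    then show "incseq (\<lambda>n k. indicator {..n} k * L0 ((K ^^ k) (\<lambda>z. F (n - k) z * H (n - k) z)))"
      by (auto simp: incseq_def le_fun_def indicator_def)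
    show "(\<lambda>n. indicator {..n} k * L0 ((K ^^ k) (\<lambda>z. F (n - k) z * H (n - k) z))) \<longlonglongrightarrow>
        L0 ((K ^^ k) (\<lambda>z. GG f z * GG h z))" for k
    \<comment> \<open>The summand is absent while \<open>n < k\<close>; from \<open>n = k\<close>
      on, it runs through the sequence at \<open>n - k\<close>.\<close>
    proof (rule LIMSEQ_offset[of _ k])
      have "(\<lambda>n. indicator {..n + k} k * L0 ((K ^^ k) (\<lambda>z. F (n + k - k) z * H (n + k - k) z))) =
          (\<lambda>n. L0 ((K ^^ k) (\<lambda>z. F n z * H n z)))" by (simp add: indicator_def)
      then show "(\<lambda>n. indicator {..n + k} k * L0 ((K ^^ k) (\<lambda>z. F (n + k - k) z * H (n + k - k) z))) \<longlonglongrightarrow>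
          L0 ((K ^^ k) (\<lambda>z. GG f z * GG h z))"
        using l(2)[of k] by (simp only:)
    qed
  qed auto
  have "(\<integral>\<^sup>+\<omega>. XI f \<omega> * XI h \<omega> \<partial>M) = L0 (GG f) * L0 (GG h) + L0 (GG (\<lambda>z. GG f z * GG h z))"
    using LIMSEQ_unique[OF 1] tendsto_add[OF 2 3] by (simp add: eq nn_integral_count_space_nat L0_GG)
  then show ?thesis
    by (simp add: L0_def mean_formula)
qed

end

lemma suminf_indicator_length:
  "(\<Sum>k. indicator {u. length u = Suc k} u) = (indicator {u. u \<noteq> []} u :: ennreal)"
proof (cases "u = []")
  case False
  have "(\<Sum>k. indicator {u. length u = Suc k} u) = (\<Sum>k\<in>{length u - 1}. indicator {u. length u = Suc k} u :: ennreal)"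
    by (intro suminf_finite) (auto simp: indicator_def)
  then show ?thesis using False by (simp add: indicator_def)
qed simp

lemma emeasure_count_space_of_nat: "emeasure (count_space UNIV) A \<in> insert top (range of_nat)"
  by (cases "finite A") (auto simp: emeasure_count_space)

section \<open>The algebra of measures\<close>

lemma space_measure_algebra: "space measure_algebra = {N. sets N = sets (borel :: 'b::topological_space measure)}"
  unfolding measure_algebra_def by (rule space_measure_of) auto

lemma sets_measure_algebra: "sets (measure_algebra :: 'b::topological_space measure measure) =
    sigma_sets {N. sets N = sets borel} {{N. sets N = sets borel \<and> emeasure N B \<in> C} | B C. B \<in> sets borel \<and> C \<in> sets borel}"
  unfolding measure_algebra_def by (rule sets_measure_of) auto

lemma measurable_measure_algebra:
  fixes \<Xi> :: "'w \<Rightarrow> 'b::topological_space measure"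
  assumes "\<And>\<omega>. sets (\<Xi> \<omega>) = sets borel"
    and m: "\<And>B. B \<in> sets borel \<Longrightarrow> (\<lambda>\<omega>. emeasure (\<Xi> \<omega>) B) \<in> borel_measurable M"
  shows "\<Xi> \<in> measurable M measure_algebra"
proof (rule measurable_sigma_sets[OF sets_measure_algebra])
  fix Y :: "'b measure set"
  assume "Y \<in> {{N. sets N = sets borel \<and> emeasure N B \<in> C} | B C. B \<in> sets borel \<and> C \<in> sets borel}"
  then obtain B C where Y: "Y = {N. sets N = sets borel \<and> emeasure N B \<in> C}" "B \<in> sets borel" "C \<in> sets borel" by blast
  have "\<Xi> -` Y \<inter> space M = (\<lambda>\<omega>. emeasure (\<Xi> \<omega>) B) -` C \<inter> space M" using assms Y by auto
  also have "\<dots> \<in> sets M" using m[OF Y(2)] Y(3) by (rule measurable_sets)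
  finally show "\<Xi> -` Y \<inter> space M \<in> sets M" .
qed (use assms in auto)

text \<open>Finitely many evaluations are prescribed at a time, which makes the family stable under
  intersection by concatenating the index ranges.\<close>

definition cylinders :: "'b::topological_space measure set set" where
  "cylinders = {{N. sets N = sets borel \<and> (\<forall>j<n. emeasure N (B j) \<in> C j)} | (n::nat) B C.
     (\<forall>j. B j \<in> sets borel \<and> C j \<in> sets borel)}"

lemma cylindersI:
  "(\<And>j. B j \<in> sets borel) \<Longrightarrow> (\<And>j. C j \<in> sets borel) \<Longrightarrow>
    {N. sets N = sets borel \<and> (\<forall>j<n::nat. emeasure N (B j) \<in> C j)} \<in> cylinders"
  unfolding cylinders_def by (rule CollectI, rule exI[of _ n], rule exI[of _ B], rule exI[of _ C]) simp

lemma cylindersE: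
  assumes "a \<in> cylinders"
  obtains n :: nat and B C where "a = {N. sets N = sets borel \<and> (\<forall>j<n. emeasure N (B j) \<in> C j)}"
    "\<forall>j. B j \<in> sets borel" "\<forall>j. C j \<in> sets borel"
  using assms unfolding cylinders_def by (elim CollectE exE conjE) auto

lemma Int_stable_cylinders: "Int_stable (cylinders :: 'b::topological_space measure set set)"
proof (rule Int_stableI)
  fix a b :: "'b measure set" assume "a \<in> cylinders" "b \<in> cylinders"
  from \<open>a \<in> cylinders\<close> obtain n :: nat and B C where
    a: "a = {N. sets N = sets borel \<and> (\<forall>j<n. emeasure N (B j) \<in> C j)}" "\<forall>j. B j \<in> sets borel" "\<forall>j. C j \<in> sets borel"
    by (rule cylindersE)
  from \<open>b \<in> cylinders\<close> obtain n' :: nat and B' C' where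
    b: "b = {N. sets N = sets borel \<and> (\<forall>j<n'. emeasure N (B' j) \<in> C' j)}" "\<forall>j. B' j \<in> sets borel" "\<forall>j. C' j \<in> sets borel"
    by (rule cylindersE)
  define B'' where "B'' j = (if j < n then B j else B' (j - n))" for j
  define C'' where "C'' j = (if j < n then C j else C' (j - n))" for j
  have "(\<forall>j<n+n'. emeasure N (B'' j) \<in> C'' j) \<longleftrightarrow> (\<forall>j<n. emeasure N (B j) \<in> C j) \<and> (\<forall>j<n'. emeasure N (B' j) \<in> C' j)" for N
  proof
    assume *: "\<forall>j<n+n'. emeasure N (B'' j) \<in> C'' j"
    have "emeasure N (B' j) \<in> C' j" if "j < n'" for j
      using *[rule_format, of "n + j"] that by (simp add: B''_def C''_def)
    moreover have "emeasure N (B j) \<in> C j" if "j < n" for j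
      using *[rule_format, of j] that by (simp add: B''_def C''_def)
    ultimately show "(\<forall>j<n. emeasure N (B j) \<in> C j) \<and> (\<forall>j<n'. emeasure N (B' j) \<in> C' j)" by blast
  qed (auto simp: B''_def C''_def)
  then have "a \<inter> b = {N. sets N = sets borel \<and> (\<forall>j<n+n'. emeasure N (B'' j) \<in> C'' j)}"
    using a b by auto
  moreover have "B'' j \<in> sets borel" "C'' j \<in> sets borel" for j
    using a(2,3) b(2,3) by (simp_all add: B''_def C''_def)
  ultimately show "a \<inter> b \<in> cylinders" using cylindersI[of B'' C'' "n + n'"] by simp
qed

lemma sets_measure_algebra_cylinders:
  "sets (measure_algebra :: 'b::topological_space measure measure) = sigma_sets {N. sets N = sets borel} cylinders"
proof -
  let ?\<Omega> = "{N. sets N = sets (borel :: 'b measure)}"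
  let ?G = "{{N. sets N = sets (borel :: 'b measure) \<and> emeasure N B \<in> C} | B C. B \<in> sets borel \<and> C \<in> sets borel}"
  interpret sigma_algebra ?\<Omega> "sigma_sets ?\<Omega> ?G" by (rule sigma_algebra_sigma_sets) auto
  have "sigma_sets ?\<Omega> ?G = sigma_sets ?\<Omega> cylinders"
  proof (rule sigma_sets_eqI)
    fix a assume "a \<in> ?G"
    then obtain B C where a: "a = {N. sets N = sets borel \<and> emeasure N B \<in> C}" "B \<in> sets borel" "C \<in> sets borel" by blast
    have "a \<in> cylinders" using cylindersI[of "\<lambda>_. B" "\<lambda>_. C" 1] a by simp
    then show "a \<in> sigma_sets ?\<Omega> cylinders" by auto
  next
    fix a :: "'b measure set" assume "a \<in> cylinders"
    then obtain n :: nat and B C where a: "a = {N. sets N = sets borel \<and> (\<forall>j<n. emeasure N (B j) \<in> C j)}"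
      and BC: "\<forall>j. B j \<in> sets borel" "\<forall>j. C j \<in> sets borel" by (rule cylindersE)
    have "{N. sets N = sets borel \<and> (\<forall>j<n. emeasure N (B j) \<in> C j)} \<in> sigma_sets ?\<Omega> ?G"
    proof (induction n)
      case 0
      then show ?case using top by simp
    next
      case (Suc n)
      have "{N. sets N = sets borel \<and> emeasure N (B n) \<in> C n} \<in> ?G" using BC by blast
      then have "{N. sets N = sets borel \<and> emeasure N (B n) \<in> C n} \<in> sigma_sets ?\<Omega> ?G" by (rule sigma_sets.Basic)
      from Int[OF Suc.IH this]
      have "{N. sets N = sets borel \<and> (\<forall>j<n. emeasure N (B j) \<in> C j)} \<inter> {N. sets N = sets borel \<and> emeasure N (B n) \<in> C n} \<in> sigma_sets ?\<Omega> ?G" .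
      moreover have "{N. sets N = sets borel \<and> (\<forall>j<n. emeasure N (B j) \<in> C j)} \<inter> {N. sets N = sets borel \<and> emeasure N (B n) \<in> C n} =
          {N. sets N = sets borel \<and> (\<forall>j<Suc n. emeasure N (B j) \<in> C j)}"
        by (auto simp: less_Suc_eq)
      ultimately show ?case by simp
    qed
    then show "a \<in> sigma_sets ?\<Omega> ?G" by (simp add: a)
  qed
  then show ?thesis by (simp add: sets_measure_algebra)
qed

text \<open>The cylinders generate the \<sigma>-algebra, are stable under intersection and include
  the whole space, so the joint laws of finitely many evaluations determine the law.\<close>

lemma distr_measure_algebra_eqI:
  fixes \<Xi> \<Xi>' :: "'w \<Rightarrow> 'b::topological_space measure"
  assumes M: "prob_space M" and \<Xi>: "\<Xi> \<in> measurable M measure_algebra" "\<Xi>' \<in> measurable M measure_algebra"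
    and eq: "\<And>(n::nat) B C. (\<And>j. B j \<in> sets borel) \<Longrightarrow> (\<And>j. C j \<in> sets borel) \<Longrightarrow>
      emeasure M {\<omega> \<in> space M. \<forall>j<n. emeasure (\<Xi> \<omega>) (B j) \<in> C j} =
      emeasure M {\<omega> \<in> space M. \<forall>j<n. emeasure (\<Xi>' \<omega>) (B j) \<in> C j}"
  shows "distr M measure_algebra \<Xi> = distr M measure_algebra \<Xi>'"
proof (rule measure_eqI_generator_eq[where E=cylinders and \<Omega>="{N. sets N = sets borel}" and A="\<lambda>_. {N. sets N = sets borel}"])
  interpret prob_space M by fact
  show "Int_stable (cylinders :: 'b measure set set)" by (rule Int_stable_cylinders)
  show sub: "cylinders \<subseteq> Pow {N. sets N = sets (borel :: 'b measure)}" by (auto simp: cylinders_def)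
  show "sets (distr M measure_algebra \<Xi>) = sigma_sets {N. sets N = sets borel} cylinders"
    "sets (distr M measure_algebra \<Xi>') = sigma_sets {N. sets N = sets borel} cylinders"
    by (simp_all add: sets_measure_algebra_cylinders)
  show "range (\<lambda>_. {N. sets N = sets (borel :: 'b measure)}) \<subseteq> cylinders"
    using cylindersI[of "\<lambda>_. {}" "\<lambda>_. {}" 0] by auto
  show "(\<Union>i::nat. {N. sets N = sets (borel :: 'b measure)}) = {N. sets N = sets borel}" by simp
  show "emeasure (distr M measure_algebra \<Xi>) {N. sets N = sets borel} \<noteq> \<infinity>"
  proof -
    interpret D: prob_space "distr M measure_algebra \<Xi>" by (rule prob_space_distr[OF \<Xi>(1)])
    show ?thesis by simp
  qed
  fix a :: "'b measure set" assume a: "a \<in> cylinders"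
  then obtain n :: nat and B C where a': "a = {N. sets N = sets borel \<and> (\<forall>j<n. emeasure N (B j) \<in> C j)}"
    and BC: "\<forall>j. B j \<in> sets borel" "\<forall>j. C j \<in> sets borel" by (rule cylindersE)
  have am: "a \<in> sets measure_algebra" using a by (auto simp: sets_measure_algebra_cylinders)
  have v: "\<Phi> -` a \<inter> space M = {\<omega> \<in> space M. \<forall>j<n. emeasure (\<Phi> \<omega>) (B j) \<in> C j}"
    if "\<Phi> \<in> measurable M measure_algebra" for \<Phi>
    using measurable_space[OF that] by (auto simp: a' space_measure_algebra)
  show "emeasure (distr M measure_algebra \<Xi>) a = emeasure (distr M measure_algebra \<Xi>') a"
    using eq[of B C n] BC by (simp add: emeasure_distr \<Xi> am v)
qed

section \<open>Finiteness, stationarity and moments\<close>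

context hawkes_data
begin

definition tau :: "real \<Rightarrow> 'a \<times> real \<Rightarrow> 'a \<times> real" where "tau h z = (fst z, h + snd z)"

lemma tau_measurable [measurable]: "tau h \<in> borel_measurable borel"
  unfolding tau_def by measurable

lemma K_tau:
  assumes [measurable]: "f \<in> borel_measurable borel"
  shows "K (\<lambda>z. f (tau h z)) p = K f (tau h p)"
  by (simp add: K_shift tau_def add.assoc)

lemma L0_tau:
  assumes [measurable]: "f \<in> borel_measurable borel"
  shows "L0 (\<lambda>z. f (tau h z)) = L0 f"
  using nn_integral_lborel_shift_time[of "\<lambda>z. lamX (fst z) * f z" h] by (simp add: L0_def tau_def)

text \<open>The offspring kernel depends on times only through their difference, so \<open>K\<close>
  commutes with time shifts, and with it every iterate of the recursion.\<close>

lemma lapf_tau: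
  assumes [measurable]: "f \<in> borel_measurable borel"
  shows "(lapf (\<lambda>z. f (tau h z)) ^^ n) (\<lambda>_. 0) = (\<lambda>z. (lapf f ^^ n) (\<lambda>_. 0) (tau h z))"
proof (induction n)
  case (Suc n)
  define q where "q = (lapf f ^^ n) (\<lambda>_. 0)"
  have [measurable]: "q \<in> borel_measurable borel" unfolding q_def by measurable
  have "(lapf (\<lambda>z. f (tau h z)) ^^ Suc n) (\<lambda>_. 0) = lapf (\<lambda>z. f (tau h z)) (\<lambda>z. q (tau h z))"
    by (simp add: Suc q_def)
  also have "\<dots> = (\<lambda>z. lapf f q (tau h z))"
    unfolding lapf_def using K_tau[of "\<lambda>z. 1 - nexp (q z)" h] by simp
  finally show ?case by (simp add: q_def)
qed simp

end

context hawkes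
begin

lemma XI_eq: "XI f \<omega> = (\<integral>\<^sup>+u. oapp f (pos u \<omega>) \<partial>count_space {u. u \<noteq> []})"
proof -
  have "XI f \<omega> = (\<Sum>k. \<integral>\<^sup>+u. oapp f (pos u \<omega>) * indicator {u. length u = Suc k} u \<partial>count_space UNIV)"
    unfolding XI_def Z_def by (subst nn_integral_count_space_indicator) auto
  also have "\<dots> = (\<integral>\<^sup>+u. oapp f (pos u \<omega>) * indicator {u. u \<noteq> []} u \<partial>count_space UNIV)"
    by (subst nn_integral_suminf[symmetric]) (auto simp: suminf_indicator_length)
  also have "\<dots> = (\<integral>\<^sup>+u. oapp f (pos u \<omega>) \<partial>count_space {u. u \<noteq> []})"
    by (rule nn_integral_count_space_indicator[symmetric]) simp
  finally show ?thesis .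
qed

text \<open>The value is a number of labels, hence natural or infinite for every outcome, as the
  uniqueness theorem for generating functions asks.\<close>

lemma XI_count: "XI (indicator B) \<omega> \<in> insert top (range of_nat)"
proof -
  have "XI (indicator B) \<omega> = (\<integral>\<^sup>+u. indicator {u. u \<noteq> [] \<and> (\<exists>b\<in>B. pos u \<omega> = Some b)} u \<partial>count_space UNIV)"
  proof -
    have "oapp (indicator B) (pos u \<omega>) * indicator {u. u \<noteq> []} u =
        (indicator {u. u \<noteq> [] \<and> (\<exists>b\<in>B. pos u \<omega> = Some b)} u :: ennreal)" for u
      by (cases "pos u \<omega>") (auto simp: indicator_def)
    then show ?thesis unfolding XI_eq by (subst nn_integral_count_space_indicator) (simp, simp only:)
  qed
  also have "\<dots> = emeasure (count_space UNIV) {u. u \<noteq> [] \<and> (\<exists>b\<in>B. pos u \<omega> = Some b)}" by simp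
  finally show ?thesis by (simp only: emeasure_count_space_of_nat)
qed

lemma XI_mono:
  assumes [measurable]: "f \<in> borel_measurable borel" "h \<in> borel_measurable borel" and le: "\<And>z. f z \<le> h z"
  shows "XI f \<omega> \<le> XI h \<omega>"
  unfolding nn_integral_hawkes[symmetric, OF assms(1)] nn_integral_hawkes[symmetric, OF assms(2)]
  by (intro nn_integral_mono le)

lemma XI_sum:
  assumes "finite J" "\<And>j. j \<in> J \<Longrightarrow> f j \<in> borel_measurable borel"
  shows "XI (\<lambda>z. \<Sum>j\<in>J. s j * f j z) \<omega> = (\<Sum>j\<in>J. s j * XI (f j) \<omega>)"
proof -
  have "XI (\<lambda>z. \<Sum>j\<in>J. s j * f j z) \<omega> = (\<integral>\<^sup>+z. (\<Sum>j\<in>J. s j * f j z) \<partial>hawkes_process pos \<omega>)"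
    using assms by (intro nn_integral_hawkes[symmetric]) auto
  also have "\<dots> = (\<Sum>j\<in>J. \<integral>\<^sup>+z. s j * f j z \<partial>hawkes_process pos \<omega>)"
    using assms by (intro nn_integral_sum) (auto cong: measurable_cong_sets)
  also have "\<dots> = (\<Sum>j\<in>J. s j * (\<integral>\<^sup>+z. f j z \<partial>hawkes_process pos \<omega>))"
    using assms by (intro sum.cong refl nn_integral_cmult) (auto cong: measurable_cong_sets)
  finally show ?thesis using assms by (simp add: nn_integral_hawkes)
qed

text \<open>A shift of the test function shifts the iterates of \<open>lapf\<close>, and
  \<open>L0\<close> does not see shifts; both Laplace functionals are limits of the same
  sequence.\<close>

lemma laplace_tau:
  assumes [measurable]: "f \<in> borel_measurable borel"
  shows "(\<integral>\<^sup>+\<omega>. nexp (XI (\<lambda>z. f (tau h z)) \<omega>) \<partial>M) = (\<integral>\<^sup>+\<omega>. nexp (XI f \<omega>) \<partial>M)"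
proof (rule LIMSEQ_unique[OF laplace_XI])
  show "(\<lambda>n. nexp (L0 (\<lambda>z. 1 - nexp ((lapf (\<lambda>z. f (tau h z)) ^^ n) (\<lambda>_. 0) z)))) \<longlonglongrightarrow> (\<integral>\<^sup>+\<omega>. nexp (XI f \<omega>) \<partial>M)"
  proof -
    have "L0 (\<lambda>z. 1 - nexp ((lapf (\<lambda>z. f (tau h z)) ^^ n) (\<lambda>_. 0) z)) = L0 (\<lambda>z. 1 - nexp ((lapf f ^^ n) (\<lambda>_. 0) z))" for n
      using L0_tau[of "\<lambda>z. 1 - nexp ((lapf f ^^ n) (\<lambda>_. 0) z)" h] by (simp add: lapf_tau)
    then show ?thesis using laplace_XI[OF assms] by simp
  qed
qed measurable

lemma hawkes_measurable: "hawkes_process pos \<in> measurable M measure_algebra"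
  by (rule measurable_measure_algebra) (simp_all add: emeasure_hawkes)

text \<open>At nonnegative combinations of indicators the Laplace functional is the joint Laplace
  transform of the counts. Equality for all combinations gives equal joint laws of the counts of the
  process and of its shift.\<close>

theorem stationary: "strongly_time_stationary M (hawkes_process pos)"
  unfolding strongly_time_stationary_def
proof (intro conjI allI)
  show "hawkes_process pos \<in> measurable M measure_algebra" by (rule hawkes_measurable)
  fix h :: real
  have e: "emeasure (distr (hawkes_process pos \<omega>) borel (\<lambda>(x, t). (x, t + h))) B = XI (\<lambda>z. indicator B (tau h z)) \<omega>"
    if B [measurable]: "B \<in> sets borel" for B \<omega>
  proof -
    have t: "(\<lambda>(x, t). (x, t + h)) = tau h" by (auto simp: tau_def)
    have m: "tau h \<in> measurable (hawkes_process pos \<omega>) borel" by (simp cong: measurable_cong_sets)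
    have "emeasure (distr (hawkes_process pos \<omega>) borel (tau h)) B = (\<integral>\<^sup>+z. indicator B z \<partial>distr (hawkes_process pos \<omega>) borel (tau h))"
      using B by simp
    also have "\<dots> = (\<integral>\<^sup>+z. indicator B (tau h z) \<partial>hawkes_process pos \<omega>)"
      using B m by (subst nn_integral_distr) auto
    also have "\<dots> = XI (\<lambda>z. indicator B (tau h z)) \<omega>" using B by (intro nn_integral_hawkes) measurable
    finally show ?thesis by (simp add: t)
  qed
  have v: "(\<lambda>z. indicator B (tau h z)) = (indicator (tau h -` B) :: _ \<Rightarrow> ennreal)" for B
    by (auto simp: indicator_def)
  have mv: "tau h -` B \<in> sets borel" if "B \<in> sets borel" for B
    using measurable_sets[OF tau_measurable that] by simp
  show "distr M measure_algebra (\<lambda>\<omega>. distr (hawkes_process pos \<omega>) borel (\<lambda>(x, t). (x, t + h))) =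
      distr M measure_algebra (hawkes_process pos)"
  proof (rule distr_measure_algebra_eqI)
    show "prob_space M" by (rule prob_M)
    show "hawkes_process pos \<in> measurable M measure_algebra" by (rule hawkes_measurable)
    show "(\<lambda>\<omega>. distr (hawkes_process pos \<omega>) borel (\<lambda>(x, t). (x, t + h))) \<in> measurable M measure_algebra"
      by (rule measurable_measure_algebra) (simp_all add: e)
    fix n :: nat and B :: "nat \<Rightarrow> ('a \<times> real) set" and C :: "nat \<Rightarrow> ennreal set"
    assume B [measurable]: "\<And>j. B j \<in> sets borel" and C [measurable]: "\<And>j. C j \<in> sets borel"
    have gf: "(\<integral>\<^sup>+\<omega>. (\<Prod>j\<in>{..<n}. indicator (C j) (XI (\<lambda>z. indicator (B j) (tau h z)) \<omega>)) \<partial>M) =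
        (\<integral>\<^sup>+\<omega>. (\<Prod>j\<in>{..<n}. indicator (C j) (XI (indicator (B j)) \<omega>)) \<partial>M)"
    proof (rule generating_function_unique)
      show "AE \<omega> in M. XI (\<lambda>z. indicator (B j) (tau h z)) \<omega> \<in> insert top (range of_nat)" for j
        unfolding v using XI_count by simp
      show "AE \<omega> in M. XI (indicator (B j)) \<omega> \<in> insert top (range of_nat)" for j using XI_count by simp
      fix s :: "nat \<Rightarrow> real"
      let ?f = "\<lambda>z. \<Sum>j<n. ennreal (s j) * indicator (B j) z"
      have "(\<integral>\<^sup>+\<omega>. (\<Prod>j<n. nexp (ennreal (s j) * XI (\<lambda>z. indicator (B j) (tau h z)) \<omega>)) \<partial>M) =
          (\<integral>\<^sup>+\<omega>. nexp (XI (\<lambda>z. ?f (tau h z)) \<omega>) \<partial>M)"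
        by (subst XI_sum) (auto simp: nexp_sum)
      also have "\<dots> = (\<integral>\<^sup>+\<omega>. nexp (XI ?f \<omega>) \<partial>M)" by (rule laplace_tau) measurable
      also have "\<dots> = (\<integral>\<^sup>+\<omega>. (\<Prod>j<n. nexp (ennreal (s j) * XI (indicator (B j)) \<omega>)) \<partial>M)"
        by (subst XI_sum) (auto simp: nexp_sum)
      finally show "(\<integral>\<^sup>+\<omega>. (\<Prod>j<n. nexp (ennreal (s j) * XI (\<lambda>z. indicator (B j) (tau h z)) \<omega>)) \<partial>M) =
          (\<integral>\<^sup>+\<omega>. (\<Prod>j<n. nexp (ennreal (s j) * XI (indicator (B j)) \<omega>)) \<partial>M)" .
    qed (auto simp: prob_M)
    have ind: "(\<Prod>j\<in>{..<n}. indicator (C j) (x j \<omega>)) = (indicator {\<omega> \<in> space M. \<forall>j<n. x j \<omega> \<in> C j} \<omega> :: ennreal)"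
      if "\<omega> \<in> space M" for x :: "nat \<Rightarrow> 'w \<Rightarrow> ennreal" and \<omega>
    proof (cases "\<forall>j<n. x j \<omega> \<in> C j")
      case False
      then obtain j where "j < n" "x j \<omega> \<notin> C j" by blast
      then have "(\<Prod>j\<in>{..<n}. indicator (C j) (x j \<omega>)) = (0::ennreal)"
        by (intro prod_zero) (auto intro!: bexI[of _ j])
      then show ?thesis using False by simp
    qed (use that in simp)
    have "(\<integral>\<^sup>+\<omega>. (\<Prod>j\<in>{..<n}. indicator (C j) (x j \<omega>)) \<partial>M) =
        (\<integral>\<^sup>+\<omega>. indicator {\<omega> \<in> space M. \<forall>j<n. x j \<omega> \<in> C j} \<omega> \<partial>M)" for x :: "nat \<Rightarrow> 'w \<Rightarrow> ennreal"
      by (rule nn_integral_cong) (rule ind)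
    with gf have "(\<integral>\<^sup>+\<omega>. indicator {\<omega> \<in> space M. \<forall>j<n. XI (\<lambda>z. indicator (B j) (tau h z)) \<omega> \<in> C j} \<omega> \<partial>M) =
        (\<integral>\<^sup>+\<omega>. indicator {\<omega> \<in> space M. \<forall>j<n. XI (indicator (B j)) \<omega> \<in> C j} \<omega> \<partial>M)"
      by (simp only:)
    then have "emeasure M {\<omega> \<in> space M. \<forall>j<n. XI (\<lambda>z. indicator (B j) (tau h z)) \<omega> \<in> C j} =
        emeasure M {\<omega> \<in> space M. \<forall>j<n. XI (indicator (B j)) \<omega> \<in> C j}"
      by simp
    then show "emeasure M {\<omega> \<in> space M. \<forall>j<n. emeasure (distr (hawkes_process pos \<omega>) borel (\<lambda>(x, t). (x, t + h))) (B j) \<in> C j} =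
        emeasure M {\<omega> \<in> space M. \<forall>j<n. emeasure (hawkes_process pos \<omega>) (B j) \<in> C j}"
      by (simp add: e emeasure_hawkes)
  qed
qed

lemma mean_rectangle:
  assumes [measurable]: "A \<in> sets borel" "I \<in> sets borel"
  shows "(\<integral>\<^sup>+\<omega>. XI (\<lambda>z. indicator A (fst z) * indicator I (snd z)) \<omega> \<partial>M) = emeasure mu A * emeasure lborel I"
  by (subst mean_XI) (auto simp: nn_integral_cmult nn_integral_multc)

lemma rectangle_indicator: "(\<lambda>z. indicator A (fst z) * indicator I (snd z)) = (indicator (A \<times> I) :: _ \<Rightarrow> ennreal)"
  by (auto simp: indicator_def)

lemma rectangle_borel: "A \<in> sets borel \<Longrightarrow> I \<in> sets borel \<Longrightarrow> A \<times> I \<in> sets (borel :: ('a \<times> real) measure)"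
  unfolding borel_prod[symmetric] by (rule pair_measureI)

theorem mean_emeasure:
  assumes "A \<in> sets borel" "I \<in> sets borel"
  shows "(\<integral>\<^sup>+\<omega>. emeasure (hawkes_process pos \<omega>) (A \<times> I) \<partial>M) = emeasure mu A * emeasure lborel I"
  using mean_rectangle[OF assms] rectangle_borel[OF assms] by (simp add: emeasure_hawkes rectangle_indicator)

text \<open>One null set has to serve all time intervals, so finiteness is first obtained for the
  countably many slabs \<open>E n\<close>.\<close>

lemma AE_finite_E: "AE \<omega> in M. \<forall>n. emeasure (hawkes_process pos \<omega>) (E n) < \<infinity>"
proof (subst AE_all_countable, rule allI)
  fix n
  have "(\<integral>\<^sup>+\<omega>. emeasure (hawkes_process pos \<omega>) (E n) \<partial>M) = emeasure mu UNIV * ennreal (2 * real n)"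
    unfolding E_def by (subst mean_emeasure) auto
  also have "\<dots> < top" using emeasure_mu_finite by (simp add: ennreal_mult_less_top)
  finally show "AE \<omega> in M. emeasure (hawkes_process pos \<omega>) (E n) < \<infinity>"
    using nn_integral_noteq_infinite[of "\<lambda>\<omega>. emeasure (hawkes_process pos \<omega>) (E n)" M] E_props(2)[of n]
    by (auto simp: less_top emeasure_hawkes)
qed

theorem locally_finite: "as_locally_finite M X (hawkes_process pos)"
  unfolding as_locally_finite_def
  using AE_finite_E
proof eventually_elim
  case (elim \<omega>)
  show ?case
  proof (intro allI)
    fix a b :: real
    obtain n where n: "max \<bar>a\<bar> \<bar>b\<bar> \<le> real n" using real_arch_simple by blast
    have "X \<times> {a..b} \<subseteq> E n" using n by (auto simp: E_def)
    then have "emeasure (hawkes_process pos \<omega>) (X \<times> {a..b}) \<le> emeasure (hawkes_process pos \<omega>) (E n)"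
      using E_props(2)[of n] by (intro emeasure_mono) auto
    also have "\<dots> < \<infinity>" using elim by blast
    finally show "emeasure (hawkes_process pos \<omega>) (X \<times> {a..b}) < \<infinity>" .
  qed
qed

lemma bounded_subset_E: assumes "bounded B" obtains n where "B \<subseteq> E n"
proof -
  obtain r where r: "\<And>z. z \<in> B \<Longrightarrow> norm z \<le> r" using assms unfolding bounded_iff by blast
  obtain n where n: "r \<le> real n" using real_arch_simple by blast
  have "z \<in> E n" if "z \<in> B" for z
  proof (cases z)
    case (Pair x t)
    have "\<bar>t\<bar> \<le> norm z" using norm_snd_le[of t x] by (simp add: Pair)
    then have "\<bar>t\<bar> \<le> real n" using r[OF that] n by simp
    then show ?thesis by (auto simp: Pair E_def)
  qed
  then show ?thesis using that by blast
qed

text \<open>One of the two cluster means is bounded by \<open>Ct\<close>. The other is integrated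
  over the time of the ancestor, where Lebesgue measure absorbs the lag and the mass of
  \<open>G x\<close> gives another factor \<open>Ct\<close>.\<close>

lemma second_E_finite: "(\<integral>\<^sup>+\<omega>. XI (indicator (E n)) \<omega> * XI (indicator (E n)) \<omega> \<partial>M) < \<infinity>"
proof -
  have [measurable]: "indicator (E n) \<in> borel_measurable (borel :: ('a \<times> real) measure)" using E_props(2) by simp
  have m: "(\<integral>\<^sup>+x. \<integral>\<^sup>+s. indicator (E n) (x, s) \<partial>lborel \<partial>mu) = emeasure mu UNIV * ennreal (2 * real n)"
  proof -
    have "indicator (E n) (x, s) = (indicator {- real n..real n} s :: ennreal)" for x :: 'a and s by (simp add: E_def indicator_def)
    then show ?thesis by (simp add: mult.commute)
  qed
  have GG_le: "GG (indicator (E n)) z \<le> Ct" for z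
  proof -
    have "GG (indicator (E n)) (fst z, snd z) \<le> (\<integral>\<^sup>+z'. 1 \<partial>G (fst z))"
      unfolding GG_eq[OF \<open>indicator (E n) \<in> borel_measurable borel\<close>]
      by (rule nn_integral_mono) (simp add: indicator_def)
    then show ?thesis using G_mass[of "fst z"] by simp
  qed
  have "(\<integral>\<^sup>+x. \<integral>\<^sup>+s. GG (indicator (E n)) (x, s) * GG (indicator (E n)) (x, s) \<partial>lborel \<partial>mu) \<le>
      (\<integral>\<^sup>+x. \<integral>\<^sup>+s. Ct * GG (indicator (E n)) (x, s) \<partial>lborel \<partial>mu)"
    by (intro nn_integral_mono mult_right_mono GG_le) auto
  also have "\<dots> = Ct * (\<integral>\<^sup>+x. \<integral>\<^sup>+s. GG (indicator (E n)) (x, s) \<partial>lborel \<partial>mu)"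
    by (simp add: nn_integral_cmult)
  also have "(\<integral>\<^sup>+x. \<integral>\<^sup>+s. GG (indicator (E n)) (x, s) \<partial>lborel \<partial>mu) \<le> (\<integral>\<^sup>+x. Ct * ennreal (2 * real n) \<partial>mu)"
  proof (rule nn_integral_mono)
    fix x
    interpret finite_measure "G x" by (rule finite_G)
    interpret pair_sigma_finite lborel "G x" ..
    have "(\<integral>\<^sup>+s. GG (indicator (E n)) (x, s) \<partial>lborel) = (\<integral>\<^sup>+s. \<integral>\<^sup>+z. indicator (E n) (fst z, s + snd z) \<partial>G x \<partial>lborel)"
      by (simp add: GG_eq)
    also have "\<dots> = (\<integral>\<^sup>+z. \<integral>\<^sup>+s. indicator (E n) (fst z, s + snd z) \<partial>lborel \<partial>G x)"
      by (rule Fubini'[symmetric]) measurable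
    also have "\<dots> = (\<integral>\<^sup>+z. ennreal (2 * real n) \<partial>G x)"
    proof (rule nn_integral_cong)
      fix z :: "'a \<times> real"
      have "(\<integral>\<^sup>+s. indicator {- real n..real n} (snd z + s) \<partial>lborel) = ennreal (2 * real n)"
        by (subst nn_integral_lborel_shift) auto
      then show "(\<integral>\<^sup>+s. indicator (E n) (fst z, s + snd z) \<partial>lborel) = ennreal (2 * real n)"
        by (simp add: E_def indicator_def add.commute)
    qed
    also have "\<dots> \<le> Ct * ennreal (2 * real n)"
      using G_mass[of x] by (simp add: mult.commute mult_right_mono)
    finally show "(\<integral>\<^sup>+s. GG (indicator (E n)) (x, s) \<partial>lborel) \<le> Ct * ennreal (2 * real n)" .
  qed
  also have "Ct * (\<integral>\<^sup>+x. Ct * ennreal (2 * real n) \<partial>mu) < \<infinity>"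
    using Ct_finite emeasure_mu_finite by (simp add: ennreal_mult_less_top)
  finally have "(\<integral>\<^sup>+x. \<integral>\<^sup>+s. GG (indicator (E n)) (x, s) * GG (indicator (E n)) (x, s) \<partial>lborel \<partial>mu) < \<infinity>"
    by (simp add: mult_left_mono)
  then show ?thesis
    using emeasure_mu_finite by (subst second_XI) (auto simp: m ennreal_mult_less_top)
qed

theorem L2: "L2_process M (hawkes_process pos)"
  unfolding L2_process_def
proof (intro conjI ballI impI)
  fix B :: "('a \<times> real) set" assume B: "B \<in> sets borel" "bounded B"
  obtain n where n: "B \<subseteq> E n" using bounded_subset_E[OF B(2)] .
  have "(\<integral>\<^sup>+\<omega>. emeasure (hawkes_process pos \<omega>) B \<partial>M) \<le> (\<integral>\<^sup>+\<omega>. emeasure (hawkes_process pos \<omega>) (E n) \<partial>M)"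
    using n E_props(2)[of n] by (intro nn_integral_mono emeasure_mono) auto
  also have "\<dots> = emeasure mu UNIV * ennreal (2 * real n)"
    unfolding E_def by (subst mean_emeasure) auto
  also have "\<dots> < \<infinity>" using emeasure_mu_finite by (simp add: ennreal_mult_less_top)
  finally show "(\<integral>\<^sup>+\<omega>. emeasure (hawkes_process pos \<omega>) B \<partial>M) < \<infinity>" .
next
  fix C :: "(('a \<times> real) \<times> 'a \<times> real) set" assume C: "C \<in> sets borel" "bounded C"
  have "bounded (fst ` C)" "bounded (snd ` C)" using C(2) by (auto intro: bounded_fst bounded_snd)
  then have "bounded (fst ` C \<union> snd ` C)" by simp
  then obtain n where n: "fst ` C \<union> snd ` C \<subseteq> E n" by (rule bounded_subset_E)
  then have sub: "C \<subseteq> E n \<times> E n" by force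
  have "(\<integral>\<^sup>+\<omega>. emeasure (hawkes_process pos \<omega> \<Otimes>\<^sub>M hawkes_process pos \<omega>) C \<partial>M) \<le>
      (\<integral>\<^sup>+\<omega>. XI (indicator (E n)) \<omega> * XI (indicator (E n)) \<omega> \<partial>M)"
  \<comment> \<open>The product formula for rectangles needs a \<sigma>-finite realization, which is
    at hand on the almost sure event of finite slabs.\<close>
  proof (rule nn_integral_mono_AE, use AE_finite_E in eventually_elim)
    case (elim \<omega>)
    let ?N = "hawkes_process pos \<omega>"
    interpret N: sigma_finite_measure ?N
    proof
      show "\<exists>A. countable A \<and> A \<subseteq> sets ?N \<and> \<Union>A = space ?N \<and> (\<forall>a\<in>A. emeasure ?N a \<noteq> \<infinity>)"
        using E_props elim sets_eq_imp_space_eq[OF sets_hawkes[of \<omega>]]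
        by (intro exI[of _ "range E"]) (auto simp: less_top)
    qed
    have EE: "E n \<times> E n \<in> sets (?N \<Otimes>\<^sub>M ?N)" using E_props(2)[of n] by (intro pair_measureI) auto
    have "emeasure (?N \<Otimes>\<^sub>M ?N) C \<le> emeasure (?N \<Otimes>\<^sub>M ?N) (E n \<times> E n)"
      using sub EE by (rule emeasure_mono)
    also have "\<dots> = XI (indicator (E n)) \<omega> * XI (indicator (E n)) \<omega>"
      using E_props(2)[of n] by (subst N.emeasure_pair_measure_Times) (auto simp: emeasure_hawkes)
    finally show ?case .
  qed
  then show "(\<integral>\<^sup>+\<omega>. emeasure (hawkes_process pos \<omega> \<Otimes>\<^sub>M hawkes_process pos \<omega>) C \<partial>M) < \<infinity>"
    using second_E_finite by (rule le_less_trans)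
qed

definition muX :: "'a measure" where "muX = restrict_space mu X"

lemma emeasure_muX: "A \<subseteq> X \<Longrightarrow> emeasure muX A = emeasure mu A"
  unfolding muX_def by (rule emeasure_restrict_space) auto

theorem spatial_mean: "spatial_mean_measure M X (hawkes_process pos) muX"
  unfolding spatial_mean_measure_def
proof (intro conjI ballI impI)
  show "sets muX = sets (restrict_space borel X)"
    unfolding muX_def by (rule sets_restrict_space_cong) simp
  show "finite_measure muX"
  proof (rule finite_measureI)
    have "space muX = X" by (simp add: muX_def space_restrict_space)
    then show "emeasure muX (space muX) \<noteq> \<infinity>"
      using emeasure_muX[of X] emeasure_mu_finite[of X] by simp
  qed
  fix A I assume "A \<in> sets borel" "A \<subseteq> X" "I \<in> sets (borel :: real measure)"
  then show "(\<integral>\<^sup>+\<omega>. emeasure (hawkes_process pos \<omega>) (A \<times> I) \<partial>M) = emeasure muX A * emeasure lborel I"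
    by (simp add: mean_emeasure emeasure_muX)
qed

end

section \<open>The second factorial moment measure\<close>

lemma locally_finite_sigma_finite:
  assumes "locally_finite_measure N" shows "sigma_finite_measure N"
proof
  have N: "sets N = sets borel" "\<And>S. S \<in> sets borel \<Longrightarrow> bounded S \<Longrightarrow> emeasure N S < \<infinity>"
    using assms by (auto simp: locally_finite_measure_def)
  have "x \<in> (\<Union>n::nat. {- real n..real n})" for x :: real
  proof -
    obtain n where "\<bar>x\<bar> \<le> real n" using real_arch_simple by blast
    then show ?thesis by (auto intro!: exI[of _ n])
  qed
  then show "\<exists>A. countable A \<and> A \<subseteq> sets N \<and> \<Union>A = space N \<and> (\<forall>a\<in>A. emeasure N a \<noteq> \<infinity>)"
    using N(1) N(2)[of "{- real n..real n}" for n] sets_eq_imp_space_eq[OF N(1)]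
    by (intro exI[of _ "range (\<lambda>n::nat. {- real n..real n})"]) (auto simp: less_top)
qed

text \<open>The image of Lebesgue measure times \<open>N\<close> under the inverse of
  \<open>(r, s) \<mapsto> (r, s - r)\<close>: it turns a reduced measure back into a measure on
  pairs of times.\<close>

definition Q :: "real measure \<Rightarrow> (real \<times> real) measure" where
  "Q N = distr (lborel \<Otimes>\<^sub>M N) borel (\<lambda>p. (fst p, fst p + snd p))"

lemma sets_Q [simp]: "sets (Q N) = sets borel"
  by (simp add: Q_def)

lemma Q_map_measurable:
  assumes "sets N = sets borel"
  shows "(\<lambda>p. (fst p, fst p + snd p)) \<in> measurable (lborel \<Otimes>\<^sub>M N) (borel :: (real \<times> real) measure)"
proof -
  have [measurable_cong]: "sets N = sets borel" by fact
  show ?thesis by measurable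
qed

lemma nn_integral_Q:
  assumes N: "sets N = sets borel" "sigma_finite_measure N" and [measurable]: "F \<in> borel_measurable borel"
  shows "(\<integral>\<^sup>+p. F p \<partial>Q N) = (\<integral>\<^sup>+r. \<integral>\<^sup>+d. F (r, r + d) \<partial>N \<partial>lborel)"
proof -
  interpret sigma_finite_measure N by fact
  have [measurable_cong]: "sets N = sets borel" by fact
  have "(\<integral>\<^sup>+p. F p \<partial>Q N) = (\<integral>\<^sup>+p. F (fst p, fst p + snd p) \<partial>(lborel \<Otimes>\<^sub>M N))"
    unfolding Q_def using Q_map_measurable[OF N(1)] by (rule nn_integral_distr) measurable
  also have "\<dots> = (\<integral>\<^sup>+r. \<integral>\<^sup>+d. F (r, r + d) \<partial>N \<partial>lborel)"
    by (subst nn_integral_fst[symmetric]) auto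
  finally show ?thesis .
qed

definition square :: "nat \<Rightarrow> (real \<times> real) set" where "square n = {- real n..real n} \<times> {- real n..real n}"

lemma square_props: "incseq square" "\<And>n. square n \<in> sets borel" "(\<Union>n. square n) = UNIV"
proof -
  show "incseq square" by (auto simp: incseq_def square_def)
  show "square n \<in> sets borel" for n unfolding square_def borel_prod[symmetric] by (intro pair_measureI) auto
  have "z \<in> (\<Union>n. square n)" for z :: "real \<times> real"
  proof -
    obtain n where "max \<bar>fst z\<bar> \<bar>snd z\<bar> \<le> real n" using real_arch_simple by blast
    then have "z \<in> square n" by (cases z) (auto simp: square_def)
    then show ?thesis by blast
  qed
  then show "(\<Union>n. square n) = UNIV" by auto
qed

lemma measure_eqI_rectangles:
  fixes M N :: "(real \<times> real) measure"
  assumes "sets M = sets borel" "sets N = sets borel"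
    and eq: "\<And>I J. I \<in> sets borel \<Longrightarrow> J \<in> sets borel \<Longrightarrow> emeasure M (I \<times> J) = emeasure N (I \<times> J)"
    and fin: "\<And>n. emeasure M (square n) < \<infinity>"
  shows "M = N"
proof (rule measure_eqI_generator_eq[where \<Omega>=UNIV and E="{a \<times> b | a b. a \<in> sets borel \<and> b \<in> sets borel}" and A=square])
  show "Int_stable {a \<times> b | a b. a \<in> sets (borel :: real measure) \<and> b \<in> sets (borel :: real measure)}"
    by (rule Int_stable_pair_measure_generator)
  have s: "sets (borel :: (real \<times> real) measure) = sigma_sets UNIV {a \<times> b | a b. a \<in> sets borel \<and> b \<in> sets borel}"
    unfolding borel_prod[symmetric] by (simp add: sets_pair_measure)
  show "sets M = sigma_sets UNIV {a \<times> b | a b. a \<in> sets borel \<and> b \<in> sets borel}" using s assms by simp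
  show "sets N = sigma_sets UNIV {a \<times> b | a b. a \<in> sets borel \<and> b \<in> sets borel}" using s assms by simp
  have "square n \<in> {a \<times> b | a b. a \<in> sets borel \<and> b \<in> sets borel}" for n
    unfolding square_def by (rule CollectI, rule exI[of _ "{- real n..real n}"], rule exI[of _ "{- real n..real n}"]) simp
  then show "range square \<subseteq> {a \<times> b | a b. a \<in> sets borel \<and> b \<in> sets borel}" by auto
  show "(\<Union>i. square i) = UNIV" by (rule square_props)
qed (use eq fin in \<open>auto simp: less_top\<close>)

context hawkes_data
begin

lemma rho_le_rho_full:
  assumes "A \<in> sets borel" "S \<in> sets borel" shows "emeasure (rho A) S \<le> emeasure (rho_full A) S"
  by (simp add: rho_full_eq[OF assms])

lemma finite_rho: "A \<in> sets borel \<Longrightarrow> emeasure (rho A) S < \<infinity>"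
proof (cases "S \<in> sets borel")
  case True
  assume A: "A \<in> sets borel"
  interpret finite_measure "rho_full A" by (rule finite_rho_full[OF A])
  have "emeasure (rho A) S \<le> emeasure (rho_full A) S" by (rule rho_le_rho_full[OF A True])
  also have "\<dots> < \<infinity>" by (simp add: less_top[symmetric])
  finally show ?thesis .
qed (simp add: emeasure_notin_sets)

lemma locally_finite_rho: "A \<in> sets borel \<Longrightarrow> locally_finite_measure (rho A)"
  by (simp add: locally_finite_measure_def finite_rho[unfolded infinity_ennreal_def])

lemma locally_finite_R:
  assumes A: "A \<in> sets borel" shows "locally_finite_measure (R A)"
  unfolding locally_finite_measure_def
proof (intro conjI ballI impI)
  fix S :: "real set" assume S: "S \<in> sets borel" "bounded S"
  have "emeasure lborel S < \<infinity>" using S by (intro emeasure_bounded_finite)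
  then show "emeasure (R A) S < \<infinity>"
    using finite_rho[OF A, of S] emeasure_mu_finite[of A] by (simp add: emeasure_R S ennreal_mult_less_top)
qed simp

lemma locally_finite_R_full:
  assumes A: "A \<in> sets borel" shows "locally_finite_measure (R_full A)"
  unfolding locally_finite_measure_def
proof (intro conjI ballI impI)
  fix S :: "real set" assume S: "S \<in> sets borel" "bounded S"
  have "emeasure (R A) S < \<infinity>" using locally_finite_R[OF A] S by (simp add: locally_finite_measure_def)
  then show "emeasure (R_full A) S < \<infinity>"
    unfolding R_full_eq[OF A] using emeasure_mu_finite[of A] S
    by (simp add: emeasure_measure_add emeasure_atom ennreal_mult_less_top indicator_def)
qed simp

end

section \<open>The measure of ordered pairs of points\<close>

context hawkes
begin

text \<open>A pair of labels is treated as the label of one point in the plane. The second moment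
  measure is then the mean measure of a point process, and the factorial one results from leaving
  out pairs of equal labels.\<close>

definition pp :: "'a set \<Rightarrow> nat list \<times> nat list \<Rightarrow> 'w \<Rightarrow> (real \<times> real) option" where
  "pp A w \<omega> = (case pos (fst w) \<omega> of None \<Rightarrow> None | Some b \<Rightarrow>
    (case pos (snd w) \<omega> of None \<Rightarrow> None | Some c \<Rightarrow>
      if fst b \<in> A \<and> fst c \<in> A then Some (snd b, snd c) else None))"

definition labels :: "(nat list \<times> nat list) set" where "labels = {w. fst w \<noteq> [] \<and> snd w \<noteq> []}"

definition PM :: "'a set \<Rightarrow> (nat list \<times> nat list) set \<Rightarrow> (real \<times> real) measure" where
  "PM A J = mixture M (point_measure J (pp A))"

lemma sets_PM [simp]: "sets (PM A J) = sets borel"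
  by (simp add: PM_def)

lemma pp_measurable:
  assumes A [measurable]: "A \<in> sets borel" and D [measurable]: "D \<in> sets borel" and w: "w \<in> labels"
  shows "{\<omega> \<in> space M. \<exists>b\<in>D. pp A w \<omega> = Some b} \<in> sets M"
proof -
  define r where "r u \<omega> = (case pos u \<omega> of None \<Rightarrow> (0, 0) | Some b \<Rightarrow> b)" for u \<omega>
  have some: "{\<omega> \<in> space M. pos u \<omega> \<noteq> None} \<in> sets M" if "u \<noteq> []" for u
  proof -
    have "{\<omega> \<in> space M. \<exists>b\<in>UNIV. pos u \<omega> = Some b} \<in> sets M" by (rule pos_measurable[OF that]) simp
    then show ?thesis by simp
  qed
  have r: "r u \<in> borel_measurable M" if u: "u \<noteq> []" for u
  proof (rule measurableI)
    fix B :: "('a \<times> real) set" assume B: "B \<in> sets borel"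
    have "r u -` B \<inter> space M = {\<omega> \<in> space M. \<exists>b\<in>B. pos u \<omega> = Some b} \<union>
        (if (0, 0) \<in> B then space M - {\<omega> \<in> space M. pos u \<omega> \<noteq> None} else {})"
      by (auto simp: r_def split: option.splits)
    then show "r u -` B \<inter> space M \<in> sets M" using pos_measurable[OF u B] some[OF u] by auto
  qed simp
  have u: "fst w \<noteq> []" "snd w \<noteq> []" using w by (auto simp: labels_def)
  note [measurable] = r[OF u(1)] r[OF u(2)] some[OF u(1)] some[OF u(2)]
  have "{\<omega> \<in> space M. \<exists>b\<in>D. pp A w \<omega> = Some b} =
     {\<omega> \<in> space M. fst (r (fst w) \<omega>) \<in> A \<and> fst (r (snd w) \<omega>) \<in> A \<and> (snd (r (fst w) \<omega>), snd (r (snd w) \<omega>)) \<in> D} \<inter>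
     ({\<omega> \<in> space M. pos (fst w) \<omega> \<noteq> None} \<inter> {\<omega> \<in> space M. pos (snd w) \<omega> \<noteq> None})"
    (is "?l = ?r")
  proof (rule set_eqI)
    fix \<omega> show "\<omega> \<in> ?l \<longleftrightarrow> \<omega> \<in> ?r"
      by (cases "pos (fst w) \<omega>"; cases "pos (snd w) \<omega>") (auto simp: pp_def r_def)
  qed
  also have "\<dots> \<in> sets M" by measurable
  finally show ?thesis .
qed

lemma point_measure_pp_measurable:
  assumes A: "A \<in> sets borel" and D: "D \<in> sets borel" and J: "J \<subseteq> labels"
  shows "(\<lambda>\<omega>. emeasure (point_measure J (pp A) \<omega>) D) \<in> borel_measurable M"
proof -
  have "emeasure (point_measure J (pp A) \<omega>) D = (\<integral>\<^sup>+w. oapp (indicator D) (pp A w \<omega>) \<partial>count_space J)" for \<omega>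
    using nn_integral_point_measure[of "indicator D" J "pp A" \<omega>] D by simp
  moreover have "(\<lambda>\<omega>. \<integral>\<^sup>+w. oapp (indicator D) (pp A w \<omega>) \<partial>count_space J) \<in> borel_measurable M"
    using assms by (intro borel_measurable_nn_integral_count_space oapp_measurable pp_measurable) auto
  ultimately show ?thesis by simp
qed

lemma emeasure_PM:
  assumes A: "A \<in> sets borel" and D: "D \<in> sets borel" and J: "J \<subseteq> labels"
  shows "emeasure (PM A J) D = (\<integral>\<^sup>+\<omega>. emeasure (point_measure J (pp A) \<omega>) D \<partial>M)"
  unfolding PM_def using assms by (intro emeasure_mixture point_measure_pp_measurable) auto

lemma emeasure_PM_split:
  assumes A: "A \<in> sets borel" and D: "D \<in> sets borel"
  shows "emeasure (PM A labels) D = emeasure (PM A {w \<in> labels. fst w \<noteq> snd w}) D +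
    emeasure (PM A {w \<in> labels. fst w = snd w}) D"
proof -
  have "emeasure (point_measure labels (pp A) \<omega>) D =
      emeasure (point_measure {w \<in> labels. fst w \<noteq> snd w} (pp A) \<omega>) D +
      emeasure (point_measure {w \<in> labels. fst w = snd w} (pp A) \<omega>) D" for \<omega>
    unfolding emeasure_point_measure[OF D]
    by (subst plus_emeasure) (auto intro!: arg_cong[where f="emeasure (count_space UNIV)"])
  then show ?thesis
    using A D by (simp add: emeasure_PM nn_integral_add point_measure_pp_measurable)
qed

lemma emeasure_PM_rectangle:
  assumes A [measurable]: "A \<in> sets borel" and I [measurable]: "I \<in> sets borel" and J [measurable]: "J \<in> sets borel"
  shows "emeasure (PM A labels) (I \<times> J) =
    (\<integral>\<^sup>+\<omega>. XI (\<lambda>z. indicator A (fst z) * indicator I (snd z)) \<omega> * XI (\<lambda>z. indicator A (fst z) * indicator J (snd z)) \<omega> \<partial>M)"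
proof -
  have IJ: "I \<times> J \<in> sets (borel :: (real \<times> real) measure)"
    unfolding borel_prod[symmetric] by (intro pair_measureI) auto
  let ?f = "\<lambda>z::'a \<times> real. indicator A (fst z) * indicator I (snd z) :: ennreal"
  let ?h = "\<lambda>z::'a \<times> real. indicator A (fst z) * indicator J (snd z) :: ennreal"
  have "emeasure (point_measure labels (pp A) \<omega>) (I \<times> J) = XI ?f \<omega> * XI ?h \<omega>" for \<omega>
  proof -
    let ?L = "{u :: nat list. u \<noteq> []}"
    have "emeasure (point_measure labels (pp A) \<omega>) (I \<times> J) =
        (\<integral>\<^sup>+w. oapp (indicator (I \<times> J)) (pp A w \<omega>) \<partial>count_space labels)"
      using nn_integral_point_measure[of "indicator (I \<times> J)" labels "pp A" \<omega>] IJ by simp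
    also have "\<dots> = (\<integral>\<^sup>+w. oapp (indicator (I \<times> J)) (pp A w \<omega>) * indicator labels w \<partial>count_space UNIV)"
      by (rule nn_integral_count_space_indicator) simp
    also have "\<dots> = (\<integral>\<^sup>+w. (oapp ?f (pos (fst w) \<omega>) * indicator ?L (fst w)) * (oapp ?h (pos (snd w) \<omega>) * indicator ?L (snd w)) \<partial>count_space UNIV)"
      by (intro nn_integral_cong) (auto simp: pp_def labels_def indicator_def split: option.splits)
    also have "\<dots> = (\<integral>\<^sup>+u. \<integral>\<^sup>+v. (oapp ?f (pos u \<omega>) * indicator ?L u) * (oapp ?h (pos v \<omega>) * indicator ?L v) \<partial>count_space UNIV \<partial>count_space UNIV)"
      by (subst nn_integral_fst_count_space[symmetric]) simp
    also have "\<dots> = (\<integral>\<^sup>+u. oapp ?f (pos u \<omega>) * indicator ?L u \<partial>count_space UNIV) * (\<integral>\<^sup>+v. oapp ?h (pos v \<omega>) * indicator ?L v \<partial>count_space UNIV)"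
      by (simp only: nn_integral_cmult nn_integral_multc borel_measurable_count_space)
    also have "\<dots> = XI ?f \<omega> * XI ?h \<omega>"
      unfolding XI_eq by (subst (3 4) nn_integral_count_space_indicator) simp_all
    finally show ?thesis .
  qed
  then show ?thesis by (simp add: emeasure_PM[OF A IJ])
qed

text \<open>A sum over pairs of equal labels is a sum over points, whose mean is known; in the
  coordinates of \<open>Q\<close> the diagonal is the time difference 0, where the atom
  sits.\<close>

lemma emeasure_PM_diagonal:
  assumes A [measurable]: "A \<in> sets borel" and D [measurable]: "D \<in> sets borel"
  shows "emeasure (PM A {w \<in> labels. fst w = snd w}) D = emeasure (Q (atom A)) D"
proof -
  let ?f = "\<lambda>z::'a \<times> real. indicator A (fst z) * indicator D (snd z, snd z) :: ennreal"
  have f [measurable]: "?f \<in> borel_measurable borel" by measurable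
  have "emeasure (point_measure {w \<in> labels. fst w = snd w} (pp A) \<omega>) D = XI ?f \<omega>" for \<omega>
  proof -
    have "emeasure (point_measure {w \<in> labels. fst w = snd w} (pp A) \<omega>) D =
        (\<integral>\<^sup>+w. oapp (indicator D) (pp A w \<omega>) \<partial>count_space {w \<in> labels. fst w = snd w})"
      using nn_integral_point_measure[of "indicator D" "{w \<in> labels. fst w = snd w}" "pp A" \<omega>] by simp
    also have "\<dots> = (\<integral>\<^sup>+u. oapp (indicator D) (pp A (u, u) \<omega>) \<partial>count_space {u. u \<noteq> []})"
      by (rule nn_integral_bij_count_space[symmetric]) (auto simp: bij_betw_def inj_on_def labels_def)
    also have "\<dots> = XI ?f \<omega>"
      unfolding XI_eq by (intro nn_integral_cong) (auto simp: pp_def split: option.splits)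
    finally show ?thesis .
  qed
  then have "emeasure (PM A {w \<in> labels. fst w = snd w}) D = (\<integral>\<^sup>+\<omega>. XI ?f \<omega> \<partial>M)"
    by (subst emeasure_PM) auto
  also have "\<dots> = emeasure mu A * (\<integral>\<^sup>+s. indicator D (s, s) \<partial>lborel)"
    by (subst mean_XI) (auto simp: nn_integral_cmult nn_integral_multc)
  also have "\<dots> = (\<integral>\<^sup>+p. indicator D p \<partial>Q (atom A))"
  proof -
    interpret finite_measure "atom A" by (rule finite_atom)
    show ?thesis by (subst nn_integral_Q) (auto simp: nn_integral_atom nn_integral_cmult sigma_finite_measure_axioms)
  qed
  finally show ?thesis by simp
qed

text \<open>On a rectangle the number of pairs is a product of two counts, whose mean is given by
  \<open>second_XI\<close>; rectangles determine the measure because the squares have finite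
  mass.\<close>

lemma PM_labels:
  assumes A [measurable]: "A \<in> sets borel" shows "PM A labels = Q (R_full A)"
proof (rule measure_eqI_rectangles)
  note sf = locally_finite_sigma_finite[OF locally_finite_R_full[OF A]]
  fix I J :: "real set" assume I [measurable]: "I \<in> sets borel" and J [measurable]: "J \<in> sets borel"
  interpret S: sigma_finite_measure "R_full A" by (rule sf)
  have IJ: "I \<times> J \<in> sets (borel :: (real \<times> real) measure)"
    unfolding borel_prod[symmetric] by (intro pair_measureI) auto
  let ?f = "\<lambda>I (z::'a \<times> real). indicator A (fst z) * indicator I (snd z) :: ennreal"
  have m: "(\<integral>\<^sup>+x. \<integral>\<^sup>+s. ?f I (x, s) \<partial>lborel \<partial>mu) = emeasure mu A * emeasure lborel I"
    if [measurable]: "I \<in> sets borel" for I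
    by (simp add: nn_integral_cmult nn_integral_multc)
  have "emeasure (PM A labels) (I \<times> J) = (emeasure mu A * emeasure lborel I) * (emeasure mu A * emeasure lborel J) +
      (\<integral>\<^sup>+r. indicator I r * (\<integral>\<^sup>+d. indicator J (r + d) \<partial>rho_full A) \<partial>lborel)"
  proof -
    have "emeasure (PM A labels) (I \<times> J) = (\<integral>\<^sup>+x. \<integral>\<^sup>+s. ?f I (x, s) \<partial>lborel \<partial>mu) * (\<integral>\<^sup>+x. \<integral>\<^sup>+s. ?f J (x, s) \<partial>lborel \<partial>mu) +
        (\<integral>\<^sup>+x. \<integral>\<^sup>+s. GG (?f I) (x, s) * GG (?f J) (x, s) \<partial>lborel \<partial>mu)"
      unfolding emeasure_PM_rectangle[OF A I J] by (rule second_XI) measurable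
    then show ?thesis
      by (simp only: m[OF I] m[OF J] mean_GG_product[OF A borel_measurable_indicator[OF I] borel_measurable_indicator[OF J]])
  qed
  also have "\<dots> = (\<integral>\<^sup>+r. \<integral>\<^sup>+d. indicator (I \<times> J) (r, r + d) \<partial>R_full A \<partial>lborel)"
  proof -
    interpret F: finite_measure "rho_full A" by (rule finite_rho_full[OF A])
    have "(\<integral>\<^sup>+d. indicator (I \<times> J) (r, r + d) \<partial>R_full A) =
        (emeasure mu A * emeasure mu A * emeasure lborel J) * indicator I r + indicator I r * (\<integral>\<^sup>+d. indicator J (r + d) \<partial>rho_full A)" for r
    proof -
      have "(\<integral>\<^sup>+d. indicator (I \<times> J) (r, r + d) \<partial>R_full A) = (\<integral>\<^sup>+d. indicator I r * indicator J (r + d) \<partial>R_full A)"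
        by (intro nn_integral_cong) (auto simp: indicator_def)
      also have "\<dots> = indicator I r * (\<integral>\<^sup>+d. indicator J (r + d) \<partial>R_full A)"
        by (rule nn_integral_cmult) measurable
      also have "(\<integral>\<^sup>+d. indicator J (r + d) \<partial>R_full A) =
          emeasure mu A * emeasure mu A * (\<integral>\<^sup>+d. indicator J (r + d) \<partial>lborel) + (\<integral>\<^sup>+d. indicator J (r + d) \<partial>rho_full A)"
        using A by (simp add: nn_integral_R_full nn_integral_rho_full nn_integral_dif)
      also have "(\<integral>\<^sup>+d. indicator J (r + d) \<partial>lborel) = emeasure lborel J"
        by (subst nn_integral_lborel_shift) auto
      finally show ?thesis by (simp add: distrib_left mult.commute)
    qed
    then have "(\<integral>\<^sup>+r. \<integral>\<^sup>+d. indicator (I \<times> J) (r, r + d) \<partial>R_full A \<partial>lborel) =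
        (\<integral>\<^sup>+r. (emeasure mu A * emeasure mu A * emeasure lborel J) * indicator I r +
          indicator I r * (\<integral>\<^sup>+d. indicator J (r + d) \<partial>rho_full A) \<partial>lborel)" by (simp only:)
    also have "\<dots> = (\<integral>\<^sup>+r. (emeasure mu A * emeasure mu A * emeasure lborel J) * indicator I r \<partial>lborel) +
        (\<integral>\<^sup>+r. indicator I r * (\<integral>\<^sup>+d. indicator J (r + d) \<partial>rho_full A) \<partial>lborel)"
      by (rule nn_integral_add) measurable
    also have "(\<integral>\<^sup>+r. (emeasure mu A * emeasure mu A * emeasure lborel J) * indicator I r \<partial>lborel) =
        (emeasure mu A * emeasure mu A * emeasure lborel J) * emeasure lborel I"
      by (rule nn_integral_cmult_indicator) simp
    finally show ?thesis by (simp only: mult_ac)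
  qed
  also have "\<dots> = (\<integral>\<^sup>+p. indicator (I \<times> J) p \<partial>Q (R_full A))"
    using IJ sf by (intro nn_integral_Q[symmetric]) auto
  finally show "emeasure (PM A labels) (I \<times> J) = emeasure (Q (R_full A)) (I \<times> J)" using IJ by simp
next
  fix n
  have [measurable]: "E n \<in> sets borel" by (rule E_props)
  have le: "XI (\<lambda>z. indicator A (fst z) * indicator {- real n..real n} (snd z)) \<omega> \<le> XI (indicator (E n)) \<omega>" for \<omega>
    by (rule XI_mono) (measurable, auto simp: E_def indicator_def)
  have "emeasure (PM A labels) (square n) \<le> (\<integral>\<^sup>+\<omega>. XI (indicator (E n)) \<omega> * XI (indicator (E n)) \<omega> \<partial>M)"
    unfolding square_def
    by (subst emeasure_PM_rectangle) (auto intro!: nn_integral_mono mult_mono le)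
  then show "emeasure (PM A labels) (square n) < \<infinity>" using second_E_finite by (rule le_less_trans)
qed simp_all

lemma emeasure_Q:
  assumes "sets N = sets borel" "sigma_finite_measure N" "D \<in> sets borel"
  shows "emeasure (Q N) D = (\<integral>\<^sup>+r. \<integral>\<^sup>+d. indicator D (r, r + d) \<partial>N \<partial>lborel)"
  using nn_integral_Q[OF assms(1,2), of "indicator D"] assms(3) by simp

text \<open>The measures of all pairs and of diagonal pairs are known. Inside a bounded square the
  diagonal part is finite and can be cancelled; \<open>nnlin_ext\<close> then passes to arbitrary
  Borel sets.\<close>

lemma PM_offdiagonal:
  assumes A [measurable]: "A \<in> sets borel" and D: "D \<in> sets borel"
  shows "emeasure (PM A {w \<in> labels. fst w \<noteq> snd w}) D = emeasure (Q (R A)) D"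
proof -
  let ?J = "{w \<in> labels. fst w \<noteq> snd w}"
  interpret a: finite_measure "atom A" by (rule finite_atom)
  have sf: "sigma_finite_measure (R_full A)" "sigma_finite_measure (R A)" "sigma_finite_measure (atom A)"
    using locally_finite_sigma_finite[OF locally_finite_R_full[OF A]] locally_finite_sigma_finite[OF locally_finite_R[OF A]]
      a.sigma_finite_measure_axioms by auto
  interpret Rs: sigma_finite_measure "R A" by (rule sf)
  have bounded: "emeasure (PM A ?J) D = emeasure (Q (R A)) D" if D [measurable]: "D \<in> sets borel" and sq: "D \<subseteq> square n" for D n
  proof -
    have "emeasure (Q (R_full A)) D = emeasure (Q (R A)) D + emeasure (Q (atom A)) D"
    proof -
      have "(\<integral>\<^sup>+d. indicator D (r, r + d) \<partial>R_full A) = (\<integral>\<^sup>+d. indicator D (r, r + d) \<partial>R A) + (\<integral>\<^sup>+d. indicator D (r, r + d) \<partial>atom A)" for r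
        unfolding R_full_eq[OF A] by (rule nn_integral_measure_add) measurable
      then show ?thesis using sf by (simp add: emeasure_Q nn_integral_add)
    qed
    moreover have "emeasure (PM A ?J) D + emeasure (Q (atom A)) D = emeasure (Q (R_full A)) D"
      by (simp only: emeasure_PM_split[OF A D] emeasure_PM_diagonal[OF A D] flip: PM_labels[OF A])
    ultimately have "emeasure (PM A ?J) D + emeasure (Q (atom A)) D = emeasure (Q (R A)) D + emeasure (Q (atom A)) D"
      by (simp only:)
    moreover have "emeasure (Q (atom A)) D \<noteq> \<infinity>"
    proof -
      have "emeasure (Q (atom A)) D = emeasure mu A * (\<integral>\<^sup>+r. indicator D (r, r) \<partial>lborel)"
        using sf by (simp add: emeasure_Q nn_integral_atom nn_integral_cmult)
      also have "\<dots> \<le> emeasure mu A * (\<integral>\<^sup>+r. indicator {- real n..real n} r \<partial>lborel)"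
        using sq by (intro mult_left_mono nn_integral_mono) (auto simp: indicator_def square_def)
      also have "\<dots> < \<infinity>" using emeasure_mu_finite by (simp add: ennreal_mult_less_top)
      finally show ?thesis by simp
    qed
    ultimately show "emeasure (PM A ?J) D = emeasure (Q (R A)) D"
      unfolding add.commute[of _ "emeasure (Q (atom A)) D"] ennreal_add_left_cancel by blast
  qed
  have "(\<integral>\<^sup>+p. indicator D p \<partial>PM A ?J) = (\<integral>\<^sup>+p. indicator D p \<partial>Q (R A))"
  proof (rule nnlin_ext[where \<Phi>="\<lambda>f. \<integral>\<^sup>+p. f p \<partial>PM A ?J" and \<Psi>="\<lambda>f. \<integral>\<^sup>+p. f p \<partial>Q (R A)",
        OF _ _ square_props])
    show "nnlin (\<lambda>f. \<integral>\<^sup>+p. f p \<partial>PM A ?J)" by (rule nnlin_nn_integral) simp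
    show "nnlin (\<lambda>f. \<integral>\<^sup>+p. f p \<partial>Q (R A))" by (rule nnlin_nn_integral) simp
    show "indicator D \<in> borel_measurable borel" using D by simp
    fix n and B :: "(real \<times> real) set" assume "B \<in> sets borel" "B \<subseteq> square n"
    then show "(\<integral>\<^sup>+p. indicator B p \<partial>PM A ?J) = (\<integral>\<^sup>+p. indicator B p \<partial>Q (R A))"
      using bounded[of B n] by simp
  qed
  then show ?thesis using D by simp
qed

theorem factorial_moment:
  assumes A: "A \<in> sets borel" shows "reduced_factorial_moment2 M pos A (R A)"
  unfolding reduced_factorial_moment2_def
proof (intro conjI ballI)
  show "locally_finite_measure (R A)" by (rule locally_finite_R[OF A])
  fix D :: "(real \<times> real) set" assume D: "D \<in> sets borel"
  define D' where "D' = (\<lambda>(r, s). (r, s - r)) -` D"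
  have "(\<lambda>p::real \<times> real. (fst p, snd p - fst p)) \<in> borel_measurable borel" by measurable
  from measurable_sets[OF this D] have D': "D' \<in> sets borel" by (simp add: D'_def case_prod_unfold)
  have set_eq: "{(u, v). u \<noteq> [] \<and> v \<noteq> [] \<and> u \<noteq> v \<and>
        (\<exists>x s y t. pos u \<omega> = Some (x, s) \<and> pos v \<omega> = Some (y, t) \<and> x \<in> A \<and> y \<in> A \<and> (s, t) \<in> D')} =
      {w \<in> {w \<in> labels. fst w \<noteq> snd w}. \<exists>b\<in>D'. pp A w \<omega> = Some b}" (is "?l = ?r") for \<omega>
  proof (rule set_eqI)
    fix w :: "nat list \<times> nat list"
    obtain u v where w: "w = (u, v)" by (cases w)
    show "w \<in> ?l \<longleftrightarrow> w \<in> ?r"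
      unfolding w by (cases "pos u \<omega>"; cases "pos v \<omega>") (auto simp: pp_def labels_def)
  qed
  have "factorial_moment2 M pos A D' = emeasure (PM A {w \<in> labels. fst w \<noteq> snd w}) D'"
    unfolding factorial_moment2_def set_eq using A D'
    by (subst emeasure_PM) (auto simp: emeasure_point_measure)
  also have "\<dots> = emeasure (Q (R A)) D'" by (rule PM_offdiagonal[OF A D'])
  also have "\<dots> = emeasure (lborel \<Otimes>\<^sub>M R A) D"
  proof -
    have "(\<lambda>p. (fst p, fst p + snd p)) -` D' \<inter> space (lborel \<Otimes>\<^sub>M R A) = D"
      using sets_eq_imp_space_eq[OF sets_R[of A]] by (auto simp: D'_def space_pair_measure)
    then show ?thesis
      unfolding Q_def using D' by (subst emeasure_distr) (auto intro!: Q_map_measurable)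
  qed
  finally show "factorial_moment2 M pos A ((\<lambda>(r, s). (r, s - r)) -` D) = emeasure (lborel \<Otimes>\<^sub>M R A) D"
    by (simp add: D'_def)
qed

end

section \<open>Comparison with the temporal resolvent\<close>

context hawkes_data
begin

lemma T_zero: "1 \<le> emeasure T {0}"
proof -
  have "emeasure T {0} = (\<integral>\<^sup>+t. indicator {0} t \<partial>T)" by simp
  also have "\<dots> = (\<Sum>k. \<integral>\<^sup>+t. indicator {0} t \<partial>temp_conv_pow_measure gt k)" by (rule nn_integral_T) simp
  also have "\<dots> \<ge> (\<Sum>k\<in>{0}. \<integral>\<^sup>+t. indicator {0} t \<partial>temp_conv_pow_measure gt k)"
    by (rule sum_le_suminf) auto
  also have "(\<Sum>k\<in>{0}. \<integral>\<^sup>+t. indicator {0} t \<partial>temp_conv_pow_measure gt k) = 1"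
    by (simp add: temp_conv_pow_measure_eq nn_integral_return)
  finally show ?thesis .
qed

lemma T_nonneg: "AE t in T. 0 \<le> t"
proof -
  have tc: "tc j t * indicator {..<0} t = 0" for j t
    using tc_eq[of t j, symmetric] by (auto simp: indicator_def)
  have z: "(\<integral>\<^sup>+t. indicator {..<0} t \<partial>temp_conv_pow_measure gt k) = 0" for k
  proof (cases k)
    case (Suc j)
    have "(\<integral>\<^sup>+t. indicator {..<0} t \<partial>density lborel (tc j)) = (\<integral>\<^sup>+t. tc j t * indicator {..<0} t \<partial>lborel)"
      by (rule nn_integral_density) auto
    then show ?thesis unfolding Suc temp_conv_pow_measure_eq tc by simp
  qed (simp add: temp_conv_pow_measure_eq nn_integral_return)
  have "emeasure T {..<0} = (\<integral>\<^sup>+t. indicator {..<0} t \<partial>T)" by simp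
  also have "\<dots> = 0" by (subst nn_integral_T) (simp_all only: z suminf_zero, simp)
  finally have "{..<0} \<in> null_sets T" by (auto intro!: null_setsI)
  then show ?thesis by (rule AE_I') auto
qed

definition Wt :: "real \<Rightarrow> (real \<times> real) set" where
  "Wt t = {(u, v). 0 \<le> u \<and> 0 \<le> v \<and> 0 \<le> v - u \<and> v - u \<le> t}"

lemma Wt_sets: "Wt t \<in> sets (T \<Otimes>\<^sub>M T)"
proof -
  have "{p \<in> space (T \<Otimes>\<^sub>M T). 0 \<le> fst p \<and> 0 \<le> snd p \<and> 0 \<le> snd p - fst p \<and> snd p - fst p \<le> t} \<in> sets (T \<Otimes>\<^sub>M T)"
    by measurable
  then show ?thesis by (simp add: Wt_def space_pair_measure case_prod_unfold)
qed

text \<open>The additional conditions \<open>0 \<le> u\<close> and \<open>0 \<le> v\<close> in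
  \<open>Wt\<close> hold almost everywhere for \<open>T\<close>.\<close>

lemma T_pairs: "(\<integral>\<^sup>+u. \<integral>\<^sup>+v. indicator {0..t} (v - u) \<partial>T \<partial>T) = emeasure (T \<Otimes>\<^sub>M T) (Wt t)"
proof -
  interpret finite_measure T by (rule finite_T)
  have W: "Wt t \<in> sets (T \<Otimes>\<^sub>M T)" by (rule Wt_sets)
  have "(\<integral>\<^sup>+u. \<integral>\<^sup>+v. indicator {0..t} (v - u) \<partial>T \<partial>T) = (\<integral>\<^sup>+u. \<integral>\<^sup>+v. indicator (Wt t) (u, v) \<partial>T \<partial>T)"
  proof (rule nn_integral_cong_AE, use T_nonneg in eventually_elim)
    case (elim u)
    show ?case
      by (rule nn_integral_cong_AE, use T_nonneg in eventually_elim) (use elim in \<open>auto simp: Wt_def indicator_def\<close>)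
  qed
  also have "\<dots> = emeasure (T \<Otimes>\<^sub>M T) (Wt t)" using W by (rule emeasure_pair_measure[symmetric])
  finally show ?thesis .
qed

text \<open>The exponent 0 gives \<open>T\<close> an atom at 0, and the pair \<open>(0, 0)\<close>
  has mass at least 1. The resulting sign of the difference with 1 is used when \<open>mu X\<close>
  is replaced by its upper bound.\<close>

lemma T_pairs_ge_1: assumes "0 \<le> t" shows "1 \<le> emeasure (T \<Otimes>\<^sub>M T) (Wt t)"
proof -
  interpret finite_measure T by (rule finite_T)
  have W: "Wt t \<in> sets (T \<Otimes>\<^sub>M T)" by (rule Wt_sets)
  have "1 * 1 \<le> emeasure T {0} * emeasure T {0}" by (intro mult_mono T_zero) auto
  also have "\<dots> = emeasure (T \<Otimes>\<^sub>M T) ({0} \<times> {0})" by (rule emeasure_pair_measure_Times[symmetric]) auto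
  also have "\<dots> \<le> emeasure (T \<Otimes>\<^sub>M T) (Wt t)" using W assms by (intro emeasure_mono) (auto simp: Wt_def)
  finally show ?thesis by simp
qed

lemma T_pairs_finite: "emeasure (T \<Otimes>\<^sub>M T) (Wt t) < top"
proof -
  interpret finite_measure T by (rule finite_T)
  have "emeasure (T \<Otimes>\<^sub>M T) (Wt t) \<le> emeasure (T \<Otimes>\<^sub>M T) (UNIV \<times> UNIV)"
    by (intro emeasure_mono pair_measureI) auto
  also have "\<dots> = emeasure T UNIV * emeasure T UNIV" by (rule emeasure_pair_measure_Times) auto
  finally show ?thesis using Ct_finite by (simp add: T_mass ennreal_mult_less_top le_less_trans)
qed

lemma mu_UNIV_eq: "emeasure mu UNIV = emeasure mu X"
proof -
  have "emeasure mu UNIV = emeasure mu X + emeasure mu (- X)"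
    by (subst plus_emeasure) auto
  then show ?thesis by (simp add: emeasure_mu_outside)
qed

text \<open>No cluster member precedes its ancestor, so the restriction of lags to
  \<open>{0..}\<close> loses nothing; and \<open>kap\<close> is \<open>conv_pow_measure\<close>
  wherever \<open>lamX\<close> does not vanish.\<close>

lemma mu_background:
  assumes A: "A \<in> sets borel"
  shows "emeasure mu A = background_conv X lam (\<lambda>y. measure_sum (\<lambda>k. conv_pow_measure X g k y)) (A \<times> {0..})"
proof -
  have B: "A \<times> {0::real..} \<in> sets borel" "A \<times> (UNIV :: real set) \<in> sets borel"
    unfolding borel_prod[symmetric] using A by (auto intro!: pair_measureI)
  have G: "emeasure (G y) (A \<times> UNIV) = emeasure (G y) (A \<times> {0..})" for y
  proof -
    have *: "cp j y (fst z) (snd z) * indicator (A \<times> UNIV) z = cp j y (fst z) (snd z) * indicator (A \<times> {0..}) z" for j z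
      by (cases "snd z < 0") (auto simp: cp_neg indicator_def)
    have "(\<integral>\<^sup>+z. indicator (A \<times> UNIV) z \<partial>G y) = (\<integral>\<^sup>+z. indicator (A \<times> {0..}) z \<partial>G y)"
      unfolding nn_integral_G_density[OF borel_measurable_indicator[OF B(1)]]
        nn_integral_G_density[OF borel_measurable_indicator[OF B(2)]] *
      by (simp add: indicator_def)
    then show ?thesis using B by simp
  qed
  show ?thesis
    unfolding emeasure_mu[OF A] background_conv_def G
  proof (rule nn_integral_cong)
    fix y
    show "lamX y * emeasure (G y) (A \<times> {0..}) = ennreal (lam y) *
        emeasure (measure_sum (\<lambda>k. conv_pow_measure X g k y)) (A \<times> {0..}) * indicator X y"
      by (cases "y \<in> X") (simp_all add: lamX_def G_def conv_pow_measure_eq_kap)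
  qed
qed

text \<open>The atom has mass \<open>mu X\<close> and lies in \<open>{0..t}\<close>. Moved to the
  other side of \<open>rho_full_le_T\<close>, it turns the factor \<open>p\<close> of
  \<open>mu X\<close> into \<open>p - 1\<close>.\<close>

lemma measure_rho_le:
  assumes t: "0 \<le> t"
  shows "measure (rho X) {0..t} \<le> enn2real (\<integral>\<^sup>+x. lamX x \<partial>lborel) / (1 - enn2real nut) *
    (measure (T \<Otimes>\<^sub>M T) (Wt t) - 1)"
proof -
  obtain m where m: "emeasure mu X = ennreal m" "0 \<le> m" using emeasure_mu_finite[of X] by (cases "emeasure mu X") auto
  obtain p where p: "emeasure (T \<Otimes>\<^sub>M T) (Wt t) = ennreal p" "0 \<le> p"
    using T_pairs_finite[of t] by (cases "emeasure (T \<Otimes>\<^sub>M T) (Wt t)") auto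
  obtain l where l: "(\<integral>\<^sup>+x. lamX x \<partial>lborel) = ennreal l" "0 \<le> l"
    using m_lam by (cases "\<integral>\<^sup>+x. lamX x \<partial>lborel") (auto simp: m_lam_eq)
  have "nut < top" using nut_less_1 by (rule order.strict_trans) simp
  then obtain n where n: "nut = ennreal n" "0 \<le> n" by (cases nut) auto
  have n1: "n < 1" using nut_less_1 n by (simp add: ennreal_less_iff flip: ennreal_1)
  obtain r where r: "emeasure (rho X) {0..t} = ennreal r" "0 \<le> r"
    using finite_rho[OF X, of "{0..t}"] by (cases "emeasure (rho X) {0..t}") auto
  have p1: "1 \<le> p" using T_pairs_ge_1[OF t] p by (simp flip: ennreal_1)
  have "emeasure (rho X) {0..t} + emeasure mu X \<le> emeasure mu X * emeasure (T \<Otimes>\<^sub>M T) (Wt t)"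
    using rho_full_eq[OF X, of "{0..t}"] rho_full_le_T[OF X, of "{0..t}"] t
    by (simp add: emeasure_atom mu_UNIV_eq T_pairs)
  then have "r + m \<le> m * p" using m p r by (simp flip: ennreal_plus ennreal_mult)
  moreover have "m \<le> l / (1 - n)"
  proof -
    have "emeasure mu X \<le> (\<integral>\<^sup>+x. lamX x \<partial>lborel) / (1 - nut)"
      by (rule emeasure_mu_le[OF X nuy_le_nut nut_less_1])
    also have "\<dots> = ennreal (l / (1 - n))"
      using l n n1 by (simp add: ennreal_minus divide_ennreal flip: ennreal_1)
    finally show ?thesis using m l n1 by (simp add: divide_nonneg_nonneg)
  qed
  ultimately have "r \<le> l / (1 - n) * (p - 1)"
    using mult_right_mono[of m "l / (1 - n)" "p - 1"] p1 by (simp add: right_diff_distrib)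
  then show ?thesis using r p l n by (simp add: measure_def)
qed

end

context hawkes
begin

lemma reduced_cov:
  assumes A: "A \<in> sets borel" "A \<subseteq> X" and S: "S \<in> sets borel" "bounded S"
  shows "reduced_factorial_cov muX R A S = measure (rho A) S"
proof -
  have "emeasure lborel S < \<infinity>" using S(2) by (rule emeasure_bounded_finite)
  then have "measure (R A) S = measure mu A * measure mu A * measure lborel S + measure (rho A) S"
    using emeasure_mu_finite[of A] finite_rho[OF A(1), of S]
    by (simp add: measure_def emeasure_R S enn2real_plus enn2real_mult ennreal_mult_less_top)
  moreover have "measure muX A = measure mu A" using A by (simp add: measure_def emeasure_muX)
  ultimately show ?thesis by (simp add: reduced_factorial_cov_def power2_eq_square)
qed

text \<open>The Lebesgue part of \<open>R A\<close> cancels against the squared mean, and the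
  remainder \<open>rho A\<close> is a measure; the negative part is null, with the whole line as
  \<open>H\<close>.\<close>

lemma jordan:
  assumes A: "A \<in> sets borel" "A \<subseteq> X"
  shows "jordan_decomposition (reduced_factorial_cov muX R A) (rho A) (null_measure borel)"
  unfolding jordan_decomposition_def
proof (intro conjI ballI impI)
  show "locally_finite_measure (rho A)" by (rule locally_finite_rho[OF A(1)])
  show "locally_finite_measure (null_measure borel)" by (simp add: locally_finite_measure_def)
  show "\<exists>H\<in>sets borel. emeasure (rho A) (- H) = 0 \<and> emeasure (null_measure borel) H = 0"
    by (intro bexI[of _ UNIV]) auto
  fix S :: "real set" assume "S \<in> sets borel" "bounded S"
  then show "reduced_factorial_cov muX R A S = measure (rho A) S - measure (null_measure borel) S"
    using A by (simp add: reduced_cov measure_def)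
qed

lemma mean_interval:
  assumes "A \<in> sets borel" "A \<subseteq> X" "0 < t"
  shows "(\<integral>\<^sup>+\<omega>. emeasure (hawkes_process pos \<omega>) (A \<times> {0<..t}) \<partial>M) = ennreal t * emeasure muX A"
  using assms by (simp add: mean_emeasure emeasure_muX mult.commute)

lemma partition_bound:
  fixes As :: "nat \<Rightarrow> 'a set"
  assumes As: "\<And>i. i \<in> {1..N} \<Longrightarrow> As i \<in> sets borel" "disjoint_family_on As {1..N}"
  shows "(\<Sum>i = 1..N. measure (rho (As i)) {0..t}) \<le> enn2real (emeasure mu UNIV * (Ct * Ct))"
proof -
  have "(\<Sum>i = 1..N. measure (rho (As i)) {0..t}) = enn2real (\<Sum>i = 1..N. emeasure (rho (As i)) {0..t})"
  proof -
    have "(\<Sum>i = 1..N. emeasure (rho (As i)) {0..t}) = (\<Sum>i = 1..N. ennreal (measure (rho (As i)) {0..t}))"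
      using finite_rho[OF As(1)] by (intro sum.cong refl emeasure_eq_ennreal_measure) (auto simp: less_top)
    then show ?thesis by (simp add: sum_nonneg)
  qed
  also have "\<dots> \<le> enn2real (emeasure mu UNIV * (Ct * Ct))"
  proof (rule enn2real_mono)
    have "(\<Sum>i = 1..N. emeasure (rho (As i)) {0..t}) \<le> (\<Sum>i = 1..N. emeasure (rho_full (As i)) UNIV)"
    proof (rule sum_mono)
      fix i assume "i \<in> {1..N}"
      then have "As i \<in> sets borel" by (rule As(1))
      then have "emeasure (rho (As i)) {0..t} \<le> emeasure (rho_full (As i)) {0..t}" by (rule rho_le_rho_full) simp
      also have "\<dots> \<le> emeasure (rho_full (As i)) UNIV" by (intro emeasure_mono) auto
      finally show "emeasure (rho (As i)) {0..t} \<le> emeasure (rho_full (As i)) UNIV" .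
    qed
    also have "\<dots> \<le> emeasure mu UNIV * (Ct * Ct)" using As by (intro sum_rho_full_le) auto
    finally show "(\<Sum>i = 1..N. emeasure (rho (As i)) {0..t}) \<le> emeasure mu UNIV * (Ct * Ct)" .
    show "emeasure mu UNIV * (Ct * Ct) < top"
      using emeasure_mu_finite Ct_finite by (simp add: ennreal_mult_less_top)
  qed
  finally show ?thesis .
qed

lemma hawkes_conclusion:
  defines "m_lam \<equiv> (\<integral>\<^sup>+ x\<in>X. ennreal (lam x) \<partial>lborel)"
    and "nu_temp \<equiv> (\<integral>\<^sup>+ h\<in>{0..}. ennreal (gt h) \<partial>lborel)"
    and "nu \<equiv> (\<lambda>y. \<integral>\<^sup>+ (x, h)\<in>X \<times> {0..}. ennreal (g y x h) \<partial>lborel)"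
  defines "nu_bar \<equiv> (SUP y\<in>X. nu y)"
  shows "as_locally_finite M X (hawkes_process pos) \<and>
      strongly_time_stationary M (hawkes_process pos) \<and>
      L2_process M (hawkes_process pos) \<and>
      (\<exists>\<mu> R Gpos Gneg.
        spatial_mean_measure M X (hawkes_process pos) \<mu> \<and>
        (\<forall>A\<in>sets borel. A \<subseteq> X \<longrightarrow>
          reduced_factorial_moment2 M pos A (R A) \<and>
          jordan_decomposition (reduced_factorial_cov \<mu> R A) (Gpos A) (Gneg A)) \<and>
        (\<forall>A\<in>sets borel. A \<subseteq> X \<longrightarrow> (\<forall>t>0.
          (\<integral>\<^sup>+ \<omega>. emeasure (hawkes_process pos \<omega>) (A \<times> {0<..t}) \<partial>M) = ennreal t * emeasure \<mu> A \<and>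
          ennreal t * emeasure \<mu> A =
            ennreal t * background_conv X lam (\<lambda>y. measure_sum (\<lambda>k. conv_pow_measure X g k y)) (A \<times> {0..}) \<and>
          ennreal t * emeasure \<mu> A \<le> ennreal t * (m_lam / (1 - nu_bar)))) \<and>
        ((\<forall>y\<in>X. \<forall>y'\<in>X. \<forall>x\<in>X. \<forall>h. g y x h = g y' x h) \<longrightarrow>
          (\<forall>y\<in>X. \<forall>t>0.
            (\<integral>\<^sup>+ \<omega>. emeasure (hawkes_process pos \<omega>) (X \<times> {0<..t}) \<partial>M) = ennreal t * emeasure \<mu> X \<and>
            ennreal t * emeasure \<mu> X = ennreal t * (m_lam / (1 - nu y)))) \<and>
        (\<forall>t\<ge>0. reduced_factorial_cov \<mu> R X {0..t} \<le>
          enn2real m_lam / (1 - enn2real nu_temp) *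
            (measure (temp_resolvent gt \<Otimes>\<^sub>M temp_resolvent gt)
              {(u, v). 0 \<le> u \<and> 0 \<le> v \<and> 0 \<le> v - u \<and> v - u \<le> t} - 1)) \<and>
        emeasure (temp_resolvent gt) {0..} \<le> 1 / (1 - nu_temp) \<and>
        1 / (1 - nu_temp) < \<infinity> \<and>
        (\<exists>\<kappa> t0. 0 \<le> \<kappa> \<and> 0 < t0 \<and>
          (\<forall>N As. (\<forall>i\<in>{1..N}. As i \<in> sets borel) \<and> disjoint_family_on As {1..N} \<and>
              (\<Union>i\<in>{1..N}. As i) = X \<longrightarrow>
            (\<forall>t\<ge>t0. (\<Sum>i = 1..N::nat. measure (Gpos (As i)) {0..t}) \<le> \<kappa>))))"
proof -
  have m: "m_lam = (\<integral>\<^sup>+x. lamX x \<partial>lborel)" by (simp add: m_lam_def m_lam_eq)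
  have nt: "nu_temp = nut" by (simp add: nu_temp_def nut_def gtp_def)
  have n: "nu y = nuy y" if "y \<in> X" for y using nuy_eq[OF that] by (simp add: nu_def)
  \<comment> \<open>The mass bounds ask for all \<open>y\<close>. Outside \<open>X\<close>, where
    the supremum says nothing, \<open>nuy\<close> is 0.\<close>
  have nb: "nuy y \<le> nu_bar" for y
  proof (cases "y \<in> X")
    case True
    then have "nu y \<le> nu_bar" unfolding nu_bar_def by (rule SUP_upper)
    then show ?thesis using True by (simp add: n)
  qed (simp add: nuy_outside)
  have nb1: "nu_bar < 1"
  proof -
    have "nu_bar \<le> nut" unfolding nu_bar_def by (rule SUP_least) (simp add: n nuy_le_nut)
    then show ?thesis using nut_less_1 by (rule le_less_trans)
  qed
  have X_sub: "X \<in> sets borel" "X \<subseteq> X" by (auto simp: X)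
  have 1: "ennreal t * emeasure muX A = ennreal t * background_conv X lam (\<lambda>y. measure_sum (\<lambda>k. conv_pow_measure X g k y)) (A \<times> {0..})"
    "ennreal t * emeasure muX A \<le> ennreal t * (m_lam / (1 - nu_bar))"
    if "A \<in> sets borel" "A \<subseteq> X" for A t
    using that emeasure_mu_le[OF that(1) nb nb1] unfolding m
    by (simp_all add: emeasure_muX mu_background mult_left_mono)
  \<comment> \<open>For a kernel that is constant in its first argument \<open>nu\<close> is
    constant on \<open>X\<close>, and the geometric series is exact instead of an upper
    bound.\<close>
  have 2: "emeasure muX X = m_lam / (1 - nu y)"
    if c: "\<forall>y\<in>X. \<forall>y'\<in>X. \<forall>x\<in>X. \<forall>h. g y x h = g y' x h" and y: "y \<in> X" for y
  proof -
    have nn: "nu y' = nu y" if "y' \<in> X" for y'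
    proof -
      have "ennreal (g y' (fst z) (snd z)) * indicator (X \<times> {0..}) z = ennreal (g y (fst z) (snd z)) * indicator (X \<times> {0..}) z" for z
      proof (cases "z \<in> X \<times> {0..}")
        case True
        then have "g y' (fst z) (snd z) = g y (fst z) (snd z)"
          using c[THEN bspec, OF that, THEN bspec, OF y] by (auto simp: mem_Times_iff)
        then show ?thesis by simp
      qed simp
      then show ?thesis unfolding nu_def case_prod_unfold by simp
    qed
    have "nuy y' = nuy y" if "y' \<in> X" for y' using nn[OF that] n[OF that] n[OF y] by argo
    then have "emeasure mu UNIV = m_lam / (1 - nuy y)"
      unfolding m using nuy_le_nut[of y] nut_less_1 by (intro emeasure_mu_UNIV_eq) (auto intro: le_less_trans)
    then show ?thesis by (simp add: n[OF y] emeasure_muX mu_UNIV_eq)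
  qed
  have 3: "reduced_factorial_cov muX R X {0..t} \<le> enn2real m_lam / (1 - enn2real nu_temp) *
      (measure (temp_resolvent gt \<Otimes>\<^sub>M temp_resolvent gt)
        {(u, v). 0 \<le> u \<and> 0 \<le> v \<and> 0 \<le> v - u \<and> v - u \<le> t} - 1)" if "0 \<le> t" for t
    using measure_rho_le[OF that] unfolding m nt Wt_def T_def[symmetric]
    by (simp add: reduced_cov[OF X_sub])
  have 4: "emeasure (temp_resolvent gt) {0..} \<le> 1 / (1 - nu_temp)"
    unfolding nt Ct_def[symmetric] T_mass[symmetric] T_def[symmetric] by (rule emeasure_mono) auto
  have 5: "1 / (1 - nu_temp) < \<infinity>" using Ct_finite by (simp add: nt Ct_def)
  have 6: "(\<Sum>i = 1..N. measure (rho (As i)) {0..t}) \<le> enn2real (emeasure mu UNIV * (Ct * Ct))"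
    if "(\<forall>i\<in>{1..N}. As i \<in> sets borel) \<and> disjoint_family_on As {1..N} \<and> (\<Union>i\<in>{1..N}. As i) = X"
    for N t and As :: "nat \<Rightarrow> 'a set"
    using that by (intro partition_bound) auto
  show ?thesis
  proof (intro conjI exI)
    show "as_locally_finite M X (hawkes_process pos)" by (rule locally_finite)
    show "strongly_time_stationary M (hawkes_process pos)" by (rule stationary)
    show "L2_process M (hawkes_process pos)" by (rule L2)
    show "spatial_mean_measure M X (hawkes_process pos) muX" by (rule spatial_mean)
    show "\<forall>A\<in>sets borel. A \<subseteq> X \<longrightarrow> reduced_factorial_moment2 M pos A (R A) \<and>
        jordan_decomposition (reduced_factorial_cov muX R A) (rho A) (null_measure borel)"
      by (intro ballI impI conjI factorial_moment jordan)
    show "\<forall>A\<in>sets borel. A \<subseteq> X \<longrightarrow> (\<forall>t>0.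
          (\<integral>\<^sup>+ \<omega>. emeasure (hawkes_process pos \<omega>) (A \<times> {0<..t}) \<partial>M) = ennreal t * emeasure muX A \<and>
          ennreal t * emeasure muX A =
            ennreal t * background_conv X lam (\<lambda>y. measure_sum (\<lambda>k. conv_pow_measure X g k y)) (A \<times> {0..}) \<and>
          ennreal t * emeasure muX A \<le> ennreal t * (m_lam / (1 - nu_bar)))"
      by (intro ballI impI allI conjI mean_interval 1)
    show "(\<forall>y\<in>X. \<forall>y'\<in>X. \<forall>x\<in>X. \<forall>h. g y x h = g y' x h) \<longrightarrow>
          (\<forall>y\<in>X. \<forall>t>0.
            (\<integral>\<^sup>+ \<omega>. emeasure (hawkes_process pos \<omega>) (X \<times> {0<..t}) \<partial>M) = ennreal t * emeasure muX X \<and>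
            ennreal t * emeasure muX X = ennreal t * (m_lam / (1 - nu y)))"
      by (intro impI ballI allI conjI mean_interval[OF X_sub] arg_cong[where f="(*) _"], assumption, rule 2)
    show "\<forall>t\<ge>0. reduced_factorial_cov muX R X {0..t} \<le> enn2real m_lam / (1 - enn2real nu_temp) *
      (measure (temp_resolvent gt \<Otimes>\<^sub>M temp_resolvent gt)
        {(u, v). 0 \<le> u \<and> 0 \<le> v \<and> 0 \<le> v - u \<and> v - u \<le> t} - 1)" using 3 by blast
    show "emeasure (temp_resolvent gt) {0..} \<le> 1 / (1 - nu_temp)" by (rule 4)
    show "1 / (1 - nu_temp) < \<infinity>" by (rule 5)
    \<comment> \<open>The constant bounds the total masses of the \<open>rho_full (As i)\<close>,
      whatever the length of the interval; \<open>t0 = 1\<close> is an arbitrary positive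
      choice.\<close>
    show "0 \<le> enn2real (emeasure mu UNIV * (Ct * Ct))" by simp
    show "(0::real) < 1" by simp
    show "\<forall>N As. (\<forall>i\<in>{1..N}. As i \<in> sets borel) \<and> disjoint_family_on As {1..N} \<and> (\<Union>i\<in>{1..N}. As i) = X \<longrightarrow>
        (\<forall>t\<ge>1. (\<Sum>i = 1..N::nat. measure (rho (As i)) {0..t}) \<le> enn2real (emeasure mu UNIV * (Ct * Ct)))"
      using 6 by blast
  qed
qed

end

section \<open>Poisson points with Lebesgue intensity\<close>

text \<open>The integrand reads the coordinates in \<open>J\<close> only, so the product measure may
  be replaced by its finite marginal, for which the product formula is known.\<close>

lemma nn_integral_PiM_prod:
  assumes M: "\<And>i. prob_space (M i)" and J: "finite J" "J \<subseteq> I"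
    and f: "\<And>j. j \<in> J \<Longrightarrow> f j \<in> borel_measurable (M j)"
  shows "(\<integral>\<^sup>+x. (\<Prod>j\<in>J. f j (x j)) \<partial>PiM I M) = (\<Prod>j\<in>J. \<integral>\<^sup>+y. f j y \<partial>M j)"
proof -
  interpret M: prob_space "M i" for i by (rule M)
  interpret product_prob_space M I by unfold_locales
  have m: "(\<lambda>x. \<Prod>j\<in>J. f j (x j)) \<in> borel_measurable (PiM J M)"
  proof (rule borel_measurable_prod_ennreal)
    fix j assume "j \<in> J"
    then show "(\<lambda>x. f j (x j)) \<in> borel_measurable (PiM J M)"
      by (auto intro: measurable_compose[OF _ f])
  qed
  have "(\<integral>\<^sup>+x. (\<Prod>j\<in>J. f j (x j)) \<partial>PiM I M) = (\<integral>\<^sup>+x. (\<Prod>j\<in>J. f j (restrict x J j)) \<partial>PiM I M)"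
    by (intro nn_integral_cong prod.cong) auto
  also have "\<dots> = (\<integral>\<^sup>+x. (\<Prod>j\<in>J. f j (x j)) \<partial>distr (PiM I M) (PiM J M) (\<lambda>x. restrict x J))"
    by (rule nn_integral_distr[symmetric, OF measurable_restrict_subset[OF J(2)]]) (simp add: m)
  also have "\<dots> = (\<integral>\<^sup>+x. (\<Prod>j\<in>J. f j (x j)) \<partial>PiM J M)" using J by (simp add: distr_PiM_restrict_finite)
  also have "\<dots> = (\<Prod>j\<in>J. \<integral>\<^sup>+y. f j y \<partial>M j)" using J(1) f by (rule product_nn_integral_prod)
  finally show ?thesis .
qed

text \<open>Serves to write an argument \<open>c\<close> of the Poisson generating function as
  \<open>nexp s\<close>; the argument 0 corresponds to infinite \<open>s\<close>.\<close>

lemma nexp_surj: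
  assumes "c \<le> 1" obtains s where "c = nexp s"
proof (cases "c = 0")
  case True
  then show ?thesis using that[of top] by simp
next
  case False
  have "c \<noteq> top" using assms by (auto simp: top_unique)
  then obtain r where r: "c = ennreal r" "0 < r"
    using False by (cases c) (auto simp: less_le)
  then have "r \<le> 1" using assms by simp
  then have "nexp (ennreal (- ln r)) = c" using r by (simp add: nexp_ennreal)
  then show ?thesis using that by metis
qed

text \<open>Lebesgue measure is infinite, so the Poisson process is built piece by piece: on each
  set of finite volume, a Poisson number of independent uniform points.\<close>

locale poisson_pieces =
  fixes W :: "nat \<Rightarrow> 'c::euclidean_space set"
  assumes W [measurable]: "\<And>n. W n \<in> sets borel"
    and W_finite: "\<And>n. emeasure lborel (W n) < top"
    and W_disjoint: "disjoint_family W" and W_UNIV: "(\<Union>n. W n) = UNIV"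
begin

text \<open>A piece of volume 0 has no uniform distribution; the Dirac measure is a dummy value, and
  \<open>number\<close> then puts no points there.\<close>

definition location :: "nat \<Rightarrow> 'c measure" where
  "location n = (if emeasure lborel (W n) = 0 then return borel 0 else uniform_measure lborel (W n))"

definition number :: "nat \<Rightarrow> nat pmf" where
  "number n = (if emeasure lborel (W n) = 0 then return_pmf 0 else poisson_pmf (measure lborel (W n)))"

definition piece :: "nat \<Rightarrow> (nat \<times> (nat \<Rightarrow> 'c)) measure" where
  "piece n = measure_pmf (number n) \<Otimes>\<^sub>M PiM UNIV (\<lambda>_. location n)"

definition space_of_points :: "(nat \<Rightarrow> nat \<times> (nat \<Rightarrow> 'c)) measure" where
  "space_of_points = PiM UNIV piece"

text \<open>The index \<open>i\<close> codes a piece and the number of a point in it; the infinite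
  supply of points in a piece is cut off at its random number of points.\<close>

definition active :: "nat \<Rightarrow> (nat \<Rightarrow> nat \<times> (nat \<Rightarrow> 'c)) \<Rightarrow> bool" where
  "active i \<sigma> \<longleftrightarrow> snd (prod_decode i) < fst (\<sigma> (fst (prod_decode i)))"

definition point :: "nat \<Rightarrow> (nat \<Rightarrow> nat \<times> (nat \<Rightarrow> 'c)) \<Rightarrow> 'c" where
  "point i \<sigma> = snd (\<sigma> (fst (prod_decode i))) (snd (prod_decode i))"

definition point_sum :: "('c \<Rightarrow> ennreal) \<Rightarrow> (nat \<Rightarrow> nat \<times> (nat \<Rightarrow> 'c)) \<Rightarrow> ennreal" where
  "point_sum f \<sigma> = (\<integral>\<^sup>+i. (if active i \<sigma> then f (point i \<sigma>) else 0) \<partial>count_space UNIV)"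

lemma sets_location [simp, measurable_cong]: "sets (location n) = sets borel"
  by (simp add: location_def)

lemma prob_location: "prob_space (location n)"
  using W_finite[of n] by (auto simp: location_def intro!: prob_space_return prob_space_uniform_measure)

lemma prob_locations: "prob_space (PiM UNIV (\<lambda>_::nat. location n))"
  by (intro prob_space_PiM prob_location)

lemma prob_piece: "prob_space (piece n)"
proof -
  interpret L: prob_space "PiM UNIV (\<lambda>_::nat. location n)" by (rule prob_locations)
  interpret pair_prob_space "measure_pmf (number n)" "PiM UNIV (\<lambda>_::nat. location n)" ..
  show ?thesis unfolding piece_def by unfold_locales
qed

lemma prob_space_of_points: "prob_space space_of_points"
  unfolding space_of_points_def by (intro prob_space_PiM prob_piece)

lemma sets_piece [measurable_cong]: "sets (piece n) = sets (count_space UNIV \<Otimes>\<^sub>M PiM UNIV (\<lambda>_. borel))"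
  unfolding piece_def by (intro sets_pair_measure_cong sets_PiM_cong) auto

lemma active_measurable [measurable]: "active i \<in> measurable space_of_points (count_space UNIV)"
  unfolding active_def[abs_def] space_of_points_def by measurable

lemma point_measurable [measurable]: "point i \<in> borel_measurable space_of_points"
proof -
  have "(\<lambda>x. snd x j) \<in> borel_measurable (count_space UNIV \<Otimes>\<^sub>M PiM UNIV (\<lambda>_::nat. borel :: 'c measure))" for j
    by measurable
  then have "(\<lambda>x. snd x j) \<in> borel_measurable (piece n)" for j n
    by (simp cong: measurable_cong_sets add: sets_piece)
  then have "(\<lambda>\<sigma>. snd (\<sigma> n) j) \<in> borel_measurable space_of_points" for n j
    unfolding space_of_points_def by (rule measurable_compose[OF measurable_component_singleton, rotated]) auto
  then show ?thesis unfolding point_def[abs_def] .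
qed

lemma piece_sum_measurable:
  fixes f :: "'c \<Rightarrow> ennreal"
  assumes [measurable]: "f \<in> borel_measurable borel"
  shows "(\<lambda>x. \<Sum>j<fst x. f (snd x j)) \<in> borel_measurable (piece n)"
proof -
  have "(\<lambda>x. \<Sum>j<fst x. f (snd x j)) \<in> borel_measurable (count_space UNIV \<Otimes>\<^sub>M PiM UNIV (\<lambda>_::nat. borel :: 'c measure))"
  proof (rule measurable_pair_measure_countable1)
    fix k :: nat
    have "(\<lambda>y. \<Sum>j<k. f (y j)) \<in> borel_measurable (PiM UNIV (\<lambda>_::nat. borel :: 'c measure))"
      by measurable
    then show "(\<lambda>y. \<Sum>j<fst (k, y). f (snd (k, y) j)) \<in> borel_measurable (PiM UNIV (\<lambda>_::nat. borel :: 'c measure))"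
      by simp
  qed simp
  then show ?thesis by (simp cong: measurable_cong_sets add: sets_piece)
qed

lemma number_mass: "pmf (number n) k = poisson_mass (emeasure lborel (W n)) k"
proof -
  have e: "emeasure lborel (W n) = ennreal (measure lborel (W n))"
    using W_finite[of n] by (simp add: emeasure_eq_ennreal_measure)
  show ?thesis
  proof (cases "emeasure lborel (W n) = 0")
    case True
    then show ?thesis by (cases k) (auto simp: number_def poisson_mass_def pmf_return)
  next
    case False
    then have "0 < measure lborel (W n)" using e by (simp add: less_le)
    then show ?thesis using False by (simp add: number_def e poisson_mass_ennreal)
  qed
qed

text \<open>Given the number of points, independence makes the Laplace functional a power of the
  single mean \<open>c\<close>; averaging over the number evaluates the Poisson generating function
  at \<open>c\<close>.\<close>

lemma nn_integral_piece:
  assumes f [measurable]: "f \<in> borel_measurable borel"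
  shows "(\<integral>\<^sup>+x. nexp (\<Sum>j<fst x. f (snd x j)) \<partial>piece n) = nexp (\<integral>\<^sup>+x. (1 - nexp (f x)) * indicator (W n) x \<partial>lborel)"
proof -
  interpret l: prob_space "location n" by (rule prob_location)
  interpret L: prob_space "PiM UNIV (\<lambda>_::nat. location n)" by (rule prob_locations)
  define w where "w = emeasure lborel (W n)"
  have w: "w < \<infinity>" using W_finite by (simp add: w_def)
  define c where "c = (\<integral>\<^sup>+x. nexp (f x) \<partial>location n)"
  have "c \<le> (\<integral>\<^sup>+x. 1 \<partial>location n)" unfolding c_def by (intro nn_integral_mono nexp_le_1)
  then have c1: "c \<le> 1" by (simp add: l.emeasure_space_1)
  then obtain s where s: "c = nexp s" by (rule nexp_surj)
  have cw: "c * w = (\<integral>\<^sup>+x. nexp (f x) * indicator (W n) x \<partial>lborel)"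
  proof (cases "w = 0")
    case True
    have "AE x in lborel. x \<notin> W n" using True W by (intro AE_not_in) (auto simp: w_def null_sets_def)
    then have "(\<integral>\<^sup>+x. nexp (f x) * indicator (W n) x \<partial>lborel) = 0"
      by (subst nn_integral_0_iff_AE) auto
    then show ?thesis using True by simp
  next
    case False
    then have "c = (\<integral>\<^sup>+x. nexp (f x) * indicator (W n) x \<partial>lborel) / w"
      unfolding c_def location_def w_def by (simp add: nn_integral_uniform_measure)
    then show ?thesis using False w by (simp add: ennreal_divide_times ennreal_times_divide mult_divide_eq_ennreal)
  qed
  have "(\<integral>\<^sup>+x. (1 - nexp (f x)) * indicator (W n) x \<partial>lborel) + c * w
      = (\<integral>\<^sup>+x. (1 - nexp (f x)) * indicator (W n) x + nexp (f x) * indicator (W n) x \<partial>lborel)"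
    unfolding cw by (rule nn_integral_add[symmetric]) auto
  also have "\<dots> = (\<integral>\<^sup>+x. indicator (W n) x \<partial>lborel)"
    by (intro nn_integral_cong) (simp add: distrib_right[symmetric] diff_add_cancel_ennreal nexp_le_1)
  also have "\<dots> = (1 - c) * w + c * w" using c1 by (simp add: w_def distrib_right[symmetric] diff_add_cancel_ennreal)
  finally have I: "(\<integral>\<^sup>+x. (1 - nexp (f x)) * indicator (W n) x \<partial>lborel) = (1 - c) * w"
  proof -
    assume "(\<integral>\<^sup>+x. (1 - nexp (f x)) * indicator (W n) x \<partial>lborel) + c * w = (1 - c) * w + c * w"
    \<comment> \<open>The integral of \<open>1 - nexp (f x)\<close> is isolated by cancelling
      \<open>c * w\<close>, which is finite.\<close>
    moreover have "c * w \<noteq> top" using c1 w by (auto simp: ennreal_mult_eq_top_iff top_unique)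
    ultimately show ?thesis unfolding add.commute[of _ "c * w"] ennreal_add_left_cancel infinity_ennreal_def by blast
  qed
  have [measurable]: "(\<lambda>x. nexp (\<Sum>j<fst x. f (snd x j))) \<in> borel_measurable (piece n)"
    using piece_sum_measurable[OF f] by measurable
  have "(\<integral>\<^sup>+x. nexp (\<Sum>j<fst x. f (snd x j)) \<partial>piece n)
      = (\<integral>\<^sup>+k. \<integral>\<^sup>+v. nexp (\<Sum>j<k. f (v j)) \<partial>PiM UNIV (\<lambda>_. location n) \<partial>measure_pmf (number n))"
    using L.nn_integral_fst[of "\<lambda>x. nexp (\<Sum>j<fst x. f (snd x j))" "measure_pmf (number n)", symmetric]
    by (simp add: piece_def[symmetric])
  also have "\<dots> = (\<integral>\<^sup>+k. c ^ k \<partial>measure_pmf (number n))"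
    unfolding nexp_sum c_def
    by (intro nn_integral_cong, subst nn_integral_PiM_prod) (auto intro: prob_location)
  also have "\<dots> = (\<Sum>k. nexp (s * of_nat k) * ennreal (poisson_mass w k))"
    by (simp add: nn_integral_measure_pmf nn_integral_count_space_nat number_mass w_def s nexp_of_nat_mult mult.commute)
  also have "\<dots> = nexp ((1 - c) * w)" unfolding s by (rule poisson_suminf_nexp[OF w])
  finally show ?thesis unfolding I .
qed

lemma point_sum_eq: "point_sum f \<sigma> = (\<Sum>n. \<Sum>j<fst (\<sigma> n). f (snd (\<sigma> n) j))"
proof -
  have pieces: "(\<Sum>j. if j < fst (\<sigma> n) then f (snd (\<sigma> n) j) else 0) = (\<Sum>j<fst (\<sigma> n). f (snd (\<sigma> n) j))" for n
    by (subst suminf_finite[where N="{..<fst (\<sigma> n)}"]) auto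
  have "point_sum f \<sigma> = (\<integral>\<^sup>+p. (if snd p < fst (\<sigma> (fst p)) then f (snd (\<sigma> (fst p)) (snd p)) else 0) \<partial>count_space UNIV)"
    unfolding point_sum_def active_def point_def
    by (rule nn_integral_bij_count_space[where f="\<lambda>p. if snd p < fst (\<sigma> (fst p)) then f (snd (\<sigma> (fst p)) (snd p)) else 0"])
      (rule bij_prod_decode)
  also have "\<dots> = (\<Sum>n. \<Sum>j. if j < fst (\<sigma> n) then f (snd (\<sigma> n) j) else 0)"
    by (subst nn_integral_fst_count_space[symmetric]) (simp add: nn_integral_count_space_nat cong del: if_weak_cong)
  finally show ?thesis unfolding pieces .
qed

lemma point_sum_measurable [measurable]:
  assumes [measurable]: "f \<in> borel_measurable borel"
  shows "point_sum f \<in> borel_measurable space_of_points"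
  unfolding point_sum_def[abs_def] nn_integral_count_space_nat by measurable

text \<open>The pieces are independent, so finitely many of them give a product; the limit over all
  pieces is dominated by 1, and the pieces tile the space.\<close>

lemma laplace_points:
  assumes f [measurable]: "f \<in> borel_measurable borel"
  shows "(\<integral>\<^sup>+\<sigma>. nexp (point_sum f \<sigma>) \<partial>space_of_points) = nexp (\<integral>\<^sup>+x. 1 - nexp (f x) \<partial>lborel)"
proof -
  interpret prob_space space_of_points by (rule prob_space_of_points)
  let ?h = "\<lambda>n \<sigma>. \<Sum>j<fst (\<sigma> n). f (snd (\<sigma> n) j)"
  have m [measurable]: "?h n \<in> borel_measurable space_of_points" for n
    unfolding space_of_points_def
    using measurable_compose[OF measurable_component_singleton[of n UNIV piece] piece_sum_measurable[OF f]] by simp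
  have "(\<integral>\<^sup>+\<sigma>. nexp (\<Sum>n<m. ?h n \<sigma>) \<partial>space_of_points)
      = nexp (\<Sum>n<m. \<integral>\<^sup>+x. (1 - nexp (f x)) * indicator (W n) x \<partial>lborel)" for m
  proof -
    have [measurable]: "(\<lambda>x. nexp (\<Sum>j<fst x. f (snd x j))) \<in> borel_measurable (piece n)" for n
      using piece_sum_measurable[OF f] by measurable
    show ?thesis
      unfolding nexp_sum[of _ "{..<m}"] space_of_points_def
      by (subst nn_integral_PiM_prod[where f="\<lambda>n x. nexp (\<Sum>j<fst x. f (snd x j))"])
        (auto intro: prob_piece simp: nn_integral_piece[OF f])
  qed
  moreover have "(\<lambda>m. \<integral>\<^sup>+\<sigma>. nexp (\<Sum>n<m. ?h n \<sigma>) \<partial>space_of_points) \<longlonglongrightarrow> (\<integral>\<^sup>+\<sigma>. nexp (point_sum f \<sigma>) \<partial>space_of_points)"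
  proof (rule nn_integral_dominated_convergence[where w="\<lambda>_. 1"])
    show "AE \<sigma> in space_of_points. (\<lambda>m. nexp (\<Sum>n<m. ?h n \<sigma>)) \<longlonglongrightarrow> nexp (point_sum f \<sigma>)"
      unfolding point_sum_eq by (intro AE_I2 tendsto_nexp summable_LIMSEQ) auto
  qed (auto simp: nexp_le_1 emeasure_space_1)
  moreover have "(\<lambda>m. nexp (\<Sum>n<m. \<integral>\<^sup>+x. (1 - nexp (f x)) * indicator (W n) x \<partial>lborel)) \<longlonglongrightarrow>
      nexp (\<Sum>n. \<integral>\<^sup>+x. (1 - nexp (f x)) * indicator (W n) x \<partial>lborel)"
    by (intro tendsto_nexp summable_LIMSEQ) auto
  ultimately have "(\<integral>\<^sup>+\<sigma>. nexp (point_sum f \<sigma>) \<partial>space_of_points) =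
      nexp (\<Sum>n. \<integral>\<^sup>+x. (1 - nexp (f x)) * indicator (W n) x \<partial>lborel)"
    by (simp add: LIMSEQ_unique)
  also have "(\<Sum>n. \<integral>\<^sup>+x. (1 - nexp (f x)) * indicator (W n) x \<partial>lborel)
      = (\<integral>\<^sup>+x. (\<Sum>n. (1 - nexp (f x)) * indicator (W n) x) \<partial>lborel)"
    by (rule nn_integral_suminf[symmetric]) auto
  also have "\<dots> = (\<integral>\<^sup>+x. 1 - nexp (f x) \<partial>lborel)"
  proof (rule nn_integral_cong)
    fix x
    have "(\<Sum>n. indicator (W n) x) = (indicator (\<Union>n. W n) x :: ennreal)"
      by (rule suminf_indicator[OF W_disjoint])
    then show "(\<Sum>n. (1 - nexp (f x)) * indicator (W n) x) = 1 - nexp (f x)" by (simp add: ennreal_suminf_cmult W_UNIV)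
  qed
  finally show ?thesis .
qed

text \<open>The Laplace functional at a combination of indicators of disjoint sets is a product of
  Poisson Laplace transforms; \<open>generating_function_product\<close> turns this into the joint
  law.\<close>

theorem poisson_points:
  fixes D :: "'j \<Rightarrow> 'c set"
  assumes J: "finite J" and D [measurable]: "\<And>j. j \<in> J \<Longrightarrow> D j \<in> sets borel" and disj: "disjoint_family_on D J"
  shows "measure space_of_points {\<sigma> \<in> space space_of_points. \<forall>j\<in>J.
      emeasure (count_space UNIV) {i. active i \<sigma> \<and> point i \<sigma> \<in> D j} = of_nat (m j)}
    = (\<Prod>j\<in>J. poisson_mass (emeasure lborel (D j)) (m j))"
proof -
  interpret prob_space space_of_points by (rule prob_space_of_points)
  have cnt: "emeasure (count_space UNIV) {i. active i \<sigma> \<and> point i \<sigma> \<in> B} = point_sum (indicator B) \<sigma>" for B \<sigma>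
  proof -
    have "(\<lambda>i. if active i \<sigma> then indicator B (point i \<sigma>) else 0) = (indicator {i. active i \<sigma> \<and> point i \<sigma> \<in> B} :: _ \<Rightarrow> ennreal)"
      by (auto simp: fun_eq_iff indicator_def)
    then show ?thesis by (simp add: point_sum_def)
  qed
  let ?n = "\<lambda>j. point_sum (indicator (D j))"
  \<comment> \<open>For infinite volume both sides are 0: all Poisson masses vanish by definition,
    and the exponent is infinite because \<open>s > 0\<close>.\<close>
  have suminf: "(\<Sum>m. ennreal (poisson_mass (emeasure lborel (D j)) m) * nexp (ennreal s) ^ m)
      = nexp ((1 - nexp (ennreal s)) * emeasure lborel (D j))" if "0 < s" for s j
  proof (cases "emeasure lborel (D j) < \<infinity>")
    case True
    then show ?thesis using poisson_suminf_nexp[OF True, of "ennreal s"] by (simp add: nexp_of_nat_mult mult.commute)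
  next
    case False
    then have "emeasure lborel (D j) = top" by (simp add: not_less top_unique)
    moreover have "1 - nexp (ennreal s) \<noteq> 0" using that by (simp add: nexp_ennreal diff_eq_0_iff_ennreal)
    ultimately show ?thesis by (simp add: poisson_mass_def ennreal_mult_top)
  qed
  have "(\<integral>\<^sup>+\<sigma>. (\<Prod>j\<in>J. indicator {of_nat (m j)} (?n j \<sigma>)) \<partial>space_of_points)
      = (\<Prod>j\<in>J. ennreal (poisson_mass (emeasure lborel (D j)) (m j)))"
  proof (rule generating_function_product[OF prob_space_of_points J])
    fix j assume j: "j \<in> J"
    show "?n j \<in> borel_measurable space_of_points" using D[OF j] by measurable
    show "AE \<sigma> in space_of_points. ?n j \<sigma> \<in> insert top (range of_nat)"
      unfolding cnt[symmetric] by (auto simp: emeasure_count_space)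
    show "(\<Sum>m. ennreal (poisson_mass (emeasure lborel (D j)) m)) \<le> 1"
    proof (cases "emeasure lborel (D j) < \<infinity>")
      case True
      then show ?thesis by (simp only: poisson_suminf_1[OF True] order_refl)
    next
      case False
      then have "emeasure lborel (D j) = \<infinity>" by (simp add: not_less top_unique)
      then show ?thesis by (simp add: poisson_mass_def)
    qed
  next
    fix s :: "'j \<Rightarrow> real" assume s: "\<And>j. 0 < s j"
    let ?f = "\<lambda>x. \<Sum>j\<in>J. ennreal (s j) * indicator (D j) x"
    have ps: "(\<Sum>j\<in>J. ennreal (s j) * ?n j \<sigma>) = point_sum ?f \<sigma>" for \<sigma>
      unfolding point_sum_def
      by (subst nn_integral_cmult[symmetric], simp, subst nn_integral_sum[symmetric]) (auto intro!: nn_integral_cong)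
    \<comment> \<open>At most one of the disjoint sets contains \<open>x\<close>, so the nonlinear
      function \<open>1 - nexp\<close> splits over the sum.\<close>
    have f: "1 - nexp (?f x) = (\<Sum>j\<in>J. (1 - nexp (ennreal (s j))) * indicator (D j) x)" for x
    proof (cases "\<exists>j\<in>J. x \<in> D j")
      case True
      then obtain j where j: "j \<in> J" "x \<in> D j" by blast
      have z: "indicator (D i) x = (if i = j then 1 else 0 :: ennreal)" if "i \<in> J" for i
      proof (cases "i = j")
        case False
        then have "x \<notin> D i" using disj j that by (auto simp: disjoint_family_on_def)
        then show ?thesis using False by simp
      qed (use j in simp)
      have "?f x = (\<Sum>i\<in>J. if i = j then ennreal (s j) else 0)" using z by (intro sum.cong) auto
      moreover have "(\<Sum>j\<in>J. (1 - nexp (ennreal (s j))) * indicator (D j) x)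
          = (\<Sum>i\<in>J. if i = j then 1 - nexp (ennreal (s j)) else 0)" using z by (intro sum.cong) auto
      ultimately show ?thesis using J j by simp
    next
      case False
      then have "indicator (D j) x = (0::ennreal)" if "j \<in> J" for j using that by auto
      then show ?thesis by simp
    qed
    have "(\<integral>\<^sup>+\<sigma>. (\<Prod>j\<in>J. nexp (ennreal (s j) * ?n j \<sigma>)) \<partial>space_of_points) = (\<integral>\<^sup>+\<sigma>. nexp (point_sum ?f \<sigma>) \<partial>space_of_points)"
      unfolding nexp_sum[symmetric] ps ..
    also have "\<dots> = nexp (\<integral>\<^sup>+x. 1 - nexp (?f x) \<partial>lborel)"
      by (rule laplace_points) (use D in measurable)
    also have "(\<integral>\<^sup>+x. 1 - nexp (?f x) \<partial>lborel) = (\<Sum>j\<in>J. (1 - nexp (ennreal (s j))) * emeasure lborel (D j))"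
      unfolding f by (subst nn_integral_sum) (auto intro!: sum.cong nn_integral_cmult_indicator)
    finally show "(\<integral>\<^sup>+\<sigma>. (\<Prod>j\<in>J. nexp (ennreal (s j) * ?n j \<sigma>)) \<partial>space_of_points)
        = (\<Prod>j\<in>J. \<Sum>m. ennreal (poisson_mass (emeasure lborel (D j)) m) * nexp (ennreal (s j)) ^ m)"
      using s by (simp add: suminf nexp_sum)
  qed
  also have "(\<integral>\<^sup>+\<sigma>. (\<Prod>j\<in>J. indicator {of_nat (m j)} (?n j \<sigma>)) \<partial>space_of_points)
      = (\<integral>\<^sup>+\<sigma>. indicator {\<sigma> \<in> space space_of_points. \<forall>j\<in>J. ?n j \<sigma> = of_nat (m j)} \<sigma> \<partial>space_of_points)"
    using J by (intro nn_integral_cong) (auto simp: indicator_def prod_zero_iff)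
  also have "\<dots> = emeasure space_of_points {\<sigma> \<in> space space_of_points. \<forall>j\<in>J. ?n j \<sigma> = of_nat (m j)}"
  proof (rule nn_integral_indicator)
    have [measurable]: "?n j \<in> borel_measurable space_of_points" if "j \<in> J" for j using D[OF that] by measurable
    show "{\<sigma> \<in> space space_of_points. \<forall>j\<in>J. ?n j \<sigma> = of_nat (m j)} \<in> sets space_of_points"
      using J by measurable
  qed
  finally show ?thesis
    unfolding cnt by (simp add: emeasure_eq_measure prod_ennreal prod_nonneg)
qed

end

lemma poisson_pieces_exist: "\<exists>W :: nat \<Rightarrow> 'c::euclidean_space set. poisson_pieces W"
proof -
  obtain W :: "nat \<Rightarrow> 'c set" where "range W \<subseteq> sets lborel" "(\<Union>i. W i) = space lborel"
      "\<And>i. emeasure lborel (W i) \<noteq> \<infinity>" "disjoint_family W"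
    using lborel.sigma_finite_disjoint by blast
  then have "poisson_pieces W" by unfold_locales (auto simp: less_top)
  then show ?thesis by (rule exI[of _ W])
qed

section \<open>Resampling the coordinates of a product measure\<close>

text \<open>Replacing one coordinate by an independent copy preserves the product measure: once the
  coordinate \<open>w\<close> is split off, its old value is overwritten and integrates to
  1.\<close>

lemma nn_integral_PiM_update:
  fixes S :: "'s measure" and w :: 'i
  assumes S: "prob_space S" and h [measurable]: "h \<in> borel_measurable (PiM UNIV (\<lambda>_::'i. S))"
  shows "(\<integral>\<^sup>+\<eta>. h \<eta> \<partial>PiM UNIV (\<lambda>_. S)) = (\<integral>\<^sup>+\<eta>. \<integral>\<^sup>+x. h (\<eta>(w := x)) \<partial>S \<partial>PiM UNIV (\<lambda>_. S))"
proof -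
  let ?P = "PiM UNIV (\<lambda>_::'i. S)" and ?Q = "PiM (UNIV - {w}) (\<lambda>_::'i. S)"
  interpret S: prob_space S by (rule S)
  interpret Q: prob_space ?Q by (intro prob_space_PiM S)
  interpret SQ: pair_sigma_finite S ?Q ..
  have ins: "insert w (UNIV - {w}) = (UNIV :: 'i set)" by auto
  have m: "(\<lambda>(x, X). X(w := x)) \<in> measurable (S \<Otimes>\<^sub>M ?Q) ?P"
    unfolding case_prod_unfold by (rule measurable_fun_upd[where J="UNIV - {w}"]) auto
  have P: "distr (S \<Otimes>\<^sub>M ?Q) ?P (\<lambda>(x, X). X(w := x)) = ?P"
    using distr_pair_PiM_eq_PiM[of "UNIV - {w}" "\<lambda>_. S" w] S unfolding ins by simp
  have split: "(\<integral>\<^sup>+\<eta>. f \<eta> \<partial>?P) = (\<integral>\<^sup>+X. \<integral>\<^sup>+x. f (X(w := x)) \<partial>S \<partial>?Q)" if f: "f \<in> borel_measurable ?P" for f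
  proof -
    have m': "(\<lambda>z. f ((snd z)(w := fst z))) \<in> borel_measurable (S \<Otimes>\<^sub>M ?Q)"
      using measurable_compose[OF m f] by (simp add: case_prod_unfold)
    have "(\<integral>\<^sup>+\<eta>. f \<eta> \<partial>?P) = (\<integral>\<^sup>+z. f ((snd z)(w := fst z)) \<partial>(S \<Otimes>\<^sub>M ?Q))"
      by (subst P[symmetric], subst nn_integral_distr[OF m]) (auto simp: f case_prod_unfold)
    also have "\<dots> = (\<integral>\<^sup>+X. \<integral>\<^sup>+x. f (X(w := x)) \<partial>S \<partial>?Q)"
      using SQ.nn_integral_snd[OF m'] by simp
    finally show ?thesis .
  qed
  have "(\<lambda>(\<eta>, x). h (\<eta>(w := x))) \<in> borel_measurable (?P \<Otimes>\<^sub>M S)"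
    unfolding case_prod_unfold
    by (rule measurable_compose[OF _ h], rule measurable_fun_upd[where J=UNIV]) auto
  then have "(\<lambda>\<eta>. \<integral>\<^sup>+x. h (\<eta>(w := x)) \<partial>S) \<in> borel_measurable ?P" by (rule S.borel_measurable_nn_integral)
  then have "(\<integral>\<^sup>+\<eta>. \<integral>\<^sup>+x. h (\<eta>(w := x)) \<partial>S \<partial>?P) = (\<integral>\<^sup>+X. \<integral>\<^sup>+y. \<integral>\<^sup>+x. h (X(w := y, w := x)) \<partial>S \<partial>S \<partial>?Q)"
    by (rule split)
  also have "\<dots> = (\<integral>\<^sup>+X. \<integral>\<^sup>+x. h (X(w := x)) \<partial>S \<partial>?Q)" by (simp add: S.emeasure_space_1)
  also have "\<dots> = (\<integral>\<^sup>+\<eta>. h \<eta> \<partial>?P)" by (rule split[symmetric]) (rule h)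
  finally show ?thesis by simp
qed

text \<open>The factor \<open>q w\<close> is the only one that reads the coordinate \<open>w\<close>, so that the coordinates in \<open>V\<close> can be
  integrated out one after the other.\<close>

lemma nn_integral_PiM_resample:
  fixes S :: "'s measure" and V :: "'i set" and a :: "('i \<Rightarrow> 's) \<Rightarrow> ennreal"
  defines "P \<equiv> PiM UNIV (\<lambda>_::'i. S)"
  assumes S: "prob_space S" and V: "finite V"
    and a: "a \<in> borel_measurable P" "\<And>w \<eta> x. w \<in> V \<Longrightarrow> \<eta> \<in> space P \<Longrightarrow> x \<in> space S \<Longrightarrow> a (\<eta>(w := x)) = a \<eta>"
    and q: "\<And>w. w \<in> V \<Longrightarrow> (\<lambda>\<eta>. q w (\<eta> w) \<eta>) \<in> borel_measurable P"
      "\<And>v w y \<eta> x. v \<in> V \<Longrightarrow> w \<in> V \<Longrightarrow> q v y (\<eta>(w := x)) = q v y \<eta>"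
    and p: "\<And>w. w \<in> V \<Longrightarrow> p w \<in> borel_measurable P"
      "\<And>v w \<eta> x. v \<in> V \<Longrightarrow> w \<in> V \<Longrightarrow> p v (\<eta>(w := x)) = p v \<eta>"
    and qp: "\<And>w \<eta>. w \<in> V \<Longrightarrow> \<eta> \<in> space P \<Longrightarrow> (\<integral>\<^sup>+y. q w y \<eta> \<partial>S) = (p w \<eta> :: ennreal)"
    and qm: "\<And>w \<eta>. w \<in> V \<Longrightarrow> \<eta> \<in> space P \<Longrightarrow> (\<lambda>y. q w y \<eta>) \<in> borel_measurable S"
  shows "(\<integral>\<^sup>+\<eta>. a \<eta> * (\<Prod>w\<in>V. q w (\<eta> w) \<eta>) \<partial>P) = (\<integral>\<^sup>+\<eta>. a \<eta> * (\<Prod>w\<in>V. p w \<eta>) \<partial>P)"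
  using V a q p qp qm
proof (induction V arbitrary: a rule: finite_induct)
  case (insert w V)
  have spP: "\<eta>(w := x) \<in> space P" if "\<eta> \<in> space P" "x \<in> space S" for \<eta> x
    using that by (auto simp: P_def space_PiM PiE_iff)
  let ?a = "\<lambda>\<eta>. a \<eta> * (\<Prod>v\<in>V. q v (\<eta> v) \<eta>)"
  have qV: "(\<lambda>\<eta>. \<Prod>v\<in>V. q v (\<eta> v) \<eta>) \<in> borel_measurable P"
    using insert.prems(3) by (intro borel_measurable_prod_ennreal) auto
  \<comment> \<open>The other factors read their own coordinates directly, and their second argument
    is insensitive to an update at \<open>w\<close>; the factor \<open>q w\<close> is therefore the
    only one to be integrated.\<close>
  have aw: "?a (\<eta>(w := x)) = ?a \<eta>" if "\<eta> \<in> space P" "x \<in> space S" for \<eta> x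
  proof -
    have "q v ((\<eta>(w := x)) v) (\<eta>(w := x)) = q v (\<eta> v) \<eta>" if "v \<in> V" for v
    proof -
      have "v \<noteq> w" using that insert.hyps by blast
      then show ?thesis using insert.prems(4)[of v w "\<eta> v" \<eta> x] that by (simp del: fun_upd_apply add: fun_upd_other)
    qed
    then have "(\<Prod>v\<in>V. q v ((\<eta>(w := x)) v) (\<eta>(w := x))) = (\<Prod>v\<in>V. q v (\<eta> v) \<eta>)" by (intro prod.cong refl)
    then show ?thesis by (simp only: insert.prems(2)[OF insertI1 that])
  qed
  have "(\<integral>\<^sup>+\<eta>. a \<eta> * (\<Prod>w\<in>insert w V. q w (\<eta> w) \<eta>) \<partial>P) = (\<integral>\<^sup>+\<eta>. ?a \<eta> * q w (\<eta> w) \<eta> \<partial>P)"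
    using insert.hyps by (intro nn_integral_cong) (simp add: ac_simps)
  also have "\<dots> = (\<integral>\<^sup>+\<eta>. \<integral>\<^sup>+x. ?a (\<eta>(w := x)) * q w ((\<eta>(w := x)) w) (\<eta>(w := x)) \<partial>S \<partial>P)"
    unfolding P_def
    by (rule nn_integral_PiM_update[OF S], unfold P_def[symmetric])
      (intro borel_measurable_times_ennreal insert.prems(1) qV insert.prems(3) insertI1)
  also have "\<dots> = (\<integral>\<^sup>+\<eta>. \<integral>\<^sup>+x. ?a \<eta> * q w x \<eta> \<partial>S \<partial>P)"
  proof (rule nn_integral_cong, rule nn_integral_cong)
    fix \<eta> x assume *: "\<eta> \<in> space P" "x \<in> space S"
    show "?a (\<eta>(w := x)) * q w ((\<eta>(w := x)) w) (\<eta>(w := x)) = ?a \<eta> * q w x \<eta>"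
      by (simp only: aw[OF *] fun_upd_same insert.prems(4)[OF insertI1 insertI1])
  qed
  also have "\<dots> = (\<integral>\<^sup>+\<eta>. ?a \<eta> * p w \<eta> \<partial>P)"
  proof (rule nn_integral_cong)
    fix \<eta> assume \<eta>: "\<eta> \<in> space P"
    have "(\<integral>\<^sup>+x. ?a \<eta> * q w x \<eta> \<partial>S) = ?a \<eta> * (\<integral>\<^sup>+x. q w x \<eta> \<partial>S)"
      using insert.prems(8)[of w \<eta>] \<eta> by (intro nn_integral_cmult) auto
    then show "(\<integral>\<^sup>+x. ?a \<eta> * q w x \<eta> \<partial>S) = ?a \<eta> * p w \<eta>" using insert.prems(7)[of w \<eta>] \<eta> by simp
  qed
  also have "\<dots> = (\<integral>\<^sup>+\<eta>. (a \<eta> * p w \<eta>) * (\<Prod>v\<in>V. q v (\<eta> v) \<eta>) \<partial>P)"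
    by (intro nn_integral_cong) (simp add: ac_simps)
  also have "\<dots> = (\<integral>\<^sup>+\<eta>. (a \<eta> * p w \<eta>) * (\<Prod>v\<in>V. p v \<eta>) \<partial>P)"
  proof (rule insert.IH)
    show "(\<lambda>\<eta>. a \<eta> * p w \<eta>) \<in> borel_measurable P"
      by (intro borel_measurable_times_ennreal insert.prems(1) insert.prems(5) insertI1)
    show "a (\<eta>(v := x)) * p w (\<eta>(v := x)) = a \<eta> * p w \<eta>" if "v \<in> V" "\<eta> \<in> space P" "x \<in> space S" for v \<eta> x
      using insert.prems(2)[of v \<eta> x] insert.prems(6)[of w v \<eta> x] that by (simp del: fun_upd_apply)
  qed (use insert.prems in auto)
  also have "\<dots> = (\<integral>\<^sup>+\<eta>. a \<eta> * (\<Prod>v\<in>insert w V. p v \<eta>) \<partial>P)"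
    using insert.hyps by (intro nn_integral_cong) (simp add: ac_simps)
  finally show ?case .
qed simp

lemma poisson_mass_le_1: "poisson_mass r m \<le> 1"
proof (cases "r < \<infinity>")
  case True
  have "ennreal (poisson_mass r m) = (\<Sum>n\<in>{m}. ennreal (poisson_mass r n))" by simp
  also have "\<dots> \<le> (\<Sum>n. ennreal (poisson_mass r n))" by (intro sum_le_suminf) auto
  also have "\<dots> = 1" by (rule poisson_suminf_1[OF True])
  finally show ?thesis by simp
next
  case False
  then have "r = \<infinity>" by (simp add: not_less top_unique)
  then show ?thesis by (simp add: poisson_mass_def)
qed

section \<open>The branching construction\<close>

type_synonym 'c points = "nat \<Rightarrow> nat \<times> (nat \<Rightarrow> 'c)"

lemma emeasure_count_space_image:
  assumes "inj f" shows "emeasure (count_space UNIV) (f ` A) = emeasure (count_space UNIV) A"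
  using assms by (simp add: emeasure_count_space finite_image_iff card_image inj_on_subset[of f UNIV])

locale branching = hawkes_data X lam g gt + poisson_pieces W
  for X :: "'a::euclidean_space set" and lam g gt and W :: "nat \<Rightarrow> (('a \<times> real) \<times> real) set"
begin

abbreviation noise :: "(nat list \<Rightarrow> (('a \<times> real) \<times> real) points) measure" where
  "noise \<equiv> PiM UNIV (\<lambda>_. space_of_points)"

text \<open>The empty label is a fictitious root whose offspring is the background process. Its rate
  ignores the location, so the location 0 that \<open>state\<close> assigns to it is a dummy
  value.\<close>

definition rate :: "nat list \<Rightarrow> 'a \<times> real \<Rightarrow> 'a \<times> real \<Rightarrow> ennreal" where
  "rate w p q = (if w = [] then lamX (fst q) else gX (fst p) (fst q) (snd q - snd p))"

text \<open>
  Every label \<open>w\<close> carries Poisson points \<open>(q, z)\<close> with Lebesgue intensity. Keeping those with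
  \<open>0 < z \<le> rate w p q\<close>, where \<open>p\<close> is the location of \<open>w\<close>, leaves a Poisson process of points \<open>q\<close> with
  intensity \<open>rate w p\<close>.
\<close>

primrec state :: "nat list \<Rightarrow> (nat list \<Rightarrow> (('a \<times> real) \<times> real) points) \<Rightarrow> bool \<times> ('a \<times> real)" where
  "state [] \<eta> = (True, 0)"
| "state (i # w) \<eta> =
    (fst (state w \<eta>) \<and> active i (\<eta> w) \<and> 0 < snd (point i (\<eta> w)) \<and>
      ennreal (snd (point i (\<eta> w))) \<le> rate w (snd (state w \<eta>)) (fst (point i (\<eta> w))),
     fst (point i (\<eta> w)))"

definition region :: "nat list \<Rightarrow> 'a \<times> real \<Rightarrow> ('a \<times> real) set \<Rightarrow> (('a \<times> real) \<times> real) set" where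
  "region w p B = {c. fst c \<in> B \<and> 0 < snd c \<and> ennreal (snd c) \<le> rate w p (fst c)}"

text \<open>The noise \<open>y\<close> of the label itself is separated from the noise
  \<open>\<eta>\<close> that determines its state, so that \<open>y\<close> can be integrated out
  while the state is held fixed.\<close>

definition count :: "nat list \<Rightarrow> (('a \<times> real) \<times> real) points \<Rightarrow>
    (nat list \<Rightarrow> (('a \<times> real) \<times> real) points) \<Rightarrow> ('a \<times> real) set \<Rightarrow> ennreal" where
  "count w y \<eta> B = (if fst (state w \<eta>)
    then emeasure (count_space UNIV) {i. active i y \<and> point i y \<in> region w (snd (state w \<eta>)) B} else 0)"

definition intensity :: "nat list \<Rightarrow> (nat list \<Rightarrow> (('a \<times> real) \<times> real) points) \<Rightarrow> ('a \<times> real) set \<Rightarrow> ennreal" where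
  "intensity w \<eta> B = (if fst (state w \<eta>) then \<integral>\<^sup>+q. rate w (snd (state w \<eta>)) q * indicator B q \<partial>lborel else 0)"

lemma rate_measurable [measurable (raw)]:
  assumes [measurable]: "f1 \<in> borel_measurable M" "f2 \<in> borel_measurable M"
  shows "(\<lambda>z. rate w (f1 z) (f2 z)) \<in> borel_measurable M"
  unfolding rate_def by (cases "w = []") auto

lemma rate_finite: "rate w p q < top"
  by (auto simp: rate_def lamX_def gX_def indicator_def)

text \<open>A strictly positive mark is accepted only where the rate is positive. This keeps every
  point in \<open>X\<close> surely, not merely almost surely, as the construction demands.\<close>

lemma rate_X: "0 < z \<Longrightarrow> ennreal z \<le> rate w p q \<Longrightarrow> fst q \<in> X"
  by (cases "fst q \<in> X") (auto simp: rate_def lamX_def gX_def split: if_splits)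

lemma state_measurable:
  "(\<lambda>\<eta>. fst (state w \<eta>)) \<in> measurable noise (count_space UNIV)"
  "(\<lambda>\<eta>. snd (state w \<eta>)) \<in> borel_measurable noise"
proof (induction w)
  case (Cons i w)
  define f s where "f \<eta> = fst (state w \<eta>)" and "s \<eta> = snd (state w \<eta>)" for \<eta>
  have [measurable]: "Measurable.pred noise f" "s \<in> borel_measurable noise"
    using Cons unfolding f_def[abs_def] s_def[abs_def] by auto
  have [measurable]: "(\<lambda>\<eta>. active i (\<eta> w)) \<in> measurable noise (count_space UNIV)"
    by (rule measurable_compose[OF _ active_measurable]) auto
  have c [measurable]: "(\<lambda>\<eta>. point i (\<eta> w)) \<in> borel_measurable noise"
    by (rule measurable_compose[OF _ point_measurable]) auto
  define q z where "q \<eta> = fst (point i (\<eta> w))" and "z \<eta> = snd (point i (\<eta> w))" for \<eta>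
  have [measurable]: "q \<in> borel_measurable noise" "z \<in> borel_measurable noise"
    using borel_measurable_fst'[OF c] borel_measurable_snd'[OF c] unfolding q_def[abs_def] z_def[abs_def] by auto
  have [measurable]: "(\<lambda>\<eta>. rate w (s \<eta>) (q \<eta>)) \<in> borel_measurable noise" by (rule rate_measurable) measurable
  then have [measurable]: "Measurable.pred noise (\<lambda>\<eta>. ennreal (z \<eta>) \<le> rate w (s \<eta>) (q \<eta>))"
    unfolding pred_def by (rule borel_measurable_le[rotated]) measurable
  have "Measurable.pred noise (\<lambda>\<eta>. f \<eta> \<and> active i (\<eta> w) \<and> 0 < z \<eta> \<and>
      ennreal (z \<eta>) \<le> rate w (s \<eta>) (q \<eta>))"
    by measurable
  then show "(\<lambda>\<eta>. fst (state (i # w) \<eta>)) \<in> measurable noise (count_space UNIV)" by (simp add: f_def s_def q_def z_def)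
  show "(\<lambda>\<eta>. snd (state (i # w) \<eta>)) \<in> borel_measurable noise" using borel_measurable_fst'[OF c] by simp
qed auto

text \<open>The state of \<open>w\<close> is computed from the noise at its proper suffixes, and
  these are shorter than \<open>v\<close>.\<close>

lemma state_update: "length w \<le> length v \<Longrightarrow> state w (\<eta>(v := x)) = state w \<eta>"
proof (induction w)
  case (Cons i w)
  then have "w \<noteq> v" by auto
  then show ?case using Cons by simp
qed simp

lemma state_X: "w \<noteq> [] \<Longrightarrow> fst (state w \<eta>) \<Longrightarrow> fst (snd (state w \<eta>)) \<in> X"
  by (cases w) (auto intro: rate_X)

lemma region_measurable [measurable]:
  assumes [measurable]: "B \<in> sets borel" shows "region w p B \<in> sets borel"
proof -
  have "{c \<in> space borel. fst c \<in> B \<and> 0 < snd c \<and> ennreal (snd c) \<le> rate w p (fst c)} \<in> sets borel" by measurable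
  then show ?thesis by (simp add: region_def)
qed

lemma emeasure_region:
  assumes [measurable]: "B \<in> sets borel"
  shows "emeasure lborel (region w p B) = (\<integral>\<^sup>+q. rate w p q * indicator B q \<partial>lborel)"
proof -
  have e: "emeasure lborel {z::real. 0 < z \<and> ennreal z \<le> rate w p q} = rate w p q" for q
  proof -
    obtain r where r: "rate w p q = ennreal r" "0 \<le> r" using rate_finite[of w p q] by (cases "rate w p q") auto
    then have "{z::real. 0 < z \<and> ennreal z \<le> rate w p q} = {0<..r}" by auto
    then show ?thesis using r by simp
  qed
  have "emeasure lborel (region w p B) = (\<integral>\<^sup>+c. indicator (region w p B) c \<partial>lborel)" by simp
  also have "\<dots> = (\<integral>\<^sup>+q. \<integral>\<^sup>+z. indicator (region w p B) (q, z) \<partial>lborel \<partial>lborel)"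
    by (rule nn_integral_lborel_pair) measurable
  also have "\<dots> = (\<integral>\<^sup>+q. \<integral>\<^sup>+z. indicator {z. 0 < z \<and> ennreal z \<le> rate w p q} z * indicator B q \<partial>lborel \<partial>lborel)"
    by (intro nn_integral_cong) (auto simp: region_def indicator_def)
  also have "\<dots> = (\<integral>\<^sup>+q. rate w p q * indicator B q \<partial>lborel)"
    by (subst nn_integral_multc) (simp_all add: e)
  finally show ?thesis .
qed

text \<open>Disjoint sets \<open>B\<close> have disjoint regions under the graph of the rate, with
  the intensities as volumes; \<open>poisson_points\<close> applies with the noise of the ancestors
  frozen.\<close>

lemma count_law:
  assumes \<B>: "finite \<B>" "\<B> \<subseteq> sets borel" "disjoint \<B>"
  shows "(\<integral>\<^sup>+y. (\<Prod>B\<in>\<B>. indicator {of_nat (m B)} (count w y \<eta> B)) \<partial>space_of_points) =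
    (\<Prod>B\<in>\<B>. ennreal (poisson_mass (intensity w \<eta> B) (m B)))"
    and "(\<lambda>y. \<Prod>B\<in>\<B>. indicator {of_nat (m B)} (count w y \<eta> B) :: ennreal) \<in> borel_measurable space_of_points"
proof -
  interpret prob_space space_of_points by (rule prob_space_of_points)
  show meas: "(\<lambda>y. \<Prod>B\<in>\<B>. indicator {of_nat (m B)} (count w y \<eta> B) :: ennreal) \<in> borel_measurable space_of_points"
  proof (rule borel_measurable_prod_ennreal)
    fix B assume "B \<in> \<B>"
    then have [measurable]: "B \<in> sets borel" using \<B> by auto
    have "(\<lambda>y. \<integral>\<^sup>+i. (if active i y \<and> point i y \<in> region w (snd (state w \<eta>)) B then 1 else 0) \<partial>count_space UNIV) \<in> borel_measurable space_of_points"
      unfolding nn_integral_count_space_nat by measurable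
    moreover have "(\<integral>\<^sup>+i. (if active i y \<and> point i y \<in> region w (snd (state w \<eta>)) B then 1 else 0) \<partial>count_space UNIV)
        = emeasure (count_space UNIV) {i. active i y \<and> point i y \<in> region w (snd (state w \<eta>)) B}" for y
      by (subst nn_integral_indicator[symmetric]) (auto intro!: nn_integral_cong simp: indicator_def simp del: nn_integral_indicator)
    ultimately have [measurable]: "(\<lambda>y. count w y \<eta> B) \<in> borel_measurable space_of_points"
      by (auto simp: count_def)
    show "(\<lambda>y. indicator {of_nat (m B)} (count w y \<eta> B) :: ennreal) \<in> borel_measurable space_of_points" by measurable
  qed
  show "(\<integral>\<^sup>+y. (\<Prod>B\<in>\<B>. indicator {of_nat (m B)} (count w y \<eta> B)) \<partial>space_of_points) =
    (\<Prod>B\<in>\<B>. ennreal (poisson_mass (intensity w \<eta> B) (m B)))"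
  proof (cases "fst (state w \<eta>)")
    case False
    have "indicator {of_nat k} (0::ennreal) = ennreal (poisson_mass 0 k)" for k
      by (cases "k = 0") (auto simp: poisson_mass_def indicator_def ennreal_of_nat_eq_real_of_nat)
    then show ?thesis using False by (simp add: count_def intensity_def emeasure_space_1)
  next
    case True
    let ?D = "region w (snd (state w \<eta>))"
    let ?E = "{y \<in> space space_of_points. \<forall>B\<in>\<B>. emeasure (count_space UNIV) {i. active i y \<and> point i y \<in> ?D B} = of_nat (m B)}"
    have ind: "(\<Prod>B\<in>\<B>. indicator {of_nat (m B)} (count w y \<eta> B)) = (indicator ?E y :: ennreal)" if "y \<in> space space_of_points" for y
      using that \<B>(1) True by (auto simp: count_def indicator_def prod_zero_iff)
    then have "(\<lambda>y. indicator ?E y :: ennreal) \<in> borel_measurable space_of_points" using meas by (simp cong: measurable_cong)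
    then have "?E \<inter> space space_of_points \<in> sets space_of_points" by (simp only: borel_measurable_indicator_iff)
    moreover have "?E \<inter> space space_of_points = ?E" by auto
    ultimately have E: "?E \<in> sets space_of_points" by (simp only:)
    have "(\<integral>\<^sup>+y. (\<Prod>B\<in>\<B>. indicator {of_nat (m B)} (count w y \<eta> B)) \<partial>space_of_points) = emeasure space_of_points ?E"
      using E by (subst nn_integral_indicator[symmetric]) (auto intro!: nn_integral_cong simp: ind simp del: nn_integral_indicator)
    also have "measure space_of_points ?E = (\<Prod>B\<in>\<B>. poisson_mass (emeasure lborel (?D B)) (m B))"
    proof (rule poisson_points[OF \<B>(1)])
      show "?D B \<in> sets borel" if "B \<in> \<B>" for B using that \<B>(2) by auto
      show "disjoint_family_on ?D \<B>"
        using \<B>(3) by (fastforce simp: disjoint_family_on_def region_def disjoint_def)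
    qed
    then have "emeasure space_of_points ?E = (\<Prod>B\<in>\<B>. ennreal (poisson_mass (emeasure lborel (?D B)) (m B)))"
      by (simp add: emeasure_eq_measure prod_ennreal)
    also have "\<dots> = (\<Prod>B\<in>\<B>. ennreal (poisson_mass (intensity w \<eta> B) (m B)))"
      using True \<B>(2) by (intro prod.cong) (auto simp: intensity_def emeasure_region)
    finally show ?thesis .
  qed
qed

lemma count_eq:
  "count w (\<eta> w) \<eta> B = emeasure (count_space UNIV) {i. fst (state (i # w) \<eta>) \<and> snd (state (i # w) \<eta>) \<in> B}"
proof (cases "fst (state w \<eta>)")
  case True
  then have "{i. fst (state (i # w) \<eta>) \<and> snd (state (i # w) \<eta>) \<in> B} =
      {i. active i (\<eta> w) \<and> point i (\<eta> w) \<in> region w (snd (state w \<eta>)) B}"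
    by (auto simp: region_def)
  then show ?thesis using True by (simp add: count_def)
next
  case False
  then show ?thesis by (simp add: count_def)
qed

lemma state_sets: "B \<in> sets borel \<Longrightarrow> {\<eta> \<in> space noise. fst (state w \<eta>) \<and> snd (state w \<eta>) \<in> B} \<in> sets noise"
proof -
  assume [measurable]: "B \<in> sets borel"
  define f s where "f \<eta> = fst (state w \<eta>)" and "s \<eta> = snd (state w \<eta>)" for \<eta>
  have [measurable]: "Measurable.pred noise f" "s \<in> borel_measurable noise"
    using state_measurable[of w] unfolding f_def[abs_def] s_def[abs_def] by auto
  have "{\<eta> \<in> space noise. f \<eta> \<and> s \<eta> \<in> B} \<in> sets noise" by measurable
  then show ?thesis by (simp add: f_def s_def)
qed

lemma count_measurable:
  assumes B: "B \<in> sets borel"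
  shows "(\<lambda>\<eta>. count w (\<eta> w) \<eta> B) \<in> borel_measurable noise"
proof -
  have e: "count w (\<eta> w) \<eta> B = (\<Sum>i. indicator {\<eta> \<in> space noise. fst (state (i # w) \<eta>) \<and> snd (state (i # w) \<eta>) \<in> B} \<eta>)"
    if "\<eta> \<in> space noise" for \<eta>
  proof -
    have "(indicator {i. fst (state (i # w) \<eta>) \<and> snd (state (i # w) \<eta>) \<in> B} :: nat \<Rightarrow> ennreal) =
        (\<lambda>i. indicator {\<eta> \<in> space noise. fst (state (i # w) \<eta>) \<and> snd (state (i # w) \<eta>) \<in> B} \<eta>)"
      using that by (auto simp: indicator_def fun_eq_iff)
    then show ?thesis
      unfolding count_eq
      by (subst nn_integral_indicator[symmetric]) (simp_all add: nn_integral_count_space_nat del: nn_integral_indicator)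
  qed
  have "(\<lambda>\<eta>. indicator {\<eta> \<in> space noise. fst (state (i # w) \<eta>) \<and> snd (state (i # w) \<eta>) \<in> B} \<eta> :: ennreal) \<in> borel_measurable noise" for i
    by (rule borel_measurable_indicator) (rule state_sets[OF B])
  then show ?thesis by (subst measurable_cong[OF e]) (auto intro: borel_measurable_suminf_order)
qed

lemma intensity_measurable:
  assumes [measurable]: "B \<in> sets borel"
  shows "(\<lambda>\<eta>. intensity w \<eta> B) \<in> borel_measurable noise"
proof -
  define f s where "f \<eta> = fst (state w \<eta>)" and "s \<eta> = snd (state w \<eta>)" for \<eta>
  have [measurable]: "Measurable.pred noise f" "s \<in> borel_measurable noise"
    using state_measurable[of w] unfolding f_def[abs_def] s_def[abs_def] by auto
  have r: "(\<lambda>x. rate w (s (fst x)) (snd x)) \<in> borel_measurable (noise \<Otimes>\<^sub>M lborel)"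
    by (rule rate_measurable) measurable
  have "(\<lambda>(\<eta>, q). rate w (s \<eta>) q * indicator B q) \<in> borel_measurable (noise \<Otimes>\<^sub>M lborel)"
    unfolding case_prod_unfold by (intro borel_measurable_times_ennreal r) measurable
  then have [measurable]: "(\<lambda>\<eta>. \<integral>\<^sup>+q. rate w (s \<eta>) q * indicator B q \<partial>lborel) \<in> borel_measurable noise"
    by (rule lborel.borel_measurable_nn_integral)
  have "(\<lambda>\<eta>. if f \<eta> then \<integral>\<^sup>+q. rate w (s \<eta>) q * indicator B q \<partial>lborel else 0) \<in> borel_measurable noise" by measurable
  then show ?thesis by (simp add: f_def s_def intensity_def cong: if_cong)
qed

text \<open>Labels of equal length are never ancestors of each other, so their noise enters none of
  their states and can be resampled label by label; \<open>A\<close> stands for an event of the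
  history.\<close>

lemma noise_law:
  assumes V: "finite V" "\<And>w. w \<in> V \<Longrightarrow> length w = k"
    and \<B>: "finite \<B>" "\<B> \<subseteq> sets borel" "disjoint \<B>"
    and A: "A \<in> sets noise" "\<And>w \<eta> x. length w = k \<Longrightarrow> \<eta> \<in> space noise \<Longrightarrow> x \<in> space space_of_points \<Longrightarrow>
      \<eta>(w := x) \<in> A \<longleftrightarrow> \<eta> \<in> A"
  shows "(\<integral>\<^sup>+\<eta>. indicator A \<eta> * (\<Prod>w\<in>V. \<Prod>B\<in>\<B>. indicator {of_nat (m w B)} (count w (\<eta> w) \<eta> B)) \<partial>noise) =
    (\<integral>\<^sup>+\<eta>. indicator A \<eta> * (\<Prod>w\<in>V. \<Prod>B\<in>\<B>. ennreal (poisson_mass (intensity w \<eta> B) (m w B))) \<partial>noise)"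
proof (rule nn_integral_PiM_resample[OF prob_space_of_points V(1), where a = "indicator A"
      and q = "\<lambda>w y \<eta>. \<Prod>B\<in>\<B>. indicator {of_nat (m w B)} (count w y \<eta> B)"
      and p = "\<lambda>w \<eta>. \<Prod>B\<in>\<B>. ennreal (poisson_mass (intensity w \<eta> B) (m w B))"])
  show "(indicator A :: _ \<Rightarrow> ennreal) \<in> borel_measurable noise" using A(1) by (rule borel_measurable_indicator)
  show "(indicator A (\<eta>(w := x)) :: ennreal) = indicator A \<eta>"
    if "w \<in> V" "\<eta> \<in> space noise" "x \<in> space space_of_points" for w \<eta> x
    using A(2)[OF V(2)[OF that(1)] that(2,3)] by (simp add: indicator_def)
  show "(\<lambda>\<eta>. \<Prod>B\<in>\<B>. indicator {of_nat (m w B)} (count w (\<eta> w) \<eta> B) :: ennreal) \<in> borel_measurable noise" for w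
  proof (rule borel_measurable_prod_ennreal)
    fix B assume "B \<in> \<B>"
    then have [measurable]: "(\<lambda>\<eta>. count w (\<eta> w) \<eta> B) \<in> borel_measurable noise" using \<B>(2) by (intro count_measurable) auto
    show "(\<lambda>\<eta>. indicator {of_nat (m w B)} (count w (\<eta> w) \<eta> B) :: ennreal) \<in> borel_measurable noise" by measurable
  qed
  show "(\<lambda>\<eta>. \<Prod>B\<in>\<B>. ennreal (poisson_mass (intensity w \<eta> B) (m w B))) \<in> borel_measurable noise" for w
    using \<B>(2)
    by (intro borel_measurable_prod_ennreal measurable_compose[OF _ measurable_ennreal]
        measurable_compose[OF intensity_measurable poisson_mass_measurable]) auto
  show "(\<Prod>B\<in>\<B>. indicator {of_nat (m v B)} (count v y (\<eta>(w := x)) B)) =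
      (\<Prod>B\<in>\<B>. indicator {of_nat (m v B)} (count v y \<eta> B) :: ennreal)" if "v \<in> V" "w \<in> V" for v w y \<eta> x
    using V(2)[OF that(1)] V(2)[OF that(2)] by (simp add: count_def state_update cong: if_cong)
  show "(\<Prod>B\<in>\<B>. ennreal (poisson_mass (intensity v (\<eta>(w := x)) B) (m v B))) =
      (\<Prod>B\<in>\<B>. ennreal (poisson_mass (intensity v \<eta> B) (m v B)))" if "v \<in> V" "w \<in> V" for v w \<eta> x
    using V(2)[OF that(1)] V(2)[OF that(2)] by (simp add: intensity_def state_update cong: if_cong)
qed (rule count_law[OF \<B>])+

end

text \<open>The noise is a random element \<open>\<xi>\<close> of an arbitrary probability space, so
  that the construction can be carried over to the type on which existence is claimed.\<close>

locale branching_on = branching X lam g gt W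
  for X :: "'a::euclidean_space set" and lam g gt and W :: "nat \<Rightarrow> (('a \<times> real) \<times> real) set" +
  fixes M :: "'w measure" and \<xi> :: "'w \<Rightarrow> nat list \<Rightarrow> (('a \<times> real) \<times> real) points"
  assumes prob_M: "prob_space M"
    and \<xi> [measurable]: "\<xi> \<in> measurable M (PiM UNIV (\<lambda>_. space_of_points))"
    and distr_\<xi>: "distr M (PiM UNIV (\<lambda>_. space_of_points)) \<xi> = PiM UNIV (\<lambda>_. space_of_points)"
begin

text \<open>Labels are reversed so that the state of a point is computed by recursion along its ancestors.\<close>

definition pos :: "nat list \<Rightarrow> 'w \<Rightarrow> ('a \<times> real) option" where
  "pos u \<omega> = (if fst (state (rev u) (\<xi> \<omega>)) then Some (snd (state (rev u) (\<xi> \<omega>))) else None)"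

lemma pos_iff: "(\<exists>b\<in>B. pos u \<omega> = Some b) \<longleftrightarrow> fst (state (rev u) (\<xi> \<omega>)) \<and> snd (state (rev u) (\<xi> \<omega>)) \<in> B"
  by (auto simp: pos_def)

lemma \<xi>_space: "\<omega> \<in> space M \<Longrightarrow> \<xi> \<omega> \<in> space noise"
  using \<xi> by (rule measurable_space)

lemma pos_vimage: "{\<omega> \<in> space M. \<exists>b\<in>B. pos u \<omega> = Some b} =
    \<xi> -` {\<eta> \<in> space noise. fst (state (rev u) \<eta>) \<and> snd (state (rev u) \<eta>) \<in> B} \<inter> space M"
  using \<xi>_space by (auto simp: pos_iff)

lemma pos_sets: "B \<in> sets borel \<Longrightarrow> {\<omega> \<in> space M. \<exists>b\<in>B. pos u \<omega> = Some b} \<in> sets M"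
  unfolding pos_vimage by (rule measurable_sets[OF \<xi>]) (rule state_sets)

lemma emeasure_offspring:
  assumes "B \<in> sets borel"
  shows "emeasure (offspring pos u \<omega>) B = count (rev u) (\<xi> \<omega> (rev u)) (\<xi> \<omega>) B"
proof -
  have "{v \<in> range (\<lambda>i. u @ [i]). \<exists>b\<in>B. pos v \<omega> = Some b} =
      (\<lambda>i. u @ [i]) ` {i. fst (state (i # rev u) (\<xi> \<omega>)) \<and> snd (state (i # rev u) (\<xi> \<omega>)) \<in> B}"
    unfolding pos_iff by (auto simp del: state.simps)
  then show ?thesis using assms
    by (simp add: offspring_def emeasure_point_measure count_eq emeasure_count_space_image inj_def del: state.simps)
qed

lemma emeasure_background:
  assumes [measurable]: "B \<in> sets borel"
  shows "emeasure (background_intensity X lam) B = intensity [] \<eta> B"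
  unfolding background_eq by (subst emeasure_density) (auto simp: intensity_def rate_def)

lemma emeasure_offspring_intensity:
  assumes [measurable]: "B \<in> sets borel" and u: "u \<noteq> []"
  shows "emeasure (offspring_intensity X g (pos u \<omega>)) B = intensity (rev u) (\<xi> \<omega>) B"
proof (cases "fst (state (rev u) (\<xi> \<omega>))")
  case True
  obtain y s where s: "snd (state (rev u) (\<xi> \<omega>)) = (y, s)" by (cases "snd (state (rev u) (\<xi> \<omega>))")
  have "y \<in> X" using state_X[of "rev u" "\<xi> \<omega>"] True u s by simp
  then have "emeasure (offspring_intensity X g (pos u \<omega>)) B = (\<integral>\<^sup>+z. gX y (fst z) (snd z - s) * indicator B z \<partial>lborel)"
    using True by (simp add: pos_def s offspring_intensity_Some emeasure_density)
  then show ?thesis using True u by (simp add: intensity_def rate_def s)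
next
  case False
  then show ?thesis by (simp add: pos_def offspring_intensity_def intensity_def)
qed

lemma generation_0: "generation pos 0 = offspring pos []"
proof -
  have "{u :: nat list. length u = Suc 0} = range (\<lambda>i. [] @ [i])" by (auto simp: length_Suc_conv)
  then show ?thesis by (simp add: generation_def offspring_def fun_eq_iff)
qed

text \<open>Positions of labels up to length \<open>k + 1\<close> are determined by the noise at
  lengths up to \<open>k\<close>. Events of the history are thus preimages of events insensitive to
  the noise at length \<open>k + 1\<close>; this passes through complements and countable
  unions.\<close>

lemma history_vimage:
  assumes "A \<in> sets (history M pos k)"
  shows "\<exists>A'\<in>sets noise. A = \<xi> -` A' \<inter> space M \<and>
    (\<forall>w \<eta> x. length w = Suc k \<longrightarrow> \<eta> \<in> space noise \<longrightarrow> x \<in> space space_of_points \<longrightarrow>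
      (\<eta>(w := x) \<in> A' \<longleftrightarrow> \<eta> \<in> A'))"
  using assms unfolding sets_history
proof (induction rule: sigma_sets.induct)
  have upd: "\<eta>(w := x) \<in> space noise" if "\<eta> \<in> space noise" "x \<in> space space_of_points" for \<eta> w x
    using that by (auto simp: space_PiM PiE_iff)
  {
    case (Basic A)
    then obtain u B where A: "A = {\<omega> \<in> space M. \<exists>b\<in>B. pos u \<omega> = Some b}" and u: "length u \<le> Suc k" and B: "B \<in> sets borel"
      by blast
    let ?A = "{\<eta> \<in> space noise. fst (state (rev u) \<eta>) \<and> snd (state (rev u) \<eta>) \<in> B}"
    show ?case
    proof (intro bexI conjI allI impI)
      show "A = \<xi> -` ?A \<inter> space M" unfolding A by (rule pos_vimage)
      show "?A \<in> sets noise" using B by (rule state_sets)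
      show "\<eta>(w := x) \<in> ?A \<longleftrightarrow> \<eta> \<in> ?A"
        if "length w = Suc k" "\<eta> \<in> space noise" "x \<in> space space_of_points" for w \<eta> x
        using u that upd[OF that(2,3)] by (simp add: state_update del: fun_upd_apply)
    qed
  next
    case Empty
    show ?case by (rule bexI[of _ "{}"]) auto
  next
    case (Compl A)
    then obtain A' where A': "A' \<in> sets noise" "A = \<xi> -` A' \<inter> space M"
      "\<forall>w \<eta> x. length w = Suc k \<longrightarrow> \<eta> \<in> space noise \<longrightarrow> x \<in> space space_of_points \<longrightarrow> (\<eta>(w := x) \<in> A' \<longleftrightarrow> \<eta> \<in> A')"
      by blast
    show ?case
    proof (intro bexI conjI allI impI)
      show "space M - A = \<xi> -` (space noise - A') \<inter> space M" unfolding A'(2) using \<xi>_space by auto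
      show "space noise - A' \<in> sets noise" using A'(1) by auto
      show "\<eta>(w := x) \<in> space noise - A' \<longleftrightarrow> \<eta> \<in> space noise - A'"
        if "length w = Suc k" "\<eta> \<in> space noise" "x \<in> space space_of_points" for w \<eta> x
        using A'(3) that upd[OF that(2,3)] by (simp del: fun_upd_apply)
    qed
  next
    case (Union A)
    have "\<forall>i. \<exists>A'. A' \<in> sets noise \<and> A i = \<xi> -` A' \<inter> space M \<and>
      (\<forall>w \<eta> x. length w = Suc k \<longrightarrow> \<eta> \<in> space noise \<longrightarrow> x \<in> space space_of_points \<longrightarrow> (\<eta>(w := x) \<in> A' \<longleftrightarrow> \<eta> \<in> A'))"
      using Union.IH unfolding Bex_def by (rule allI)
    then obtain A' where A': "\<forall>i. A' i \<in> sets noise \<and> A i = \<xi> -` A' i \<inter> space M \<and>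
      (\<forall>w \<eta> x. length w = Suc k \<longrightarrow> \<eta> \<in> space noise \<longrightarrow> x \<in> space space_of_points \<longrightarrow> (\<eta>(w := x) \<in> A' i \<longleftrightarrow> \<eta> \<in> A' i))"
      by (rule choice[THEN exE])
    show ?case
    proof (intro bexI conjI allI impI)
      show "(\<Union>i. A i) = \<xi> -` (\<Union>i. A' i) \<inter> space M" using A' by auto
      show "(\<Union>i. A' i) \<in> sets noise" using A' by (intro sets.countable_UN) auto
      show "\<eta>(w := x) \<in> (\<Union>i. A' i) \<longleftrightarrow> \<eta> \<in> (\<Union>i. A' i)"
        if "length w = Suc k" "\<eta> \<in> space noise" "x \<in> space space_of_points" for w \<eta> x
        using A' that by (simp del: fun_upd_apply)
    qed
  }
qed

text \<open>\<open>noise_law\<close> read on \<open>M\<close>: reversal preserves the length of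
  labels, and \<open>\<xi>\<close> transports the integrals. The case \<open>k = 0\<close> is the
  background process, larger \<open>k\<close> give the offspring processes.\<close>

lemma offspring_law:
  assumes U: "finite U" "\<And>u. u \<in> U \<Longrightarrow> length u = k"
    and \<B>: "finite \<B>" "\<B> \<subseteq> sets borel" "disjoint \<B>"
    and A: "A \<in> sets noise" "\<And>w \<eta> x. length w = k \<Longrightarrow> \<eta> \<in> space noise \<Longrightarrow> x \<in> space space_of_points \<Longrightarrow>
      \<eta>(w := x) \<in> A \<longleftrightarrow> \<eta> \<in> A"
  shows "emeasure M ({\<omega> \<in> space M. \<forall>u\<in>U. \<forall>B\<in>\<B>. emeasure (offspring pos u \<omega>) B = of_nat (m u B)} \<inter> \<xi> -` A) =
    (\<integral>\<^sup>+\<omega>. indicator (\<xi> -` A) \<omega> * (\<Prod>u\<in>U. \<Prod>B\<in>\<B>. ennreal (poisson_mass (intensity (rev u) (\<xi> \<omega>) B) (m u B))) \<partial>M)"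
    (is "emeasure M (?E \<inter> _) = _")
    and "{\<omega> \<in> space M. \<forall>u\<in>U. \<forall>B\<in>\<B>. emeasure (offspring pos u \<omega>) B = of_nat (m u B)} \<in> sets M"
proof -
  have mO: "(\<lambda>\<omega>. emeasure (offspring pos u \<omega>) B) \<in> borel_measurable M" if "B \<in> \<B>" for u B
  proof -
    have "B \<in> sets borel" using that \<B>(2) by auto
    then show ?thesis
      using measurable_compose[OF \<xi> count_measurable[of B "rev u"]] by (simp add: emeasure_offspring)
  qed
  show E: "?E \<in> sets M" using U(1) \<B>(1) mO by measurable
  have EA: "?E \<inter> \<xi> -` A \<in> sets M"
  proof -
    have "?E \<inter> \<xi> -` A = ?E \<inter> (\<xi> -` A \<inter> space M)" by auto
    then show ?thesis using E measurable_sets[OF \<xi> A(1)] by auto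
  qed
  let ?V = "rev ` U"
  let ?q = "\<lambda>\<eta>. indicator A \<eta> * (\<Prod>w\<in>?V. \<Prod>B\<in>\<B>. indicator {of_nat (m (rev w) B)} (count w (\<eta> w) \<eta> B)) :: ennreal"
  let ?p = "\<lambda>\<eta>. indicator A \<eta> * (\<Prod>w\<in>?V. \<Prod>B\<in>\<B>. ennreal (poisson_mass (intensity w \<eta> B) (m (rev w) B)))"
  have q: "?q \<in> borel_measurable noise"
  proof (intro borel_measurable_times_ennreal borel_measurable_prod_ennreal)
    fix w B assume "B \<in> \<B>"
    then have [measurable]: "(\<lambda>\<eta>. count w (\<eta> w) \<eta> B) \<in> borel_measurable noise" using \<B>(2) by (intro count_measurable) auto
    show "(\<lambda>\<eta>. indicator {of_nat (m (rev w) B)} (count w (\<eta> w) \<eta> B) :: ennreal) \<in> borel_measurable noise" by measurable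
  qed (rule borel_measurable_indicator[OF A(1)])
  have p: "?p \<in> borel_measurable noise"
    using \<B>(2)
    by (intro borel_measurable_times_ennreal borel_measurable_prod_ennreal measurable_compose[OF _ measurable_ennreal]
        measurable_compose[OF intensity_measurable poisson_mass_measurable] borel_measurable_indicator[OF A(1)]) auto
  have push: "(\<integral>\<^sup>+\<omega>. f (\<xi> \<omega>) \<partial>M) = (\<integral>\<^sup>+\<eta>. f \<eta> \<partial>noise)" if "f \<in> borel_measurable noise" for f
    using nn_integral_distr[OF \<xi>, of f] that unfolding distr_\<xi> by simp
  have r: "(\<Prod>w\<in>?V. h w) = (\<Prod>u\<in>U. h (rev u))" for h :: "nat list \<Rightarrow> ennreal"
    by (subst prod.reindex) (auto simp: inj_on_def)
  have "emeasure M (?E \<inter> \<xi> -` A) = (\<integral>\<^sup>+\<omega>. indicator (?E \<inter> \<xi> -` A) \<omega> \<partial>M)" using EA by simp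
  also have "\<dots> = (\<integral>\<^sup>+\<omega>. ?q (\<xi> \<omega>) \<partial>M)"
  proof (rule nn_integral_cong)
    fix \<omega> assume \<omega>: "\<omega> \<in> space M"
    have "(\<Prod>u\<in>U. \<Prod>B\<in>\<B>. indicator {of_nat (m u B)} (emeasure (offspring pos u \<omega>) B)) = (indicator ?E \<omega> :: ennreal)"
      using \<omega> U(1) \<B>(1) by (auto simp: indicator_def prod_zero_iff)
    moreover have "(\<Prod>u\<in>U. \<Prod>B\<in>\<B>. indicator {of_nat (m u B)} (emeasure (offspring pos u \<omega>) B)) =
        (\<Prod>u\<in>U. \<Prod>B\<in>\<B>. indicator {of_nat (m u B)} (count (rev u) (\<xi> \<omega> (rev u)) (\<xi> \<omega>) B) :: ennreal)"
      using \<B>(2) by (intro prod.cong) (auto simp: emeasure_offspring)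
    ultimately show "indicator (?E \<inter> \<xi> -` A) \<omega> = ?q (\<xi> \<omega>)"
      by (simp only: r rev_rev_ident) (simp add: indicator_inter_arith indicator_vimage mult.commute)
  qed
  also have "\<dots> = (\<integral>\<^sup>+\<eta>. ?q \<eta> \<partial>noise)" by (rule push[OF q])
  also have "\<dots> = (\<integral>\<^sup>+\<eta>. ?p \<eta> \<partial>noise)" using U \<B> A by (intro noise_law[where k=k]) auto
  also have "\<dots> = (\<integral>\<^sup>+\<omega>. ?p (\<xi> \<omega>) \<partial>M)" by (rule push[OF p, symmetric])
  also have "\<dots> = (\<integral>\<^sup>+\<omega>. indicator (\<xi> -` A) \<omega> * (\<Prod>u\<in>U. \<Prod>B\<in>\<B>. ennreal (poisson_mass (intensity (rev u) (\<xi> \<omega>) B) (m u B))) \<partial>M)"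
    by (intro nn_integral_cong) (simp only: r rev_rev_ident, simp add: indicator_vimage)
  finally show "emeasure M (?E \<inter> \<xi> -` A) =
    (\<integral>\<^sup>+\<omega>. indicator (\<xi> -` A) \<omega> * (\<Prod>u\<in>U. \<Prod>B\<in>\<B>. ennreal (poisson_mass (intensity (rev u) (\<xi> \<omega>) B) (m u B))) \<partial>M)" .
qed

lemma poisson_process_background: "poisson_process M (generation pos 0) (background_intensity X lam)"
  unfolding poisson_process_def
proof (intro allI impI)
  fix \<B> :: "('a \<times> real) set set" and m :: "('a \<times> real) set \<Rightarrow> nat"
  assume "finite \<B> \<and> \<B> \<subseteq> sets borel \<and> disjoint \<B>"
  then have \<B>: "finite \<B>" "\<B> \<subseteq> sets borel" "disjoint \<B>" by auto
  interpret prob_space M by (rule prob_M)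
  let ?E = "{\<omega> \<in> space M. \<forall>B\<in>\<B>. emeasure (generation pos 0 \<omega>) B = of_nat (m B)}"
  have upd: "\<eta>(w := x) \<in> space noise \<longleftrightarrow> \<eta> \<in> space noise" if "\<eta> \<in> space noise" "x \<in> space space_of_points" for \<eta> w x
    using that by (auto simp: space_PiM PiE_iff)
  have "emeasure M (?E \<inter> \<xi> -` space noise) =
      (\<integral>\<^sup>+\<omega>. indicator (\<xi> -` space noise) \<omega> * (\<Prod>B\<in>\<B>. ennreal (poisson_mass (intensity [] (\<xi> \<omega>) B) (m B))) \<partial>M)"
    using offspring_law(1)[of "{[]}" 0 \<B> "space noise" "\<lambda>_. m", OF _ _ \<B> sets.top upd] by (simp add: generation_0)
  also have "?E \<inter> \<xi> -` space noise = ?E" using \<xi>_space by auto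
  also have "(\<integral>\<^sup>+\<omega>. indicator (\<xi> -` space noise) \<omega> * (\<Prod>B\<in>\<B>. ennreal (poisson_mass (intensity [] (\<xi> \<omega>) B) (m B))) \<partial>M)
      = (\<integral>\<^sup>+\<omega>. (\<Prod>B\<in>\<B>. ennreal (poisson_mass (emeasure (background_intensity X lam) B) (m B))) \<partial>M)"
  proof (rule nn_integral_cong)
    fix \<omega> assume "\<omega> \<in> space M"
    then have i: "indicator (\<xi> -` space noise) \<omega> = (1 :: ennreal)" using \<xi>_space by simp
    show "indicator (\<xi> -` space noise) \<omega> * (\<Prod>B\<in>\<B>. ennreal (poisson_mass (intensity [] (\<xi> \<omega>) B) (m B)))
        = (\<Prod>B\<in>\<B>. ennreal (poisson_mass (emeasure (background_intensity X lam) B) (m B)))"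
      unfolding i mult_1_left using \<B>(2) by (intro prod.cong) (auto simp: emeasure_background[of _ "\<xi> \<omega>"])
  qed
  also have "\<dots> = ennreal (\<Prod>B\<in>\<B>. poisson_mass (emeasure (background_intensity X lam) B) (m B))"
    by (simp add: emeasure_space_1 prod_ennreal)
  finally show "measure M ?E = (\<Prod>B\<in>\<B>. poisson_mass (emeasure (background_intensity X lam) B) (m B))"
    by (simp add: emeasure_eq_measure prod_nonneg)
qed

text \<open>The product of Poisson masses is measurable for the history and, by
  \<open>offspring_law\<close>, has the right integral over each of its events; this characterizes
  the conditional expectation.\<close>

lemma cond_indep_offspring:
  "cond_indep_poisson_processes M (history M pos k) {u. length u = Suc k}
    (offspring pos) (\<lambda>u \<omega>. offspring_intensity X g (pos u \<omega>))"
  unfolding cond_indep_poisson_processes_def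
proof (intro allI impI)
  fix U :: "nat list set" and \<B> :: "('a \<times> real) set set" and m :: "nat list \<Rightarrow> ('a \<times> real) set \<Rightarrow> nat"
  assume "finite U \<and> U \<subseteq> {u. length u = Suc k} \<and> finite \<B> \<and> \<B> \<subseteq> sets borel \<and> disjoint \<B>"
  then have U: "finite U" "\<And>u. u \<in> U \<Longrightarrow> length u = Suc k" and \<B>: "finite \<B>" "\<B> \<subseteq> sets borel" "disjoint \<B>" by auto
  interpret prob_space M by (rule prob_M)
  have sub: "subalgebra M (history M pos k)" by (rule subalgebra_history) (rule pos_sets)
  interpret S: finite_measure_subalgebra M "history M pos k" by standard (rule sub)
  let ?E = "{\<omega> \<in> space M. \<forall>u\<in>U. \<forall>B\<in>\<B>. emeasure (offspring pos u \<omega>) B = of_nat (m u B)}"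
  let ?P = "\<lambda>\<omega>. \<Prod>u\<in>U. \<Prod>B\<in>\<B>. poisson_mass (emeasure (offspring_intensity X g (pos u \<omega>)) B) (m u B)"
  have upd: "\<eta>(w := x) \<in> space noise \<longleftrightarrow> \<eta> \<in> space noise" if "\<eta> \<in> space noise" "x \<in> space space_of_points" for \<eta> w x
    using that by (auto simp: space_PiM PiE_iff)
  have E: "?E \<in> sets M" by (rule offspring_law(2)[OF U \<B> sets.top upd])
  have Eq: "emeasure (offspring_intensity X g (pos u \<omega>)) B = oapp (K (indicator B)) (pos u \<omega>)"
    if "B \<in> sets borel" "u \<noteq> []" for u B \<omega>
  proof -
    have "y \<in> X" if "pos u \<omega> = Some (y, s)" for y s
      using that state_X[of "rev u" "\<xi> \<omega>"] \<open>u \<noteq> []\<close> by (auto simp: pos_def split: if_splits)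
    then have "(\<integral>\<^sup>+z. indicator B z \<partial>offspring_intensity X g (pos u \<omega>)) = oapp (K (indicator B)) (pos u \<omega>)"
      using that by (intro nn_integral_offspring_intensity) auto
    then show ?thesis using that by simp
  qed
  have P: "?P \<in> borel_measurable (history M pos k)"
  proof (intro borel_measurable_prod)
    fix u B assume u: "u \<in> U" and B: "B \<in> \<B>"
    then have uB: "u \<noteq> []" "length u \<le> Suc k" "B \<in> sets borel" using U(2)[OF u] \<B>(2) by auto
    have "(\<lambda>\<omega>. emeasure (offspring_intensity X g (pos u \<omega>)) B) \<in> borel_measurable (history M pos k)"
      unfolding Eq[OF uB(3,1)] using uB by (intro oapp_measurable K_measurable) (auto intro!: history_gen)
    then show "(\<lambda>\<omega>. poisson_mass (emeasure (offspring_intensity X g (pos u \<omega>)) B) (m u B)) \<in> borel_measurable (history M pos k)"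
      by (rule measurable_compose[OF _ poisson_mass_measurable])
  qed
  then have PM [measurable]: "?P \<in> borel_measurable M" by (rule measurable_from_subalg[OF sub])
  have P01: "0 \<le> ?P \<omega>" "?P \<omega> \<le> 1" for \<omega>
    by (auto intro!: prod_nonneg prod_le_1 poisson_mass_le_1)
  have iP: "integrable M ?P"
    by (rule integrable_const_bound[where B=1]) (use P01 PM in \<open>auto simp: abs_of_nonneg\<close>)
  show "AE \<omega> in M. real_cond_exp M (history M pos k) (indicat_real ?E) \<omega> = ?P \<omega>"
  proof (rule S.real_cond_exp_charact)
    show "integrable M (indicat_real ?E)" using E by (simp add: less_top[symmetric])
    show "integrable M ?P" by (rule iP)
    show "?P \<in> borel_measurable (history M pos k)" by (rule P)
    fix H assume H: "H \<in> sets (history M pos k)"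
    then have HM: "H \<in> sets M" using sub by (auto simp: subalgebra_def)
    obtain A where A: "A \<in> sets noise" "H = \<xi> -` A \<inter> space M"
      "\<forall>w \<eta> x. length w = Suc k \<longrightarrow> \<eta> \<in> space noise \<longrightarrow> x \<in> space space_of_points \<longrightarrow> (\<eta>(w := x) \<in> A \<longleftrightarrow> \<eta> \<in> A)"
      using history_vimage[OF H] by (elim bexE conjE)
    have "(\<integral>\<omega>\<in>H. indicat_real ?E \<omega> \<partial>M) = measure M (?E \<inter> H)"
      using HM E by (simp add: set_lebesgue_integral_def indicator_inter_arith[symmetric] Int_commute)
    also have "?E \<inter> H = ?E \<inter> \<xi> -` A" unfolding A(2) by auto
    also have "measure M (?E \<inter> \<xi> -` A) = enn2real (\<integral>\<^sup>+\<omega>. indicator (\<xi> -` A) \<omega> *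
        (\<Prod>u\<in>U. \<Prod>B\<in>\<B>. ennreal (poisson_mass (intensity (rev u) (\<xi> \<omega>) B) (m u B))) \<partial>M)"
      unfolding measure_def
      by (rule arg_cong[where f=enn2real], rule offspring_law(1)[OF U \<B> A(1)], assumption, rule A(3)[rule_format])
    also have "\<dots> = enn2real (\<integral>\<^sup>+\<omega>. ennreal (indicator H \<omega> * ?P \<omega>) \<partial>M)"
    proof (intro arg_cong[where f=enn2real] nn_integral_cong)
      fix \<omega> assume \<omega>: "\<omega> \<in> space M"
      have "intensity (rev u) (\<xi> \<omega>) B = emeasure (offspring_intensity X g (pos u \<omega>)) B" if "u \<in> U" "B \<in> \<B>" for u B
      proof -
        have "u \<noteq> []" "B \<in> sets borel" using U(2)[OF that(1)] \<B>(2) that(2) by auto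
        then show ?thesis by (simp add: emeasure_offspring_intensity)
      qed
      then have "(\<Prod>u\<in>U. \<Prod>B\<in>\<B>. ennreal (poisson_mass (intensity (rev u) (\<xi> \<omega>) B) (m u B))) = ennreal (?P \<omega>)"
        by (simp add: prod_ennreal prod_nonneg)
      then show "indicator (\<xi> -` A) \<omega> * (\<Prod>u\<in>U. \<Prod>B\<in>\<B>. ennreal (poisson_mass (intensity (rev u) (\<xi> \<omega>) B) (m u B)))
          = ennreal (indicator H \<omega> * ?P \<omega>)"
        unfolding A(2) using \<omega> by (simp add: indicator_def)
    qed
    also have "\<dots> = (\<integral>\<omega>\<in>H. ?P \<omega> \<partial>M)"
      unfolding set_lebesgue_integral_def real_scaleR_def
      by (rule integral_eq_nn_integral[symmetric]) (use HM P01 in \<open>auto intro!: AE_I2 mult_nonneg_nonneg\<close>)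
    finally show "(\<integral>\<omega>\<in>H. indicat_real ?E \<omega> \<partial>M) = (\<integral>\<omega>\<in>H. ?P \<omega> \<partial>M)" .
  qed
qed

theorem hawkes_construction_pos: "hawkes_construction M X lam g pos"
  unfolding hawkes_construction_def
proof (intro conjI allI impI ballI)
  show "x \<in> X" if "u \<noteq> [] \<and> \<omega> \<in> space M \<and> pos u \<omega> = Some (x, t)" for u \<omega> x t
    using that state_X[of "rev u" "\<xi> \<omega>"] by (auto simp: pos_def split: if_splits)
qed (use prob_M pos_sets poisson_process_background cond_indep_offspring in auto)

end

text \<open>Existence is asserted on the type \<open>nat \<Rightarrow> real\<close>, into which the noise is embedded.\<close>

definition coordinate :: "nat \<times> (nat \<Rightarrow> ('a::euclidean_space \<times> real) \<times> real) \<Rightarrow> nat \<Rightarrow> nat \<Rightarrow> real" where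
  "coordinate y j l = (case l of 0 \<Rightarrow> real (fst y) | Suc 0 \<Rightarrow> snd (snd y j) | Suc (Suc 0) \<Rightarrow> snd (fst (snd y j))
    | Suc (Suc (Suc i)) \<Rightarrow> fst (fst (snd y j)) \<bullet> from_nat_into Basis i)"

definition encode :: "(nat list \<Rightarrow> (('a::euclidean_space \<times> real) \<times> real) points) \<Rightarrow> nat \<Rightarrow> real" where
  "encode \<eta> n = (case prod_decode n of (w, r) \<Rightarrow> case prod_decode r of (i, s) \<Rightarrow> case prod_decode s of (j, l) \<Rightarrow>
    coordinate (\<eta> (list_decode w) i) j l)"

lemma inj_coordinate: "inj coordinate"
proof (rule injI)
  fix y z :: "nat \<times> (nat \<Rightarrow> ('a \<times> real) \<times> real)"
  assume "coordinate y = coordinate z"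
  then have eq: "coordinate y j l = coordinate z j l" for j l by simp
  have "fst y = fst z" using eq[of 0 0] by (simp add: coordinate_def)
  moreover have "snd y j = snd z j" for j
  proof (intro prod_eqI)
    show "snd (snd y j) = snd (snd z j)" using eq[of j 1] by (simp add: coordinate_def)
    show "snd (fst (snd y j)) = snd (fst (snd z j))" using eq[of j 2] by (simp add: coordinate_def numeral_2_eq_2)
    show "fst (fst (snd y j)) = fst (fst (snd z j))"
    proof (rule euclidean_eqI)
      fix b :: 'a assume "b \<in> Basis"
      then obtain i where "b = from_nat_into Basis i"
        using from_nat_into_surj[of "Basis :: 'a set" b] by (auto simp: countable_finite)
      then show "fst (fst (snd y j)) \<bullet> b = fst (fst (snd z j)) \<bullet> b"
        using eq[of j "Suc (Suc (Suc i))"] by (simp add: coordinate_def)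
    qed
  qed
  ultimately show "y = z" by (rule prod_eqI[OF _ ext])
qed

lemma inj_encode: "inj encode"
proof (rule injI, rule ext, rule ext)
  fix \<eta> \<theta> :: "nat list \<Rightarrow> (('a \<times> real) \<times> real) points" and w i
  assume eq: "encode \<eta> = encode \<theta>"
  have "coordinate (\<eta> w i) j l = coordinate (\<theta> w i) j l" for j l
    using fun_cong[OF eq, of "prod_encode (list_encode w, prod_encode (i, prod_encode (j, l)))"]
    by (simp add: encode_def)
  then have "coordinate (\<eta> w i) = coordinate (\<theta> w i)" by (intro ext)
  then show "\<eta> w i = \<theta> w i" by (rule injD[OF inj_coordinate])
qed

text \<open>\<open>embed_measure\<close> carries the noise along the injection \<open>encode\<close>
  together with its \<sigma>-algebra, so \<open>inv encode\<close> is measurable and recovers the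
  noise with its law.\<close>

theorem (in hawkes_data) hawkes_exists:
  "\<exists>(M :: (nat \<Rightarrow> real) measure) pos. hawkes_construction M X lam g pos"
proof -
  obtain W :: "nat \<Rightarrow> (('a \<times> real) \<times> real) set" where W: "poisson_pieces W"
    using poisson_pieces_exist by blast
  interpret W: poisson_pieces W by (rule W)
  interpret b: branching X lam g gt W ..
  let ?P = "PiM UNIV (\<lambda>_. W.space_of_points) :: (nat list \<Rightarrow> (('a \<times> real) \<times> real) points) measure"
  let ?M = "embed_measure ?P encode"
  have P: "prob_space ?P" by (intro prob_space_PiM W.prob_space_of_points)
  have e: "encode \<in> measurable ?P ?M" by (rule measurable_embed_measure2) (rule inj_encode)
  have M: "?M = distr ?P ?M encode" by (rule embed_measure_eq_distr) (rule inj_encode)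
  have \<xi>: "inv encode \<in> measurable ?M ?P"
    by (rule measurable_embed_measure1) (simp add: inv_f_f[OF inj_encode])
  have d: "distr ?M ?P (inv encode) = ?P"
  proof -
    have "distr ?M ?P (inv encode) = distr (distr ?P ?M encode) ?P (inv encode)"
      by (rule arg_cong[where f="\<lambda>N. distr N ?P (inv encode)"]) (rule M)
    also have "\<dots> = distr ?P ?P (inv encode \<circ> encode)" by (rule distr_distr[OF \<xi> e])
    also have "\<dots> = ?P" by (simp add: inv_o_cancel[OF inj_encode] id_def)
    finally show ?thesis .
  qed
  have pM: "prob_space ?M" by (subst M) (rule prob_space.prob_space_distr[OF P e])
  interpret b: branching_on X lam g gt W ?M "inv encode"
    by (intro branching_on.intro branching_on_axioms.intro b.branching_axioms pM \<xi> d)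
  show ?thesis using b.hawkes_construction_pos by (intro exI)
qed

theorem proposition4p10:
  fixes X :: "'a::euclidean_space set"
    and lam :: "'a \<Rightarrow> real"
    and g :: "'a \<Rightarrow> 'a \<Rightarrow> real \<Rightarrow> real"
    and gt :: "real \<Rightarrow> real"
  defines "m_lam \<equiv> (\<integral>\<^sup>+ x\<in>X. ennreal (lam x) \<partial>lborel)"
    and "nu_temp \<equiv> (\<integral>\<^sup>+ h\<in>{0..}. ennreal (gt h) \<partial>lborel)"
    and "nu \<equiv> (\<lambda>y. \<integral>\<^sup>+ (x, h)\<in>X \<times> {0..}. ennreal (g y x h) \<partial>lborel)"
  defines "nu_bar \<equiv> (SUP y\<in>X. nu y)"
  assumes X: "bounded X" "X \<in> sets borel"
    and lam: "lam \<in> borel_measurable (restrict_space borel X)"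
      "\<And>x. x \<in> X \<Longrightarrow> 0 \<le> lam x"
      "m_lam < \<infinity>"
    and g: "(\<lambda>(y, x, h). g y x h) \<in> borel_measurable (restrict_space borel (X \<times> X \<times> UNIV))"
      "\<And>y x h. y \<in> X \<Longrightarrow> x \<in> X \<Longrightarrow> 0 \<le> g y x h"
      "\<And>y x h. y \<in> X \<Longrightarrow> x \<in> X \<Longrightarrow> h < 0 \<Longrightarrow> g y x h = 0"
    and gt: "gt \<in> borel_measurable (restrict_space borel {0..})"
      "\<And>h. 0 \<le> h \<Longrightarrow> 0 \<le> gt h"
      "nu_temp < 1"
      "\<And>h. 0 \<le> h \<Longrightarrow> (SUP y\<in>X. \<integral>\<^sup>+ x\<in>X. ennreal (g y x h) \<partial>lborel) \<le> ennreal (gt h)"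
  shows "(\<exists>(M :: (nat \<Rightarrow> real) measure) pos. hawkes_construction M X lam g pos) \<and>
    (\<forall>(M :: 'w measure) pos. hawkes_construction M X lam g pos \<longrightarrow>
      as_locally_finite M X (hawkes_process pos) \<and>
      strongly_time_stationary M (hawkes_process pos) \<and>
      L2_process M (hawkes_process pos) \<and>
      (\<exists>\<mu> R Gpos Gneg.
        spatial_mean_measure M X (hawkes_process pos) \<mu> \<and>
        (\<forall>A\<in>sets borel. A \<subseteq> X \<longrightarrow>
          reduced_factorial_moment2 M pos A (R A) \<and>
          jordan_decomposition (reduced_factorial_cov \<mu> R A) (Gpos A) (Gneg A)) \<and>
        (\<forall>A\<in>sets borel. A \<subseteq> X \<longrightarrow> (\<forall>t>0.
          (\<integral>\<^sup>+ \<omega>. emeasure (hawkes_process pos \<omega>) (A \<times> {0<..t}) \<partial>M) = ennreal t * emeasure \<mu> A \<and>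
          ennreal t * emeasure \<mu> A =
            ennreal t * background_conv X lam (\<lambda>y. measure_sum (\<lambda>k. conv_pow_measure X g k y)) (A \<times> {0..}) \<and>
          ennreal t * emeasure \<mu> A \<le> ennreal t * (m_lam / (1 - nu_bar)))) \<and>
        ((\<forall>y\<in>X. \<forall>y'\<in>X. \<forall>x\<in>X. \<forall>h. g y x h = g y' x h) \<longrightarrow>
          (\<forall>y\<in>X. \<forall>t>0.
            (\<integral>\<^sup>+ \<omega>. emeasure (hawkes_process pos \<omega>) (X \<times> {0<..t}) \<partial>M) = ennreal t * emeasure \<mu> X \<and>
            ennreal t * emeasure \<mu> X = ennreal t * (m_lam / (1 - nu y)))) \<and>
        (\<forall>t\<ge>0. reduced_factorial_cov \<mu> R X {0..t} \<le>
          enn2real m_lam / (1 - enn2real nu_temp) *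
            (measure (temp_resolvent gt \<Otimes>\<^sub>M temp_resolvent gt)
              {(u, v). 0 \<le> u \<and> 0 \<le> v \<and> 0 \<le> v - u \<and> v - u \<le> t} - 1)) \<and>
        emeasure (temp_resolvent gt) {0..} \<le> 1 / (1 - nu_temp) \<and>
        1 / (1 - nu_temp) < \<infinity> \<and>
        (\<exists>\<kappa> t0. 0 \<le> \<kappa> \<and> 0 < t0 \<and>
          (\<forall>N As. (\<forall>i\<in>{1..N}. As i \<in> sets borel) \<and> disjoint_family_on As {1..N} \<and>
              (\<Union>i\<in>{1..N}. As i) = X \<longrightarrow>
            (\<forall>t\<ge>t0. (\<Sum>i = 1..N::nat. measure (Gpos (As i)) {0..t}) \<le> \<kappa>)))))"
proof -
  \<comment> \<open>The bound on the supremum over \<open>y\<close> is passed on as a bound for each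
    \<open>y\<close> in \<open>X\<close>.\<close>
  have d: "hawkes_data X lam g gt"
  proof
    show "(\<integral>\<^sup>+x\<in>X. ennreal (g y x h) \<partial>lborel) \<le> ennreal (gt h)" if "y \<in> X" "0 \<le> h" for y h
      using gt(4)[OF that(2)] that(1) by (rule order_trans[OF SUP_upper, rotated])
  qed (rule X(2) lam(1) lam(3)[unfolded m_lam_def] g(1) g(3) gt(1) gt(3)[unfolded nu_temp_def]; assumption)+
  show ?thesis
    unfolding m_lam_def nu_temp_def nu_bar_def nu_def
    by (rule conjI, rule hawkes_data.hawkes_exists[OF d], (rule allI)+, rule impI,
        rule hawkes.hawkes_conclusion, rule hawkes.intro[OF d], rule hawkes_axioms.intro)
qed

end
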